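(* Let $\mathcal{F}$ be a saturated fusion system over the finite $p$-group $S$. If $\mathcal{F}\cong\mathcal{F}_S(G)$ for some finite group $G$ with Sylow $p$-subgroup $S$ such that the map $\kappa_G\colon\mathrm{Out}(G)\to\mathrm{Out}(\mathcal{L}_S^c(G))$ is surjective, then $\mathcal{F}$ is tame.
   Context: $p$ is a prime. For a finite group $G$ with Sylow $p$-subgroup $S$, $\mathcal{F}_S(G)$ is the fusion system on $S$ whose morphisms are the conjugation maps between subgroups of $S$ induced by elements of $G$. $O_{p'}(H)$ is the largest normal subgroup of $H$ of order prime to $p$; ${}^gP=gPg^{-1}$. A subgroup $P\le S$ is $p$-centric in $G$ if $C_G(P)=Z(P)\times O_{p'}(C_G(P))$. The centric linking system $\mathcal{L}=\mathcal{L}_S^c(G)$ is the category whose objects are the subgroups of $S$ that are $p$-centric in $G$, with $\mathrm{Mor}_{\mathcal{L}}(P,Q)=N_G(P,Q)/O_{p'}(C_G(P))$, where $N_G(P,Q)=\{g\in G:{}^gP\le Q\}$ and $O_{p'}(C_G(P))$ acts from the right; composition is induced by multiplication in $G$. For objects $P,Q$, let $\delta_{P,Q}\colon N_S(P,Q)\to\mathrm{Mor}_{\mathcal{L}}(P,Q)$ be $s\mapsto sO_{p'}(C_G(P))$, and $\delta_P=\delta_{P,P}$. $\mathrm{Aut}(\mathcal{L})$ is the group of self-equivalences $\alpha$ of the category $\mathcal{L}$ (automatically invertible functors) such that $\alpha(\delta_P(P))=\delta_{\alpha(P)}(\alpha(P))$ for all objects $P$, and $\alpha(\delta_{P,Q}(1))=\delta_{\alpha(P),\alpha(Q)}(1)$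 for all objects $P\le Q$. An automorphism of $\mathcal{L}$ is inner if, for some $g\in N_G(S)$, it sends $P$ to ${}^gP$ and the class of $h\in N_G(P,Q)$ to the class of $ghg^{-1}$. $\mathrm{Out}(\mathcal{L})$ is $\mathrm{Aut}(\mathcal{L})$ modulo inner automorphisms. Let $N_{\mathrm{Aut}(G)}(S)$ be the group of automorphisms of $G$ leaving $S$ invariant. Each $\alpha\in N_{\mathrm{Aut}(G)}(S)$ induces $\tilde\kappa_G(\alpha)\in\mathrm{Aut}(\mathcal{L})$, sending $P$ to $\alpha(P)$ and $gO_{p'}(C_G(P))$ to $\alpha(g)O_{p'}(C_G(\alpha(P)))$. By Sylow's theorem $\mathrm{Out}(G)=N_{\mathrm{Aut}(G)}(S)/N_{\mathrm{Inn}(G)}(S)$, and $\tilde\kappa_G$ induces the homomorphism $\kappa_G\colon\mathrm{Out}(G)\to\mathrm{Out}(\mathcal{L})$. A saturated fusion system $\mathcal{F}$ over $S$ is tame if $\mathcal{F}=\mathcal{F}_S(G)$ for some finite group $G$ with Sylow $p$-subgroup $S$ such that $\kappa_G$ is split surjective (i.e. there is a group homomorphism $s\colon\mathrm{Out}(\mathcal{L}_S^c(G))\to\mathrm{Out}(G)$ with $\kappa_G\circ s=\mathrm{id}$). *)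

theory Defs
  imports "HOL-Algebra.Group_Action" "HOL-Algebra.Sylow"
begin

section \<open>Finite groups\<close>

definition sylow_subgroup :: "nat \<Rightarrow> ('a, 'm) monoid_scheme \<Rightarrow> 'a set \<Rightarrow> bool" where
  "sylow_subgroup p G T \<longleftrightarrow> subgroup T G \<and> card T = p ^ multiplicity p (order G)"

definition finite_p_group :: "nat \<Rightarrow> ('a, 'm) monoid_scheme \<Rightarrow> bool" where
  "finite_p_group p S \<longleftrightarrow> group S \<and> finite (carrier S) \<and> (\<exists>n. order S = p ^ n)"

definition conj_by :: "('a, 'm) monoid_scheme \<Rightarrow> 'a \<Rightarrow> 'a \<Rightarrow> 'a" where
  "conj_by G g x = g \<otimes>\<^bsub>G\<^esub> x \<otimes>\<^bsub>G\<^esub> inv\<^bsub>G\<^esub> g"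

definition transporter :: "('a, 'm) monoid_scheme \<Rightarrow> 'a set \<Rightarrow> 'a set \<Rightarrow> 'a set" where
  "transporter G P Q = {g \<in> carrier G. conj_by G g ` P \<subseteq> Q}"

text \<open>The library constant \<open>normalizer\<close> is phrased through a stabilizer; this is the
  elementary version.\<close>

definition normalizer_in :: "('a, 'm) monoid_scheme \<Rightarrow> 'a set \<Rightarrow> 'a set" where
  "normalizer_in G P = {g \<in> carrier G. conj_by G g ` P = P}"

definition centralizer_in :: "('a, 'm) monoid_scheme \<Rightarrow> 'a set \<Rightarrow> 'a set" where
  "centralizer_in G P = {g \<in> carrier G. \<forall>x\<in>P. g \<otimes>\<^bsub>G\<^esub> x = x \<otimes>\<^bsub>G\<^esub> g}"

definition center_of :: "('a, 'm) monoid_scheme \<Rightarrow> 'a set \<Rightarrow> 'a set" where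
  "center_of G P = {z \<in> P. \<forall>x\<in>P. z \<otimes>\<^bsub>G\<^esub> x = x \<otimes>\<^bsub>G\<^esub> z}"

text \<open>\<open>p_prime_core p G H\<close> is $O_{p'}(H)$ for a subgroup \<open>H\<close> of \<open>G\<close>; \<open>GREATEST\<close> refers to
  inclusion.\<close>

definition p_prime_core :: "nat \<Rightarrow> ('a, 'm) monoid_scheme \<Rightarrow> 'a set \<Rightarrow> 'a set" where
  "p_prime_core p G H = (GREATEST N. N \<lhd> (G\<lparr>carrier := H\<rparr>) \<and> coprime (card N) p)"

definition internal_direct_product ::
    "('a, 'm) monoid_scheme \<Rightarrow> 'a set \<Rightarrow> 'a set \<Rightarrow> 'a set \<Rightarrow> bool" where
  "internal_direct_product G C A B \<longleftrightarrow>
     (\<lambda>(a, b). a \<otimes>\<^bsub>G\<^esub> b) \<in>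
       iso ((G\<lparr>carrier := A\<rparr>) \<times>\<times> (G\<lparr>carrier := B\<rparr>)) (G\<lparr>carrier := C\<rparr>)"

definition inner_automorphisms :: "('a, 'm) monoid_scheme \<Rightarrow> ('a \<Rightarrow> 'a) set" where
  "inner_automorphisms G = (\<lambda>g. \<lambda>x\<in>carrier G. conj_by G g x) ` carrier G"

definition OutGroup :: "('a, 'm) monoid_scheme \<Rightarrow> ('a \<Rightarrow> 'a) set monoid" where
  "OutGroup G = AutoGroup G Mod inner_automorphisms G"


section \<open>Fusion systems\<close>

text \<open>A fusion system over \<open>S\<close> is given by its morphism sets \<open>F P Q\<close>, for subgroups \<open>P\<close> and
  \<open>Q\<close> of \<open>S\<close>; morphisms from \<open>P\<close> are functions extensional on \<open>P\<close>. Values of \<open>F\<close> on sets that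
  are not subgroups of \<open>S\<close> are irrelevant throughout.\<close>

type_synonym 'a hom_system = "'a set \<Rightarrow> 'a set \<Rightarrow> ('a \<Rightarrow> 'a) set"

text \<open>For a Sylow subgroup \<open>T\<close> of \<open>G\<close>, the fusion system $\mathcal{F}_T(G)$ is \<open>conj_homs G\<close>
  regarded over \<open>G\<lparr>carrier := T\<rparr>\<close>.\<close>

definition conj_homs :: "('a, 'm) monoid_scheme \<Rightarrow> 'a hom_system" where
  "conj_homs G P Q = (\<lambda>g. \<lambda>x\<in>P. conj_by G g x) ` transporter G P Q"

definition fusion_system :: "nat \<Rightarrow> ('a, 'm) monoid_scheme \<Rightarrow> 'a hom_system \<Rightarrow> bool" where
  "fusion_system p S F \<longleftrightarrow>
     finite_p_group p S \<and>
     (\<forall>P Q. subgroup P S \<longrightarrow> subgroup Q S \<longrightarrow>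
        conj_homs S P Q \<subseteq> F P Q \<and>
        F P Q \<subseteq> {f \<in> extensional P \<inter> hom (S\<lparr>carrier := P\<rparr>) (S\<lparr>carrier := Q\<rparr>). inj_on f P}) \<and>
     (\<forall>P Q R f g. subgroup P S \<longrightarrow> subgroup Q S \<longrightarrow> subgroup R S \<longrightarrow>
        f \<in> F P Q \<longrightarrow> g \<in> F Q R \<longrightarrow> compose P g f \<in> F P R) \<and>
     (\<forall>P Q f. subgroup P S \<longrightarrow> subgroup Q S \<longrightarrow> f \<in> F P Q \<longrightarrow>
        f \<in> F P (f ` P) \<and> (\<lambda>y\<in>f ` P. inv_into P f y) \<in> F (f ` P) P)"

definition fusion_isos :: "'a hom_system \<Rightarrow> 'a set \<Rightarrow> 'a set \<Rightarrow> ('a \<Rightarrow> 'a) set" where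
  "fusion_isos F P Q = {f \<in> F P Q. f ` P = Q}"

definition fusion_aut_group :: "'a hom_system \<Rightarrow> 'a set \<Rightarrow> ('a \<Rightarrow> 'a) monoid" where
  "fusion_aut_group F P = \<lparr>carrier = F P P, monoid.mult = compose P, one = (\<lambda>x\<in>P. x)\<rparr>"

definition fully_automized ::
    "nat \<Rightarrow> ('a, 'm) monoid_scheme \<Rightarrow> 'a hom_system \<Rightarrow> 'a set \<Rightarrow> bool" where
  "fully_automized p S F P \<longleftrightarrow> sylow_subgroup p (fusion_aut_group F P) (conj_homs S P P)"

definition extension_subgroup ::
    "('a, 'm) monoid_scheme \<Rightarrow> 'a set \<Rightarrow> 'a set \<Rightarrow> ('a \<Rightarrow> 'a) \<Rightarrow> 'a set" where
  "extension_subgroup S Q P f =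
     {g \<in> normalizer_in S Q. (\<lambda>y\<in>P. f (conj_by S g (inv_into Q f y))) \<in> conj_homs S P P}"

definition receptive :: "('a, 'm) monoid_scheme \<Rightarrow> 'a hom_system \<Rightarrow> 'a set \<Rightarrow> bool" where
  "receptive S F P \<longleftrightarrow>
     (\<forall>Q f. subgroup Q S \<longrightarrow> f \<in> fusion_isos F Q P \<longrightarrow>
        (\<exists>h \<in> F (extension_subgroup S Q P f) (carrier S). \<forall>x\<in>Q. h x = f x))"

text \<open>Saturation in the formulation of Roberts and Shpectorov, as used by Aschbacher, Kessar
  and Oliver.\<close>

definition saturated :: "nat \<Rightarrow> ('a, 'm) monoid_scheme \<Rightarrow> 'a hom_system \<Rightarrow> bool" where
  "saturated p S F \<longleftrightarrow>
     (\<forall>P. subgroup P S \<longrightarrow>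
        (\<exists>Q. subgroup Q S \<and> fusion_isos F P Q \<noteq> {} \<and>
             fully_automized p S F Q \<and> receptive S F Q))"

definition fusion_isomorphism ::
    "('a, 'm) monoid_scheme \<Rightarrow> 'a hom_system \<Rightarrow> ('b, 'n) monoid_scheme \<Rightarrow> 'b hom_system \<Rightarrow>
     ('a \<Rightarrow> 'b) \<Rightarrow> bool" where
  "fusion_isomorphism S F T E \<phi> \<longleftrightarrow>
     \<phi> \<in> iso S T \<and>
     (\<forall>P Q. subgroup P S \<longrightarrow> subgroup Q S \<longrightarrow>
        E (\<phi> ` P) (\<phi> ` Q) = (\<lambda>f. \<lambda>y\<in>\<phi> ` P. \<phi> (f (inv_into (carrier S) \<phi> y))) ` F P Q)"

definition fusion_isomorphic ::
    "('a, 'm) monoid_scheme \<Rightarrow> 'a hom_system \<Rightarrow> ('b, 'n) monoid_scheme \<Rightarrow> 'b hom_system \<Rightarrow> bool"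
  where "fusion_isomorphic S F T E \<longleftrightarrow> (\<exists>\<phi>. fusion_isomorphism S F T E \<phi>)"


section \<open>Categories, functors and equivalences\<close>

text \<open>\<open>Comp C P Q R h g\<close> is the composite of \<open>g : P \<rightarrow> Q\<close> and \<open>h : Q \<rightarrow> R\<close>. Morphism sets need
  not be disjoint, so the action of a functor on morphisms takes source and target as
  arguments.\<close>

record ('o, 'm) cat =
  Ob :: "'o set"
  Mor :: "'o \<Rightarrow> 'o \<Rightarrow> 'm set"
  Comp :: "'o \<Rightarrow> 'o \<Rightarrow> 'o \<Rightarrow> 'm \<Rightarrow> 'm \<Rightarrow> 'm"
  Ident :: "'o \<Rightarrow> 'm"

record ('o, 'm, 'q, 'n) funct =
  on_ob :: "'o \<Rightarrow> 'q"
  on_mor :: "'o \<Rightarrow> 'o \<Rightarrow> 'm \<Rightarrow> 'n"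

definition is_functor :: "('o, 'm) cat \<Rightarrow> ('q, 'n) cat \<Rightarrow> ('o, 'm, 'q, 'n) funct \<Rightarrow> bool" where
  "is_functor C D A \<longleftrightarrow>
     (\<forall>P\<in>Ob C. on_ob A P \<in> Ob D) \<and>
     (\<forall>P\<in>Ob C. \<forall>Q\<in>Ob C. \<forall>m\<in>Mor C P Q. on_mor A P Q m \<in> Mor D (on_ob A P) (on_ob A Q)) \<and>
     (\<forall>P\<in>Ob C. on_mor A P P (Ident C P) = Ident D (on_ob A P)) \<and>
     (\<forall>P\<in>Ob C. \<forall>Q\<in>Ob C. \<forall>R\<in>Ob C. \<forall>g\<in>Mor C P Q. \<forall>h\<in>Mor C Q R.
        on_mor A P R (Comp C P Q R h g) =
          Comp D (on_ob A P) (on_ob A Q) (on_ob A R) (on_mor A Q R h) (on_mor A P Q g))"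

definition restrict_functor ::
    "('o, 'm) cat \<Rightarrow> ('o, 'm, 'q, 'n) funct \<Rightarrow> ('o, 'm, 'q, 'n) funct" where
  "restrict_functor C A =
     \<lparr>on_ob = (\<lambda>P\<in>Ob C. on_ob A P),
      on_mor = (\<lambda>P Q m. if P \<in> Ob C \<and> Q \<in> Ob C \<and> m \<in> Mor C P Q
                        then on_mor A P Q m else undefined)\<rparr>"

definition id_functor :: "('o, 'm) cat \<Rightarrow> ('o, 'm, 'o, 'm) funct" where
  "id_functor C = restrict_functor C \<lparr>on_ob = (\<lambda>P. P), on_mor = (\<lambda>P Q m. m)\<rparr>"

definition comp_functor ::
    "('o, 'm) cat \<Rightarrow> ('q, 'n, 'r, 'k) funct \<Rightarrow> ('o, 'm, 'q, 'n) funct \<Rightarrow> ('o, 'm, 'r, 'k) funct"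
  where
  "comp_functor C B A = restrict_functor C
     \<lparr>on_ob = (\<lambda>P. on_ob B (on_ob A P)),
      on_mor = (\<lambda>P Q m. on_mor B (on_ob A P) (on_ob A Q) (on_mor A P Q m))\<rparr>"

definition is_isomorphism :: "('o, 'm) cat \<Rightarrow> 'o \<Rightarrow> 'o \<Rightarrow> 'm \<Rightarrow> bool" where
  "is_isomorphism C P Q m \<longleftrightarrow>
     m \<in> Mor C P Q \<and>
     (\<exists>n\<in>Mor C Q P. Comp C P Q P n m = Ident C P \<and> Comp C Q P Q m n = Ident C Q)"

definition naturally_isomorphic ::
    "('o, 'm) cat \<Rightarrow> ('q, 'n) cat \<Rightarrow> ('o, 'm, 'q, 'n) funct \<Rightarrow> ('o, 'm, 'q, 'n) funct \<Rightarrow> bool"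
  where
  "naturally_isomorphic C D A B \<longleftrightarrow>
     (\<exists>\<eta>. (\<forall>P\<in>Ob C. is_isomorphism D (on_ob A P) (on_ob B P) (\<eta> P)) \<and>
          (\<forall>P\<in>Ob C. \<forall>Q\<in>Ob C. \<forall>m\<in>Mor C P Q.
             Comp D (on_ob A P) (on_ob A Q) (on_ob B Q) (\<eta> Q) (on_mor A P Q m) =
             Comp D (on_ob A P) (on_ob B P) (on_ob B Q) (on_mor B P Q m) (\<eta> P)))"

definition is_equivalence :: "('o, 'm) cat \<Rightarrow> ('q, 'n) cat \<Rightarrow> ('o, 'm, 'q, 'n) funct \<Rightarrow> bool" where
  "is_equivalence C D A \<longleftrightarrow>
     is_functor C D A \<and>
     (\<exists>B. is_functor D C B \<and>
          naturally_isomorphic C C (comp_functor C B A) (id_functor C) \<and>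
          naturally_isomorphic D D (comp_functor D A B) (id_functor D))"


section \<open>Centric linking systems and their automorphisms\<close>

definition p_centric :: "nat \<Rightarrow> ('a, 'm) monoid_scheme \<Rightarrow> 'a set \<Rightarrow> bool" where
  "p_centric p G P \<longleftrightarrow>
     internal_direct_product G (centralizer_in G P) (center_of G P)
       (p_prime_core p G (centralizer_in G P))"

definition link_delta :: "nat \<Rightarrow> ('a, 'm) monoid_scheme \<Rightarrow> 'a set \<Rightarrow> 'a \<Rightarrow> 'a set" where
  "link_delta p G P g = g <#\<^bsub>G\<^esub> p_prime_core p G (centralizer_in G P)"

text \<open>\<open>link_delta p G P g\<close> is the class of \<open>g\<close> in \<open>Mor P Q\<close>, for any \<open>Q\<close> with
  \<open>g \<in> transporter G P Q\<close>. Composition is the setwise product of cosets, as for \<open>Mod\<close>: the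
  product of the class of \<open>h\<close> in \<open>Mor Q R\<close> and that of \<open>g\<close> in \<open>Mor P Q\<close> is the class of \<open>hg\<close>,
  because $g^{-1}O_{p'}(C_G(Q))g \le O_{p'}(C_G(P))$ for p-centric \<open>P\<close> and \<open>Q\<close>.\<close>

definition linking_system ::
    "nat \<Rightarrow> ('a, 'm) monoid_scheme \<Rightarrow> 'a set \<Rightarrow> ('a set, 'a set) cat" where
  "linking_system p G T =
     \<lparr>Ob = {P. subgroup P G \<and> P \<subseteq> T \<and> p_centric p G P},
      Mor = (\<lambda>P Q. link_delta p G P ` transporter G P Q),
      Comp = (\<lambda>P Q R h g. h <#>\<^bsub>G\<^esub> g),
      Ident = (\<lambda>P. link_delta p G P \<one>\<^bsub>G\<^esub>)\<rparr>"

type_synonym 'a link_functor = "('a set, 'a set, 'a set, 'a set) funct"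

text \<open>Functors in the carrier are normalized to be \<open>undefined\<close> outside the category, so that
  equality in \<open>AutLink\<close> is equality of functors.\<close>

definition AutLink :: "nat \<Rightarrow> ('a, 'm) monoid_scheme \<Rightarrow> 'a set \<Rightarrow> 'a link_functor monoid" where
  "AutLink p G T = (let L = linking_system p G T in
     \<lparr>carrier = {A. is_equivalence L L A \<and> restrict_functor L A = A \<and>
        (\<forall>P\<in>Ob L. on_mor A P P ` (link_delta p G P ` P) =
                    link_delta p G (on_ob A P) ` on_ob A P) \<and>
        (\<forall>P\<in>Ob L. \<forall>Q\<in>Ob L. P \<subseteq> Q \<longrightarrow>
           on_mor A P Q (link_delta p G P \<one>\<^bsub>G\<^esub>) = link_delta p G (on_ob A P) \<one>\<^bsub>G\<^esub>)},
      monoid.mult = comp_functor L,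
      one = id_functor L\<rparr>)"

text \<open>For an automorphism \<open>f\<close> of \<open>G\<close> with \<open>f ` T = T\<close>, the image under \<open>f\<close> of the coset
  $gO_{p'}(C_G(P))$ is the coset $f(g)O_{p'}(C_G(f(P)))$; hence \<open>induced_functor p G T f\<close> is
  $\tilde\kappa_G(f)$.\<close>

definition induced_functor ::
    "nat \<Rightarrow> ('a, 'm) monoid_scheme \<Rightarrow> 'a set \<Rightarrow> ('a \<Rightarrow> 'a) \<Rightarrow> 'a link_functor" where
  "induced_functor p G T f = restrict_functor (linking_system p G T)
     \<lparr>on_ob = (\<lambda>P. f ` P), on_mor = (\<lambda>P Q m. f ` m)\<rparr>"

definition InnLink :: "nat \<Rightarrow> ('a, 'm) monoid_scheme \<Rightarrow> 'a set \<Rightarrow> 'a link_functor set" where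
  "InnLink p G T = (\<lambda>g. induced_functor p G T (conj_by G g)) ` normalizer_in G T"

definition OutLink :: "nat \<Rightarrow> ('a, 'm) monoid_scheme \<Rightarrow> 'a set \<Rightarrow> 'a link_functor set monoid" where
  "OutLink p G T = AutLink p G T Mod InnLink p G T"


section \<open>The homomorphism kappa and tameness\<close>

definition stable_automorphisms :: "('a, 'm) monoid_scheme \<Rightarrow> 'a set \<Rightarrow> ('a \<Rightarrow> 'a) set" where
  "stable_automorphisms G T = {f \<in> carrier (AutoGroup G). f ` T = T}"

text \<open>Every class \<open>X\<close> in \<open>OutGroup G\<close> has a representative leaving the Sylow subgroup \<open>T\<close>
  invariant, and the class of the induced functor does not depend on which one is chosen.\<close>

definition kappa ::
    "nat \<Rightarrow> ('a, 'm) monoid_scheme \<Rightarrow> 'a set \<Rightarrow> ('a \<Rightarrow> 'a) set \<Rightarrow> 'a link_functor set" where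
  "kappa p G T X = InnLink p G T #>\<^bsub>AutLink p G T\<^esub>
     induced_functor p G T (SOME f. f \<in> X \<inter> stable_automorphisms G T)"

definition kappa_surjective :: "nat \<Rightarrow> ('a, 'm) monoid_scheme \<Rightarrow> 'a set \<Rightarrow> bool" where
  "kappa_surjective p G T \<longleftrightarrow>
     kappa p G T ` carrier (OutGroup G) = carrier (OutLink p G T)"

definition kappa_split_surjective :: "nat \<Rightarrow> ('a, 'm) monoid_scheme \<Rightarrow> 'a set \<Rightarrow> bool" where
  "kappa_split_surjective p G T \<longleftrightarrow>
     (\<exists>s \<in> hom (OutLink p G T) (OutGroup G).
        \<forall>x \<in> carrier (OutLink p G T). kappa p G T (s x) = x)"

text \<open>A group having \<open>S\<close> as a Sylow subgroup cannot in general live on the same type as \<open>S\<close>.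
  Therefore \<open>S\<close> is identified with a Sylow subgroup \<open>T\<close> of \<open>G\<close> along an isomorphism carrying
  \<open>F\<close> to $\mathcal{F}_T(G)$. Taking \<open>G\<close> over \<open>nat\<close> is no restriction, since every finite group
  is isomorphic to one whose elements are natural numbers.\<close>

definition tame :: "nat \<Rightarrow> ('a, 'm) monoid_scheme \<Rightarrow> 'a hom_system \<Rightarrow> bool" where
  "tame p S F \<longleftrightarrow>
     (\<exists>(G :: nat monoid) T.
        group G \<and> finite (carrier G) \<and> sylow_subgroup p G T \<and>
        fusion_isomorphic S F (G\<lparr>carrier := T\<rparr>) (conj_homs G) \<and>
        kappa_split_surjective p G T)"

end

theory Submission
  imports Defs "HOL-Algebra.Multiplicative_Group"
begin

text \<open>
  Let \<open>\<Gamma>\<close> be the group of automorphisms of \<open>G\<close> that leave \<open>T\<close> invariant. Since \<open>kappa\<close> is surjective and the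
  inner automorphisms of the linking system come from \<open>G\<close>, the group \<open>\<Gamma>\<close> maps onto the group
  of automorphisms of the linking system (lemma \<open>AutLink_induced\<close>). Let \<open>K\<close> be the kernel of this map.
  The obstruction to splitting \<open>kappa\<close> is that elements of \<open>K\<close> need not be inner. The idea is to
  adjoin \<open>K\<close> to \<open>G\<close>, which makes them inner; this does not change the Sylow subgroup, the fusion system and
  the linking system, provided that the order of \<open>K\<close> is prime to \<open>p\<close>.

  That situation is reached first. For a Sylow \<open>p\<close>-subgroup \<open>R\<close> of \<open>K\<close>, the group \<open>G\<close> is replaced by its
  subgroup \<open>H\<close> of elements fixed by \<open>R\<close>. Elements of \<open>K\<close> fix \<open>T\<close> pointwise and every class
  $gO_{p'}(C_G(P))$ setwise. The size of such a class is prime to \<open>p\<close>, hence \<open>R\<close> fixes one of its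
  elements, and so \<open>H\<close> realizes all conjugations between \<open>p\<close>-centric subgroups of \<open>T\<close>. By Alperin's
  fusion theorem (\<open>fusion_controlled_of_centric\<close>) it realizes the whole fusion system. By a Frattini
  argument the normalizer of \<open>R\<close> in \<open>\<Gamma>\<close>, which acts on \<open>H\<close>, still induces all automorphisms of the linking
  system, and \<open>R\<close> acts trivially on \<open>H\<close>; see \<open>link_kernel_coprime_reduction\<close>.

  Now let the order of \<open>K\<close> be prime to \<open>p\<close>, and let \<open>Y\<close> be the quotient of the semidirect product of \<open>G\<close> and \<open>K\<close> by
  the normal subgroup of those pairs \<open>(u, k)\<close> with \<open>u\<close> in $O_{p'}(C_G(T))$ that centralize \<open>G\<close>. The
  group \<open>\<Gamma>\<close> acts on \<open>Y\<close>. Elements of \<open>K\<close> act as inner automorphisms. If \<open>g\<close> normalizes \<open>T\<close>, then for \<open>k\<close> in \<open>K\<close> the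
  element \<open>u = g k(g\<inverse>)\<close> lies in $O_{p'}(C_G(T))$ and acts on \<open>G\<close> like the commutator of \<open>g\<close> and \<open>k\<close>, so
  the two become equal in \<open>Y\<close>; this says that conjugation by \<open>g\<close>, as an element of \<open>\<Gamma>\<close>, acts on \<open>Y\<close> as
  conjugation by the image of \<open>g\<close> (\<open>ext_inner\<close>). Therefore the map from \<open>\<Gamma>\<close> to the outer automorphisms of
  \<open>Y\<close> factors through the outer automorphism group of the linking system, and this factorization is a section
  of \<open>kappa\<close> for \<open>Y\<close> (\<open>kappa_split\<close>).

  Both replacements are handled by one comparison result, the locale \<open>linking_comparison\<close>: a
  homomorphism that is an isomorphism on Sylow subgroups and fusion systems, with a kernel
  of \<open>p\<close>-regular elements commuting with the Sylow subgroup, identifies the centric linking systems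
  together with their automorphisms. It rests on the elementwise description of \<open>p\<close>-centric
  subgroups in \<open>p_centric_iff\<close>, which needs that a central Sylow subgroup splits off
  (\<open>central_sylow_complement\<close>, by transfer).
\<close>

section \<open>Elements of p-power order and of order prime to p\<close>

text \<open>Witnessing exponents, in place of the order of \<open>x\<close>, make both notions visibly
  preserved by homomorphisms and independent of the subgroup in which \<open>x\<close> is considered.\<close>

definition p_element :: "nat \<Rightarrow> ('a, 'm) monoid_scheme \<Rightarrow> 'a \<Rightarrow> bool" where
  "p_element p G x \<longleftrightarrow> (\<exists>n. x [^]\<^bsub>G\<^esub> (p ^ n :: nat) = \<one>\<^bsub>G\<^esub>)"

definition p_regular :: "nat \<Rightarrow> ('a, 'm) monoid_scheme \<Rightarrow> 'a \<Rightarrow> bool" where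
  "p_regular p G x \<longleftrightarrow> (\<exists>m::nat. coprime m p \<and> x [^]\<^bsub>G\<^esub> m = \<one>\<^bsub>G\<^esub>)"

lemma p_element_carrier_update [simp]: "p_element p (G\<lparr>carrier := H\<rparr>) x = p_element p G x"
  by (simp add: p_element_def nat_pow_def)

lemma p_regular_carrier_update [simp]: "p_regular p (G\<lparr>carrier := H\<rparr>) x = p_regular p G x"
  by (simp add: p_regular_def nat_pow_def)

lemma (in group) inv_mult_cancel [simp]:
  "\<lbrakk>x \<in> carrier G; y \<in> carrier G\<rbrakk> \<Longrightarrow> inv x \<otimes> (x \<otimes> y) = y"
  by (simp flip: m_assoc)

lemma (in group) mult_inv_cancel [simp]:
  "\<lbrakk>x \<in> carrier G; y \<in> carrier G\<rbrakk> \<Longrightarrow> x \<otimes> (inv x \<otimes> y) = y"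
  by (simp flip: m_assoc)

lemma (in group) pow_dvd_eq_one:
  assumes "x \<in> carrier G" "x [^] (m::nat) = \<one>" "m dvd n"
  shows "x [^] n = \<one>"
  using assms by (metis dvdE nat_pow_one nat_pow_pow)

lemma (in group) p_element_p_regular_one:
  assumes "x \<in> carrier G" "p_element p G x" "p_regular p G x"
  shows "x = \<one>"
proof -
  obtain n m where nm: "x [^] (p ^ n :: nat) = \<one>" "coprime m p" "x [^] (m::nat) = \<one>"
    using assms unfolding p_element_def p_regular_def by blast
  then have "ord x dvd p ^ n" "ord x dvd m" using assms(1) pow_eq_id by blast+
  then have "ord x = 1" using nm(2) by (metis coprime_common_divisor_nat coprime_power_right_iff gcd_nat.extremum_uniqueI is_unit_gcd coprime_def nat_dvd_1_iff_1)
  then show ?thesis using assms(1) by (metis ord_eq_1)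
qed

lemma (in group) p_element_mult:
  assumes "x \<in> carrier G" "y \<in> carrier G" "x \<otimes> y = y \<otimes> x" "p_element p G x" "p_element p G y"
  shows "p_element p G (x \<otimes> y)"
proof -
  obtain n m where nm: "x [^] (p ^ n :: nat) = \<one>" "y [^] (p ^ m :: nat) = \<one>"
    using assms unfolding p_element_def by blast
  have "x [^] (p ^ (n + m)) = \<one>" "y [^] (p ^ (n + m)) = \<one>"
    using nm assms(1,2) pow_dvd_eq_one by (metis dvd_triv_left dvd_triv_right power_add)+
  then have "(x \<otimes> y) [^] (p ^ (n + m)) = \<one>" using assms by (simp add: pow_mult_distrib)
  then show ?thesis unfolding p_element_def by blast
qed

lemma (in group) p_regular_mult:
  assumes "x \<in> carrier G" "y \<in> carrier G" "x \<otimes> y = y \<otimes> x" "p_regular p G x" "p_regular p G y"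
  shows "p_regular p G (x \<otimes> y)"
proof -
  obtain n m where nm: "x [^] (n :: nat) = \<one>" "y [^] (m :: nat) = \<one>" "coprime n p" "coprime m p"
    using assms unfolding p_regular_def by blast
  have "x [^] (n * m) = \<one>" "y [^] (n * m) = \<one>"
    using nm assms(1,2) pow_dvd_eq_one by (meson dvd_triv_left dvd_triv_right)+
  then have "(x \<otimes> y) [^] (n * m) = \<one>" using assms by (simp add: pow_mult_distrib)
  moreover have "coprime (n * m) p" using nm by simp
  ultimately show ?thesis unfolding p_regular_def by blast
qed

lemma (in group) p_element_inv:
  "\<lbrakk>x \<in> carrier G; p_element p G x\<rbrakk> \<Longrightarrow> p_element p G (inv x)"
  unfolding p_element_def by (metis inv_one nat_pow_inv)

lemma (in group) p_regular_inv:
  "\<lbrakk>x \<in> carrier G; p_regular p G x\<rbrakk> \<Longrightarrow> p_regular p G (inv x)"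
  unfolding p_regular_def by (metis inv_one nat_pow_inv)

lemma p_element_hom:
  assumes "group G" "group H" "f \<in> hom G H" "x \<in> carrier G" "p_element p G x"
  shows "p_element p H (f x)"
proof -
  interpret group_hom G H f using assms by (simp add: group_hom_def group_hom_axioms_def)
  show ?thesis using assms(4,5) unfolding p_element_def by (metis hom_nat_pow hom_one)
qed

lemma p_regular_hom:
  assumes "group G" "group H" "f \<in> hom G H" "x \<in> carrier G" "p_regular p G x"
  shows "p_regular p H (f x)"
proof -
  interpret group_hom G H f using assms by (simp add: group_hom_def group_hom_axioms_def)
  show ?thesis using assms(4,5) unfolding p_regular_def by (metis hom_nat_pow hom_one)
qed

lemma (in group) subgroup_pow_card:
  assumes "subgroup H G" "x \<in> H"
  shows "x [^] card H = \<one>"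
proof -
  have "group (G\<lparr>carrier := H\<rparr>)" using assms by (simp add: subgroup.subgroup_is_group)
  from group.pow_order_eq_1[OF this, of x] assms show ?thesis
    by (simp add: order_def nat_pow_def)
qed

lemma (in group) p_element_of_p_subgroup:
  "\<lbrakk>subgroup H G; card H = p ^ n; x \<in> H\<rbrakk> \<Longrightarrow> p_element p G x"
  unfolding p_element_def by (metis subgroup_pow_card)

lemma (in group) p_regular_of_coprime_subgroup:
  "\<lbrakk>subgroup H G; coprime (card H) p; x \<in> H\<rbrakk> \<Longrightarrow> p_regular p G x"
  unfolding p_regular_def by (metis subgroup_pow_card)

lemma sylow_subgroup_exists:
  assumes "prime p" "group G" "finite (carrier G)"
  shows "\<exists>T. sylow_subgroup p G T"
proof -
  obtain m where "order G = p ^ multiplicity p (order G) * m"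
    by (meson dvd_def multiplicity_dvd)
  from sylow_thm[OF assms(1,2) this assms(3)] show ?thesis
    unfolding sylow_subgroup_def by blast
qed

lemma sylow_subgroup_index:
  assumes "prime p" "group G" "finite (carrier G)" "sylow_subgroup p G T"
  shows "order G = card T * card (rcosets\<^bsub>G\<^esub> T)" "\<not> p dvd card (rcosets\<^bsub>G\<^esub> T)"
proof -
  interpret group G by fact
  have T: "subgroup T G" "card T = p ^ multiplicity p (order G)"
    using assms unfolding sylow_subgroup_def by auto
  show *: "order G = card T * card (rcosets\<^bsub>G\<^esub> T)" using lagrange[OF T(1)] by (simp add: mult.commute)
  have "order G \<noteq> 0" using assms(3) order_gt_0_iff_finite by simp
  show "\<not> p dvd card (rcosets\<^bsub>G\<^esub> T)"
  proof
    assume "p dvd card (rcosets\<^bsub>G\<^esub> T)"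
    then have "p ^ Suc (multiplicity p (order G)) dvd order G"
      using * T(2) by (metis mult.commute mult_dvd_mono dvd_refl power_Suc)
    then show False using \<open>order G \<noteq> 0\<close> assms(1)
      by (metis Suc_n_not_le_n multiplicity_geI not_prime_unit)
  qed
qed

lemma sylow_subgroupI:
  assumes "prime p" "group G" "finite (carrier G)" "subgroup T G" "card T = p ^ n"
    "\<not> p dvd card (rcosets\<^bsub>G\<^esub> T)"
  shows "sylow_subgroup p G T"
proof -
  have "order G = p ^ n * card (rcosets\<^bsub>G\<^esub> T)"
    using group.lagrange[OF assms(2,4)] assms(5) by (simp add: mult.commute)
  then have "multiplicity p (order G) = n"
    using assms(1,6) by (simp add: multiplicity_decomposeI prime_gt_0_nat not_prime_unit)
  then show ?thesis using assms unfolding sylow_subgroup_def by simp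
qed

text \<open>By Sylow's theorem a subgroup of order divisible by \<open>p\<close> contains a nontrivial \<open>p\<close>-element, which
  cannot be \<open>p\<close>-regular.\<close>

lemma (in group) coprime_card_of_p_regular:
  assumes "prime p" "finite (carrier G)" "subgroup H G" "\<And>x. x \<in> H \<Longrightarrow> p_regular p G x"
  shows "coprime (card H) p"
proof (rule ccontr)
  assume nc: "\<not> coprime (card H) p"
  have gH: "group (G\<lparr>carrier := H\<rparr>)" using assms by (simp add: subgroup.subgroup_is_group)
  have fH: "finite H" using assms(2,3) by (meson finite_subset subgroup.subset)
  have "p dvd card H" using nc assms(1) by (metis coprime_commute prime_imp_coprime)
  then obtain m where "order (G\<lparr>carrier := H\<rparr>) = p ^ 1 * m" by (auto simp: order_def)
  from sylow_thm[OF assms(1) gH this] fH obtain K where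
    K: "subgroup K (G\<lparr>carrier := H\<rparr>)" "card K = p" by auto
  have KG: "subgroup K G" using K assms(3) by (simp add: incl_subgroup)
  have "K = {\<one>}"
  proof (intro equalityI subsetI)
    fix x assume "x \<in> K"
    then have "p_element p G x" using p_element_of_p_subgroup[OF KG, of p 1] K by simp
    moreover have "p_regular p G x" using assms(4) \<open>x \<in> K\<close> K(1) subgroup.subset by fastforce
    ultimately show "x \<in> {\<one>}" using p_element_p_regular_one KG \<open>x \<in> K\<close>
      by (metis singletonI subgroup.mem_carrier)
  qed (use KG subgroup.one_closed in auto)
  then show False using K(2) prime_gt_1_nat[OF assms(1)] by simp
qed

section \<open>Actions of p-groups and Sylow's theorems\<close>

text \<open>Every orbit that is not a fixed point has size divisible by \<open>p\<close>. All the Sylow theory below, and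
  the coprime action in the reduction step, come from this count.\<close>

lemma p_group_fixed_points:
  fixes act :: "'r \<Rightarrow> 'x \<Rightarrow> 'x"
  assumes "prime p" "group R" "order R = p ^ n" "finite E"
    and closed: "\<And>r x. \<lbrakk>r \<in> carrier R; x \<in> E\<rbrakk> \<Longrightarrow> act r x \<in> E"
    and act_one: "\<And>x. x \<in> E \<Longrightarrow> act \<one>\<^bsub>R\<^esub> x = x"
    and act_mult: "\<And>r s x. \<lbrakk>r \<in> carrier R; s \<in> carrier R; x \<in> E\<rbrakk> \<Longrightarrow>
            act (r \<otimes>\<^bsub>R\<^esub> s) x = act r (act s x)"
  shows "p dvd card E \<longleftrightarrow> p dvd card {x \<in> E. \<forall>r\<in>carrier R. act r x = x}"
proof -
  interpret R: group R by fact
  define \<phi> where "\<phi> r = (\<lambda>x\<in>E. act r x)" for r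
  have inv_act: "act (inv\<^bsub>R\<^esub> r) (act r x) = x" "act r (act (inv\<^bsub>R\<^esub> r) x) = x"
    if "r \<in> carrier R" "x \<in> E" for r x
    using that act_mult[of "inv\<^bsub>R\<^esub> r" r x] act_mult[of r "inv\<^bsub>R\<^esub> r" x] act_one by auto
  have bij: "\<phi> r \<in> Bij E" if "r \<in> carrier R" for r
  proof -
    have "bij_betw (\<phi> r) E E"
      by (rule bij_betw_byWitness[where f' = "act (inv\<^bsub>R\<^esub> r)"])
        (use that closed inv_act in \<open>auto simp: \<phi>_def\<close>)
    then show ?thesis by (simp add: Bij_def \<phi>_def)
  qed
  have "\<phi> \<in> hom R (BijGroup E)"
  proof (rule homI)
    fix r s assume rs: "r \<in> carrier R" "s \<in> carrier R"
    then show "\<phi> (r \<otimes>\<^bsub>R\<^esub> s) = \<phi> r \<otimes>\<^bsub>BijGroup E\<^esub> \<phi> s"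
      using bij[OF rs(1)] bij[OF rs(2)] closed act_mult
      by (auto simp: BijGroup_def \<phi>_def compose_def restrict_def fun_eq_iff)
  qed (use bij in \<open>simp add: BijGroup_def\<close>)
  then interpret group_action R E \<phi>
    by (simp add: group_action_def group_hom_def group_hom_axioms_def group_BijGroup \<open>group R\<close>)
  define Fx where "Fx = {x \<in> E. \<forall>r\<in>carrier R. act r x = x}"
  let ?O = "orbits R E \<phi>"
  have orbE: "orbit R \<phi> x \<subseteq> E" "x \<in> orbit R \<phi> x" if "x \<in> E" for x
    using that closed act_one orbit_refl[OF that] by (auto simp: orbit_def \<phi>_def)
  have fixorb: "(\<lambda>x. {x}) ` Fx \<subseteq> ?O"
  proof clarify
    fix x assume "x \<in> Fx"
    then have "orbit R \<phi> x = {x}"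
      using R.one_closed act_one by (force simp: orbit_def \<phi>_def Fx_def)
    then show "{x} \<in> ?O" using \<open>x \<in> Fx\<close> by (auto simp: orbits_def Fx_def)
  qed
  have big: "p dvd card orb" if orb: "orb \<in> ?O - (\<lambda>x. {x}) ` Fx" for orb
  proof -
    obtain x where x: "x \<in> E" "orb = orbit R \<phi> x" using orb by (auto simp: orbits_def)
    have "card orb dvd p ^ n" using orbit_stabilizer_theorem[OF x(1)] x(2) assms(3)
      by (metis dvd_triv_left)
    then obtain k where k: "card orb = p ^ k" using \<open>prime p\<close> by (metis divides_primepow_nat)
    have "k \<noteq> 0"
    proof
      assume "k = 0"
      then have "orb = {x}" using k orbE[OF x(1)] x(2) by (metis card_1_singletonE power_0 singletonD)
      then have "act r x = x" if "r \<in> carrier R" for r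
        using that x by (auto simp: orbit_def \<phi>_def)
      then show False using orb \<open>orb = {x}\<close> x(1) by (auto simp: Fx_def)
    qed
    then show ?thesis using k by simp
  qed
  have finO: "finite ?O" using \<open>finite E\<close> by (simp add: orbits_def)
  have "card E = (\<Sum>orb\<in>?O. card orb)"
    using disjoint_sum[OF \<open>finite E\<close>, of "\<lambda>_. 1::nat"] by simp
  also have "\<dots> = (\<Sum>orb\<in>?O - (\<lambda>x. {x}) ` Fx. card orb) + (\<Sum>orb\<in>(\<lambda>x. {x}) ` Fx. card orb)"
    by (rule sum.subset_diff[OF fixorb finO])
  also have "(\<Sum>orb\<in>(\<lambda>x. {x}) ` Fx. card orb) = card Fx"
    by (subst sum.reindex) auto
  finally have "card E = (\<Sum>orb\<in>?O - (\<lambda>x. {x}) ` Fx. card orb) + card Fx" .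
  moreover have "p dvd (\<Sum>orb\<in>?O - (\<lambda>x. {x}) ` Fx. card orb)"
    by (rule dvd_sum) (rule big)
  ultimately show ?thesis unfolding Fx_def by (simp add: dvd_add_right_iff)
qed

lemma (in group) r_coset_act:
  assumes "subgroup K G" "X \<in> rcosets K" "q \<in> carrier G"
  shows "X #> q \<in> rcosets K"
  using assms by (auto simp: RCOSETS_def coset_mult_assoc subgroup.subset)

lemma (in group) r_coset_fixed:
  assumes "subgroup K G" "g \<in> carrier G" "q \<in> carrier G" "(K #> g) #> q = K #> g"
  shows "g \<otimes> q \<otimes> inv g \<in> K"
proof -
  have "g \<otimes> q \<in> K #> (g \<otimes> q)" using assms by (simp add: rcos_self)
  also have "K #> (g \<otimes> q) = K #> g" using assms by (simp add: coset_mult_assoc subgroup.subset)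
  finally show ?thesis using assms
    by (metis group.subgroup_self inv_closed is_group m_closed subgroup.rcos_module_imp)
qed

text \<open>The coset \<open>Kg\<close> is fixed by right multiplication with \<open>Q\<close> exactly when \<open>g\<close> conjugates \<open>Q\<close>
  into \<open>K\<close>, so that counting fixed cosets produces conjugating elements.\<close>

lemma (in group) p_subgroup_fixes_coset:
  assumes "prime p" "finite (carrier G)" "subgroup K G" "subgroup Q G" "card Q = p ^ n"
  defines "E \<equiv> {X \<in> rcosets K. \<forall>q\<in>Q. X #> q = X}"
  shows "p dvd card (rcosets K) \<longleftrightarrow> p dvd card E"
proof -
  interpret Q: subgroup Q G by fact
  have gQ: "group (G\<lparr>carrier := Q\<rparr>)" by (simp add: assms subgroup.subgroup_is_group)
  have fin: "finite (rcosets K)" using assms(2) rcosets_part_G[OF assms(3)] by (metis finite_UnionD)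
  have "p dvd card (rcosets K) \<longleftrightarrow>
    p dvd card {X \<in> rcosets K. \<forall>q\<in>carrier (G\<lparr>carrier := Q\<rparr>). X #> inv q = X}"
  proof (rule p_group_fixed_points[OF assms(1) gQ _ fin])
    fix r s X assume rsX: "r \<in> carrier (G\<lparr>carrier := Q\<rparr>)" "s \<in> carrier (G\<lparr>carrier := Q\<rparr>)" "X \<in> rcosets K"
    have "X \<subseteq> carrier G" using rsX(3) assms(3) by (simp add: subgroup.rcosets_carrier is_group)
    then show "X #> inv (r \<otimes>\<^bsub>G\<lparr>carrier := Q\<rparr>\<^esub> s) = X #> inv s #> inv r"
      using rsX by (simp add: inv_mult_group coset_mult_assoc)
  next
    fix X assume "X \<in> rcosets K"
    then have "X \<subseteq> carrier G" using assms(3) by (simp add: subgroup.rcosets_carrier is_group)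
    then show "X #> inv \<one>\<^bsub>G\<lparr>carrier := Q\<rparr>\<^esub> = X" by simp
  qed (use assms(3,5) in \<open>auto simp: order_def r_coset_act\<close>)
  also have "{X \<in> rcosets K. \<forall>q\<in>carrier (G\<lparr>carrier := Q\<rparr>). X #> inv q = X} = E"
    unfolding E_def
  proof (intro Collect_cong conj_cong refl iffI ballI)
    fix X q assume "\<forall>q\<in>carrier (G\<lparr>carrier := Q\<rparr>). X #> inv q = X" "q \<in> Q"
    moreover have "inv q \<in> carrier (G\<lparr>carrier := Q\<rparr>)" using \<open>q \<in> Q\<close> Q.m_inv_closed by simp
    ultimately have "X #> inv (inv q) = X" by blast
    then show "X #> q = X" using \<open>q \<in> Q\<close> by (metis Q.mem_carrier inv_inv)
  qed (use Q.m_inv_closed in \<open>auto simp del: m_inv_consistent\<close>)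
  finally show ?thesis .
qed

text \<open>The index of a Sylow subgroup is prime to \<open>p\<close>, so \<open>Q\<close> fixes one of its cosets.\<close>

theorem (in group) p_subgroup_conj_into_sylow:
  assumes "prime p" "finite (carrier G)" "sylow_subgroup p G T" "subgroup Q G" "card Q = p ^ n"
  shows "\<exists>g\<in>carrier G. conj_by G g ` Q \<subseteq> T"
proof -
  have T: "subgroup T G" using assms(3) by (simp add: sylow_subgroup_def)
  have "\<not> p dvd card {X \<in> rcosets T. \<forall>q\<in>Q. X #> q = X}"
    using p_subgroup_fixes_coset[OF assms(1,2) T assms(4,5)]
      sylow_subgroup_index(2)[OF assms(1) is_group assms(2,3)] by blast
  then have "{X \<in> rcosets T. \<forall>q\<in>Q. X #> q = X} \<noteq> {}" by (metis card.empty dvd_0_right)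
  then obtain g where "g \<in> carrier G" "\<forall>q\<in>Q. T #> g #> q = T #> g"
    by (auto simp: RCOSETS_def)
  then have "conj_by G g ` Q \<subseteq> T"
    using r_coset_fixed[OF T] assms(4) by (auto simp: conj_by_def subgroup.mem_carrier)
  then show ?thesis using \<open>g \<in> carrier G\<close> by blast
qed

text \<open>\<open>P\<close> fixes its own coset, and the number of fixed cosets is divisible by \<open>p\<close>: there is a second
  one, and its representatives normalize \<open>P\<close>.\<close>

lemma (in group) p_subgroup_normalizer_grows:
  assumes "prime p" "finite (carrier G)" "order G = p ^ n" "subgroup P G" "P \<noteq> carrier G"
  shows "\<exists>x\<in>carrier G - P. \<forall>q\<in>P. x \<otimes> q \<otimes> inv x \<in> P"
proof -
  interpret P: subgroup P G by fact
  have lag: "card (rcosets P) * card P = p ^ n" using lagrange assms by simp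
  then obtain k where k: "card P = p ^ k" using assms(1) by (metis divides_primepow_nat dvd_triv_right)
  define E where "E = {X \<in> rcosets P. \<forall>q\<in>P. X #> q = X}"
  have "card P \<noteq> order G" using assms(2,5) P.subset by (metis card_subset_eq order_def)
  then have "card (rcosets P) \<noteq> 1" using lagrange[OF assms(4)] by auto
  then have "p dvd card (rcosets P)" using lag assms(1)
    by (metis dvd_triv_left divides_primepow_nat dvd_power neq0_conv power_0)
  then have "p dvd card E"
    using p_subgroup_fixes_coset[OF assms(1,2,4,4) k] unfolding E_def by blast
  moreover have PE: "P \<in> E" unfolding E_def
    using P.subgroup_in_rcosets[OF is_group] by (auto simp: coset_join2 assms(4) P.subset)
  ultimately have "E \<noteq> {P}" using assms(1) by auto
  then obtain X where "X \<in> E" "X \<noteq> P" using PE by blast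
  then obtain x where x: "x \<in> carrier G" "X = P #> x" "\<forall>q\<in>P. P #> x #> q = P #> x"
    by (auto simp: E_def RCOSETS_def)
  then have "x \<notin> P" using \<open>X \<noteq> P\<close> coset_join2 assms(4) by auto
  then show ?thesis using x r_coset_fixed[OF assms(4) x(1)] P.mem_carrier by blast
qed

section \<open>Normal subgroups of order prime to p\<close>

lemma set_multI: "\<lbrakk>x \<in> A; y \<in> B\<rbrakk> \<Longrightarrow> x \<otimes>\<^bsub>G\<^esub> y \<in> A <#>\<^bsub>G\<^esub> B"
  by (auto simp: set_mult_def)

lemma set_multE:
  assumes "a \<in> A <#>\<^bsub>G\<^esub> B"
  obtains x y where "x \<in> A" "y \<in> B" "a = x \<otimes>\<^bsub>G\<^esub> y"
  using assms by (auto simp: set_mult_def)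

lemma (in group) normal_set_mult_normal:
  assumes "N1 \<lhd> G" "N2 \<lhd> G"
  shows "N1 <#> N2 \<lhd> G"
proof -
  interpret N1: normal N1 G by fact
  interpret N2: normal N2 G by fact
  show ?thesis
  proof (rule normal_invI)
    show "subgroup (N1 <#> N2) G"
    proof (rule subgroupI)
      show "N1 <#> N2 \<subseteq> carrier G" by (auto simp: set_mult_def)
      show "N1 <#> N2 \<noteq> {}" using set_multI[OF N1.one_closed N2.one_closed] by blast
      show "inv a \<in> N1 <#> N2" if "a \<in> N1 <#> N2" for a
      proof -
        obtain x y where a: "x \<in> N1" "y \<in> N2" "a = x \<otimes> y" using \<open>a \<in> N1 <#> N2\<close> by (elim set_multE)
        have "inv a = (inv y \<otimes> inv x \<otimes> y) \<otimes> inv y" using a by (simp add: inv_mult_group m_assoc)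
        moreover have "inv y \<otimes> inv x \<otimes> y \<in> N1" using a N1.inv_op_closed1 by simp
        ultimately show ?thesis using a by (metis set_multI N2.m_inv_closed)
      qed
      show "a \<otimes> b \<in> N1 <#> N2" if "a \<in> N1 <#> N2" "b \<in> N1 <#> N2" for a b
      proof -
        obtain x y where a: "x \<in> N1" "y \<in> N2" "a = x \<otimes> y" using \<open>a \<in> N1 <#> N2\<close> by (elim set_multE)
        obtain x' y' where b: "x' \<in> N1" "y' \<in> N2" "b = x' \<otimes> y'" using \<open>b \<in> N1 <#> N2\<close> by (elim set_multE)
        have "a \<otimes> b = (x \<otimes> (y \<otimes> x' \<otimes> inv y)) \<otimes> (y \<otimes> y')" using a b by (simp add: m_assoc)
        moreover have "x \<otimes> (y \<otimes> x' \<otimes> inv y) \<in> N1" using a b N1.inv_op_closed2 by simp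
        ultimately show ?thesis using a b by (metis set_multI N2.m_closed)
      qed
    qed
  next
    fix g a assume g: "g \<in> carrier G" and "a \<in> N1 <#> N2"
    then obtain x y where a: "x \<in> N1" "y \<in> N2" "a = x \<otimes> y" by (elim set_multE)
    have "g \<otimes> a \<otimes> inv g = (g \<otimes> x \<otimes> inv g) \<otimes> (g \<otimes> y \<otimes> inv g)" using a g by (simp add: m_assoc)
    then show "g \<otimes> a \<otimes> inv g \<in> N1 <#> N2"
      using set_multI[OF N1.inv_op_closed2[OF g a(1)] N2.inv_op_closed2[OF g a(2)]] by simp
  qed
qed

lemma (in group) normal_mult_pow:
  assumes "N \<lhd> G" "x \<in> N" "y \<in> carrier G"
  shows "\<exists>n\<in>N. (x \<otimes> y) [^] (m::nat) = n \<otimes> y [^] m"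
proof (induction m)
  case 0
  show ?case using subgroup.one_closed[OF normal_imp_subgroup[OF assms(1)]]
    by (intro bexI[of _ \<one>]) simp_all
next
  case (Suc m)
  interpret normal N G by fact
  obtain n where n: "n \<in> N" "(x \<otimes> y) [^] m = n \<otimes> y [^] m" using Suc by blast
  have "(x \<otimes> y) [^] Suc m = (n \<otimes> (y [^] m \<otimes> x \<otimes> inv (y [^] m))) \<otimes> y [^] Suc m"
    using n assms by (simp add: m_assoc)
  moreover have "n \<otimes> (y [^] m \<otimes> x \<otimes> inv (y [^] m)) \<in> N" using n assms inv_op_closed2 by simp
  ultimately show ?case by blast
qed

text \<open>Modulo \<open>N1\<close> a product \<open>xy\<close> is \<open>y\<close>, so its power with exponent \<open>card N2\<close> lies in \<open>N1\<close>. Hence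
  all elements of the product are \<open>p\<close>-regular.\<close>

lemma (in group) coprime_normal_set_mult:
  assumes "prime p" "finite (carrier G)" "N1 \<lhd> G" "N2 \<lhd> G" "coprime (card N1) p" "coprime (card N2) p"
  shows "coprime (card (N1 <#> N2)) p"
proof (rule coprime_card_of_p_regular[OF assms(1,2)])
  show "subgroup (N1 <#> N2) G" using normal_set_mult_normal assms normal_imp_subgroup by blast
  fix a assume "a \<in> N1 <#> N2"
  then obtain x y where a: "x \<in> N1" "y \<in> N2" "a = x \<otimes> y" by (elim set_multE)
  have c: "x \<in> carrier G" "y \<in> carrier G" using a assms(3,4) normal_imp_subgroup subgroup.mem_carrier by metis+
  obtain n where n: "n \<in> N1" "a [^] card N2 = n \<otimes> y [^] card N2"
    using normal_mult_pow[OF assms(3) a(1) c(2)] a(3) by blast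
  have "y [^] card N2 = \<one>" using subgroup_pow_card normal_imp_subgroup assms(4) a(2) by blast
  then have "a [^] card N2 = n" using n assms(3) by (metis normal_imp_subgroup subgroup.mem_carrier r_one)
  then have "(a [^] card N2) [^] card N1 = \<one>" using subgroup_pow_card normal_imp_subgroup assms(3) n(1) by blast
  then have "a [^] (card N2 * card N1) = \<one>" using a(3) c by (simp add: nat_pow_pow)
  then show "p_regular p G a" unfolding p_regular_def using assms(5,6) by (metis coprime_mult_left_iff)
qed

text \<open>This justifies the use of \<open>GREATEST\<close> in the definition of \<open>p_prime_core\<close>.\<close>

lemma (in group) greatest_normal_coprime:
  assumes "prime p" "finite (carrier G)"
  defines "K \<equiv> GREATEST N. N \<lhd> G \<and> coprime (card N) p"
  shows "K \<lhd> G" "coprime (card K) p" "\<And>N. \<lbrakk>N \<lhd> G; coprime (card N) p\<rbrakk> \<Longrightarrow> N \<subseteq> K"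
proof -
  let ?A = "{N. N \<lhd> G \<and> coprime (card N) p}"
  have "N \<in> Pow (carrier G)" if "N \<in> ?A" for N
    using that subgroup.subset[OF normal_imp_subgroup[of N G]] by simp
  then have fin: "finite ?A" using assms(2) by (intro finite_subset[of ?A "Pow (carrier G)"]) auto
  have "{\<one>} \<in> ?A" using one_is_normal by simp
  then have ne: "?A \<noteq> {}" by (metis empty_iff)
  obtain M where "M \<in> ?A" and max: "\<forall>N\<in>?A. M \<subseteq> N \<longrightarrow> M = N"
    using finite_has_maximal[OF fin ne] by (elim bexE)
  then have M: "M \<lhd> G" "coprime (card M) p" by simp_all
  have sub: "N \<subseteq> M" if N: "N \<lhd> G" "coprime (card N) p" for N
  proof -
    have MN: "M <#> N \<in> ?A"
      using normal_set_mult_normal[OF M(1) N(1)]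
        coprime_normal_set_mult[OF assms(1,2) M(1) N(1) M(2) N(2)] by simp
    have "x \<in> M <#> N" if "x \<in> M \<or> x \<in> N" for x
    proof -
      interpret M: normal M G by (rule M)
      interpret N: normal N G by (rule N)
      from that show ?thesis
      proof
        assume "x \<in> M"
        then have "x = x \<otimes> \<one>" by simp
        then show ?thesis using set_multI[OF \<open>x \<in> M\<close> N.one_closed] by metis
      next
        assume "x \<in> N"
        then have "x = \<one> \<otimes> x" by simp
        then show ?thesis using set_multI[OF M.one_closed \<open>x \<in> N\<close>] by metis
      qed
    qed
    then have "M \<subseteq> M <#> N" "N \<subseteq> M <#> N" by blast+
    then show ?thesis using bspec[OF max MN] by simp
  qed
  have "K = M" unfolding K_def by (rule Greatest_equality) (simp_all add: M sub)
  then show "K \<lhd> G" "coprime (card K) p" "\<And>N. \<lbrakk>N \<lhd> G; coprime (card N) p\<rbrakk> \<Longrightarrow> N \<subseteq> K"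
    using M sub by simp_all
qed

section \<open>Central Sylow subgroups have normal complements\<close>

text \<open>The transfer into a central subgroup \<open>Z\<close>: the product over all cosets \<open>X\<close> of the elements
  of \<open>Z\<close> that compare \<open>r(X)g\<close> with the chosen representative of \<open>Xg\<close>. On \<open>Z\<close> every factor is \<open>z\<close>
  itself, because \<open>z\<close> fixes every coset.\<close>

lemma (in group) transfer_into_central_subgroup:
  assumes fin: "finite (carrier G)" and Z: "subgroup Z G"
    and central: "\<And>z x. \<lbrakk>z \<in> Z; x \<in> carrier G\<rbrakk> \<Longrightarrow> z \<otimes> x = x \<otimes> z"
  shows "\<exists>V \<in> hom G (G\<lparr>carrier := Z\<rparr>). \<forall>z\<in>Z. V z = z [^] card (rcosets Z)"
proof -
  interpret Z: subgroup Z G by fact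
  let ?Z = "G\<lparr>carrier := Z\<rparr>"
  have gZ: "group ?Z" using Z by (simp add: subgroup.subgroup_is_group)
  interpret cZ: comm_group ?Z
    by (rule group.group_comm_groupI[OF gZ]) (simp add: central)
  define r where "r X = (SOME x. x \<in> X)" for X :: "'a set"
  have rX: "r X \<in> X" "r X \<in> carrier G" "Z #> r X = X" if X: "X \<in> rcosets Z" for X
  proof -
    have "X \<noteq> {}" using Z.rcosets_non_empty[OF X] .
    then show "r X \<in> X" unfolding r_def by (simp add: some_in_eq)
    then show "r X \<in> carrier G" using Z.rcosets_carrier[OF is_group X] by blast
    show "Z #> r X = X" using X \<open>r X \<in> X\<close> repr_independence[OF _ _ Z] by (auto simp: RCOSETS_def)
  qed
  have cl: "X #> g \<in> rcosets Z" if "X \<in> rcosets Z" "g \<in> carrier G" for X g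
    using r_coset_act[OF Z that] .
  define d where "d g X = r X \<otimes> g \<otimes> inv (r (X #> g))" for g X
  have dZ: "d g X \<in> Z" if X: "X \<in> rcosets Z" and g: "g \<in> carrier G" for g X
  proof -
    have "r X \<otimes> g \<in> X #> g" using rX(1)[OF X] by (auto simp: r_coset_def)
    then have "r X \<otimes> g \<in> Z #> r (X #> g)" using rX(3)[OF cl[OF X g]] by simp
    then show ?thesis unfolding d_def
      using Z.rcos_module_imp[OF is_group rX(2)[OF cl[OF X g]]] by simp
  qed
  have coc: "d (g \<otimes> h) X = d g X \<otimes> d h (X #> g)"
    if "X \<in> rcosets Z" "g \<in> carrier G" "h \<in> carrier G" for g h X
  proof -
    have "X #> (g \<otimes> h) = X #> g #> h"
      using that Z.rcosets_carrier[OF is_group] by (simp add: coset_mult_assoc)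
    then show ?thesis unfolding d_def
      using rX(2) cl that by (simp add: m_assoc)
  qed
  define V where "V g = finprod ?Z (d g) (rcosets Z)" for g
  have bij: "bij_betw (\<lambda>X. X #> g) (rcosets Z) (rcosets Z)" if g: "g \<in> carrier G" for g
    by (rule bij_betw_byWitness[where f' = "\<lambda>X. X #> inv g"])
      (use g cl in \<open>auto simp: coset_mult_assoc Z.rcosets_carrier[OF is_group]\<close>)
  have "V \<in> hom G ?Z"
  proof (rule homI)
    fix g h assume gh: "g \<in> carrier G" "h \<in> carrier G"
    have "V (g \<otimes> h) = finprod ?Z (\<lambda>X. d g X \<otimes>\<^bsub>?Z\<^esub> d h (X #> g)) (rcosets Z)"
      unfolding V_def by (rule cZ.finprod_cong') (use gh dZ cl coc in auto)
    also have "\<dots> = V g \<otimes>\<^bsub>?Z\<^esub> finprod ?Z (\<lambda>X. d h (X #> g)) (rcosets Z)"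
      unfolding V_def by (rule cZ.finprod_multf) (use gh dZ cl in auto)
    also have "finprod ?Z (\<lambda>X. d h (X #> g)) (rcosets Z) = finprod ?Z (d h) ((\<lambda>X. X #> g) ` (rcosets Z))"
      by (rule cZ.finprod_reindex[symmetric])
        (use gh dZ bij[OF gh(1)] in \<open>auto simp: bij_betw_def\<close>)
    also have "(\<lambda>X. X #> g) ` (rcosets Z) = rcosets Z" using bij[OF gh(1)] by (simp add: bij_betw_def)
    finally show "V (g \<otimes> h) = V g \<otimes>\<^bsub>?Z\<^esub> V h" unfolding V_def .
  next
    fix g assume "g \<in> carrier G"
    then show "V g \<in> carrier ?Z" unfolding V_def by (intro cZ.finprod_closed) (use dZ in auto)
  qed
  moreover have "V z = z [^] card (rcosets Z)" if z: "z \<in> Z" for z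
  proof -
    have "d z X = z" if X: "X \<in> rcosets Z" for X
    proof -
      have "X #> z = Z #> z #> r X"
        using rX[OF X] z central by (metis Z.mem_carrier Z.subset coset_mult_assoc)
      then have "X #> z = X" using rX(3)[OF X] z Z by (metis coset_join2 Z.mem_carrier)
      then have "d z X = z \<otimes> r X \<otimes> inv (r X)"
        unfolding d_def using central[OF z rX(2)[OF X]] by simp
      then show ?thesis using rX(2)[OF X] z by (simp add: m_assoc)
    qed
    then have "V z = finprod ?Z (\<lambda>X. z) (rcosets Z)"
      unfolding V_def by (intro cZ.finprod_cong') (use z in auto)
    also have "\<dots> = z [^]\<^bsub>?Z\<^esub> card (rcosets Z)" using z by (intro cZ.finprod_const) simp
    finally show ?thesis by (simp add: nat_pow_def)
  qed
  ultimately show ?thesis by blast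
qed

text \<open>The kernel of the transfer is the complement: on \<open>Z\<close> the transfer is raising to the power
  of the index, which is bijective since the index is prime to \<open>p\<close>.\<close>

lemma (in group) central_sylow_complement:
  assumes "prime p" and fin: "finite (carrier G)" and Z: "subgroup Z G" "card Z = p ^ n"
    and central: "\<And>z x. \<lbrakk>z \<in> Z; x \<in> carrier G\<rbrakk> \<Longrightarrow> z \<otimes> x = x \<otimes> z"
    and all: "\<And>x. \<lbrakk>x \<in> carrier G; p_element p G x\<rbrakk> \<Longrightarrow> x \<in> Z"
  shows "\<exists>N. N \<lhd> G \<and> coprime (card N) p \<and> (\<forall>x\<in>carrier G. \<exists>z\<in>Z. \<exists>n\<in>N. x = z \<otimes> n)"
proof -
  interpret Z: subgroup Z G by fact
  let ?Z = "G\<lparr>carrier := Z\<rparr>"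
  have gZ: "group ?Z" using Z by (simp add: subgroup.subgroup_is_group)
  have finZ: "finite Z" using fin Z.subset by (rule finite_subset[rotated])
  obtain T where T: "sylow_subgroup p G T" using sylow_subgroup_exists[OF assms(1) is_group fin] by blast
  then have sT: "subgroup T G" "card T = p ^ multiplicity p (order G)" by (auto simp: sylow_subgroup_def)
  have TZ: "T \<subseteq> Z"
    using all p_element_of_p_subgroup[OF sT] subgroup.mem_carrier[OF sT(1)] by blast
  have "card Z dvd order G" using lagrange[OF Z(1)] by (metis dvd_triv_right)
  then have "n \<le> multiplicity p (order G)"
    using Z(2) assms(1) fin by (metis multiplicity_geI not_prime_unit order_gt_0_iff_finite less_numeral_extra(3))
  then have "card Z \<le> card T" using Z(2) sT(2) assms(1) by (metis power_increasing prime_ge_1_nat)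
  then have "T = Z" using TZ finZ by (simp add: card_seteq)
  define m where "m = card (rcosets Z)"
  have m: "\<not> p dvd m"
    unfolding m_def using sylow_subgroup_index(2)[OF assms(1) is_group fin T] \<open>T = Z\<close> by simp
  have pm: "order G = p ^ n * m" unfolding m_def using lagrange[OF Z(1)] Z(2) by (simp add: mult.commute)
  have cop: "coprime m p" using m assms(1) by (metis coprime_commute prime_imp_coprime)
  obtain V where V: "V \<in> hom G ?Z" "\<forall>z\<in>Z. V z = z [^] m"
    using transfer_into_central_subgroup[OF fin Z(1) central] unfolding m_def by blast
  interpret V: group_hom G ?Z V using V(1) gZ by (simp add: group_hom_def group_hom_axioms_def)
  have pZ: "p_element p G z" if "z \<in> Z" for z using p_element_of_p_subgroup[OF Z that] .
  have pow1: "z = \<one>" if "z \<in> Z" "z [^] m = \<one>" for z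
    using p_element_p_regular_one[of z p] pZ that cop unfolding p_regular_def by auto
  have "inj_on V Z"
  proof (rule inj_onI)
    fix x y assume xy: "x \<in> Z" "y \<in> Z" "V x = V y"
    have "V (x \<otimes> inv y) = V y \<otimes>\<^bsub>?Z\<^esub> inv\<^bsub>?Z\<^esub> V y"
      using V.hom_mult[of x "inv y"] V.hom_inv[of y] xy by (simp del: m_inv_consistent)
    also have "\<dots> = \<one>" using group.r_inv[OF gZ, of "V y"] V.hom_closed[of y] xy by (simp del: m_inv_consistent)
    finally have "V (x \<otimes> inv y) = \<one>" .
    then have "x \<otimes> inv y = \<one>" using pow1[of "x \<otimes> inv y"] V(2) xy by simp
    then show "x = y" using xy by (metis Z.mem_carrier inv_closed inv_equality inv_inv)
  qed
  moreover have "V ` Z \<subseteq> Z" using V.hom_closed by auto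
  ultimately have surj: "V ` Z = Z" using finZ by (simp add: endo_inj_surj)
  define N where "N = kernel G ?Z V"
  have N: "N \<lhd> G" unfolding N_def by (rule V.normal_kernel)
  have "coprime (card N) p"
  proof (rule coprime_card_of_p_regular[OF assms(1) fin normal_imp_subgroup[OF N]])
    fix x assume "x \<in> N"
    then have x: "x \<in> carrier G" "V x = \<one>" by (auto simp: N_def kernel_def)
    have "(x [^] m) [^] (p ^ n) = \<one>" using x pow_order_eq_1[of x] pm fin
      by (simp add: nat_pow_pow mult.commute)
    then have "x [^] m \<in> Z" using all x unfolding p_element_def by blast
    moreover have "V (x [^] m) = \<one>" using x(2) V.hom_nat_pow[OF x(1), of m]
        monoid.nat_pow_one[OF group.is_monoid[OF gZ], of m] by simp
    ultimately have "x [^] m = \<one>" using pow1[of "x [^] m"] V(2) by simp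
    then show "p_regular p G x" using cop unfolding p_regular_def by blast
  qed
  moreover have "\<exists>z\<in>Z. \<exists>n\<in>N. x = z \<otimes> n" if x: "x \<in> carrier G" for x
  proof -
    have "V x \<in> V ` Z" using surj V.hom_closed[OF x] by simp
    then obtain z where z: "z \<in> Z" "V z = V x" by auto
    have "V (inv z \<otimes> x) = inv\<^bsub>?Z\<^esub> V z \<otimes>\<^bsub>?Z\<^esub> V x" using x z by (simp add: V.hom_mult V.hom_inv del: m_inv_consistent)
    then have "inv z \<otimes> x \<in> N" using x z V.hom_closed[OF x] group.l_inv[OF gZ, of "V x"]
      by (simp add: N_def kernel_def del: m_inv_consistent)
    moreover have "x = z \<otimes> (inv z \<otimes> x)" using x z by simp
    ultimately show ?thesis using z by blast
  qed
  ultimately show ?thesis using N by blast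
qed

section \<open>p-centric subgroups\<close>

lemma (in group) centralizer_in_subgroup: 
  assumes "P \<subseteq> carrier G"
  shows "subgroup (centralizer_in G P) G"
proof (rule subgroupI)
  show "centralizer_in G P \<subseteq> carrier G" by (auto simp: centralizer_in_def)
  show "centralizer_in G P \<noteq> {}" using assms by (auto simp: centralizer_in_def dest: subsetD intro!: exI[of _ \<one>])
  show "inv a \<in> centralizer_in G P" if a: "a \<in> centralizer_in G P" for a
  proof -
    have "inv a \<otimes> x = x \<otimes> inv a" if "x \<in> P" for x
    proof -
      have c: "a \<in> carrier G" "x \<in> carrier G" "a \<otimes> x = x \<otimes> a"
        using a that assms by (auto simp: centralizer_in_def)
      have "inv a \<otimes> x = inv a \<otimes> (x \<otimes> a) \<otimes> inv a" using c(1,2) by (simp add: m_assoc)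
      also have "\<dots> = x \<otimes> inv a" unfolding c(3)[symmetric] using c(1,2) by (simp add: m_assoc)
      finally show ?thesis .
    qed
    then show ?thesis using a by (simp add: centralizer_in_def)
  qed
  show "a \<otimes> b \<in> centralizer_in G P" if "a \<in> centralizer_in G P" "b \<in> centralizer_in G P" for a b
  proof -
    have "a \<otimes> b \<otimes> x = x \<otimes> (a \<otimes> b)" if "x \<in> P" for x
    proof -
      have c: "a \<in> carrier G" "b \<in> carrier G" "x \<in> carrier G" "a \<otimes> x = x \<otimes> a" "b \<otimes> x = x \<otimes> b"
        using \<open>a \<in> _\<close> \<open>b \<in> _\<close> that assms by (auto simp: centralizer_in_def)
      then show ?thesis by (metis m_assoc)
    qed
    then show ?thesis using that by (simp add: centralizer_in_def)
  qed
qed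

lemma (in group) center_of_eq: "P \<subseteq> carrier G \<Longrightarrow> center_of G P = P \<inter> centralizer_in G P"
  by (auto simp: center_of_def centralizer_in_def)

lemma (in group) centralizer_core:
  assumes "prime p" "finite (carrier G)" "P \<subseteq> carrier G"
  defines "C \<equiv> centralizer_in G P"
  shows "p_prime_core p G C \<lhd> (G\<lparr>carrier := C\<rparr>)" "coprime (card (p_prime_core p G C)) p"
proof -
  have C: "subgroup C G" unfolding C_def using centralizer_in_subgroup assms by blast
  then have "group (G\<lparr>carrier := C\<rparr>)" by (simp add: subgroup.subgroup_is_group)
  moreover have "finite (carrier (G\<lparr>carrier := C\<rparr>))"
    using assms(2) subgroup.subset[OF C] finite_subset by auto
  ultimately show "p_prime_core p G C \<lhd> (G\<lparr>carrier := C\<rparr>)" "coprime (card (p_prime_core p G C)) p"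
    unfolding p_prime_core_def using group.greatest_normal_coprime(1,2) assms(1) by blast+
qed

text \<open>For a \<open>p\<close>-subgroup \<open>P\<close>, being \<open>p\<close>-centric means that \<open>P\<close> contains all \<open>p\<close>-elements that
  centralize it: then its center is a central Sylow subgroup of its centralizer, and splits off.
  The complement consists of the \<open>p\<close>-regular elements. This elementwise description is the form in
  which centricity and the group $O_{p'}(C_G(P))$ are handled from here on.\<close>

lemma (in group)
  assumes "prime p" and fin: "finite (carrier G)" and P: "subgroup P G" "card P = p ^ n"
  shows p_centric_iff: "p_centric p G P \<longleftrightarrow> (\<forall>x\<in>centralizer_in G P. p_element p G x \<longrightarrow> x \<in> P)"
    and p_centric_core: "p_centric p G P \<Longrightarrow>
       p_prime_core p G (centralizer_in G P) = {x \<in> centralizer_in G P. p_regular p G x}"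
    and p_centric_decomp: "\<lbrakk>p_centric p G P; x \<in> centralizer_in G P\<rbrakk> \<Longrightarrow>
       \<exists>z\<in>P. \<exists>y\<in>p_prime_core p G (centralizer_in G P). x = z \<otimes> y"
proof -
  let ?R = "\<forall>x\<in>centralizer_in G P. p_element p G x \<longrightarrow> x \<in> P"
  let ?core = "p_prime_core p G (centralizer_in G P)"
  interpret P: subgroup P G by fact
  define C where "C = centralizer_in G P"
  have C: "subgroup C G" unfolding C_def using centralizer_in_subgroup P.subset by blast
  interpret C: subgroup C G by (rule C)
  have gC: "group (G\<lparr>carrier := C\<rparr>)" using C by (simp add: subgroup.subgroup_is_group)
  have finC: "finite C" using fin C.subset finite_subset by blast
  have comm: "x \<otimes> z = z \<otimes> x" if "x \<in> C" "z \<in> P" for x z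
    using that unfolding C_def centralizer_in_def by blast
  have pP: "p_element p G z" if "z \<in> P" for z using p_element_of_p_subgroup[OF P that] .
  define Z where "Z = center_of G P"
  have Zeq: "Z = P \<inter> C" unfolding Z_def C_def using center_of_eq P.subset by blast
  have ZG: "subgroup Z G" unfolding Zeq by (rule subgroups_Inter_pair[OF P(1) C])
  note core = centralizer_core[OF assms(1,2) P.subset, folded C_def]
  let ?K = "p_prime_core p G C"
  have KG: "subgroup ?K G" by (rule incl_subgroup[OF C normal_imp_subgroup[OF core(1)]])
  have KC: "?K \<subseteq> C" using subgroup.subset[OF normal_imp_subgroup[OF core(1)]] by simp
  have Kreg: "p_regular p G x" if "x \<in> ?K" for x using p_regular_of_coprime_subgroup[OF KG core(2) that] .
  have dir1: ?R if "p_centric p G P"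
  proof (intro ballI impI)
    fix x assume x: "x \<in> centralizer_in G P" "p_element p G x"
    have "(\<lambda>(a, b). a \<otimes> b) ` (Z \<times> ?K) = C"
      using that by (simp add: p_centric_def internal_direct_product_def iso_def bij_betw_def flip: C_def Z_def)
    moreover have "x \<in> C" using x C_def by simp
    ultimately obtain z y where zy: "z \<in> Z" "y \<in> ?K" "x = z \<otimes> y" by force
    have z: "z \<in> P" "z \<in> carrier G" "y \<in> carrier G" using zy Zeq KC by auto
    have y: "y = inv z \<otimes> x" using zy z by simp
    have "inv z \<otimes> x = x \<otimes> inv z" using comm[OF \<open>x \<in> C\<close>] P.m_inv_closed[OF z(1)] by simp
    then have "p_element p G y" unfolding y
      using p_element_mult[of "inv z" x p] p_element_inv[of z p] pP z x(2) C.mem_carrier[OF \<open>x \<in> C\<close>] by simp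
    then have "y = \<one>" using p_element_p_regular_one[of y p] Kreg[OF zy(2)] z by simp
    then show "x \<in> P" using zy z by simp
  qed
  have dir2: "?K = {x \<in> C. p_regular p G x} \<and> (\<forall>x\<in>C. \<exists>z\<in>Z. \<exists>y\<in>?K. x = z \<otimes> y) \<and> p_centric p G P" if R: ?R
  proof -
    have "\<exists>N. N \<lhd> (G\<lparr>carrier := C\<rparr>) \<and> coprime (card N) p \<and>
      (\<forall>x\<in>carrier (G\<lparr>carrier := C\<rparr>). \<exists>z\<in>Z. \<exists>n\<in>N. x = z \<otimes>\<^bsub>G\<lparr>carrier := C\<rparr>\<^esub> n)"
    proof -
      have "card Z dvd p ^ n"
        using group.lagrange[OF P.subgroup_is_group[OF is_group] subgroup_incl[OF ZG P(1)]] Zeq P(2)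
        by (simp add: order_def) (metis dvd_triv_right)
      then obtain k where k: "card Z = p ^ k" using assms(1) by (metis divides_primepow_nat)
      show ?thesis
      proof (rule group.central_sylow_complement[OF gC assms(1) _ _ k])
        show "subgroup Z (G\<lparr>carrier := C\<rparr>)" using subgroup_incl[OF ZG C] Zeq by simp
      qed (use finC Zeq comm R in \<open>auto simp: C_def\<close>)
    qed
    then obtain N where N: "N \<lhd> (G\<lparr>carrier := C\<rparr>)" "coprime (card N) p"
      and dec: "\<And>x. x \<in> C \<Longrightarrow> \<exists>z\<in>Z. \<exists>n\<in>N. x = z \<otimes> n" by auto
    have NK: "N \<subseteq> ?K" unfolding p_prime_core_def
      using group.greatest_normal_coprime(3)[OF gC assms(1) _ N] finC by simp
    have dec: "\<exists>z\<in>Z. \<exists>y\<in>?K. x = z \<otimes> y" if "x \<in> C" for x using dec[OF that] NK by blast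
    have one: "z = \<one>" if "z \<in> Z" "p_regular p G z" for z
      using that Zeq p_element_p_regular_one[of z p] pP[of z] by simp
    have reg: "?K = {x \<in> C. p_regular p G x}"
    proof (intro equalityI subsetI)
      fix x assume "x \<in> {x \<in> C. p_regular p G x}"
      then have x: "x \<in> C" "p_regular p G x" by auto
      obtain z y where zy: "z \<in> Z" "y \<in> ?K" "x = z \<otimes> y" using dec[OF x(1)] by blast
      have c: "z \<in> P" "z \<in> carrier G" "y \<in> carrier G" "y \<in> C" using zy Zeq KC by auto
      have zxy: "z = x \<otimes> inv y" using zy c by (simp add: m_assoc)
      have "inv y \<otimes> x = inv y \<otimes> (y \<otimes> z)" using zy(3) comm[OF c(4,1)] by simp
      then have "x \<otimes> inv y = inv y \<otimes> x" using c(2,3) zxy by simp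
      then have "p_regular p G z" unfolding zxy
        using p_regular_mult[of x "inv y" p] p_regular_inv[OF c(3) Kreg[OF zy(2)]] c(3) x(2) C.mem_carrier[OF x(1)]
        by simp
      then have "z = \<one>" using one zy by blast
      then show "x \<in> ?K" using zy c by simp
    qed (use KC Kreg in auto)
    have "(\<lambda>(a, b). a \<otimes> b) \<in> iso ((G\<lparr>carrier := Z\<rparr>) \<times>\<times> (G\<lparr>carrier := ?K\<rparr>)) (G\<lparr>carrier := C\<rparr>)"
    proof (rule isoI)
      show "(\<lambda>(a, b). a \<otimes> b) \<in> hom ((G\<lparr>carrier := Z\<rparr>) \<times>\<times> (G\<lparr>carrier := ?K\<rparr>)) (G\<lparr>carrier := C\<rparr>)"
      proof (rule homI)
        fix u v assume uv: "u \<in> carrier ((G\<lparr>carrier := Z\<rparr>) \<times>\<times> (G\<lparr>carrier := ?K\<rparr>))"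
          "v \<in> carrier ((G\<lparr>carrier := Z\<rparr>) \<times>\<times> (G\<lparr>carrier := ?K\<rparr>))"
        obtain a b where ab: "u = (a, b)" "a \<in> Z" "b \<in> ?K" using uv by auto
        obtain c d where cd: "v = (c, d)" "c \<in> Z" "d \<in> ?K" using uv by auto
        have abcd: "a \<in> carrier G" "b \<in> carrier G" "c \<in> carrier G" "d \<in> carrier G"
          using ab cd Zeq KC by auto
        have bc: "b \<otimes> c = c \<otimes> b" using comm[of b c] ab(3) cd(2) KC Zeq by blast
        have "a \<otimes> c \<otimes> (b \<otimes> d) = a \<otimes> (c \<otimes> b) \<otimes> d" using abcd by (simp add: m_assoc)
        also have "\<dots> = a \<otimes> b \<otimes> (c \<otimes> d)" unfolding bc[symmetric] using abcd by (simp add: m_assoc)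
        finally show "(\<lambda>(a, b). a \<otimes> b) (u \<otimes>\<^bsub>(G\<lparr>carrier := Z\<rparr>) \<times>\<times> (G\<lparr>carrier := ?K\<rparr>)\<^esub> v) =
          (\<lambda>(a, b). a \<otimes> b) u \<otimes>\<^bsub>G\<lparr>carrier := C\<rparr>\<^esub> (\<lambda>(a, b). a \<otimes> b) v" using ab cd by simp
      qed (use Zeq KC in auto)
      show "bij_betw (\<lambda>(a, b). a \<otimes> b) (carrier ((G\<lparr>carrier := Z\<rparr>) \<times>\<times> (G\<lparr>carrier := ?K\<rparr>))) (carrier (G\<lparr>carrier := C\<rparr>))"
        unfolding bij_betw_def
      proof
        show "inj_on (\<lambda>(a, b). a \<otimes> b) (carrier ((G\<lparr>carrier := Z\<rparr>) \<times>\<times> (G\<lparr>carrier := ?K\<rparr>)))"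
        proof (clarsimp simp: inj_on_def)
          fix a b c d assume ab: "a \<in> Z" "b \<in> ?K" and cd: "c \<in> Z" "d \<in> ?K" and eq: "a \<otimes> b = c \<otimes> d"
          have abcd: "a \<in> carrier G" "b \<in> carrier G" "c \<in> carrier G" "d \<in> carrier G"
            using ab cd Zeq KC by auto
          have "inv c \<otimes> a = inv c \<otimes> (a \<otimes> b) \<otimes> inv b" using abcd by (simp add: m_assoc)
          also have "\<dots> = d \<otimes> inv b" unfolding eq using abcd by (simp add: m_assoc)
          finally have e: "inv c \<otimes> a = d \<otimes> inv b" .
          have "inv c \<otimes> a \<in> Z" using ab(1) cd(1) subgroup.m_closed[OF ZG] subgroup.m_inv_closed[OF ZG] by simp
          moreover have "d \<otimes> inv b \<in> ?K" using ab(2) cd(2) subgroup.m_closed[OF KG] subgroup.m_inv_closed[OF KG] by simp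
          ultimately have "inv c \<otimes> a = \<one>" using one[of "inv c \<otimes> a"] Kreg e by simp
          then have "a = c" using abcd by (metis inv_equality inv_inv inv_closed)
          then show "a = c \<and> b = d" using abcd eq by simp
        qed
        show "(\<lambda>(a, b). a \<otimes> b) ` carrier ((G\<lparr>carrier := Z\<rparr>) \<times>\<times> (G\<lparr>carrier := ?K\<rparr>)) = carrier (G\<lparr>carrier := C\<rparr>)"
          using dec Zeq KC by force
      qed
    qed
    then have "p_centric p G P" by (simp add: p_centric_def internal_direct_product_def flip: C_def Z_def)
    then show ?thesis using reg dec by blast
  qed
  show "p_centric p G P \<longleftrightarrow> ?R" using dir1 dir2 by blast
  show "?core = {x \<in> centralizer_in G P. p_regular p G x}" if "p_centric p G P"
    using dir2[OF dir1[OF that]] C_def by simp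
  show "\<exists>z\<in>P. \<exists>y\<in>?core. x = z \<otimes> y" if "p_centric p G P" "x \<in> centralizer_in G P"
    using dir2[OF dir1[OF that(1)]] that(2) unfolding C_def Zeq by blast
qed

section \<open>Conjugation\<close>

context group
begin

lemma conj_by_closed [simp]: "\<lbrakk>g \<in> carrier G; x \<in> carrier G\<rbrakk> \<Longrightarrow> conj_by G g x \<in> carrier G"
  by (simp add: conj_by_def)

lemma conj_by_one [simp]: "x \<in> carrier G \<Longrightarrow> conj_by G \<one> x = x"
  by (simp add: conj_by_def)

lemma conj_by_conj_by:
  "\<lbrakk>g \<in> carrier G; h \<in> carrier G; x \<in> carrier G\<rbrakk> \<Longrightarrow>
     conj_by G g (conj_by G h x) = conj_by G (g \<otimes> h) x"
  by (simp add: conj_by_def inv_mult_group m_assoc)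

lemma conj_by_mult:
  "\<lbrakk>g \<in> carrier G; x \<in> carrier G; y \<in> carrier G\<rbrakk> \<Longrightarrow>
     conj_by G g (x \<otimes> y) = conj_by G g x \<otimes> conj_by G g y"
  by (simp add: conj_by_def m_assoc)

lemma conj_by_inv_cancel [simp]:
  "\<lbrakk>g \<in> carrier G; x \<in> carrier G\<rbrakk> \<Longrightarrow> conj_by G (inv g) (conj_by G g x) = x"
  "\<lbrakk>g \<in> carrier G; x \<in> carrier G\<rbrakk> \<Longrightarrow> conj_by G g (conj_by G (inv g) x) = x"
  by (simp_all add: conj_by_conj_by)

lemma conj_by_eq_self_iff:
  "\<lbrakk>g \<in> carrier G; x \<in> carrier G\<rbrakk> \<Longrightarrow> conj_by G g x = x \<longleftrightarrow> g \<otimes> x = x \<otimes> g"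
  unfolding conj_by_def by (rule inv_solve_right') simp_all

lemma inj_on_conj_by: "\<lbrakk>g \<in> carrier G; A \<subseteq> carrier G\<rbrakk> \<Longrightarrow> inj_on (conj_by G g) A"
  by (rule inj_on_inverseI[where g = "conj_by G (inv g)"]) (simp add: subset_iff)

lemma conj_by_image_carrier [simp]: "g \<in> carrier G \<Longrightarrow> conj_by G g ` carrier G = carrier G"
proof (intro equalityI subsetI)
  fix x assume "g \<in> carrier G" "x \<in> carrier G"
  then have "conj_by G g (conj_by G (inv g) x) = x" "conj_by G (inv g) x \<in> carrier G" by simp_all
  then show "x \<in> conj_by G g ` carrier G" by (metis imageI)
qed auto

lemma conj_by_hom: "g \<in> carrier G \<Longrightarrow> conj_by G g \<in> hom G G"
  by (simp add: hom_def conj_by_mult Pi_def)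

lemma group_hom_conj_by: "g \<in> carrier G \<Longrightarrow> group_hom G G (conj_by G g)"
  by (simp add: group_hom_def group_hom_axioms_def conj_by_hom)

lemma conj_by_image_image:
  "\<lbrakk>g \<in> carrier G; h \<in> carrier G; A \<subseteq> carrier G\<rbrakk> \<Longrightarrow>
     conj_by G g ` conj_by G h ` A = conj_by G (g \<otimes> h) ` A"
  by (auto simp: image_image conj_by_conj_by subset_iff intro!: image_cong)

lemma conj_by_image_one [simp]: "A \<subseteq> carrier G \<Longrightarrow> conj_by G \<one> ` A = A"
  by (auto simp: subset_iff image_iff)

lemma conj_by_image_subgroup:
  "\<lbrakk>g \<in> carrier G; subgroup A G\<rbrakk> \<Longrightarrow> subgroup (conj_by G g ` A) G"
  by (rule group_hom.subgroup_img_is_subgroup[OF group_hom_conj_by])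

lemma card_conj_by_image:
  "\<lbrakk>g \<in> carrier G; A \<subseteq> carrier G\<rbrakk> \<Longrightarrow> card (conj_by G g ` A) = card A"
  by (simp add: card_image inj_on_conj_by)

lemma conj_by_image_swap:
  assumes "g \<in> carrier G" "A \<subseteq> carrier G" "conj_by G g ` A = B"
  shows "conj_by G (inv g) ` B = A"
  using assms conj_by_image_image[of "inv g" g A] by simp

lemma conj_by_p_element:
  "\<lbrakk>g \<in> carrier G; x \<in> carrier G; p_element p G x\<rbrakk> \<Longrightarrow> p_element p G (conj_by G g x)"
  by (rule p_element_hom[OF is_group is_group conj_by_hom])

lemma conj_by_p_regular:
  "\<lbrakk>g \<in> carrier G; x \<in> carrier G; p_regular p G x\<rbrakk> \<Longrightarrow> p_regular p G (conj_by G g x)"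
  by (rule p_regular_hom[OF is_group is_group conj_by_hom])

lemma conj_by_self_subgroup:
  assumes "subgroup A G" "g \<in> A"
  shows "conj_by G g ` A = A"
proof -
  interpret subgroup A G by fact
  have *: "conj_by G h ` A \<subseteq> A" if "h \<in> A" for h using that by (auto simp: conj_by_def)
  have "A = conj_by G g ` conj_by G (inv g) ` A"
    using conj_by_image_image[of g "inv g" A] assms subset by simp
  also have "\<dots> \<subseteq> conj_by G g ` A" using *[of "inv g"] assms by (intro image_mono) simp
  finally show ?thesis using *[OF assms(2)] by blast
qed

lemma centralizer_inD: "\<lbrakk>g \<in> centralizer_in G P; x \<in> P\<rbrakk> \<Longrightarrow> g \<otimes> x = x \<otimes> g"
  by (simp add: centralizer_in_def)

lemma centralizer_in_carrier: "g \<in> centralizer_in G P \<Longrightarrow> g \<in> carrier G"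
  by (simp add: centralizer_in_def)

lemma centralizer_in_iff_conj_by:
  "P \<subseteq> carrier G \<Longrightarrow> g \<in> centralizer_in G P \<longleftrightarrow> g \<in> carrier G \<and> (\<forall>x\<in>P. conj_by G g x = x)"
  using conj_by_eq_self_iff by (auto simp: centralizer_in_def subset_iff)

lemma centralizer_in_conj_by:
  assumes "P \<subseteq> carrier G" "g \<in> carrier G" "c \<in> centralizer_in G P"
  shows "conj_by G g c \<in> centralizer_in G (conj_by G g ` P)"
  unfolding centralizer_in_def
proof (simp add: assms centralizer_in_carrier[OF assms(3)], intro ballI)
  fix x assume "x \<in> P"
  then show "conj_by G g c \<otimes> conj_by G g x = conj_by G g x \<otimes> conj_by G g c"
    using centralizer_inD[OF assms(3), of x] assms(1,2) centralizer_in_carrier[OF assms(3)]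
    by (simp flip: conj_by_mult add: subset_iff)
qed

lemma normalizer_in_subgroup:
  assumes "P \<subseteq> carrier G"
  shows "subgroup (normalizer_in G P) G"
proof (rule subgroupI)
  show "normalizer_in G P \<noteq> {}" using assms by (force simp: normalizer_in_def)
  show "inv a \<in> normalizer_in G P" if "a \<in> normalizer_in G P" for a
    using that assms conj_by_image_swap[of a P P] by (simp add: normalizer_in_def)
  show "a \<otimes> b \<in> normalizer_in G P" if "a \<in> normalizer_in G P" "b \<in> normalizer_in G P" for a b
    using that assms by (simp add: normalizer_in_def flip: conj_by_image_image)
qed (auto simp: normalizer_in_def)

lemma normalizer_in_conj_by:
  assumes "P \<subseteq> carrier G" "g \<in> carrier G" "n \<in> normalizer_in G P"
  shows "conj_by G g n \<in> normalizer_in G (conj_by G g ` P)"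
proof -
  have n: "n \<in> carrier G" "conj_by G n ` P = P" using assms(3) by (auto simp: normalizer_in_def)
  have "conj_by G (conj_by G g n) ` conj_by G g ` P = conj_by G (conj_by G g n \<otimes> g) ` P"
    using assms n by (intro conj_by_image_image) auto
  also have "conj_by G g n \<otimes> g = g \<otimes> n" using assms n by (simp add: conj_by_def m_assoc)
  also have "conj_by G (g \<otimes> n) ` P = conj_by G g ` P"
    using assms n by (simp flip: conj_by_image_image)
  finally show ?thesis using assms n by (simp add: normalizer_in_def)
qed

lemma commuting_set_mult_subgroup:
  assumes "subgroup A G" "subgroup B G" "B \<subseteq> centralizer_in G A"
  shows "subgroup (A <#> B) G" "A \<subseteq> A <#> B" "B \<subseteq> A <#> B"
proof -
  interpret A: subgroup A G by fact
  interpret B: subgroup B G by fact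
  have comm: "b \<otimes> a = a \<otimes> b" if "a \<in> A" "b \<in> B" for a b
    using centralizer_inD[of b A a] that assms(3) by blast
  show "subgroup (A <#> B) G"
  proof (rule subgroupI)
    show "A <#> B \<subseteq> carrier G" by (auto elim!: set_multE)
    show "A <#> B \<noteq> {}" using set_multI[OF A.one_closed B.one_closed] by blast
  next
    fix x assume "x \<in> A <#> B"
    then obtain a b where ab: "a \<in> A" "b \<in> B" "x = a \<otimes> b" by (elim set_multE)
    then have "inv x = inv a \<otimes> inv b" using comm[of "inv a" "inv b"] by (simp add: inv_mult_group)
    then show "inv x \<in> A <#> B" using set_multI[of "inv a" A "inv b" B] ab by simp
  next
    fix x y assume "x \<in> A <#> B" "y \<in> A <#> B"
    then obtain a b c d where ab: "a \<in> A" "b \<in> B" "x = a \<otimes> b" and cd: "c \<in> A" "d \<in> B" "y = c \<otimes> d"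
      by (elim set_multE)
    have "x \<otimes> y = a \<otimes> (b \<otimes> c) \<otimes> d" using ab cd by (simp add: m_assoc)
    also have "\<dots> = (a \<otimes> c) \<otimes> (b \<otimes> d)" unfolding comm[OF cd(1) ab(2)] using ab cd by (simp add: m_assoc)
    finally show "x \<otimes> y \<in> A <#> B" using set_multI[of "a \<otimes> c" A "b \<otimes> d" B] ab cd by simp
  qed
  show "A \<subseteq> A <#> B"
  proof
    fix x assume "x \<in> A"
    then show "x \<in> A <#> B" using set_multI[OF \<open>x \<in> A\<close> B.one_closed, where G = G] by simp
  qed
  show "B \<subseteq> A <#> B"
  proof
    fix x assume "x \<in> B"
    then show "x \<in> A <#> B" using set_multI[OF A.one_closed \<open>x \<in> B\<close>, where G = G] by simp
  qed
qed

text \<open>Cauchy's theorem for the primes other than \<open>p\<close>.\<close>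

lemma card_of_p_elements:
  assumes "prime p" "finite (carrier G)" "subgroup H G" "\<And>x. x \<in> H \<Longrightarrow> p_element p G x"
  shows "\<exists>n. card H = p ^ n"
proof -
  interpret subgroup H G by fact
  have finH: "finite H" using assms(2) subset by (rule finite_subset[rotated])
  then have "card H \<noteq> 0" using subgroup.one_closed[OF assms(3)] by (metis card_0_eq empty_iff)
  then obtain m where m: "card H = p ^ multiplicity p (card H) * m" "\<not> p dvd m"
    using multiplicity_decompose'[of "card H" p] assms(1) by (metis not_prime_unit)
  have "m = 1"
  proof (rule ccontr)
    assume "m \<noteq> 1"
    then obtain q where q: "prime q" "q dvd m" using prime_factor_nat by blast
    then have "q dvd card H" using m(1) by (metis dvd_mult)
    then obtain k where "order (G\<lparr>carrier := H\<rparr>) = q ^ 1 * k" by (auto simp: order_def)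
    from sylow_thm[OF q(1) subgroup_is_group[OF is_group] this] finH obtain K where
      K: "subgroup K (G\<lparr>carrier := H\<rparr>)" "card K = q" by auto
    have KG: "subgroup K G" using incl_subgroup[OF assms(3) K(1)] .
    have "coprime q p" using q m(2) assms(1) by (metis primes_coprime)
    have "K \<subseteq> {\<one>}"
    proof
      fix x assume x: "x \<in> K"
      have "x \<in> H" using subgroup.subset[OF K(1)] x by auto
      then have "p_element p G x" by (rule assms(4))
      moreover have "p_regular p G x"
        using p_regular_of_coprime_subgroup[OF KG _ x] K(2) \<open>coprime q p\<close> by simp
      ultimately show "x \<in> {\<one>}" using p_element_p_regular_one \<open>x \<in> H\<close> by simp
    qed
    then have "card K \<le> 1" using card_mono[of "{\<one>}" K] by simp
    then show False using K(2) prime_gt_1_nat[OF q(1)] by simp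
  qed
  then show ?thesis using m(1) by auto
qed

lemma p_element_generate:
  assumes "prime p" "x \<in> carrier G" "p_element p G x"
  shows "\<exists>k. card (generate G {x}) = p ^ k"
proof -
  obtain n where "x [^] (p ^ n :: nat) = \<one>" using assms(3) unfolding p_element_def by blast
  then have "ord x dvd p ^ n" using pow_eq_id[OF assms(2)] by simp
  then show ?thesis using generate_pow_card[OF assms(2)] assms(1) by (metis divides_primepow_nat)
qed

text \<open>The witness is the product of \<open>P\<close> with the cyclic group generated by \<open>y\<close>.\<close>

lemma p_subgroup_mult_p_element:
  assumes "prime p" "finite (carrier G)" "subgroup P G" "card P = p ^ n"
    "y \<in> centralizer_in G P" "p_element p G y"
  shows "\<exists>Q m. subgroup Q G \<and> card Q = p ^ m \<and> P \<subseteq> Q \<and> y \<in> Q"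
proof -
  interpret P: subgroup P G by fact
  have y: "y \<in> carrier G" using assms(5) by (rule centralizer_in_carrier)
  let ?Y = "generate G {y}"
  obtain k where k: "card ?Y = p ^ k" using p_element_generate[OF assms(1) y assms(6)] by blast
  have Y: "subgroup ?Y G" using y by (intro generate_is_subgroup) simp
  have YC: "?Y \<subseteq> centralizer_in G P"
    using assms(5) by (intro generate_subgroup_incl centralizer_in_subgroup P.subset) simp
  have yY: "y \<in> ?Y" by (rule generate.incl) simp
  note Q = commuting_set_mult_subgroup[OF assms(3) Y YC]
  have "p_element p G x" if "x \<in> P <#> ?Y" for x
  proof -
    obtain a b where ab: "a \<in> P" "b \<in> ?Y" "x = a \<otimes> b" using \<open>x \<in> P <#> ?Y\<close> by (elim set_multE)
    have bc: "b \<in> centralizer_in G P" using YC ab by blast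
    show ?thesis unfolding ab(3)
    proof (rule p_element_mult)
      show "a \<otimes> b = b \<otimes> a" using centralizer_inD[OF bc ab(1)] by (rule sym)
      show "p_element p G a" using p_element_of_p_subgroup[OF assms(3,4) ab(1)] .
      show "p_element p G b" using p_element_of_p_subgroup[OF Y k ab(2)] .
    qed (use ab(1) centralizer_in_carrier[OF bc] in auto)
  qed
  then have "\<exists>m. card (P <#> ?Y) = p ^ m" using card_of_p_elements[OF assms(1,2) Q(1)] by blast
  then show ?thesis using Q yY by blast
qed

section \<open>Sylow subgroups of subgroups\<close>

text \<open>The index of \<open>T\<close> in \<open>N\<close> divides its index in \<open>G\<close>.\<close>

lemma sylow_subgroup_between:
  assumes "prime p" "finite (carrier G)" "sylow_subgroup p G T" "subgroup N G" "T \<subseteq> N"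
  shows "sylow_subgroup p (G\<lparr>carrier := N\<rparr>) T"
proof -
  interpret N: subgroup N G by fact
  have T: "subgroup T G" "card T = p ^ multiplicity p (order G)"
    using assms(3) by (auto simp: sylow_subgroup_def)
  have gN: "group (G\<lparr>carrier := N\<rparr>)" by (rule N.subgroup_is_group[OF is_group])
  have TN: "subgroup T (G\<lparr>carrier := N\<rparr>)" using subgroup_incl[OF T(1) assms(4,5)] .
  have pos: "card T > 0" using T(2) prime_gt_0_nat[OF assms(1)] by simp
  have "card (rcosets\<^bsub>G\<lparr>carrier := N\<rparr>\<^esub> T) * card T = card N"
    using group.lagrange[OF gN TN] by (simp add: order_def)
  moreover have "card (rcosets N) * card N = card (rcosets T) * card T"
    using lagrange[OF assms(4)] lagrange[OF T(1)] by simp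
  ultimately have "card (rcosets N) * card (rcosets\<^bsub>G\<lparr>carrier := N\<rparr>\<^esub> T) = card (rcosets T)"
    using pos by (metis mult.assoc mult_right_cancel not_gr0)
  then have "\<not> p dvd card (rcosets\<^bsub>G\<lparr>carrier := N\<rparr>\<^esub> T)"
    using sylow_subgroup_index(2)[OF assms(1) is_group assms(2,3)] by (metis dvd_mult)
  moreover have "finite (carrier (G\<lparr>carrier := N\<rparr>))" using assms(2) N.subset finite_subset by auto
  ultimately show ?thesis using sylow_subgroupI[OF assms(1) gN _ TN T(2)] by blast
qed

lemma p_subgroup_conj_into_sylow_of:
  assumes "prime p" "finite (carrier G)" "subgroup N G" "sylow_subgroup p (G\<lparr>carrier := N\<rparr>) Y"
    "subgroup Q G" "Q \<subseteq> N" "card Q = p ^ n"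
  shows "\<exists>g\<in>N. conj_by G g ` Q \<subseteq> Y"
proof -
  interpret N: subgroup N G by fact
  have "group (G\<lparr>carrier := N\<rparr>)" by (rule N.subgroup_is_group[OF is_group])
  moreover have "finite (carrier (G\<lparr>carrier := N\<rparr>))" using assms(2) N.subset finite_subset by auto
  moreover have "subgroup Q (G\<lparr>carrier := N\<rparr>)" using subgroup_incl[OF assms(5,3,6)] .
  ultimately obtain g where "g \<in> N" "conj_by (G\<lparr>carrier := N\<rparr>) g ` Q \<subseteq> Y"
    using group.p_subgroup_conj_into_sylow[OF _ assms(1) _ assms(4) _ assms(7)] by auto
  moreover have "conj_by (G\<lparr>carrier := N\<rparr>) g x = conj_by G g x" if "g \<in> N" for g x
    using that assms(3) by (simp add: conj_by_def)
  ultimately show ?thesis by auto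
qed

lemma sylow_subgroup_of_exists:
  assumes "prime p" "finite (carrier G)" "subgroup N G"
  obtains Y n where "sylow_subgroup p (G\<lparr>carrier := N\<rparr>) Y" "subgroup Y G" "Y \<subseteq> N" "card Y = p ^ n"
proof -
  interpret N: subgroup N G by fact
  have "finite (carrier (G\<lparr>carrier := N\<rparr>))" using assms(2) N.subset finite_subset by auto
  then obtain Y where Y: "sylow_subgroup p (G\<lparr>carrier := N\<rparr>) Y"
    using sylow_subgroup_exists[OF assms(1) N.subgroup_is_group[OF is_group]] by blast
  then have "subgroup Y (G\<lparr>carrier := N\<rparr>)" and c: "card Y = p ^ multiplicity p (order (G\<lparr>carrier := N\<rparr>))"
    by (auto simp: sylow_subgroup_def)
  then have "subgroup Y G" "Y \<subseteq> N"
    using incl_subgroup[OF assms(3)] subgroup.subset by fastforce+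
  then show ?thesis using that Y c by blast
qed

text \<open>\<open>T\<close> is a normal Sylow subgroup of its normalizer, so a conjugate of \<open>x\<close> in the normalizer
  that lies in \<open>T\<close> forces \<open>x\<close> into \<open>T\<close>.\<close>

lemma p_element_normalizing_sylow:
  assumes "prime p" "finite (carrier G)" "sylow_subgroup p G T"
    "x \<in> normalizer_in G T" "p_element p G x"
  shows "x \<in> T"
proof -
  have T: "subgroup T G" using assms(3) by (simp add: sylow_subgroup_def)
  interpret T: subgroup T G by (rule T)
  let ?N = "normalizer_in G T"
  have N: "subgroup ?N G" by (rule normalizer_in_subgroup[OF T.subset])
  have TN: "T \<subseteq> ?N" using conj_by_self_subgroup[OF T] T.subset by (auto simp: normalizer_in_def)
  have xc: "x \<in> carrier G" using assms(4) by (simp add: normalizer_in_def)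
  let ?Y = "generate G {x}"
  obtain k where k: "card ?Y = p ^ k" using p_element_generate[OF assms(1) xc assms(5)] by blast
  have Y: "subgroup ?Y G" using xc by (intro generate_is_subgroup) simp
  have YN: "?Y \<subseteq> ?N" using assms(4) by (intro generate_subgroup_incl N) simp
  have xY: "x \<in> ?Y" by (rule generate.incl) simp
  obtain g where g: "g \<in> ?N" "conj_by G g ` ?Y \<subseteq> T"
    using p_subgroup_conj_into_sylow_of[OF assms(1,2) N sylow_subgroup_between[OF assms(1-3) N TN] Y YN k] by blast
  then have "conj_by G g x \<in> T" "g \<in> carrier G" "conj_by G g ` T = T" using xY by (auto simp: normalizer_in_def)
  then have "x \<in> conj_by G (inv g) ` T" using xc by (metis conj_by_inv_cancel(1) imageI)
  also have "\<dots> = T" using conj_by_image_swap[OF _ T.subset \<open>conj_by G g ` T = T\<close>] \<open>g \<in> carrier G\<close> by simp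
  finally show ?thesis .
qed

lemma centralizer_subset_normalizer:
  assumes "P \<subseteq> carrier G"
  shows "centralizer_in G P \<subseteq> normalizer_in G P"
proof
  fix x assume x: "x \<in> centralizer_in G P"
  then have "conj_by G x y = y" if "y \<in> P" for y
    using that centralizer_in_iff_conj_by[OF assms] by blast
  then have "conj_by G x ` P = P" by simp
  then show "x \<in> normalizer_in G P" using centralizer_in_carrier[OF x] by (simp add: normalizer_in_def)
qed

lemma sylow_p_centric:
  assumes "prime p" "finite (carrier G)" "sylow_subgroup p G T"
  shows "p_centric p G T"
proof -
  have T: "subgroup T G" "card T = p ^ multiplicity p (order G)"
    using assms(3) by (auto simp: sylow_subgroup_def)
  show ?thesis
    unfolding p_centric_iff[OF assms(1,2) T]
    using p_element_normalizing_sylow[OF assms] centralizer_subset_normalizer[OF subgroup.subset[OF T(1)]]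
    by blast
qed

lemma subgroup_of_p_subgroup:
  assumes "prime p" "subgroup T G" "card T = p ^ n" "subgroup P G" "P \<subseteq> T"
  obtains m where "card P = p ^ m"
proof -
  have "subgroup P (G\<lparr>carrier := T\<rparr>)" by (rule subgroup_incl[OF assms(4,2,5)])
  then have "card P dvd card T"
    using group.lagrange[OF subgroup.subgroup_is_group[OF assms(2) is_group]]
    by (metis dvd_triv_right order_def partial_object.select_convs(1) partial_object.surjective partial_object.update_convs(1))
  then show ?thesis using that assms(1,3) by (metis divides_primepow_nat)
qed

end

section \<open>Control of fusion\<close>

text \<open>Equivalently, every \<open>g\<close> conjugating \<open>P\<close> into \<open>T\<close> lies in \<open>H C_G(P)\<close>.\<close>

definition fusion_controlled ::
    "('a, 'm) monoid_scheme \<Rightarrow> 'a set \<Rightarrow> 'a set \<Rightarrow> 'a set \<Rightarrow> bool" where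
  "fusion_controlled G T H P \<longleftrightarrow>
     (\<forall>g\<in>carrier G. conj_by G g ` P \<subseteq> T \<longrightarrow> (\<exists>h\<in>H. \<forall>y\<in>P. conj_by G h y = conj_by G g y))"

lemma fusion_controlledD:
  assumes "fusion_controlled G T H Q" "g \<in> carrier G" "conj_by G g ` Q \<subseteq> T" "P \<subseteq> Q"
  shows "\<exists>h\<in>H. \<forall>y\<in>P. conj_by G h y = conj_by G g y"
  using assms unfolding fusion_controlled_def by (metis subsetD)

context group
begin

text \<open>A Sylow subgroup of the normalizer of \<open>Q\<close>, chosen to contain the normalizer of \<open>Q\<close> in \<open>T\<close>, is
  moved into \<open>T\<close>. The image of \<open>Q\<close> is then fully normalized: its normalizer in \<open>T\<close> is a Sylow
  subgroup of its normalizer in \<open>G\<close>.\<close>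

lemma move_to_fully_normalized:
  assumes "prime p" "finite (carrier G)" "sylow_subgroup p G T" "subgroup Q G" "Q \<subseteq> T"
  shows "\<exists>x\<in>carrier G. conj_by G x ` Q \<subseteq> T \<and>
    conj_by G x ` (T \<inter> normalizer_in G Q) \<subseteq> T \<inter> normalizer_in G (conj_by G x ` Q) \<and>
    sylow_subgroup p (G\<lparr>carrier := normalizer_in G (conj_by G x ` Q)\<rparr>)
      (T \<inter> normalizer_in G (conj_by G x ` Q))"
proof -
  have T: "subgroup T G" "card T = p ^ multiplicity p (order G)"
    using assms(3) by (auto simp: sylow_subgroup_def)
  interpret T: subgroup T G by (rule T)
  interpret Q: subgroup Q G by fact
  let ?N = "normalizer_in G Q"
  have N: "subgroup ?N G" by (rule normalizer_in_subgroup[OF Q.subset])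
  have NT: "subgroup (T \<inter> ?N) G" by (rule subgroups_Inter_pair[OF T(1) N])
  obtain k where k: "card (T \<inter> ?N) = p ^ k"
    using subgroup_of_p_subgroup[OF assms(1) T NT] by blast
  obtain Y n where Y: "sylow_subgroup p (G\<lparr>carrier := ?N\<rparr>) Y" "subgroup Y G" "Y \<subseteq> ?N" "card Y = p ^ n"
    using sylow_subgroup_of_exists[OF assms(1,2) N] by blast
  obtain g where g: "g \<in> ?N" "conj_by G g ` (T \<inter> ?N) \<subseteq> Y"
    using p_subgroup_conj_into_sylow_of[OF assms(1,2) N Y(1) NT _ k] by blast
  obtain x0 where x0: "x0 \<in> carrier G" "conj_by G x0 ` Y \<subseteq> T"
    using p_subgroup_conj_into_sylow[OF assms(1-3) Y(2,4)] by blast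
  have gc: "g \<in> carrier G" "conj_by G g ` Q = Q" using g(1) by (auto simp: normalizer_in_def)
  define x where "x = x0 \<otimes> g"
  have x: "x \<in> carrier G" unfolding x_def using x0 gc by simp
  have xi: "conj_by G x ` A = conj_by G x0 ` conj_by G g ` A" if "A \<subseteq> carrier G" for A
    unfolding x_def using conj_by_image_image[OF x0(1) gc(1) that] by simp
  define Q' where "Q' = conj_by G x ` Q"
  have Q': "Q' = conj_by G x0 ` Q" unfolding Q'_def xi[OF Q.subset] gc(2) ..
  have Q'c: "Q' \<subseteq> carrier G" unfolding Q'_def using x Q.subset by auto
  have x0Y: "conj_by G x0 ` Y \<subseteq> T \<inter> normalizer_in G Q'"
    using x0(2) Y(3) normalizer_in_conj_by[OF Q.subset x0(1)] unfolding Q' by blast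
  have QN: "Q \<subseteq> T \<inter> ?N"
    using assms(5) conj_by_self_subgroup[OF assms(4)] Q.subset by (auto simp: normalizer_in_def)
  have sub: "conj_by G x ` (T \<inter> ?N) \<subseteq> T \<inter> normalizer_in G Q'"
    using xi[of "T \<inter> ?N"] image_mono[OF g(2), of "conj_by G x0"] x0Y T.subset by blast
  have N': "subgroup (normalizer_in G Q') G" by (rule normalizer_in_subgroup[OF Q'c])
  have NT': "subgroup (T \<inter> normalizer_in G Q') G" by (rule subgroups_Inter_pair[OF T(1) N'])
  have cardN: "card (normalizer_in G Q') = card ?N"
  proof -
    have "conj_by G x ` ?N = normalizer_in G Q'"
    proof (intro equalityI subsetI)
      fix y assume y: "y \<in> normalizer_in G Q'"
      have "conj_by G (inv x) ` Q' = Q" using conj_by_image_swap[OF x Q.subset] Q'_def by simp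
      then have "conj_by G (inv x) y \<in> ?N"
        using normalizer_in_conj_by[OF Q'c inv_closed[OF x] y] by simp
      moreover have "y = conj_by G x (conj_by G (inv x) y)"
        using x y by (simp add: normalizer_in_def)
      ultimately show "y \<in> conj_by G x ` ?N" by blast
    qed (use normalizer_in_conj_by[OF Q.subset x] Q'_def in auto)
    then show ?thesis using card_conj_by_image[OF x subgroup.subset[OF N]] by simp
  qed
  obtain k' where k': "card (T \<inter> normalizer_in G Q') = p ^ k'"
    using subgroup_of_p_subgroup[OF assms(1) T NT'] by blast
  have fin': "finite (normalizer_in G Q')" using finite_subset[OF subgroup.subset[OF N'] assms(2)] .
  have "card (T \<inter> normalizer_in G Q') = p ^ multiplicity p (card ?N)"
  proof (rule antisym)
    have "subgroup (T \<inter> normalizer_in G Q') (G\<lparr>carrier := normalizer_in G Q'\<rparr>)"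
      using subgroup_incl[OF NT' N'] by simp
    from group.lagrange[OF subgroup.subgroup_is_group[OF N' is_group] this]
    have "p ^ k' dvd card ?N" using k' cardN by (metis dvd_triv_right order_def partial_object.select_convs(1) partial_object.surjective partial_object.update_convs(1))
    moreover have "card ?N \<noteq> 0"
      using cardN fin' subgroup.one_closed[OF N'] by (metis card_0_eq empty_iff)
    ultimately have "k' \<le> multiplicity p (card ?N)"
      using assms(1) by (metis multiplicity_geI not_prime_unit)
    then show "card (T \<inter> normalizer_in G Q') \<le> p ^ multiplicity p (card ?N)"
      using k' assms(1) by (metis power_increasing prime_ge_1_nat)
    have "card Y = p ^ multiplicity p (card ?N)" using Y(1) by (simp add: sylow_subgroup_def order_def)
    moreover have "card (conj_by G x0 ` Y) = card Y" using card_conj_by_image[OF x0(1) subgroup.subset[OF Y(2)]] .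
    moreover have "finite (T \<inter> normalizer_in G Q')" using fin' by simp
    ultimately show "p ^ multiplicity p (card ?N) \<le> card (T \<inter> normalizer_in G Q')"
      using card_mono[OF _ x0Y] by simp
  qed
  then have "sylow_subgroup p (G\<lparr>carrier := normalizer_in G Q'\<rparr>) (T \<inter> normalizer_in G Q')"
    using subgroup_incl[OF NT' N'] cardN by (simp add: sylow_subgroup_def order_def)
  moreover have "Q' \<subseteq> T" using sub QN unfolding Q'_def by blast
  ultimately show ?thesis using x sub unfolding Q'_def by blast
qed

text \<open>If \<open>Q\<close> is fully normalized but not \<open>p\<close>-centric, then by a Frattini argument every
  automorphism of \<open>Q\<close> induced by its normalizer extends to the product of \<open>Q\<close> with a Sylow subgroup
  \<open>D\<close> of its centralizer. That product is larger than \<open>Q\<close>, because \<open>y\<close> witnesses that \<open>D\<close> is not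
  contained in \<open>Q\<close>.\<close>

lemma fully_normalized_aut_controlled:
  assumes "prime p" "finite (carrier G)" "sylow_subgroup p G T" "subgroup Q G" "Q \<subseteq> T"
    and NT: "sylow_subgroup p (G\<lparr>carrier := normalizer_in G Q\<rparr>) (T \<inter> normalizer_in G Q)"
    and nc: "y \<in> centralizer_in G Q" "p_element p G y" "y \<notin> Q"
    and IH: "\<And>R. \<lbrakk>subgroup R G; R \<subseteq> T; card Q < card R\<rbrakk> \<Longrightarrow> fusion_controlled G T H R"
    and n: "n \<in> normalizer_in G Q"
  shows "\<exists>h\<in>H. \<forall>z\<in>Q. conj_by G h z = conj_by G n z"
proof -
  have T: "subgroup T G" "card T = p ^ multiplicity p (order G)"
    using assms(3) by (auto simp: sylow_subgroup_def)
  interpret T: subgroup T G by (rule T)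
  interpret Q: subgroup Q G by fact
  let ?N = "normalizer_in G Q" and ?C = "centralizer_in G Q"
  have N: "subgroup ?N G" by (rule normalizer_in_subgroup[OF Q.subset])
  have C: "subgroup ?C G" by (rule centralizer_in_subgroup[OF Q.subset])
  have CN: "?C \<subseteq> ?N" by (rule centralizer_subset_normalizer[OF Q.subset])
  have norm: "conj_by G m c \<in> ?C" if "m \<in> ?N" "c \<in> ?C" for m c
    using centralizer_in_conj_by[OF Q.subset _ that(2), of m] that(1) by (simp add: normalizer_in_def)
  \<comment> \<open>\<open>T\<close> meets the normalizer in a Sylow subgroup, so an element of the normalizer moves a
    Sylow subgroup of the centralizer into \<open>T\<close>.\<close>
  obtain D0 k0 where D0: "sylow_subgroup p (G\<lparr>carrier := ?C\<rparr>) D0" "subgroup D0 G" "D0 \<subseteq> ?C" "card D0 = p ^ k0"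
    using sylow_subgroup_of_exists[OF assms(1,2) C] by blast
  have "D0 \<subseteq> ?N" using D0(3) CN by blast
  then obtain g where g: "g \<in> ?N" "conj_by G g ` D0 \<subseteq> T \<inter> ?N"
    using p_subgroup_conj_into_sylow_of[OF assms(1,2) N NT D0(2) _ D0(4)] by blast
  have gc: "g \<in> carrier G" using g(1) by (simp add: normalizer_in_def)
  define D where "D = conj_by G g ` D0"
  have D: "subgroup D G" unfolding D_def by (rule conj_by_image_subgroup[OF gc D0(2)])
  have DT: "D \<subseteq> T" using g(2) D_def by blast
  have DC: "D \<subseteq> ?C" using norm[OF g(1)] D0(3) unfolding D_def by blast
  have cD: "card D = card D0" unfolding D_def using card_conj_by_image[OF gc subgroup.subset[OF D0(2)]] .
  have sD: "sylow_subgroup p (G\<lparr>carrier := ?C\<rparr>) D"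
    using D0(1) cD subgroup_incl[OF D C DC] by (simp add: sylow_subgroup_def)
  have Dk: "card D = p ^ k0" using cD D0(4) by simp
  \<comment> \<open>Otherwise a conjugate of \<open>y\<close> by an element of the centralizer would lie in \<open>Q\<close>; such
    elements fix \<open>Q\<close> pointwise, so \<open>y\<close> itself would lie in \<open>Q\<close>.\<close>
  have DQ: "\<not> D \<subseteq> Q"
  proof
    assume "D \<subseteq> Q"
    obtain k where k: "card (generate G {y}) = p ^ k"
      using p_element_generate[OF assms(1) centralizer_in_carrier[OF nc(1)] nc(2)] by blast
    have Y: "subgroup (generate G {y}) G" using centralizer_in_carrier[OF nc(1)] by (intro generate_is_subgroup) simp
    have YC: "generate G {y} \<subseteq> ?C" using nc(1) by (intro generate_subgroup_incl C) simp
    obtain c where c: "c \<in> ?C" "conj_by G c ` generate G {y} \<subseteq> D"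
      using p_subgroup_conj_into_sylow_of[OF assms(1,2) C sD Y YC k] by blast
    have cc: "c \<in> carrier G" using centralizer_in_carrier[OF c(1)] .
    have "y \<in> generate G {y}" by (rule generate.incl) simp
    then have q: "conj_by G c y \<in> Q" using c(2) \<open>D \<subseteq> Q\<close> by blast
    then have "conj_by G c (conj_by G c y) = conj_by G c y"
      using c(1) centralizer_in_iff_conj_by[OF Q.subset] by blast
    then have "conj_by G c y = y"
      using inj_on_conj_by[OF cc subset_refl] cc centralizer_in_carrier[OF nc(1)]
      by (metis conj_by_closed inj_onD)
    then show False using q nc(3) by simp
  qed
  have nC: "n \<in> carrier G" "conj_by G n ` Q = Q" using n by (auto simp: normalizer_in_def)
  have nD: "subgroup (conj_by G n ` D) G" by (rule conj_by_image_subgroup[OF nC(1) D])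
  have nDC: "conj_by G n ` D \<subseteq> ?C" using norm[OF n] DC by blast
  have nDk: "card (conj_by G n ` D) = p ^ k0"
    using card_conj_by_image[OF nC(1) subgroup.subset[OF D]] Dk by simp
  \<comment> \<open>Correcting \<open>n\<close> by \<open>c\<close> changes nothing on \<open>Q\<close> and makes it map \<open>D\<close> to itself.\<close>
  obtain c where c: "c \<in> ?C" "conj_by G c ` conj_by G n ` D \<subseteq> D"
    using p_subgroup_conj_into_sylow_of[OF assms(1,2) C sD nD nDC nDk] by blast
  have cc: "c \<in> carrier G" using centralizer_in_carrier[OF c(1)] .
  define m where "m = c \<otimes> n"
  have mc: "m \<in> carrier G" unfolding m_def using cc nC by simp
  have mD: "conj_by G m ` D \<subseteq> D"
    unfolding m_def using c(2) conj_by_image_image[OF cc nC(1) subgroup.subset[OF D]] by simp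
  have mQ: "conj_by G m z = conj_by G n z" if "z \<in> Q" for z
  proof -
    have "conj_by G m z = conj_by G c (conj_by G n z)"
      unfolding m_def using conj_by_conj_by[OF cc nC(1)] that by simp
    moreover have "conj_by G n z \<in> Q" using nC(2) that by blast
    ultimately show ?thesis using c(1) centralizer_in_iff_conj_by[OF Q.subset] by auto
  qed
  define E where "E = Q <#> D"
  note E = commuting_set_mult_subgroup[OF assms(4) D DC, folded E_def]
  have ET: "E \<subseteq> T"
  proof
    fix e assume "e \<in> E"
    then obtain a b where "a \<in> Q" "b \<in> D" "e = a \<otimes> b" unfolding E_def by (elim set_multE)
    then show "e \<in> T" using assms(5) DT by (auto intro!: T.m_closed)
  qed
  have finE: "finite E" using ET T.subset assms(2) by (meson finite_subset)
  have "Q \<subset> E" using E(2,3) DQ by blast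
  then have "card Q < card E" by (rule psubset_card_mono[OF finE])
  then have ctrl: "fusion_controlled G T H E" using IH[OF E(1) ET] by simp
  have "conj_by G m ` E \<subseteq> T"
  proof clarify
    fix e assume "e \<in> E"
    then obtain a b where ab: "a \<in> Q" "b \<in> D" "e = a \<otimes> b" unfolding E_def by (elim set_multE)
    have "b \<in> carrier G" using ab(2) subgroup.subset[OF D] by blast
    then have "conj_by G m e = conj_by G n a \<otimes> conj_by G m b"
      using ab mQ conj_by_mult[OF mc] by simp
    moreover have "conj_by G n a \<in> T" using nC(2) ab(1) assms(5) by blast
    moreover have "conj_by G m b \<in> T" using mD ab(2) DT by blast
    ultimately show "conj_by G m e \<in> T" by simp
  qed
  from fusion_controlledD[OF ctrl mc this E(2)] show ?thesis using mQ by simp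
qed

lemma normalizer_meets_larger:
  assumes "prime p" "finite (carrier G)" "subgroup T G" "card T = p ^ k" "subgroup Q G" "Q \<subseteq> T" "Q \<noteq> T"
  shows "card Q < card (T \<inter> normalizer_in G Q)" "Q \<subseteq> T \<inter> normalizer_in G Q"
    "subgroup (T \<inter> normalizer_in G Q) G"
proof -
  interpret T: subgroup T G by fact
  interpret Q: subgroup Q G by fact
  have finT: "finite T" using assms(2) T.subset finite_subset by blast
  have "\<exists>x\<in>carrier (G\<lparr>carrier := T\<rparr>) - Q. \<forall>q\<in>Q. x \<otimes>\<^bsub>G\<lparr>carrier := T\<rparr>\<^esub> q \<otimes>\<^bsub>G\<lparr>carrier := T\<rparr>\<^esub> inv\<^bsub>G\<lparr>carrier := T\<rparr>\<^esub> x \<in> Q"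
    by (rule group.p_subgroup_normalizer_grows[OF T.subgroup_is_group[OF is_group] assms(1) _ _ subgroup_incl[OF assms(5,3,6)]])
      (use finT assms(4,7) in \<open>auto simp: order_def\<close>)
  then obtain x where x: "x \<in> T" "x \<notin> Q" "\<And>q. q \<in> Q \<Longrightarrow> conj_by G x q \<in> Q"
    using assms(3) by (auto simp: conj_by_def)
  have "conj_by G x ` Q = Q"
  proof (rule card_subset_eq)
    show "finite Q" using finT assms(6) finite_subset by blast
    show "card (conj_by G x ` Q) = card Q" using card_conj_by_image[OF T.mem_carrier[OF x(1)] Q.subset] .
  qed (use x(3) in auto)
  then have "x \<in> T \<inter> normalizer_in G Q" using x(1) by (simp add: normalizer_in_def)
  show sub: "Q \<subseteq> T \<inter> normalizer_in G Q"
    using assms(6) conj_by_self_subgroup[OF assms(5)] Q.subset by (auto simp: normalizer_in_def)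
  have "Q \<subset> T \<inter> normalizer_in G Q" using sub x(2) \<open>x \<in> T \<inter> _\<close> by blast
  then show "card Q < card (T \<inter> normalizer_in G Q)" using finT by (intro psubset_card_mono) auto
  show "subgroup (T \<inter> normalizer_in G Q) G"
    by (rule subgroups_Inter_pair[OF assms(3) normalizer_in_subgroup[OF Q.subset]])
qed

text \<open>A form of Alperin's fusion theorem: conjugations between subgroups of \<open>T\<close> are composites of
  restrictions of conjugations between \<open>p\<close>-centric subgroups. The induction goes from large to small
  subgroups. A conjugation from \<open>P\<close> to \<open>P2\<close> is routed through fully normalized conjugates of both;
  each leg is defined on the normalizer in \<open>T\<close>, which is larger, and what remains is an
  automorphism of a fully normalized subgroup.\<close>

theorem fusion_controlled_of_centric:
  assumes "prime p" "finite (carrier G)" "sylow_subgroup p G T" "subgroup H G"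
    and centric: "\<And>P. \<lbrakk>subgroup P G; P \<subseteq> T; p_centric p G P\<rbrakk> \<Longrightarrow> fusion_controlled G T H P"
    and "subgroup P G" "P \<subseteq> T"
  shows "fusion_controlled G T H P"
  using assms(6,7)
proof (induction "card T - card P" arbitrary: P rule: less_induct)
  case less
  have T: "subgroup T G" "card T = p ^ multiplicity p (order G)"
    using assms(3) by (auto simp: sylow_subgroup_def)
  interpret T: subgroup T G by (rule T)
  interpret P: subgroup P G by (rule less.prems)
  interpret H: subgroup H G by fact
  have finT: "finite T" using assms(2) T.subset finite_subset by blast
  have cardle: "card R \<le> card T" if "R \<subseteq> T" for R using finT that by (rule card_mono)
  have IH: "fusion_controlled G T H R" if "subgroup R G" "R \<subseteq> T" "card P < card R" for R
    using less.hyps[of R] that cardle[OF that(2)] by (simp add: diff_less_mono2)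
  show ?case
  proof (cases "p_centric p G P")
    case True
    then show ?thesis using centric less.prems by blast
  next
    case nc: False
    have "P \<noteq> T" using nc sylow_p_centric[OF assms(1-3)] by blast
    obtain k where k: "card P = p ^ k"
      using subgroup_of_p_subgroup[OF assms(1) T less.prems] by blast
    obtain y where y: "y \<in> centralizer_in G P" "p_element p G y" "y \<notin> P"
      using nc p_centric_iff[OF assms(1,2) less.prems(1) k] by blast
    show ?thesis unfolding fusion_controlled_def
    proof (intro ballI impI)
      fix g assume g: "g \<in> carrier G" and gP: "conj_by G g ` P \<subseteq> T"
      define P2 where "P2 = conj_by G g ` P"
      have P2: "subgroup P2 G" "P2 \<subseteq> T" "card P2 = card P"
        unfolding P2_def using g gP conj_by_image_subgroup[OF g less.prems(1)] card_conj_by_image[OF g P.subset] by auto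
      have P2c: "P2 \<subseteq> carrier G" using P2(1) by (rule subgroup.subset)
      have "P2 \<noteq> T" using P2(3) \<open>P \<noteq> T\<close> less.prems(2) finT by (metis card_subset_eq)
      obtain x where x: "x \<in> carrier G" "conj_by G x ` P \<subseteq> T"
        "conj_by G x ` (T \<inter> normalizer_in G P) \<subseteq> T \<inter> normalizer_in G (conj_by G x ` P)"
        using move_to_fully_normalized[OF assms(1-3) less.prems] by blast
      obtain x2 where x2: "x2 \<in> carrier G" "conj_by G x2 ` P2 \<subseteq> T"
        "conj_by G x2 ` (T \<inter> normalizer_in G P2) \<subseteq> T \<inter> normalizer_in G (conj_by G x2 ` P2)"
        "sylow_subgroup p (G\<lparr>carrier := normalizer_in G (conj_by G x2 ` P2)\<rparr>)
           (T \<inter> normalizer_in G (conj_by G x2 ` P2))"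
        using move_to_fully_normalized[OF assms(1-3) P2(1,2)] by blast
      define P' where "P' = conj_by G x ` P"
      define Q where "Q = conj_by G x2 ` P2"
      have P': "subgroup P' G" "P' \<subseteq> T" "card P' = card P"
        unfolding P'_def using x conj_by_image_subgroup[OF x(1) less.prems(1)] card_conj_by_image[OF x(1) P.subset] by auto
      have Q: "subgroup Q G" "Q \<subseteq> T" "card Q = card P"
        unfolding Q_def using x2 conj_by_image_subgroup[OF x2(1) P2(1)] card_conj_by_image[OF x2(1) P2c] P2(3) by auto
      have "P' \<noteq> T" using P'(3) \<open>P \<noteq> T\<close> less.prems(2) finT by (metis card_subset_eq)
      note NP = normalizer_meets_larger[OF assms(1,2) T less.prems \<open>P \<noteq> T\<close>]
      note NP2 = normalizer_meets_larger[OF assms(1,2) T P2(1,2) \<open>P2 \<noteq> T\<close>]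
      note NP' = normalizer_meets_larger[OF assms(1,2) T P'(1,2) \<open>P' \<noteq> T\<close>]
      \<comment> \<open>Conjugation by \<open>x\<close> carries the normalizer of \<open>P\<close> in \<open>T\<close>, which is larger than \<open>P\<close>, into \<open>T\<close>.\<close>
      have "conj_by G x ` (T \<inter> normalizer_in G P) \<subseteq> T" using x(3) by blast
      from fusion_controlledD[OF IH[OF NP(3) _ NP(1)] x(1) this NP(2)]
      obtain h1 where h1: "h1 \<in> H" "\<forall>z\<in>P. conj_by G h1 z = conj_by G x z" by blast
      \<comment> \<open>\<open>w\<close> carries \<open>P'\<close> to the fully normalized \<open>Q\<close>. Sylow's theorem in the normalizer of \<open>Q\<close>
        provides \<open>n\<close> such that \<open>nw\<close> carries the normalizer of \<open>P'\<close> in \<open>T\<close> into \<open>T\<close>.\<close>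
      define w where "w = x2 \<otimes> g \<otimes> inv x"
      have w: "w \<in> carrier G" unfolding w_def using x x2 g by simp
      have wx: "conj_by G w (conj_by G x z) = conj_by G x2 (conj_by G g z)" if "z \<in> carrier G" for z
        unfolding w_def using x(1) x2(1) g that by (simp add: conj_by_conj_by m_assoc)
      have wP': "conj_by G w ` P' = Q"
        unfolding P'_def Q_def P2_def image_image using wx P.subset by (intro image_cong) auto
      let ?M = "T \<inter> normalizer_in G P'"
      have P'c: "P' \<subseteq> carrier G" using P'(1) by (rule subgroup.subset)
      have Qc: "Q \<subseteq> carrier G" using Q(1) by (rule subgroup.subset)
      have wM: "subgroup (conj_by G w ` ?M) G" by (rule conj_by_image_subgroup[OF w NP'(3)])
      have wMN: "conj_by G w ` ?M \<subseteq> normalizer_in G Q"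
        using normalizer_in_conj_by[OF P'c w] wP' by auto
      obtain k1 where "card ?M = p ^ k1"
        using subgroup_of_p_subgroup[OF assms(1) T NP'(3)] by blast
      then have "card (conj_by G w ` ?M) = p ^ k1" using card_conj_by_image[OF w subgroup.subset[OF NP'(3)]] by simp
      then obtain n where n: "n \<in> normalizer_in G Q" "conj_by G n ` conj_by G w ` ?M \<subseteq> T \<inter> normalizer_in G Q"
        using p_subgroup_conj_into_sylow_of[OF assms(1,2) normalizer_in_subgroup[OF Qc] x2(4)[folded Q_def] wM wMN] by blast
      have nc': "n \<in> carrier G" "conj_by G n ` Q = Q" using n(1) by (auto simp: normalizer_in_def)
      have nw: "n \<otimes> w \<in> carrier G" using nc' w by simp
      have "conj_by G (n \<otimes> w) ` ?M \<subseteq> T"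
        using n(2) conj_by_image_image[OF nc'(1) w subgroup.subset[OF NP'(3)]] by simp
      moreover have "card P < card ?M" using NP'(1) P'(3) by simp
      ultimately obtain h3 where h3: "h3 \<in> H" "\<forall>z\<in>P'. conj_by G h3 z = conj_by G (n \<otimes> w) z"
        using fusion_controlledD[OF IH[OF NP'(3)] nw _ NP'(2)] by blast
      \<comment> \<open>The correction \<open>n\<close> is an automorphism of \<open>Q\<close>; it is undone with
        \<open>fully_normalized_aut_controlled\<close>, for which \<open>y'\<close> witnesses that \<open>Q\<close> is not centric.\<close>
      have gx: "x2 \<otimes> g \<in> carrier G" using x2 g by simp
      have Qg: "Q = conj_by G (x2 \<otimes> g) ` P"
        unfolding Q_def P2_def using conj_by_image_image[OF x2(1) g P.subset] by simp
      define y' where "y' = conj_by G (x2 \<otimes> g) y"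
      have yc: "y \<in> carrier G" using y(1) by (rule centralizer_in_carrier)
      have y': "y' \<in> centralizer_in G Q" "p_element p G y'" "y' \<notin> Q"
      proof -
        show "y' \<in> centralizer_in G Q" unfolding y'_def Qg by (rule centralizer_in_conj_by[OF P.subset gx y(1)])
        show "p_element p G y'" unfolding y'_def by (rule conj_by_p_element[OF gx yc y(2)])
        show "y' \<notin> Q"
        proof
          assume "y' \<in> Q"
          then obtain z where z: "z \<in> P" "conj_by G (x2 \<otimes> g) y = conj_by G (x2 \<otimes> g) z"
            unfolding y'_def Qg by blast
          then have "y = z" using inj_onD[OF inj_on_conj_by[OF gx subset_refl] z(2)] yc by simp
          then show False using z(1) y(3) by simp
        qed
      qed
      have invn: "inv n \<in> normalizer_in G Q"
        using subgroup.m_inv_closed[OF normalizer_in_subgroup[OF Qc] n(1)] .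
      obtain h4 where h4: "h4 \<in> H" "\<forall>z\<in>Q. conj_by G h4 z = conj_by G (inv n) z"
        using fully_normalized_aut_controlled[OF assms(1-3) Q(1,2) x2(4)[folded Q_def] y' _ invn, of H]
          IH Q(3) by auto
      \<comment> \<open>The inverse of \<open>x2\<close> is applied on \<open>M2\<close>, which is larger than \<open>Q\<close>.\<close>
      define M2 where "M2 = conj_by G x2 ` (T \<inter> normalizer_in G P2)"
      have M2: "subgroup M2 G" "M2 \<subseteq> T" "card P < card M2" "Q \<subseteq> M2"
        unfolding M2_def Q_def
        using conj_by_image_subgroup[OF x2(1) NP2(3)] x2(3) NP2(1,2) P2(3)
          card_conj_by_image[OF x2(1) subgroup.subset[OF NP2(3)]] by auto
      have "conj_by G (inv x2) ` M2 = T \<inter> normalizer_in G P2"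
        unfolding M2_def by (rule conj_by_image_swap[OF x2(1) subgroup.subset[OF NP2(3)] refl])
      then have "conj_by G (inv x2) ` M2 \<subseteq> T" by simp
      from fusion_controlledD[OF IH[OF M2(1-3)] inv_closed[OF x2(1)] this M2(4)]
      obtain h5 where h5: "h5 \<in> H" "\<forall>z\<in>Q. conj_by G h5 z = conj_by G (inv x2) z" by blast
      \<comment> \<open>On \<open>P\<close> the composite of these conjugations is \<open>x2\<inverse> n\<inverse> (n w) x = g\<close>.\<close>
      have "\<forall>z\<in>P. conj_by G (h5 \<otimes> h4 \<otimes> h3 \<otimes> h1) z = conj_by G g z"
      proof
        fix z assume z: "z \<in> P"
        then have zc: "z \<in> carrier G" by simp
        have hc: "h1 \<in> carrier G" "h3 \<in> carrier G" "h4 \<in> carrier G" "h5 \<in> carrier G"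
          using h1(1) h3(1) h4(1) h5(1) by simp_all
        define u where "u = conj_by G (x2 \<otimes> g) z"
        have uQ: "u \<in> Q" unfolding u_def Qg using z by blast
        have uc: "u \<in> carrier G" using uQ Qc by blast
        have 1: "conj_by G h3 (conj_by G h1 z) = conj_by G n u"
        proof -
          have "conj_by G h1 z = conj_by G x z" using h1(2) z by blast
          moreover have "conj_by G x z \<in> P'" unfolding P'_def using z by blast
          ultimately have "conj_by G h3 (conj_by G h1 z) = conj_by G (n \<otimes> w) (conj_by G x z)" using h3(2) by simp
          also have "\<dots> = conj_by G n (conj_by G w (conj_by G x z))"
            using conj_by_conj_by[OF nc'(1) w] x(1) zc by simp
          also have "conj_by G w (conj_by G x z) = u"
            unfolding u_def using wx[OF zc] conj_by_conj_by[OF x2(1) g zc] by simp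
          finally show ?thesis .
        qed
        have nuQ: "conj_by G n u \<in> Q" using nc'(2) uQ by blast
        have "conj_by G (h5 \<otimes> h4 \<otimes> h3 \<otimes> h1) z = conj_by G h5 (conj_by G h4 (conj_by G h3 (conj_by G h1 z)))"
          using hc zc by (simp add: conj_by_conj_by m_assoc)
        also have "\<dots> = conj_by G h5 (conj_by G (inv n) (conj_by G n u))" unfolding 1 using h4(2) nuQ by simp
        also have "\<dots> = conj_by G h5 u" using nc'(1) uc by simp
        also have "\<dots> = conj_by G (inv x2) u" using h5(2) uQ by simp
        also have "\<dots> = conj_by G g z" unfolding u_def using x2(1) g zc by (simp add: conj_by_conj_by)
        finally show "conj_by G (h5 \<otimes> h4 \<otimes> h3 \<otimes> h1) z = conj_by G g z" .
      qed
      moreover have "h5 \<otimes> h4 \<otimes> h3 \<otimes> h1 \<in> H" using h1(1) h3(1) h4(1) h5(1) by simp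
      ultimately show "\<exists>h\<in>H. \<forall>y\<in>P. conj_by G h y = conj_by G g y" by blast
    qed
  qed
qed

end

section \<open>The centric linking system\<close>

lemma functor_eqI:
  assumes "restrict_functor C A = A" "restrict_functor C B = B"
    and "\<And>P. P \<in> Ob C \<Longrightarrow> on_ob A P = on_ob B P"
    and "\<And>P Q m. \<lbrakk>P \<in> Ob C; Q \<in> Ob C; m \<in> Mor C P Q\<rbrakk> \<Longrightarrow> on_mor A P Q m = on_mor B P Q m"
  shows "A = B"
proof -
  have "restrict_functor C A = restrict_functor C B"
    unfolding restrict_functor_def using assms(3,4) by (auto simp: fun_eq_iff restrict_def)
  then show ?thesis using assms(1,2) by simp
qed

lemma restrict_functor_idem [simp]: "restrict_functor C (restrict_functor C A) = restrict_functor C A"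
  by (auto simp: restrict_functor_def fun_eq_iff restrict_def)

lemma on_ob_restrict [simp]: "P \<in> Ob C \<Longrightarrow> on_ob (restrict_functor C A) P = on_ob A P"
  by (simp add: restrict_functor_def)

lemma on_mor_restrict [simp]:
  "\<lbrakk>P \<in> Ob C; Q \<in> Ob C; m \<in> Mor C P Q\<rbrakk> \<Longrightarrow> on_mor (restrict_functor C A) P Q m = on_mor A P Q m"
  by (simp add: restrict_functor_def)

lemma comp_functor_restricted [simp]: "restrict_functor C (comp_functor C B A) = comp_functor C B A"
  by (simp add: comp_functor_def)

lemma id_functor_restricted [simp]: "restrict_functor C (id_functor C) = id_functor C"
  by (simp add: id_functor_def)

locale sylow_pair = group G for G (structure) +
  fixes p :: nat and T
  assumes prime_p: "prime p" and fin: "finite (carrier G)" and sylow: "sylow_subgroup p G T"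
begin

abbreviation "L \<equiv> linking_system p G T"
abbreviation "Core P \<equiv> p_prime_core p G (centralizer_in G P)"
abbreviation "\<delta> \<equiv> link_delta p G"
abbreviation "ind \<equiv> induced_functor p G T"

lemma T_sub: "subgroup T G" and card_T: "card T = p ^ multiplicity p (order G)"
  using sylow by (auto simp: sylow_subgroup_def)

lemma Ob_iff: "P \<in> Ob L \<longleftrightarrow> subgroup P G \<and> P \<subseteq> T \<and> p_centric p G P"
  by (simp add: linking_system_def)

lemma Ob_subgroup: "P \<in> Ob L \<Longrightarrow> subgroup P G" and Ob_T: "P \<in> Ob L \<Longrightarrow> P \<subseteq> T"
  and Ob_carrier: "P \<in> Ob L \<Longrightarrow> P \<subseteq> carrier G"
  by (auto simp: Ob_iff dest: subgroup.subset)

lemma T_Ob: "T \<in> Ob L"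
  using sylow_p_centric[OF prime_p fin sylow] T_sub by (simp add: Ob_iff)

lemma p_subgroup: "\<lbrakk>subgroup P G; P \<subseteq> T\<rbrakk> \<Longrightarrow> \<exists>n. card P = p ^ n"
  using subgroup_of_p_subgroup[OF prime_p T_sub card_T] by metis

lemma T_p_element: "x \<in> T \<Longrightarrow> p_element p G x"
  using p_element_of_p_subgroup[OF T_sub card_T] .

lemma centric_iff:
  "\<lbrakk>subgroup P G; P \<subseteq> T\<rbrakk> \<Longrightarrow>
    p_centric p G P \<longleftrightarrow> (\<forall>x\<in>centralizer_in G P. p_element p G x \<longrightarrow> x \<in> P)"
  using p_subgroup p_centric_iff[OF prime_p fin] by blast

lemma Core_eq:
  assumes "P \<in> Ob L" shows "Core P = {x \<in> centralizer_in G P. p_regular p G x}"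
  using assms p_subgroup p_centric_core[OF prime_p fin] Ob_iff by blast

lemma Core_decomp:
  "\<lbrakk>P \<in> Ob L; x \<in> centralizer_in G P\<rbrakk> \<Longrightarrow> \<exists>z\<in>P. \<exists>y\<in>Core P. x = z \<otimes> y"
  using p_subgroup p_centric_decomp[OF prime_p fin] Ob_iff by blast

lemma Core_subgroup:
  assumes "P \<in> Ob L" shows "subgroup (Core P) G" "coprime (card (Core P)) p"
proof -
  note c = centralizer_core[OF prime_p fin Ob_carrier[OF assms]]
  show "subgroup (Core P) G"
    by (rule incl_subgroup[OF centralizer_in_subgroup[OF Ob_carrier[OF assms]] normal_imp_subgroup[OF c(1)]])
  show "coprime (card (Core P)) p" by (rule c(2))
qed

lemma Core_carrier: "\<lbrakk>P \<in> Ob L; x \<in> Core P\<rbrakk> \<Longrightarrow> x \<in> carrier G"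
  using Core_subgroup(1) subgroup.mem_carrier by metis

lemma delta_mem_iff:
  assumes "P \<in> Ob L" "g \<in> carrier G" "h \<in> carrier G"
  shows "h \<in> \<delta> P g \<longleftrightarrow> inv g \<otimes> h \<in> Core P"
proof -
  have "h = g \<otimes> w \<longleftrightarrow> w = inv g \<otimes> h" if "w \<in> Core P" for w
    using Core_carrier[OF assms(1) that] assms(2,3) by auto
  then show ?thesis unfolding link_delta_def l_coset_def by auto
qed

lemma delta_subset: "\<lbrakk>P \<in> Ob L; g \<in> carrier G\<rbrakk> \<Longrightarrow> \<delta> P g \<subseteq> carrier G"
  using Core_carrier by (auto simp: link_delta_def l_coset_def)

lemma delta_self: "\<lbrakk>P \<in> Ob L; g \<in> carrier G\<rbrakk> \<Longrightarrow> g \<in> \<delta> P g"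
  using delta_mem_iff subgroup.one_closed[OF Core_subgroup(1)] by simp

lemma delta_eq_iff:
  assumes "P \<in> Ob L" "g \<in> carrier G" "h \<in> carrier G"
  shows "\<delta> P g = \<delta> P h \<longleftrightarrow> inv g \<otimes> h \<in> Core P"
proof
  assume "\<delta> P g = \<delta> P h"
  then show "inv g \<otimes> h \<in> Core P" using delta_mem_iff[OF assms] delta_self[OF assms(1,3)] by simp
next
  assume "inv g \<otimes> h \<in> Core P"
  then have "h \<in> g <# Core P" using delta_mem_iff[OF assms] by (simp add: link_delta_def)
  then show "\<delta> P g = \<delta> P h"
    unfolding link_delta_def using l_repr_independence[OF _ assms(2) Core_subgroup(1)[OF assms(1)]] by simp
qed

lemma transporter_iff:
  "g \<in> transporter G P Q \<longleftrightarrow> g \<in> carrier G \<and> conj_by G g ` P \<subseteq> Q"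
  by (simp add: transporter_def)

lemma Mor_iff: "m \<in> Mor L P Q \<longleftrightarrow> (\<exists>g\<in>transporter G P Q. m = \<delta> P g)"
  by (auto simp: linking_system_def)

lemma Comp_L [simp]: "Comp L P Q R h g = h <#> g" and Ident_L [simp]: "Ident L P = \<delta> P \<one>"
  by (simp_all add: linking_system_def)

lemma one_transporter: "\<lbrakk>P \<in> Ob L; P \<subseteq> Q\<rbrakk> \<Longrightarrow> \<one> \<in> transporter G P Q"
  using Ob_carrier by (simp add: transporter_iff)

lemma transporter_mult:
  assumes "P \<in> Ob L" "h \<in> transporter G Q R" "g \<in> transporter G P Q"
  shows "h \<otimes> g \<in> transporter G P R"
proof -
  have g: "g \<in> carrier G" "conj_by G g ` P \<subseteq> Q" and h: "h \<in> carrier G" "conj_by G h ` Q \<subseteq> R"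
    using assms by (auto simp: transporter_iff)
  have "conj_by G (h \<otimes> g) ` P = conj_by G h ` conj_by G g ` P"
    using conj_by_image_image[OF h(1) g(1) Ob_carrier[OF assms(1)]] by simp
  also have "\<dots> \<subseteq> R" using g(2) h(2) by blast
  finally show ?thesis using g h by (simp add: transporter_iff)
qed

text \<open>An element of \<open>Core Q\<close> centralizes \<open>gPg\<inverse>\<close>, and \<open>p\<close>-regularity is preserved by conjugation.\<close>

lemma Core_conj:
  assumes "P \<in> Ob L" "Q \<in> Ob L" "g \<in> transporter G P Q" "w \<in> Core Q"
  shows "conj_by G (inv g) w \<in> Core P"
proof -
  have g: "g \<in> carrier G" "conj_by G g ` P \<subseteq> Q" using assms(3) by (auto simp: transporter_iff)
  have w: "w \<in> centralizer_in G Q" "p_regular p G w" using assms(2,4) by (auto simp: Core_eq)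
  have wc: "w \<in> carrier G" using w(1) by (rule centralizer_in_carrier)
  have "w \<in> centralizer_in G (conj_by G g ` P)" using w(1) g(2) unfolding centralizer_in_def by blast
  then have "conj_by G (inv g) w \<in> centralizer_in G (conj_by G (inv g) ` conj_by G g ` P)"
    using g Ob_carrier[OF assms(1)] by (intro centralizer_in_conj_by) auto
  also have "conj_by G (inv g) ` conj_by G g ` P = P"
    using conj_by_image_swap[OF g(1) Ob_carrier[OF assms(1)] refl] .
  finally show ?thesis using conj_by_p_regular[OF inv_closed[OF g(1)] wc w(2)] Core_eq[OF assms(1)] by simp
qed

text \<open>The setwise product of two classes is a single class because \<open>Core Q\<close> is carried into \<open>Core P\<close>
  when it is moved past \<open>g\<close>.\<close>

lemma delta_mult:
  assumes "P \<in> Ob L" "Q \<in> Ob L" "g \<in> transporter G P Q" "h \<in> carrier G"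
  shows "\<delta> Q h <#> \<delta> P g = \<delta> P (h \<otimes> g)"
proof -
  have g: "g \<in> carrier G" using assms(3) by (simp add: transporter_iff)
  show ?thesis
  proof (intro equalityI subsetI)
    fix x assume "x \<in> \<delta> Q h <#> \<delta> P g"
    then obtain a b where "a \<in> \<delta> Q h" "b \<in> \<delta> P g" "x = a \<otimes> b" by (elim set_multE)
    then obtain v w where vw: "v \<in> Core Q" "w \<in> Core P" "x = (h \<otimes> v) \<otimes> (g \<otimes> w)"
      by (auto simp: link_delta_def l_coset_def)
    have vc: "v \<in> carrier G" "w \<in> carrier G" using vw Core_carrier assms(1,2) by auto
    have "inv (h \<otimes> g) \<otimes> x = conj_by G (inv g) v \<otimes> w"
      unfolding vw(3) using g assms(4) vc by (simp add: conj_by_def inv_mult_group m_assoc)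
    moreover have "conj_by G (inv g) v \<otimes> w \<in> Core P"
      using subgroup.m_closed[OF Core_subgroup(1)[OF assms(1)] Core_conj[OF assms(1-3) vw(1)] vw(2)] .
    moreover have "x \<in> carrier G" using vw(3) vc g assms(4) by simp
    ultimately show "x \<in> \<delta> P (h \<otimes> g)" using delta_mem_iff[OF assms(1), of "h \<otimes> g" x] g assms(4) by simp
  next
    fix x assume "x \<in> \<delta> P (h \<otimes> g)"
    then obtain w where w: "w \<in> Core P" "x = (h \<otimes> g) \<otimes> w" by (auto simp: link_delta_def l_coset_def)
    have "x = h \<otimes> (g \<otimes> w)" using w Core_carrier[OF assms(1) w(1)] g assms(4) by (simp add: m_assoc)
    moreover have "g \<otimes> w \<in> \<delta> P g" using w(1) by (auto simp: link_delta_def l_coset_def)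
    ultimately show "x \<in> \<delta> Q h <#> \<delta> P g" using set_multI[OF delta_self[OF assms(2,4)]] by metis
  qed
qed

lemma Comp_Mor:
  assumes "P \<in> Ob L" "Q \<in> Ob L" "R \<in> Ob L" "g \<in> Mor L P Q" "h \<in> Mor L Q R"
  shows "Comp L P Q R h g \<in> Mor L P R"
proof -
  obtain a where a: "a \<in> transporter G P Q" "g = \<delta> P a" using assms(4) by (auto simp: Mor_iff)
  obtain b where b: "b \<in> transporter G Q R" "h = \<delta> Q b" using assms(5) by (auto simp: Mor_iff)
  have "b \<in> carrier G" using b(1) by (simp add: transporter_iff)
  then have "Comp L P Q R h g = \<delta> P (b \<otimes> a)" using delta_mult[OF assms(1,2) a(1)] a(2) b(2) by simp
  then show ?thesis using transporter_mult[OF assms(1) b(1) a(1)] by (auto simp: Mor_iff)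
qed

section \<open>Automorphisms stabilizing the Sylow subgroup\<close>

text \<open>Unlike the members of \<open>stable_automorphisms\<close>, the functions considered here may be
  arbitrary outside the carrier, so that conjugations qualify without restriction.\<close>

definition stable :: "('a \<Rightarrow> 'a) \<Rightarrow> bool" where
  "stable f \<longleftrightarrow> f \<in> iso G G \<and> f ` T = T"

lemma stable_group_hom: "stable f \<Longrightarrow> group_hom G G f"
  by (simp add: stable_def iso_def group_hom_def group_hom_axioms_def)

lemma stable_closed: "\<lbrakk>stable f; x \<in> carrier G\<rbrakk> \<Longrightarrow> f x \<in> carrier G"
  by (simp add: stable_def iso_def hom_def Pi_def)

lemma stable_mult: "\<lbrakk>stable f; x \<in> carrier G; y \<in> carrier G\<rbrakk> \<Longrightarrow> f (x \<otimes> y) = f x \<otimes> f y"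
  by (simp add: stable_def iso_def hom_def)

lemma stable_inv: "\<lbrakk>stable f; x \<in> carrier G\<rbrakk> \<Longrightarrow> f (inv x) = inv (f x)"
  using group_hom.hom_inv[OF stable_group_hom] .

lemma stable_one: "stable f \<Longrightarrow> f \<one> = \<one>"
  using group_hom.hom_one[OF stable_group_hom] .

lemma stable_inj: "stable f \<Longrightarrow> inj_on f (carrier G)"
  by (simp add: stable_def iso_def bij_betw_def)

lemma stable_surj: "stable f \<Longrightarrow> f ` carrier G = carrier G"
  by (simp add: stable_def iso_def bij_betw_def)

lemma stable_conj: "\<lbrakk>stable f; g \<in> carrier G; x \<in> carrier G\<rbrakk> \<Longrightarrow> f (conj_by G g x) = conj_by G (f g) (f x)"
  by (simp add: conj_by_def stable_mult stable_inv stable_closed)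

lemma stable_conj_image:
  "\<lbrakk>stable f; g \<in> carrier G; A \<subseteq> carrier G\<rbrakk> \<Longrightarrow> f ` conj_by G g ` A = conj_by G (f g) ` f ` A"
  by (auto simp: image_image stable_conj subset_iff intro!: image_cong)

lemma stable_conj_by: "g \<in> normalizer_in G T \<Longrightarrow> stable (conj_by G g)"
  by (auto simp: stable_def iso_def normalizer_in_def bij_betw_def conj_by_hom inj_on_conj_by)

lemma stable_comp: "\<lbrakk>stable f; stable g\<rbrakk> \<Longrightarrow> stable (f \<circ> g)"
  unfolding stable_def using iso_set_trans[of g G G f G] by (metis image_comp)

lemma stable_cong:
  assumes "stable f" "\<And>x. x \<in> carrier G \<Longrightarrow> g x = f x"
  shows "stable g"
proof -
  have "g \<in> iso G G" using iso_eq[of f G g] assms by (simp add: stable_def)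
  moreover have "g ` T = f ` T" using assms(2) subgroup.subset[OF T_sub] by (intro image_cong) auto
  ultimately show ?thesis using assms(1) by (simp add: stable_def)
qed

lemma stable_id: "stable (\<lambda>x. x)"
  by (simp add: stable_def iso_set_refl)

lemma stable_centralizer:
  assumes "stable f" "P \<subseteq> carrier G"
  shows "centralizer_in G (f ` P) = f ` centralizer_in G P"
proof (intro equalityI subsetI)
  fix x assume x: "x \<in> centralizer_in G (f ` P)"
  then have "x \<in> f ` carrier G" using stable_surj[OF assms(1)] centralizer_in_carrier by blast
  then obtain y where y: "y \<in> carrier G" "x = f y" by blast
  have "y \<otimes> z = z \<otimes> y" if "z \<in> P" for z
  proof -
    have "f (y \<otimes> z) = f (z \<otimes> y)"
      using centralizer_inD[OF x, of "f z"] that y assms stable_mult[OF assms(1) y(1), of z]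
        stable_mult[OF assms(1) _ y(1), of z] by auto
    then show ?thesis using inj_onD[OF stable_inj[OF assms(1)], of "y \<otimes> z" "z \<otimes> y"] y(1) that assms(2) by auto
  qed
  then have "y \<in> centralizer_in G P" using y(1) unfolding centralizer_in_def by blast
  then show "x \<in> f ` centralizer_in G P" using y(2) by blast
next
  fix x assume "x \<in> f ` centralizer_in G P"
  then obtain y where y: "y \<in> centralizer_in G P" "x = f y" by blast
  have yc: "y \<in> carrier G" using y(1) by (rule centralizer_in_carrier)
  have "f y \<otimes> f z = f z \<otimes> f y" if "z \<in> P" for z
    using centralizer_inD[OF y(1) that] yc that assms by (metis stable_mult subsetD)
  then show "x \<in> centralizer_in G (f ` P)"
    using y(2) stable_closed[OF assms(1) yc] unfolding centralizer_in_def by blast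
qed

lemma stable_p_element_iff:
  assumes "stable f" "x \<in> carrier G"
  shows "p_element p G (f x) \<longleftrightarrow> p_element p G x" "p_regular p G (f x) \<longleftrightarrow> p_regular p G x"
proof -
  interpret group_hom G G f by (rule stable_group_hom[OF assms(1)])
  have "(f x) [^] n = \<one> \<longleftrightarrow> x [^] n = \<one>" for n :: nat
  proof -
    have "f (x [^] n) = f \<one> \<longleftrightarrow> x [^] n = \<one>"
      using inj_on_eq_iff[OF stable_inj[OF assms(1)]] assms(2) by blast
    then show ?thesis using hom_nat_pow[OF assms(2), of n] hom_one by simp
  qed
  then show "p_element p G (f x) \<longleftrightarrow> p_element p G x" "p_regular p G (f x) \<longleftrightarrow> p_regular p G x"
    by (simp_all add: p_element_def p_regular_def)
qed

lemma stable_Ob: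
  assumes "stable f" "P \<in> Ob L"
  shows "f ` P \<in> Ob L"
proof -
  have s: "subgroup (f ` P) G" using group_hom.subgroup_img_is_subgroup[OF stable_group_hom[OF assms(1)] Ob_subgroup[OF assms(2)]] .
  have t: "f ` P \<subseteq> T" using assms Ob_T by (force simp: stable_def)
  have "\<forall>x\<in>centralizer_in G (f ` P). p_element p G x \<longrightarrow> x \<in> f ` P"
  proof (intro ballI impI)
    fix x assume x: "x \<in> centralizer_in G (f ` P)" "p_element p G x"
    then obtain y where y: "y \<in> centralizer_in G P" "x = f y"
      using stable_centralizer[OF assms(1) Ob_carrier[OF assms(2)]] by blast
    then have "p_element p G y" using x stable_p_element_iff(1)[OF assms(1) centralizer_in_carrier[OF y(1)]] by simp
    then have "y \<in> P" using y(1) assms(2) centric_iff[of P] by (auto simp: Ob_iff)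
    then show "x \<in> f ` P" using y(2) by blast
  qed
  then have "p_centric p G (f ` P)" using centric_iff[OF s t] by blast
  then show ?thesis using s t by (simp add: Ob_iff)
qed

lemma stable_Core:
  assumes "stable f" "P \<in> Ob L"
  shows "Core (f ` P) = f ` Core P"
proof -
  have "Core (f ` P) = {x \<in> f ` centralizer_in G P. p_regular p G x}"
    using Core_eq[OF stable_Ob[OF assms]] stable_centralizer[OF assms(1) Ob_carrier[OF assms(2)]] by simp
  also have "\<dots> = f ` {x \<in> centralizer_in G P. p_regular p G x}"
    using stable_p_element_iff(2)[OF assms(1) centralizer_in_carrier] by auto
  finally show ?thesis unfolding Core_eq[OF assms(2)] .
qed

lemma stable_delta:
  assumes "stable f" "P \<in> Ob L" "g \<in> carrier G"
  shows "f ` \<delta> P g = \<delta> (f ` P) (f g)"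
  unfolding link_delta_def l_coset_def stable_Core[OF assms(1,2)]
  by (simp add: image_UN stable_mult[OF assms(1,3)] Core_carrier[OF assms(2)])

lemma stable_transporter:
  assumes "stable f" "P \<in> Ob L" "g \<in> transporter G P Q"
  shows "f g \<in> transporter G (f ` P) (f ` Q)"
proof -
  have g: "g \<in> carrier G" "conj_by G g ` P \<subseteq> Q" using assms(3) by (auto simp: transporter_iff)
  have "conj_by G (f g) ` f ` P = f ` conj_by G g ` P"
    using stable_conj_image[OF assms(1) g(1) Ob_carrier[OF assms(2)]] by simp
  also have "\<dots> \<subseteq> f ` Q" using g(2) by (rule image_mono)
  finally show ?thesis using stable_closed[OF assms(1) g(1)] by (simp add: transporter_iff)
qed

lemma Mor_carrier:
  assumes "P \<in> Ob L" "m \<in> Mor L P Q" shows "m \<subseteq> carrier G"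
proof -
  obtain g where "g \<in> carrier G" "m = \<delta> P g" using assms(2) by (auto simp: Mor_iff transporter_iff)
  then show ?thesis using delta_subset[OF assms(1)] by simp
qed

lemma ind_ob: "P \<in> Ob L \<Longrightarrow> on_ob (ind f) P = f ` P"
  by (simp add: induced_functor_def)

lemma ind_mor: "\<lbrakk>P \<in> Ob L; Q \<in> Ob L; m \<in> Mor L P Q\<rbrakk> \<Longrightarrow> on_mor (ind f) P Q m = f ` m"
  by (simp add: induced_functor_def)

lemma ind_restricted [simp]: "restrict_functor L (ind f) = ind f"
  by (simp add: induced_functor_def)

lemma stable_Mor:
  assumes "stable f" "P \<in> Ob L" "m \<in> Mor L P Q" shows "f ` m \<in> Mor L (f ` P) (f ` Q)"
proof -
  obtain g where g: "g \<in> transporter G P Q" "m = \<delta> P g" using assms(3) Mor_iff by blast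
  then show ?thesis using stable_delta[OF assms(1,2), of g] stable_transporter[OF assms(1,2) g(1)]
    by (auto simp: Mor_iff transporter_iff)
qed

lemma ind_comp:
  assumes "stable g"
  shows "comp_functor L (ind f) (ind g) = ind (f \<circ> g)"
proof (rule functor_eqI)
  fix P assume P: "P \<in> Ob L"
  then show "on_ob (comp_functor L (ind f) (ind g)) P = on_ob (ind (f \<circ> g)) P"
    by (simp add: comp_functor_def ind_ob stable_Ob[OF assms] image_comp)
next
  fix P Q m assume "P \<in> Ob L" "Q \<in> Ob L" "m \<in> Mor L P Q"
  then show "on_mor (comp_functor L (ind f) (ind g)) P Q m = on_mor (ind (f \<circ> g)) P Q m"
    by (simp add: comp_functor_def ind_ob ind_mor stable_Ob[OF assms] stable_Mor[OF assms] image_comp)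
qed simp_all

lemma ind_cong:
  assumes "\<And>x. x \<in> carrier G \<Longrightarrow> f x = g x"
  shows "ind f = ind g"
proof (rule functor_eqI)
  fix P assume P: "P \<in> Ob L"
  then show "on_ob (ind f) P = on_ob (ind g) P"
    using assms Ob_carrier[OF P] by (auto simp: ind_ob intro!: image_cong)
next
  fix P Q m assume P: "P \<in> Ob L" "Q \<in> Ob L" "m \<in> Mor L P Q"
  then show "on_mor (ind f) P Q m = on_mor (ind g) P Q m"
    using assms Mor_carrier[OF P(1,3)] by (auto simp: ind_mor intro!: image_cong)
qed simp_all

lemma ind_id: "ind (\<lambda>x. x) = id_functor L"
  by (simp add: induced_functor_def id_functor_def)

lemma comp_id_functor:
  assumes "restrict_functor L A = A" "is_functor L L A"
  shows "comp_functor L (id_functor L) A = A"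
proof (rule functor_eqI[OF _ assms(1)])
  fix P assume P: "P \<in> Ob L"
  then have "on_ob A P \<in> Ob L" using assms(2) by (simp add: is_functor_def)
  then show "on_ob (comp_functor L (id_functor L) A) P = on_ob A P"
    using P by (simp add: comp_functor_def id_functor_def)
next
  fix P Q m assume P: "P \<in> Ob L" "Q \<in> Ob L" "m \<in> Mor L P Q"
  then have "on_ob A P \<in> Ob L" "on_ob A Q \<in> Ob L" "on_mor A P Q m \<in> Mor L (on_ob A P) (on_ob A Q)"
    using assms(2) by (simp_all add: is_functor_def)
  then show "on_mor (comp_functor L (id_functor L) A) P Q m = on_mor A P Q m"
    using P by (simp add: comp_functor_def id_functor_def)
qed simp

section \<open>Surjectivity of kappa in terms of automorphisms\<close>

lemma AutoGroup_carrier: "f \<in> carrier (AutoGroup G) \<longleftrightarrow> f \<in> extensional (carrier G) \<and> f \<in> iso G G"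
  by (auto simp: AutoGroup_def auto_def Bij_def iso_def)

lemma AutoGroup_mult:
  assumes "f \<in> carrier (AutoGroup G)" "g \<in> carrier (AutoGroup G)"
  shows "f \<otimes>\<^bsub>AutoGroup G\<^esub> g = compose (carrier G) f g"
  using assms by (simp add: AutoGroup_def auto_def BijGroup_def)

lemma AutoGroup_one: "\<one>\<^bsub>AutoGroup G\<^esub> = (\<lambda>x\<in>carrier G. x)"
  by (simp add: AutoGroup_def BijGroup_def)

lemma stable_automorphisms_iff:
  "f \<in> stable_automorphisms G T \<longleftrightarrow> f \<in> extensional (carrier G) \<and> stable f"
  by (auto simp: stable_automorphisms_def AutoGroup_carrier stable_def)

lemma AutoGroup_inv:
  assumes "f \<in> carrier (AutoGroup G)" "x \<in> carrier G"
  shows "f ((inv\<^bsub>AutoGroup G\<^esub> f) x) = x" "(inv\<^bsub>AutoGroup G\<^esub> f) (f x) = x"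
proof -
  interpret A: group "AutoGroup G" by (rule AutoGroup)
  have i: "inv\<^bsub>AutoGroup G\<^esub> f \<in> carrier (AutoGroup G)" using assms(1) by simp
  have "f \<otimes>\<^bsub>AutoGroup G\<^esub> inv\<^bsub>AutoGroup G\<^esub> f = (\<lambda>x\<in>carrier G. x)" 
    "inv\<^bsub>AutoGroup G\<^esub> f \<otimes>\<^bsub>AutoGroup G\<^esub> f = (\<lambda>x\<in>carrier G. x)"
    using assms(1) AutoGroup_one by simp_all
  then show "f ((inv\<^bsub>AutoGroup G\<^esub> f) x) = x" "(inv\<^bsub>AutoGroup G\<^esub> f) (f x) = x"
    using assms(2) unfolding AutoGroup_mult[OF assms(1) i] AutoGroup_mult[OF i assms(1)]
    by (metis compose_eq restrict_apply')+
qed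

lemma finite_AutoGroup: "finite (carrier (AutoGroup G))"
proof (rule finite_subset)
  show "carrier (AutoGroup G) \<subseteq> (carrier G \<rightarrow>\<^sub>E carrier G)"
    by (auto simp: AutoGroup_carrier iso_def hom_def PiE_def)
  show "finite (carrier G \<rightarrow>\<^sub>E carrier G)" using fin by (intro finite_PiE) auto
qed

lemma stable_automorphisms_subgroup: "subgroup (stable_automorphisms G T) (AutoGroup G)"
proof (rule group.subgroupI[OF AutoGroup])
  show "stable_automorphisms G T \<subseteq> carrier (AutoGroup G)" by (auto simp: stable_automorphisms_def)
  have "(\<lambda>x\<in>carrier G. x) \<in> stable_automorphisms G T"
    using stable_cong[OF stable_id] by (simp add: stable_automorphisms_iff)
  then show "stable_automorphisms G T \<noteq> {}" by blast
next
  fix f assume f: "f \<in> stable_automorphisms G T"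
  then have fc: "f \<in> carrier (AutoGroup G)" "f ` T = T" by (auto simp: stable_automorphisms_def)
  let ?i = "inv\<^bsub>AutoGroup G\<^esub> f"
  have i: "?i \<in> carrier (AutoGroup G)" using fc by (simp add: group.inv_closed[OF AutoGroup])
  have "?i ` f ` T = T"
    using AutoGroup_inv(2)[OF fc(1)] subgroup.subset[OF T_sub] by (force simp: image_image subset_iff)
  then show "?i \<in> stable_automorphisms G T" using i fc by (simp add: stable_automorphisms_def)
next
  fix f g assume f: "f \<in> stable_automorphisms G T" and g: "g \<in> stable_automorphisms G T"
  then have "stable (f \<circ> g)" using stable_comp by (simp add: stable_automorphisms_iff)
  then have "stable (compose (carrier G) f g)" by (rule stable_cong) (simp add: compose_def)
  moreover have "f \<otimes>\<^bsub>AutoGroup G\<^esub> g = compose (carrier G) f g"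
    using f g by (intro AutoGroup_mult) (auto simp: stable_automorphisms_def)
  ultimately show "f \<otimes>\<^bsub>AutoGroup G\<^esub> g \<in> stable_automorphisms G T" by (simp add: stable_automorphisms_iff)
qed

lemma ind_compose: "stable g \<Longrightarrow> ind (compose (carrier G) f g) = comp_functor L (ind f) (ind g)"
  unfolding ind_comp by (rule ind_cong) (simp add: compose_def)

lemma restrict_conj_by_stable:
  "g \<in> normalizer_in G T \<Longrightarrow> restrict (conj_by G g) (carrier G) \<in> stable_automorphisms G T"
  using stable_cong[OF stable_conj_by] by (simp add: stable_automorphisms_iff)

text \<open>Since induction of functors is multiplicative, cosets of \<open>InnLink\<close> can be written
  with functors induced by automorphisms only. In this way the algebra of \<open>OutLink\<close> is reduced to
  that of automorphisms of \<open>G\<close>.\<close>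

lemma InnLink_coset:
  assumes "stable f"
  shows "InnLink p G T #>\<^bsub>AutLink p G T\<^esub> ind f = (\<lambda>g. ind (conj_by G g \<circ> f)) ` normalizer_in G T"
  unfolding InnLink_def r_coset_def AutLink_def by (auto simp: Let_def ind_comp[OF assms])

lemma AutLinkD:
  assumes "A \<in> carrier (AutLink p G T)"
  shows "is_equivalence L L A" "restrict_functor L A = A" "is_functor L L A"
  using assms by (auto simp: AutLink_def Let_def is_equivalence_def)

text \<open>By Sylow's theorem an automorphism can be corrected by an inner one to stabilize \<open>T\<close>.\<close>

lemma outer_class_meets_stable:
  assumes "X \<in> carrier (OutGroup G)"
  shows "\<exists>f. f \<in> X \<inter> stable_automorphisms G T"
proof -
  obtain f where f: "f \<in> carrier (AutoGroup G)" "X = inner_automorphisms G #>\<^bsub>AutoGroup G\<^esub> f"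
    using assms by (auto simp: OutGroup_def carrier_FactGroup)
  have fi: "f \<in> iso G G" using f by (simp add: AutoGroup_carrier)
  then interpret group_hom G G f by (simp add: iso_def group_hom_def group_hom_axioms_def)
  have inj: "inj_on f (carrier G)" using fi by (simp add: iso_def bij_betw_def)
  have fT: "subgroup (f ` T) G" using subgroup_img_is_subgroup[OF T_sub] .
  have c: "card (f ` T) = card T" using card_image[OF inj_on_subset[OF inj subgroup.subset[OF T_sub]]] .
  then obtain g where g: "g \<in> carrier G" "conj_by G g ` f ` T \<subseteq> T"
    using p_subgroup_conj_into_sylow[OF prime_p fin sylow fT] card_T by metis
  have finT: "finite T" using finite_subset[OF subgroup.subset[OF T_sub] fin] .
  have "card (conj_by G g ` f ` T) = card T" using card_conj_by_image[OF g(1) subgroup.subset[OF fT]] c by simp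
  then have eq: "conj_by G g ` f ` T = T" using card_subset_eq[OF finT g(2)] by simp
  let ?c = "restrict (conj_by G g) (carrier G)"
  have cI: "?c \<in> inner_automorphisms G" using g by (auto simp: inner_automorphisms_def)
  have cA: "?c \<in> carrier (AutoGroup G)"
  proof -
    have "conj_by G g \<in> iso G G" using g by (simp add: iso_def bij_betw_def conj_by_hom inj_on_conj_by)
    then have "?c \<in> iso G G" using iso_eq[of "conj_by G g" G ?c] by simp
    then show ?thesis by (simp add: AutoGroup_carrier)
  qed
  define k where "k = ?c \<otimes>\<^bsub>AutoGroup G\<^esub> f"
  have k: "k = compose (carrier G) ?c f" unfolding k_def by (rule AutoGroup_mult[OF cA f(1)])
  have "k \<in> X" unfolding f(2) k_def r_coset_def using cI by blast
  moreover have "k \<in> carrier (AutoGroup G)" unfolding k_def using cA f(1) group.is_monoid[OF AutoGroup] monoid.m_closed by metis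
  moreover have "k ` T = T"
  proof -
    have "k ` T = conj_by G g ` f ` T"
      unfolding k image_image using subgroup.subset[OF T_sub] by (intro image_cong) (auto simp: compose_def)
    then show ?thesis using eq by simp
  qed
  ultimately show ?thesis by (auto simp: stable_automorphisms_def)
qed

text \<open>Surjectivity of \<open>kappa\<close> concerns classes modulo inner automorphisms, but the inner automorphisms
  of the linking system are themselves induced from \<open>G\<close>. Hence every automorphism of the linking system
  is induced, not only every class.\<close>

lemma AutLink_induced:
  assumes "kappa_surjective p G T" "A \<in> carrier (AutLink p G T)"
  shows "\<exists>f\<in>stable_automorphisms G T. A = ind f"
proof -
  have oneN: "\<one> \<in> normalizer_in G T" using subgroup.one_closed[OF normalizer_in_subgroup[OF subgroup.subset[OF T_sub]]] .
  have "InnLink p G T #>\<^bsub>AutLink p G T\<^esub> A \<in> carrier (OutLink p G T)"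
    using assms(2) by (simp add: OutLink_def carrier_FactGroup)
  then obtain X where X: "X \<in> carrier (OutGroup G)" "InnLink p G T #>\<^bsub>AutLink p G T\<^esub> A = kappa p G T X"
    using assms(1) unfolding kappa_surjective_def by (metis imageE)
  define f where "f = (SOME f. f \<in> X \<inter> stable_automorphisms G T)"
  have "f \<in> X \<inter> stable_automorphisms G T" unfolding f_def by (rule someI_ex[OF outer_class_meets_stable[OF X(1)]])
  then have f: "stable f" by (simp add: stable_automorphisms_iff)
  have "ind (conj_by G \<one>) = id_functor L" unfolding ind_id[symmetric] by (rule ind_cong) simp
  then have "A \<in> InnLink p G T #>\<^bsub>AutLink p G T\<^esub> A"
    unfolding r_coset_def InnLink_def using oneN comp_id_functor[OF AutLinkD(2,3)[OF assms(2)]]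
    by (auto simp: AutLink_def Let_def intro!: bexI[of _ \<one>])
  then have "A \<in> (\<lambda>g. ind (conj_by G g \<circ> f)) ` normalizer_in G T"
    unfolding X(2) kappa_def f_def[symmetric] InnLink_coset[OF f] .
  then obtain g where g: "g \<in> normalizer_in G T" "A = ind (conj_by G g \<circ> f)" by blast
  let ?h = "restrict (conj_by G g \<circ> f) (carrier G)"
  have "A = ind ?h" unfolding g(2) by (rule ind_cong) simp
  moreover have "?h \<in> stable_automorphisms G T"
    using stable_cong[OF stable_comp[OF stable_conj_by[OF g(1)] f]] by (simp add: stable_automorphisms_iff)
  ultimately show ?thesis by blast
qed

lemma ind_eq_iff:
  assumes "stable f" "stable g"
  shows "ind f = ind g \<longleftrightarrow> (\<forall>P\<in>Ob L. f ` P = g ` P \<and>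
     (\<forall>Q\<in>Ob L. \<forall>x\<in>transporter G P Q. \<delta> (f ` P) (f x) = \<delta> (f ` P) (g x)))" (is "_ \<longleftrightarrow> ?R")
proof
  assume eq: "ind f = ind g"
  show ?R
  proof (intro ballI conjI)
    fix P assume P: "P \<in> Ob L"
    show fg: "f ` P = g ` P" using eq ind_ob[OF P] by metis
    fix Q x assume Q: "Q \<in> Ob L" and x: "x \<in> transporter G P Q"
    then have m: "\<delta> P x \<in> Mor L P Q" "x \<in> carrier G" by (auto simp: Mor_iff transporter_iff)
    have "f ` \<delta> P x = g ` \<delta> P x" using eq ind_mor[OF P Q m(1)] by metis
    then show "\<delta> (f ` P) (f x) = \<delta> (f ` P) (g x)"
      using stable_delta[OF assms(1) P m(2)] stable_delta[OF assms(2) P m(2)] fg by simp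
  qed
next
  assume R: ?R
  show "ind f = ind g"
  proof (rule functor_eqI)
    fix P assume P: "P \<in> Ob L" then show "on_ob (ind f) P = on_ob (ind g) P" using R ind_ob by simp
  next
    fix P Q m assume P: "P \<in> Ob L" "Q \<in> Ob L" "m \<in> Mor L P Q"
    then obtain x where x: "x \<in> transporter G P Q" "m = \<delta> P x" using Mor_iff by blast
    have xc: "x \<in> carrier G" using x(1) by (simp add: transporter_iff)
    note RP = bspec[OF R P(1)]
    have "f ` P = g ` P" using RP by (rule conjunct1)
    moreover have "\<delta> (f ` P) (f x) = \<delta> (f ` P) (g x)"
      by (rule bspec[OF bspec[OF conjunct2[OF RP] P(2)] x(1)])
    ultimately have "f ` m = g ` m"
      unfolding x(2) using stable_delta[OF assms(1) P(1) xc] stable_delta[OF assms(2) P(1) xc] by simp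
    then show "on_mor (ind f) P Q m = on_mor (ind g) P Q m" using ind_mor[OF P] by simp
  qed simp_all
qed

lemma ind_is_functor:
  assumes "stable f"
  shows "is_functor L L (ind f)"
  unfolding is_functor_def
proof (intro conjI ballI)
  fix P assume P: "P \<in> Ob L"
  show "on_ob (ind f) P \<in> Ob L" unfolding ind_ob[OF P] by (rule stable_Ob[OF assms P])
  have "Ident L P \<in> Mor L P P" using one_transporter[OF P] by (auto simp: Mor_iff)
  then show "on_mor (ind f) P P (Ident L P) = Ident L (on_ob (ind f) P)"
    using stable_delta[OF assms P one_closed] stable_one[OF assms] by (simp add: ind_mor[OF P P] ind_ob[OF P])
next
  fix P Q m assume P: "P \<in> Ob L" "Q \<in> Ob L" "m \<in> Mor L P Q"
  show "on_mor (ind f) P Q m \<in> Mor L (on_ob (ind f) P) (on_ob (ind f) Q)"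
    unfolding ind_mor[OF P] ind_ob[OF P(1)] ind_ob[OF P(2)] by (rule stable_Mor[OF assms P(1,3)])
next
  fix P Q R g h assume P: "P \<in> Ob L" "Q \<in> Ob L" "R \<in> Ob L" "g \<in> Mor L P Q" "h \<in> Mor L Q R"
  have "f ` (h <#> g) = f ` h <#> f ` g"
  proof -
    have c: "g \<subseteq> carrier G" "h \<subseteq> carrier G" using Mor_carrier P by blast+
    have "f ` (h <#> g) = (\<Union>a\<in>h. \<Union>b\<in>g. {f (a \<otimes> b)})" unfolding set_mult_def by blast
    also have "\<dots> = (\<Union>a\<in>h. \<Union>b\<in>g. {f a \<otimes> f b})"
      using c stable_mult[OF assms] by (intro SUP_cong refl) auto
    also have "\<dots> = f ` h <#> f ` g" unfolding set_mult_def by blast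
    finally show ?thesis .
  qed
  then show "on_mor (ind f) P R (Comp L P Q R h g) =
      Comp L (on_ob (ind f) P) (on_ob (ind f) Q) (on_ob (ind f) R) (on_mor (ind f) Q R h) (on_mor (ind f) P Q g)"
    using ind_mor[OF P(1,3) Comp_Mor[OF P]] ind_mor[OF P(1,2,4)] ind_mor[OF P(2,3,5)] by simp
qed

lemma AutLink_iff:
  "A \<in> carrier (AutLink p G T) \<longleftrightarrow> is_equivalence L L A \<and> restrict_functor L A = A \<and>
     (\<forall>P\<in>Ob L. on_mor A P P ` \<delta> P ` P = \<delta> (on_ob A P) ` on_ob A P) \<and>
     (\<forall>P\<in>Ob L. \<forall>Q\<in>Ob L. P \<subseteq> Q \<longrightarrow> on_mor A P Q (\<delta> P \<one>) = \<delta> (on_ob A P) \<one>)"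
  by (simp add: AutLink_def Let_def)

end

section \<open>Transport of self-equivalences along isomorphisms of categories\<close>

definition transport_functor ::
    "('q, 'n) cat \<Rightarrow> ('o, 'm, 'q, 'n) funct \<Rightarrow> ('q, 'n, 'o, 'm) funct \<Rightarrow>
     ('o, 'm, 'o, 'm) funct \<Rightarrow> ('q, 'n, 'q, 'n) funct" where
  "transport_functor D \<Phi> \<Psi> A = comp_functor D \<Phi> (comp_functor D A \<Psi>)"

lemma is_functorD:
  assumes "is_functor C D A"
  shows "P \<in> Ob C \<Longrightarrow> on_ob A P \<in> Ob D"
    and "\<lbrakk>P \<in> Ob C; Q \<in> Ob C; m \<in> Mor C P Q\<rbrakk> \<Longrightarrow> on_mor A P Q m \<in> Mor D (on_ob A P) (on_ob A Q)"
    and "P \<in> Ob C \<Longrightarrow> on_mor A P P (Ident C P) = Ident D (on_ob A P)"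
    and "\<lbrakk>P \<in> Ob C; Q \<in> Ob C; R \<in> Ob C; g \<in> Mor C P Q; h \<in> Mor C Q R\<rbrakk> \<Longrightarrow>
        on_mor A P R (Comp C P Q R h g) =
          Comp D (on_ob A P) (on_ob A Q) (on_ob A R) (on_mor A Q R h) (on_mor A P Q g)"
  using assms unfolding is_functor_def by blast+

lemma is_functorI:
  assumes "\<And>P. P \<in> Ob C \<Longrightarrow> on_ob A P \<in> Ob D"
    and "\<And>P Q m. \<lbrakk>P \<in> Ob C; Q \<in> Ob C; m \<in> Mor C P Q\<rbrakk> \<Longrightarrow> on_mor A P Q m \<in> Mor D (on_ob A P) (on_ob A Q)"
    and "\<And>P. P \<in> Ob C \<Longrightarrow> on_mor A P P (Ident C P) = Ident D (on_ob A P)"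
    and "\<And>P Q R g h. \<lbrakk>P \<in> Ob C; Q \<in> Ob C; R \<in> Ob C; g \<in> Mor C P Q; h \<in> Mor C Q R\<rbrakk> \<Longrightarrow>
        on_mor A P R (Comp C P Q R h g) =
          Comp D (on_ob A P) (on_ob A Q) (on_ob A R) (on_mor A Q R h) (on_mor A P Q g)"
  shows "is_functor C D A"
  using assms unfolding is_functor_def by blast

text \<open>A strict isomorphism of categories, given by two mutually inverse functors. A natural
  isomorphism can be pushed forward along \<open>\<Phi>\<close>, so conjugation with the pair maps self-equivalences
  to self-equivalences.\<close>

locale category_iso =
  fixes C :: "('o, 'm) cat" and D :: "('q, 'n) cat"
    and \<Phi> :: "('o, 'm, 'q, 'n) funct" and \<Psi> :: "('q, 'n, 'o, 'm) funct"
  assumes \<Phi>: "is_functor C D \<Phi>" and \<Psi>: "is_functor D C \<Psi>"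
    and \<Psi>\<Phi>_ob: "P \<in> Ob C \<Longrightarrow> on_ob \<Psi> (on_ob \<Phi> P) = P"
    and \<Phi>\<Psi>_ob: "P' \<in> Ob D \<Longrightarrow> on_ob \<Phi> (on_ob \<Psi> P') = P'"
    and \<Psi>\<Phi>_mor: "\<lbrakk>P \<in> Ob C; Q \<in> Ob C; m \<in> Mor C P Q\<rbrakk> \<Longrightarrow>
       on_mor \<Psi> (on_ob \<Phi> P) (on_ob \<Phi> Q) (on_mor \<Phi> P Q m) = m"
    and \<Phi>\<Psi>_mor: "\<lbrakk>P' \<in> Ob D; Q' \<in> Ob D; n \<in> Mor D P' Q'\<rbrakk> \<Longrightarrow>
       on_mor \<Phi> (on_ob \<Psi> P') (on_ob \<Psi> Q') (on_mor \<Psi> P' Q' n) = n"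
    and C_comp: "\<lbrakk>P \<in> Ob C; Q \<in> Ob C; R \<in> Ob C; g \<in> Mor C P Q; h \<in> Mor C Q R\<rbrakk> \<Longrightarrow>
       Comp C P Q R h g \<in> Mor C P R"
    and D_comp: "\<lbrakk>P' \<in> Ob D; Q' \<in> Ob D; R' \<in> Ob D; g' \<in> Mor D P' Q'; h' \<in> Mor D Q' R'\<rbrakk> \<Longrightarrow>
       Comp D P' Q' R' h' g' \<in> Mor D P' R'"
    and C_id: "P \<in> Ob C \<Longrightarrow> Ident C P \<in> Mor C P P"
    and D_id: "P' \<in> Ob D \<Longrightarrow> Ident D P' \<in> Mor D P' P'"
begin

abbreviation "tr \<equiv> transport_functor D \<Phi> \<Psi>"

lemma flip: "category_iso D C \<Psi> \<Phi>"
  by unfold_locales (fact \<Phi> \<Psi> \<Psi>\<Phi>_ob \<Phi>\<Psi>_ob \<Psi>\<Phi>_mor \<Phi>\<Psi>_mor C_comp D_comp C_id D_id)+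

lemmas \<Phi>_ob = is_functorD(1)[OF \<Phi>] and \<Phi>_mor = is_functorD(2)[OF \<Phi>]
  and \<Phi>_id = is_functorD(3)[OF \<Phi>] and \<Phi>_comp = is_functorD(4)[OF \<Phi>]
lemmas \<Psi>_ob = is_functorD(1)[OF \<Psi>] and \<Psi>_mor = is_functorD(2)[OF \<Psi>]
  and \<Psi>_id = is_functorD(3)[OF \<Psi>] and \<Psi>_comp = is_functorD(4)[OF \<Psi>]

lemma tr_ob: "P \<in> Ob D \<Longrightarrow> on_ob (tr A) P = on_ob \<Phi> (on_ob A (on_ob \<Psi> P))"
  by (simp add: transport_functor_def comp_functor_def)

lemma tr_mor:
  "\<lbrakk>P \<in> Ob D; Q \<in> Ob D; m \<in> Mor D P Q\<rbrakk> \<Longrightarrow> on_mor (tr A) P Q m =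
     on_mor \<Phi> (on_ob A (on_ob \<Psi> P)) (on_ob A (on_ob \<Psi> Q))
       (on_mor A (on_ob \<Psi> P) (on_ob \<Psi> Q) (on_mor \<Psi> P Q m))"
  by (simp add: transport_functor_def comp_functor_def)

lemma tr_restricted [simp]: "restrict_functor D (tr A) = tr A"
  by (simp add: transport_functor_def)

lemma tr_functor:
  assumes A: "is_functor C C A"
  shows "is_functor D D (tr A)"
proof (rule is_functorI)
  fix P assume P: "P \<in> Ob D"
  then show "on_ob (tr A) P \<in> Ob D"
    by (simp add: tr_ob \<Phi>_ob \<Psi>_ob is_functorD(1)[OF A])
  show "on_mor (tr A) P P (Ident D P) = Ident D (on_ob (tr A) P)"
    using P by (simp add: tr_ob tr_mor D_id \<Psi>_id \<Phi>_id \<Psi>_ob is_functorD(1,3)[OF A])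
next
  fix P Q m assume P: "P \<in> Ob D" "Q \<in> Ob D" "m \<in> Mor D P Q"
  then show "on_mor (tr A) P Q m \<in> Mor D (on_ob (tr A) P) (on_ob (tr A) Q)"
    by (simp add: tr_ob tr_mor \<Psi>_mor \<Psi>_ob \<Phi>_mor is_functorD(1,2)[OF A])
next
  fix P Q R g h assume P: "P \<in> Ob D" "Q \<in> Ob D" "R \<in> Ob D" "g \<in> Mor D P Q" "h \<in> Mor D Q R"
  then show "on_mor (tr A) P R (Comp D P Q R h g) =
      Comp D (on_ob (tr A) P) (on_ob (tr A) Q) (on_ob (tr A) R) (on_mor (tr A) Q R h) (on_mor (tr A) P Q g)"
    by (simp add: tr_ob tr_mor D_comp \<Psi>_comp \<Psi>_mor \<Psi>_ob is_functorD(1,2,4)[OF A] \<Phi>_comp)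
qed

lemma tr_comp:
  assumes A: "is_functor C C A" and B: "is_functor C C B"
  shows "comp_functor D (tr B) (tr A) = tr (comp_functor C B A)"
proof (rule functor_eqI)
  fix P assume "P \<in> Ob D"
  then show "on_ob (comp_functor D (tr B) (tr A)) P = on_ob (tr (comp_functor C B A)) P"
    by (simp add: comp_functor_def[of D] comp_functor_def[of C] tr_ob \<Psi>_ob \<Phi>_ob \<Psi>\<Phi>_ob is_functorD(1)[OF A])
next
  fix P Q m assume P: "P \<in> Ob D" "Q \<in> Ob D" "m \<in> Mor D P Q"
  then show "on_mor (comp_functor D (tr B) (tr A)) P Q m = on_mor (tr (comp_functor C B A)) P Q m"
    by (simp add: comp_functor_def[of D] comp_functor_def[of C] tr_ob tr_mor \<Psi>_ob \<Phi>_ob \<Psi>_mor \<Phi>_mor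
        \<Psi>\<Phi>_ob \<Psi>\<Phi>_mor is_functorD(1,2)[OF A])
qed simp_all

lemma tr_id: "tr (id_functor C) = id_functor D"
proof (rule functor_eqI)
  fix P assume "P \<in> Ob D"
  then show "on_ob (tr (id_functor C)) P = on_ob (id_functor D) P"
    by (simp add: tr_ob id_functor_def \<Psi>_ob \<Phi>\<Psi>_ob)
next
  fix P Q m assume P: "P \<in> Ob D" "Q \<in> Ob D" "m \<in> Mor D P Q"
  then show "on_mor (tr (id_functor C)) P Q m = on_mor (id_functor D) P Q m"
    by (simp add: tr_mor id_functor_def \<Psi>_ob \<Psi>_mor \<Phi>\<Psi>_mor)
qed simp_all

lemma tr_tr:
  assumes A: "is_functor C C A" and "restrict_functor C A = A"
  shows "transport_functor C \<Psi> \<Phi> (tr A) = A"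
proof -
  interpret f: category_iso D C \<Psi> \<Phi> by (rule flip)
  show ?thesis
  proof (rule functor_eqI[OF f.tr_restricted assms(2)])
    fix P assume "P \<in> Ob C"
    then show "on_ob (f.tr (tr A)) P = on_ob A P"
      by (simp add: f.tr_ob tr_ob \<Phi>_ob \<Psi>\<Phi>_ob is_functorD(1)[OF A])
  next
    fix P Q m assume P: "P \<in> Ob C" "Q \<in> Ob C" "m \<in> Mor C P Q"
    then show "on_mor (f.tr (tr A)) P Q m = on_mor A P Q m"
      by (simp add: f.tr_mor tr_mor tr_ob \<Phi>_ob \<Phi>_mor \<Psi>\<Phi>_ob \<Psi>\<Phi>_mor is_functorD(1,2)[OF A])
  qed
qed

lemma \<Phi>_isomorphism:
  assumes "P \<in> Ob C" "Q \<in> Ob C" "is_isomorphism C P Q m"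
  shows "is_isomorphism D (on_ob \<Phi> P) (on_ob \<Phi> Q) (on_mor \<Phi> P Q m)"
proof -
  obtain n where n: "m \<in> Mor C P Q" "n \<in> Mor C Q P" "Comp C P Q P n m = Ident C P" "Comp C Q P Q m n = Ident C Q"
    using assms(3) unfolding is_isomorphism_def by blast
  have "Comp D (on_ob \<Phi> P) (on_ob \<Phi> Q) (on_ob \<Phi> P) (on_mor \<Phi> Q P n) (on_mor \<Phi> P Q m) = Ident D (on_ob \<Phi> P)"
    using \<Phi>_comp[OF assms(1,2,1) n(1,2)] n(3) \<Phi>_id[OF assms(1)] by simp
  moreover have "Comp D (on_ob \<Phi> Q) (on_ob \<Phi> P) (on_ob \<Phi> Q) (on_mor \<Phi> P Q m) (on_mor \<Phi> Q P n) = Ident D (on_ob \<Phi> Q)"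
    using \<Phi>_comp[OF assms(2,1,2) n(2,1)] n(4) \<Phi>_id[OF assms(2)] by simp
  ultimately show ?thesis unfolding is_isomorphism_def
    using \<Phi>_mor[OF assms(1,2) n(1)] \<Phi>_mor[OF assms(2,1) n(2)] by blast
qed

lemma tr_naturally_isomorphic:
  assumes A: "is_functor C C A" and B: "is_functor C C B" and "naturally_isomorphic C C A B"
  shows "naturally_isomorphic D D (tr A) (tr B)"
proof -
  obtain \<eta> where iso: "\<And>P. P \<in> Ob C \<Longrightarrow> is_isomorphism C (on_ob A P) (on_ob B P) (\<eta> P)"
    and nat: "\<And>P Q m. \<lbrakk>P \<in> Ob C; Q \<in> Ob C; m \<in> Mor C P Q\<rbrakk> \<Longrightarrow>
             Comp C (on_ob A P) (on_ob A Q) (on_ob B Q) (\<eta> Q) (on_mor A P Q m) =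
             Comp C (on_ob A P) (on_ob B P) (on_ob B Q) (on_mor B P Q m) (\<eta> P)"
    using assms(3) unfolding naturally_isomorphic_def by blast
  have \<eta>: "\<eta> P \<in> Mor C (on_ob A P) (on_ob B P)" if "P \<in> Ob C" for P
    using iso[OF that] by (simp add: is_isomorphism_def)
  define \<theta> where "\<theta> P = on_mor \<Phi> (on_ob A (on_ob \<Psi> P)) (on_ob B (on_ob \<Psi> P)) (\<eta> (on_ob \<Psi> P))" for P
  show ?thesis unfolding naturally_isomorphic_def
  proof (intro exI[of _ \<theta>] conjI ballI)
    fix P assume P: "P \<in> Ob D"
    then show "is_isomorphism D (on_ob (tr A) P) (on_ob (tr B) P) (\<theta> P)"
      unfolding \<theta>_def
      by (simp add: tr_ob \<Phi>_isomorphism iso \<Psi>_ob is_functorD(1)[OF A] is_functorD(1)[OF B])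
  next
    fix P Q m assume P: "P \<in> Ob D" "Q \<in> Ob D" "m \<in> Mor D P Q"
    define P' Q' m' where "P' = on_ob \<Psi> P" "Q' = on_ob \<Psi> Q" "m' = on_mor \<Psi> P Q m"
    note d = \<open>P' = _\<close> \<open>Q' = _\<close> \<open>m' = _\<close>
    have P': "P' \<in> Ob C" "Q' \<in> Ob C" "m' \<in> Mor C P' Q'" unfolding d using P \<Psi>_ob \<Psi>_mor by simp_all
    have obs: "on_ob A P' \<in> Ob C" "on_ob A Q' \<in> Ob C" "on_ob B P' \<in> Ob C" "on_ob B Q' \<in> Ob C"
      using P' is_functorD(1)[OF A] is_functorD(1)[OF B] by simp_all
    have "Comp D (on_ob (tr A) P) (on_ob (tr A) Q) (on_ob (tr B) Q) (\<theta> Q) (on_mor (tr A) P Q m) =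
      on_mor \<Phi> (on_ob A P') (on_ob B Q') (Comp C (on_ob A P') (on_ob A Q') (on_ob B Q') (\<eta> Q') (on_mor A P' Q' m'))"
      using \<Phi>_comp[OF obs(1,2,4) is_functorD(2)[OF A P'] \<eta>[OF P'(2)]] P
      by (simp add: tr_ob tr_mor \<theta>_def flip: d)
    also have "\<dots> = on_mor \<Phi> (on_ob A P') (on_ob B Q') (Comp C (on_ob A P') (on_ob B P') (on_ob B Q') (on_mor B P' Q' m') (\<eta> P'))"
      using nat[OF P'] by simp
    also have "\<dots> = Comp D (on_ob (tr A) P) (on_ob (tr B) P) (on_ob (tr B) Q) (on_mor (tr B) P Q m) (\<theta> P)"
      using \<Phi>_comp[OF obs(1,3,4) \<eta>[OF P'(1)] is_functorD(2)[OF B P']] P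
      by (simp add: tr_ob tr_mor \<theta>_def flip: d)
    finally show "Comp D (on_ob (tr A) P) (on_ob (tr A) Q) (on_ob (tr B) Q) (\<theta> Q) (on_mor (tr A) P Q m) =
      Comp D (on_ob (tr A) P) (on_ob (tr B) P) (on_ob (tr B) Q) (on_mor (tr B) P Q m) (\<theta> P)" .
  qed
qed

lemma comp_is_functor:
  assumes A: "is_functor C C A" and B: "is_functor C C B"
  shows "is_functor C C (comp_functor C B A)"
proof (rule is_functorI)
  fix P Q R g h assume P: "P \<in> Ob C" "Q \<in> Ob C" "R \<in> Ob C" "g \<in> Mor C P Q" "h \<in> Mor C Q R"
  then show "on_mor (comp_functor C B A) P R (Comp C P Q R h g) =
      Comp C (on_ob (comp_functor C B A) P) (on_ob (comp_functor C B A) Q) (on_ob (comp_functor C B A) R)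
        (on_mor (comp_functor C B A) Q R h) (on_mor (comp_functor C B A) P Q g)"
    by (simp add: comp_functor_def C_comp is_functorD(1,2,4)[OF A] is_functorD(4)[OF B])
qed (simp_all add: comp_functor_def C_id is_functorD(1,2,3)[OF A] is_functorD(1,2,3)[OF B])

lemma id_is_functor: "is_functor C C (id_functor C)"
  by (rule is_functorI) (simp_all add: id_functor_def C_id C_comp)

lemma tr_equivalence:
  assumes "is_equivalence C C A"
  shows "is_equivalence D D (tr A)"
proof -
  obtain B where A: "is_functor C C A" and B: "is_functor C C B"
    and nat: "naturally_isomorphic C C (comp_functor C B A) (id_functor C)"
      "naturally_isomorphic C C (comp_functor C A B) (id_functor C)"
    using assms unfolding is_equivalence_def by blast
  have "naturally_isomorphic D D (comp_functor D (tr B) (tr A)) (id_functor D)"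
    "naturally_isomorphic D D (comp_functor D (tr A) (tr B)) (id_functor D)"
    unfolding tr_comp[OF A B] tr_comp[OF B A] tr_id[symmetric]
    using tr_naturally_isomorphic[OF _ id_is_functor] comp_is_functor A B nat by auto
  then show ?thesis unfolding is_equivalence_def using tr_functor A B by blast
qed

end

section \<open>Homomorphisms inducing isomorphisms of linking systems\<close>

text \<open>A homomorphism that maps \<open>T\<close> onto \<open>U\<close>, whose kernel consists of \<open>p\<close>-regular elements commuting
  with \<open>T\<close>, and along which conjugations of subgroups of \<open>U\<close> lift, induces an isomorphism of the
  centric linking systems. It will be applied to the inclusion of a subgroup and to the map
  from a group to an extension of one of its quotients; in both cases automorphisms of
  linking systems have to be carried over from one group to the other.\<close>

locale linking_comparison = H: sylow_pair H p T + G: sylow_pair G p U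
  for H :: "('h, 'k) monoid_scheme" and p T and G :: "('g, 'l) monoid_scheme" and U +
  fixes \<phi> :: "'h \<Rightarrow> 'g"
  assumes hom: "\<phi> \<in> hom H G" and \<phi>_T: "\<phi> ` T = U"
    and ker_regular: "\<lbrakk>x \<in> carrier H; \<phi> x = \<one>\<^bsub>G\<^esub>\<rbrakk> \<Longrightarrow> p_regular p H x"
    and ker_commutes: "\<lbrakk>x \<in> carrier H; \<phi> x = \<one>\<^bsub>G\<^esub>; t \<in> T\<rbrakk> \<Longrightarrow> x \<otimes>\<^bsub>H\<^esub> t = t \<otimes>\<^bsub>H\<^esub> x"
    and fusion: "\<lbrakk>subgroup P H; P \<subseteq> T; y \<in> carrier G; conj_by G y ` \<phi> ` P \<subseteq> U\<rbrakk> \<Longrightarrow>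
       \<exists>h\<in>carrier H. \<forall>x\<in>P. conj_by G y (\<phi> x) = \<phi> (conj_by H h x)"
begin

sublocale \<phi>: group_hom H G \<phi>
  by (simp add: group_hom_def group_hom_axioms_def hom H.is_group G.is_group)

lemma T_carrier: "t \<in> T \<Longrightarrow> t \<in> carrier H"
  using subgroup.mem_carrier[OF H.T_sub] .

text \<open>The quotient \<open>x t\<inverse>\<close> lies in the kernel, so it is \<open>p\<close>-regular; it is also a product of commuting
  \<open>p\<close>-elements.\<close>

lemma p_element_eqI:
  assumes x: "x \<in> carrier H" "p_element p H x" and t: "t \<in> T" and eq: "\<phi> x = \<phi> t"
  shows "x = t"
proof -
  have tc: "t \<in> carrier H" by (rule T_carrier[OF t])
  define k where "k = x \<otimes>\<^bsub>H\<^esub> inv\<^bsub>H\<^esub> t"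
  have kc: "k \<in> carrier H" unfolding k_def using x tc by simp
  have k1: "\<phi> k = \<one>\<^bsub>G\<^esub>" unfolding k_def using x(1) tc eq \<phi>.hom_inv by simp
  have xk: "x = k \<otimes>\<^bsub>H\<^esub> t" unfolding k_def using x(1) tc by (simp add: H.m_assoc)
  have kt: "k \<otimes>\<^bsub>H\<^esub> t = t \<otimes>\<^bsub>H\<^esub> k" by (rule ker_commutes[OF kc k1 t])
  have "x \<otimes>\<^bsub>H\<^esub> inv\<^bsub>H\<^esub> t = inv\<^bsub>H\<^esub> t \<otimes>\<^bsub>H\<^esub> x"
  proof -
    have "inv\<^bsub>H\<^esub> t \<otimes>\<^bsub>H\<^esub> x = inv\<^bsub>H\<^esub> t \<otimes>\<^bsub>H\<^esub> (t \<otimes>\<^bsub>H\<^esub> k)" using xk kt by simp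
    also have "\<dots> = k" using tc kc by simp
    finally show ?thesis unfolding k_def by simp
  qed
  then have "p_element p H k" unfolding k_def
    using H.p_element_mult[OF x(1) _ _ x(2) H.p_element_inv[OF tc H.T_p_element[OF t]]] tc by simp
  then have "k = \<one>\<^bsub>H\<^esub>" using H.p_element_p_regular_one[OF kc] ker_regular[OF kc k1] by simp
  then show ?thesis using xk tc by simp
qed

lemma inj_T: "inj_on \<phi> T"
  using p_element_eqI H.T_p_element T_carrier by (intro inj_onI) blast

lemma conj_eqI:
  assumes "h \<in> carrier H" "x \<in> T" "t \<in> T" "conj_by G (\<phi> h) (\<phi> x) = \<phi> t"
  shows "conj_by H h x = t"
proof (rule p_element_eqI)
  have xc: "x \<in> carrier H" by (rule T_carrier[OF assms(2)])
  show "p_element p H (conj_by H h x)" by (rule H.conj_by_p_element[OF assms(1) xc H.T_p_element[OF assms(2)]])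
  show "\<phi> (conj_by H h x) = \<phi> t" using assms(1,4) xc by (simp add: conj_by_def)
  show "conj_by H h x \<in> carrier H" using assms(1) xc by simp
qed fact

lemma \<phi>_conj: "\<lbrakk>h \<in> carrier H; x \<in> carrier H\<rbrakk> \<Longrightarrow> \<phi> (conj_by H h x) = conj_by G (\<phi> h) (\<phi> x)"
  by (simp add: conj_by_def)

lemma \<phi>_conj_image: "\<lbrakk>h \<in> carrier H; A \<subseteq> carrier H\<rbrakk> \<Longrightarrow> \<phi> ` conj_by H h ` A = conj_by G (\<phi> h) ` \<phi> ` A"
  by (auto simp: image_image \<phi>_conj subset_iff intro!: image_cong)

text \<open>The conjugate of \<open>P\<close> by \<open>h\<close> is a priori contained in \<open>Q\<close> only modulo the kernel; it lies in \<open>Q\<close>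
  because \<open>\<phi>\<close> separates the \<open>p\<close>-elements of \<open>H\<close> from those of \<open>T\<close>.\<close>

lemma fusion_lift:
  assumes P: "subgroup P H" "P \<subseteq> T" and y: "y \<in> carrier G" "conj_by G y ` \<phi> ` P \<subseteq> \<phi> ` Q" and Q: "Q \<subseteq> T"
  shows "\<exists>h\<in>transporter H P Q. \<forall>x\<in>P. conj_by G y (\<phi> x) = \<phi> (conj_by H h x)"
proof -
  have "conj_by G y ` \<phi> ` P \<subseteq> U" using y(2) Q \<phi>_T by blast
  then obtain h where h: "h \<in> carrier H" "\<And>x. x \<in> P \<Longrightarrow> conj_by G y (\<phi> x) = \<phi> (conj_by H h x)"
    using fusion[OF P y(1)] by blast
  have "conj_by H h x \<in> Q" if x: "x \<in> P" for x
  proof -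
    have "conj_by G y (\<phi> x) \<in> \<phi> ` Q" using y(2) x by blast
    then obtain t where t: "t \<in> Q" "conj_by G y (\<phi> x) = \<phi> t" by blast
    have xT: "x \<in> T" and tT: "t \<in> T" using x P(2) t(1) Q by auto
    have "conj_by G (\<phi> h) (\<phi> x) = \<phi> t" using h(2)[OF x] \<phi>_conj[OF h(1) T_carrier[OF xT]] t(2) by simp
    then show ?thesis using conj_eqI[OF h(1) xT tT] t(1) by simp
  qed
  then have "h \<in> transporter H P Q" using h(1) by (auto simp: transporter_def)
  then show ?thesis using h(2) by blast
qed

lemma \<phi>_centralizer_iff:
  assumes "P \<subseteq> T" "h \<in> carrier H"
  shows "\<phi> h \<in> centralizer_in G (\<phi> ` P) \<longleftrightarrow> h \<in> centralizer_in H P"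
proof -
  have Pc: "P \<subseteq> carrier H" using assms(1) T_carrier by blast
  have Pc': "\<phi> ` P \<subseteq> carrier G" using Pc \<phi>.hom_closed by blast
  have "conj_by G (\<phi> h) (\<phi> x) = \<phi> x \<longleftrightarrow> conj_by H h x = x" if "x \<in> P" for x
    using conj_eqI[OF assms(2), of x x] \<phi>_conj[OF assms(2), of x] that assms(1) Pc by auto
  then show ?thesis
    using H.centralizer_in_iff_conj_by[OF Pc, of h] G.centralizer_in_iff_conj_by[OF Pc', of "\<phi> h"] assms(2)
    by simp
qed

lemma \<phi>_subgroup: "subgroup P H \<Longrightarrow> subgroup (\<phi> ` P) G"
  by (rule \<phi>.subgroup_img_is_subgroup)

lemma \<phi>_subset: "P \<subseteq> T \<Longrightarrow> \<phi> ` P \<subseteq> U"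
  using \<phi>_T by blast

lemma \<phi>_p_regular_iff:
  assumes "h \<in> carrier H"
  shows "p_regular p G (\<phi> h) \<longleftrightarrow> p_regular p H h"
proof
  assume "p_regular p G (\<phi> h)"
  then obtain m :: nat where m: "coprime m p" "\<phi> h [^]\<^bsub>G\<^esub> m = \<one>\<^bsub>G\<^esub>" unfolding p_regular_def by blast
  then have "\<phi> (h [^]\<^bsub>H\<^esub> m) = \<one>\<^bsub>G\<^esub>" using \<phi>.hom_nat_pow[OF assms] by simp
  then have "p_regular p H (h [^]\<^bsub>H\<^esub> m)" using ker_regular assms by simp
  then obtain n :: nat where "coprime n p" "(h [^]\<^bsub>H\<^esub> m) [^]\<^bsub>H\<^esub> n = \<one>\<^bsub>H\<^esub>" unfolding p_regular_def by blast
  then have "coprime (m * n) p" "h [^]\<^bsub>H\<^esub> (m * n) = \<one>\<^bsub>H\<^esub>" using m(1) assms by (auto simp: H.nat_pow_pow)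
  then show "p_regular p H h" unfolding p_regular_def by blast
qed (rule p_regular_hom[OF H.is_group G.is_group hom assms])

text \<open>For the harder direction, a \<open>p\<close>-element \<open>y\<close> centralizing \<open>\<phi>(P)\<close> is moved into \<open>U\<close> together with
  \<open>\<phi>(P)\<close>. There it comes from an element \<open>t\<close> of \<open>T\<close> centralizing a conjugate of \<open>P\<close>, and conjugates of
  \<open>P\<close> are centric.\<close>

lemma centric_iff:
  assumes P: "subgroup P H" "P \<subseteq> T"
  shows "p_centric p G (\<phi> ` P) \<longleftrightarrow> p_centric p H P"
proof
  assume c: "p_centric p G (\<phi> ` P)"
  have "x \<in> P" if x: "x \<in> centralizer_in H P" "p_element p H x" for x
  proof -
    have xc: "x \<in> carrier H" using H.centralizer_in_carrier[OF x(1)] .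
    have "\<phi> x \<in> centralizer_in G (\<phi> ` P)" using \<phi>_centralizer_iff[OF P(2) xc] x(1) by simp
    moreover have "p_element p G (\<phi> x)" by (rule p_element_hom[OF H.is_group G.is_group hom xc x(2)])
    ultimately have "\<phi> x \<in> \<phi> ` P" using c G.centric_iff[OF \<phi>_subgroup[OF P(1)] \<phi>_subset[OF P(2)]] by blast
    then obtain t where "t \<in> P" "\<phi> x = \<phi> t" by blast
    then show ?thesis using p_element_eqI[OF xc x(2), of t] P(2) by blast
  qed
  then show "p_centric p H P" using H.centric_iff[OF P] by blast
next
  assume c: "p_centric p H P"
  have Pc: "P \<subseteq> carrier H" using subgroup.subset[OF P(1)] .
  have sG: "subgroup (\<phi> ` P) G" "\<phi> ` P \<subseteq> U" using \<phi>_subgroup[OF P(1)] \<phi>_subset[OF P(2)] by auto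
  obtain n where n: "card (\<phi> ` P) = p ^ n" using G.p_subgroup[OF sG] by blast
  have "y \<in> \<phi> ` P" if y: "y \<in> centralizer_in G (\<phi> ` P)" "p_element p G y" for y
  proof -
    have yc: "y \<in> carrier G" using G.centralizer_in_carrier[OF y(1)] .
    obtain Q m where Q: "subgroup Q G" "card Q = p ^ m" "\<phi> ` P \<subseteq> Q" "y \<in> Q"
      using G.p_subgroup_mult_p_element[OF G.prime_p G.fin sG(1) n y] by blast
    obtain g where g: "g \<in> carrier G" "conj_by G g ` Q \<subseteq> U"
      using G.p_subgroup_conj_into_sylow[OF G.prime_p G.fin G.sylow Q(1,2)] by blast
    have "conj_by G g ` \<phi> ` P \<subseteq> \<phi> ` T" using g(2) Q(3) \<phi>_T by blast
    then obtain h where h: "h \<in> transporter H P T" "\<And>x. x \<in> P \<Longrightarrow> conj_by G g (\<phi> x) = \<phi> (conj_by H h x)"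
      using fusion_lift[OF P g(1) _ subset_refl] by blast
    have hc: "h \<in> carrier H" "conj_by H h ` P \<subseteq> T" using h(1) by (auto simp: transporter_def)
    define P' where "P' = conj_by H h ` P"
    have gP: "conj_by G g ` \<phi> ` P = \<phi> ` P'"
      unfolding P'_def image_image using h(2) by (intro image_cong) auto
    have "conj_by G g y \<in> \<phi> ` T" using g(2) Q(4) \<phi>_T by blast
    then obtain t where t: "t \<in> T" "conj_by G g y = \<phi> t" by blast
    have tc: "t \<in> carrier H" by (rule T_carrier[OF t(1)])
    have "\<phi> t \<in> centralizer_in G (\<phi> ` P')"
      using G.centralizer_in_conj_by[OF subgroup.subset[OF sG(1)] g(1) y(1)] t(2) gP by simp
    then have tC: "t \<in> centralizer_in H P'" using \<phi>_centralizer_iff[of P' t] hc(2) tc P'_def by simp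
    have "conj_by H (inv\<^bsub>H\<^esub> h) t \<in> centralizer_in H (conj_by H (inv\<^bsub>H\<^esub> h) ` P')"
      using tC hc(1) Pc unfolding P'_def by (intro H.centralizer_in_conj_by) auto
    also have "conj_by H (inv\<^bsub>H\<^esub> h) ` P' = P" unfolding P'_def by (rule H.conj_by_image_swap[OF hc(1) Pc refl])
    finally have "conj_by H (inv\<^bsub>H\<^esub> h) t \<in> P"
      using c H.centric_iff[OF P] H.conj_by_p_element[OF H.inv_closed[OF hc(1)] tc H.T_p_element[OF t(1)]] by blast
    then have "conj_by H h (conj_by H (inv\<^bsub>H\<^esub> h) t) \<in> P'" unfolding P'_def by (rule imageI)
    then have "t \<in> P'" using hc(1) tc by simp
    then have "conj_by G g y \<in> conj_by G g ` \<phi> ` P" using t(2) gP by simp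
    then obtain z where z: "z \<in> \<phi> ` P" "conj_by G g y = conj_by G g z" by blast
    have "z \<in> carrier G" using z(1) subgroup.subset[OF sG(1)] by blast
    then have "y = z" using inj_onD[OF G.inj_on_conj_by[OF g(1) subset_refl] z(2)] yc by simp
    then show ?thesis using z(1) by simp
  qed
  then show "p_centric p G (\<phi> ` P)" using G.centric_iff[OF sG] by blast
qed

text \<open>On classes of elements, \<open>\<Phi>\<close> and \<open>\<Psi>\<close> are induced by \<open>\<phi>\<close>. The image of a coset of \<open>Core P\<close> is in general
  smaller than a coset of the core of \<open>\<phi>(P)\<close>, whence the product with that core.\<close>

definition \<Phi> :: "('h set, 'h set, 'g set, 'g set) funct" where
  "\<Phi> = \<lparr>on_ob = (\<lambda>P. \<phi> ` P), on_mor = (\<lambda>P Q m. \<phi> ` m <#>\<^bsub>G\<^esub> G.Core (\<phi> ` P))\<rparr>"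

definition \<Psi> :: "('g set, 'g set, 'h set, 'h set) funct" where
  "\<Psi> = \<lparr>on_ob = (\<lambda>Q. {t \<in> T. \<phi> t \<in> Q}), on_mor = (\<lambda>P Q m. {h \<in> carrier H. \<phi> h \<in> m})\<rparr>"

lemma \<Phi>_ob [simp]: "on_ob \<Phi> P = \<phi> ` P" by (simp add: \<Phi>_def)

lemma \<Phi>_Ob: "P \<in> Ob H.L \<Longrightarrow> \<phi> ` P \<in> Ob G.L"
  using centric_iff \<phi>_subgroup \<phi>_subset by (simp add: H.Ob_iff G.Ob_iff)

lemma Core_iff:
  assumes "P \<in> Ob H.L" "h \<in> carrier H"
  shows "\<phi> h \<in> G.Core (\<phi> ` P) \<longleftrightarrow> h \<in> H.Core P"
  using \<phi>_centralizer_iff[OF H.Ob_T[OF assms(1)] assms(2)] \<phi>_p_regular_iff[OF assms(2)]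
  by (simp add: H.Core_eq[OF assms(1)] G.Core_eq[OF \<Phi>_Ob[OF assms(1)]])

lemma \<Psi>\<Phi>_ob:
  assumes "P \<in> Ob H.L"
  shows "on_ob \<Psi> (\<phi> ` P) = P"
proof -
  have "\<phi> t \<in> \<phi> ` P \<longleftrightarrow> t \<in> P" if "t \<in> T" for t
    by (rule inj_on_image_mem_iff[OF inj_T that H.Ob_T[OF assms]])
  then show ?thesis using H.Ob_T[OF assms] by (auto simp: \<Psi>_def)
qed

lemma \<Psi>_preimage:
  assumes "Q \<in> Ob G.L"
  shows "\<phi> ` on_ob \<Psi> Q = Q" "on_ob \<Psi> Q \<in> Ob H.L"
proof -
  have QU: "Q \<subseteq> U" using G.Ob_T[OF assms] .
  show img: "\<phi> ` on_ob \<Psi> Q = Q" using QU unfolding \<phi>_T[symmetric] by (auto simp: \<Psi>_def)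
  interpret Q: subgroup Q G by (rule G.Ob_subgroup[OF assms])
  interpret T: subgroup T H by (rule H.T_sub)
  have s: "subgroup (on_ob \<Psi> Q) H"
  proof (rule H.subgroupI)
    show "on_ob \<Psi> Q \<subseteq> carrier H" by (auto simp: \<Psi>_def)
    show "on_ob \<Psi> Q \<noteq> {}" using img Q.one_closed by blast
  qed (auto simp: \<Psi>_def \<phi>.hom_inv)
  moreover have sT: "on_ob \<Psi> Q \<subseteq> T" by (auto simp: \<Psi>_def)
  ultimately show "on_ob \<Psi> Q \<in> Ob H.L"
    using centric_iff[OF s sT] assms unfolding H.Ob_iff img G.Ob_iff by simp
qed

lemma \<Psi>_Ob: "Q \<in> Ob G.L \<Longrightarrow> \<exists>P\<in>Ob H.L. Q = \<phi> ` P"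
  using \<Psi>_preimage by metis

lemma \<phi>_transporter:
  assumes "P \<subseteq> carrier H" "h \<in> transporter H P Q"
  shows "\<phi> h \<in> transporter G (\<phi> ` P) (\<phi> ` Q)"
proof -
  have h: "h \<in> carrier H" "conj_by H h ` P \<subseteq> Q" using assms(2) by (auto simp: transporter_def)
  have "conj_by G (\<phi> h) ` \<phi> ` P = \<phi> ` conj_by H h ` P" using \<phi>_conj_image[OF h(1) assms(1)] by simp
  also have "\<dots> \<subseteq> \<phi> ` Q" using h(2) by (rule image_mono)
  finally show ?thesis using h(1) by (simp add: transporter_def)
qed

lemma \<Phi>_delta:
  assumes "P \<in> Ob H.L" "h \<in> carrier H"
  shows "on_mor \<Phi> P Q (H.\<delta> P h) = G.\<delta> (\<phi> ` P) (\<phi> h)"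
proof -
  have oG: "\<phi> ` P \<in> Ob G.L" by (rule \<Phi>_Ob[OF assms(1)])
  interpret K: subgroup "G.Core (\<phi> ` P)" G by (rule G.Core_subgroup(1)[OF oG])
  show ?thesis unfolding \<Phi>_def funct.simps
  proof (intro equalityI subsetI)
    fix x assume "x \<in> \<phi> ` H.\<delta> P h <#>\<^bsub>G\<^esub> G.Core (\<phi> ` P)"
    then obtain a w where "a \<in> \<phi> ` H.\<delta> P h" and w: "w \<in> G.Core (\<phi> ` P)" and x: "x = a \<otimes>\<^bsub>G\<^esub> w" by (elim set_multE)
    then obtain v where v: "v \<in> H.Core P" "a = \<phi> (h \<otimes>\<^bsub>H\<^esub> v)" by (auto simp: link_delta_def l_coset_def)
    have vc: "v \<in> carrier H" by (rule H.Core_carrier[OF assms(1) v(1)])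
    have "x = \<phi> h \<otimes>\<^bsub>G\<^esub> (\<phi> v \<otimes>\<^bsub>G\<^esub> w)" unfolding x v(2) using assms(2) vc w by (simp add: G.m_assoc)
    moreover have "\<phi> v \<otimes>\<^bsub>G\<^esub> w \<in> G.Core (\<phi> ` P)" using v(1) Core_iff[OF assms(1) vc] w by simp
    ultimately show "x \<in> G.\<delta> (\<phi> ` P) (\<phi> h)" by (auto simp: link_delta_def l_coset_def)
  next
    fix x assume "x \<in> G.\<delta> (\<phi> ` P) (\<phi> h)"
    then obtain w where w: "w \<in> G.Core (\<phi> ` P)" "x = \<phi> h \<otimes>\<^bsub>G\<^esub> w" by (auto simp: link_delta_def l_coset_def)
    show "x \<in> \<phi> ` H.\<delta> P h <#>\<^bsub>G\<^esub> G.Core (\<phi> ` P)"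
      unfolding w(2) by (rule set_multI[OF imageI[OF H.delta_self[OF assms]] w(1)])
  qed
qed

lemma \<Psi>_delta:
  assumes "P \<in> Ob H.L" "h \<in> carrier H"
  shows "on_mor \<Psi> A B (G.\<delta> (\<phi> ` P) (\<phi> h)) = H.\<delta> P h"
proof -
  have "x \<in> on_mor \<Psi> A B (G.\<delta> (\<phi> ` P) (\<phi> h)) \<longleftrightarrow> x \<in> H.\<delta> P h" if x: "x \<in> carrier H" for x
  proof -
    have "inv\<^bsub>G\<^esub> \<phi> h \<otimes>\<^bsub>G\<^esub> \<phi> x = \<phi> (inv\<^bsub>H\<^esub> h \<otimes>\<^bsub>H\<^esub> x)" using assms(2) x by simp
    then show ?thesis
      using G.delta_mem_iff[OF \<Phi>_Ob[OF assms(1)], of "\<phi> h" "\<phi> x"] H.delta_mem_iff[OF assms x]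
        Core_iff[OF assms(1), of "inv\<^bsub>H\<^esub> h \<otimes>\<^bsub>H\<^esub> x"] assms(2) x by (simp add: \<Psi>_def)
  qed
  moreover have "on_mor \<Psi> A B (G.\<delta> (\<phi> ` P) (\<phi> h)) \<subseteq> carrier H" by (auto simp: \<Psi>_def)
  ultimately show ?thesis using H.delta_subset[OF assms] by blast
qed

text \<open>Fullness: an element \<open>y\<close> and a lift \<open>h\<close> of its conjugation differ by an element of the
  centralizer of \<open>\<phi>(P)\<close>. As \<open>\<phi>(P)\<close> is centric, that element is a product of an element of \<open>\<phi>(P)\<close>, which
  is absorbed into \<open>h\<close>, and one of the core.\<close>

lemma Mor_G:
  assumes "P \<in> Ob H.L" "Q \<in> Ob H.L" "m \<in> Mor G.L (\<phi> ` P) (\<phi> ` Q)"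
  shows "\<exists>h\<in>transporter H P Q. m = G.\<delta> (\<phi> ` P) (\<phi> h)"
proof -
  obtain y where y: "y \<in> carrier G" "conj_by G y ` \<phi> ` P \<subseteq> \<phi> ` Q" "m = G.\<delta> (\<phi> ` P) y"
    using assms(3) by (auto simp: G.Mor_iff transporter_def)
  have P: "subgroup P H" "P \<subseteq> T" using assms(1) by (auto simp: H.Ob_iff)
  have Pc: "P \<subseteq> carrier H" by (rule subgroup.subset[OF P(1)])
  have oG: "\<phi> ` P \<in> Ob G.L" by (rule \<Phi>_Ob[OF assms(1)])
  obtain h where h: "h \<in> transporter H P Q" "\<And>x. x \<in> P \<Longrightarrow> conj_by G y (\<phi> x) = \<phi> (conj_by H h x)"
    using fusion_lift[OF P y(1,2) H.Ob_T[OF assms(2)]] by blast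
  have hc: "h \<in> carrier H" "conj_by H h ` P \<subseteq> Q" using h(1) by (auto simp: transporter_def)
  define c where "c = inv\<^bsub>G\<^esub> \<phi> h \<otimes>\<^bsub>G\<^esub> y"
  have cc: "c \<in> carrier G" unfolding c_def using hc y by simp
  have "conj_by G c (\<phi> x) = \<phi> x" if x: "x \<in> P" for x
  proof -
    have xc: "x \<in> carrier H" using x Pc by blast
    have "conj_by G c (\<phi> x) = conj_by G (inv\<^bsub>G\<^esub> \<phi> h) (conj_by G y (\<phi> x))"
      unfolding c_def using hc y xc by (simp add: G.conj_by_conj_by)
    also have "\<dots> = \<phi> x" using h(2)[OF x] \<phi>_conj[OF hc(1) xc] hc(1) xc by simp
    finally show ?thesis .
  qed
  then have "c \<in> centralizer_in G (\<phi> ` P)"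
    using G.centralizer_in_iff_conj_by[OF G.Ob_carrier[OF oG]] cc by blast
  then obtain z w where zw: "z \<in> \<phi> ` P" "w \<in> G.Core (\<phi> ` P)" "c = z \<otimes>\<^bsub>G\<^esub> w"
    using G.Core_decomp[OF oG] by blast
  then obtain s where s: "s \<in> P" "z = \<phi> s" by blast
  have sc: "s \<in> carrier H" using s(1) Pc by blast
  have wc: "w \<in> carrier G" by (rule G.Core_carrier[OF oG zw(2)])
  have "y = \<phi> h \<otimes>\<^bsub>G\<^esub> c" unfolding c_def using hc y by simp
  also have "\<dots> = \<phi> (h \<otimes>\<^bsub>H\<^esub> s) \<otimes>\<^bsub>G\<^esub> w" unfolding zw(3) s(2) using hc sc wc by (simp add: G.m_assoc)
  finally have y2: "y = \<phi> (h \<otimes>\<^bsub>H\<^esub> s) \<otimes>\<^bsub>G\<^esub> w" .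
  have hs: "h \<otimes>\<^bsub>H\<^esub> s \<in> transporter H P Q"
  proof -
    have "conj_by H (h \<otimes>\<^bsub>H\<^esub> s) ` P = conj_by H h ` conj_by H s ` P"
      using H.conj_by_image_image[OF hc(1) sc Pc] by simp
    also have "\<dots> = conj_by H h ` P" using H.conj_by_self_subgroup[OF P(1) s(1)] by simp
    finally show ?thesis using hc sc by (simp add: transporter_def)
  qed
  have "inv\<^bsub>G\<^esub> \<phi> (h \<otimes>\<^bsub>H\<^esub> s) \<otimes>\<^bsub>G\<^esub> y = w" unfolding y2 using hc sc wc by simp
  then have "m = G.\<delta> (\<phi> ` P) (\<phi> (h \<otimes>\<^bsub>H\<^esub> s))"
    unfolding y(3) using G.delta_eq_iff[OF oG, of "\<phi> (h \<otimes>\<^bsub>H\<^esub> s)" y] hc sc y(1) zw(2) by simp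
  then show ?thesis using hs by blast
qed

lemma transporterD: "h \<in> transporter H P Q \<Longrightarrow> h \<in> carrier H"
  by (simp add: transporter_def)

sublocale iso: category_iso H.L G.L \<Phi> \<Psi>
proof
  show "is_functor H.L G.L \<Phi>"
  proof (rule is_functorI)
    fix P Q m assume P: "P \<in> Ob H.L" "Q \<in> Ob H.L" "m \<in> Mor H.L P Q"
    then obtain h where h: "h \<in> transporter H P Q" "m = H.\<delta> P h" by (auto simp: H.Mor_iff)
    show "on_mor \<Phi> P Q m \<in> Mor G.L (on_ob \<Phi> P) (on_ob \<Phi> Q)"
      unfolding h(2) \<Phi>_delta[OF P(1) transporterD[OF h(1)]] \<Phi>_ob
      using \<phi>_transporter[OF H.Ob_carrier[OF P(1)] h(1)] by (auto simp: G.Mor_iff)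
  next
    fix P Q R g h assume P: "P \<in> Ob H.L" "Q \<in> Ob H.L" "R \<in> Ob H.L" "g \<in> Mor H.L P Q" "h \<in> Mor H.L Q R"
    obtain a where a: "a \<in> transporter H P Q" "g = H.\<delta> P a" using P(4) by (auto simp: H.Mor_iff)
    obtain b where b: "b \<in> transporter H Q R" "h = H.\<delta> Q b" using P(5) by (auto simp: H.Mor_iff)
    have ab: "a \<in> carrier H" "b \<in> carrier H" using a b transporterD by auto
    have "on_mor \<Phi> P R (h <#>\<^bsub>H\<^esub> g) = G.\<delta> (\<phi> ` P) (\<phi> b \<otimes>\<^bsub>G\<^esub> \<phi> a)"
      unfolding a(2) b(2) H.delta_mult[OF P(1,2) a(1) ab(2)] using \<Phi>_delta[OF P(1)] ab by simp
    also have "\<dots> = on_mor \<Phi> Q R h <#>\<^bsub>G\<^esub> on_mor \<Phi> P Q g"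
      unfolding a(2) b(2) \<Phi>_delta[OF P(1) ab(1)] \<Phi>_delta[OF P(2) ab(2)]
      using G.delta_mult[OF \<Phi>_Ob[OF P(1)] \<Phi>_Ob[OF P(2)] \<phi>_transporter[OF H.Ob_carrier[OF P(1)] a(1)], of "\<phi> b"] ab by simp
    finally show "on_mor \<Phi> P R (Comp H.L P Q R h g) =
      Comp G.L (on_ob \<Phi> P) (on_ob \<Phi> Q) (on_ob \<Phi> R) (on_mor \<Phi> Q R h) (on_mor \<Phi> P Q g)" by simp
  qed (simp_all add: \<Phi>_Ob \<Phi>_delta)
  show "is_functor G.L H.L \<Psi>"
  proof (rule is_functorI)
    fix P assume P: "P \<in> Ob G.L"
    show "on_ob \<Psi> P \<in> Ob H.L" by (rule \<Psi>_preimage(2)[OF P])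
    obtain A where A: "A \<in> Ob H.L" "P = \<phi> ` A" using \<Psi>_Ob[OF P] by blast
    show "on_mor \<Psi> P P (Ident G.L P) = Ident H.L (on_ob \<Psi> P)"
      unfolding A(2) \<Psi>\<Phi>_ob[OF A(1)] using \<Psi>_delta[OF A(1), of "\<one>\<^bsub>H\<^esub>"] by simp
  next
    fix P Q m assume P: "P \<in> Ob G.L" "Q \<in> Ob G.L" "m \<in> Mor G.L P Q"
    obtain A where A: "A \<in> Ob H.L" "P = \<phi> ` A" using \<Psi>_Ob[OF P(1)] by blast
    obtain B where B: "B \<in> Ob H.L" "Q = \<phi> ` B" using \<Psi>_Ob[OF P(2)] by blast
    obtain h where h: "h \<in> transporter H A B" "m = G.\<delta> (\<phi> ` A) (\<phi> h)" using Mor_G[OF A(1) B(1)] P(3) A B by blast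
    show "on_mor \<Psi> P Q m \<in> Mor H.L (on_ob \<Psi> P) (on_ob \<Psi> Q)"
      unfolding A(2) B(2) \<Psi>\<Phi>_ob[OF A(1)] \<Psi>\<Phi>_ob[OF B(1)] h(2) \<Psi>_delta[OF A(1) transporterD[OF h(1)]]
      using h(1) by (auto simp: H.Mor_iff)
  next
    fix P Q R g h assume P: "P \<in> Ob G.L" "Q \<in> Ob G.L" "R \<in> Ob G.L" "g \<in> Mor G.L P Q" "h \<in> Mor G.L Q R"
    obtain A where A: "A \<in> Ob H.L" "P = \<phi> ` A" using \<Psi>_Ob[OF P(1)] by blast
    obtain B where B: "B \<in> Ob H.L" "Q = \<phi> ` B" using \<Psi>_Ob[OF P(2)] by blast
    obtain C where C: "C \<in> Ob H.L" "R = \<phi> ` C" using \<Psi>_Ob[OF P(3)] by blast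
    obtain a where a: "a \<in> transporter H A B" "g = G.\<delta> (\<phi> ` A) (\<phi> a)" using Mor_G[OF A(1) B(1)] P(4) A B by blast
    obtain b where b: "b \<in> transporter H B C" "h = G.\<delta> (\<phi> ` B) (\<phi> b)" using Mor_G[OF B(1) C(1)] P(5) B C by blast
    have ab: "a \<in> carrier H" "b \<in> carrier H" using a b transporterD by auto
    have "h <#>\<^bsub>G\<^esub> g = G.\<delta> (\<phi> ` A) (\<phi> (b \<otimes>\<^bsub>H\<^esub> a))"
      unfolding a(2) b(2)
      using G.delta_mult[OF \<Phi>_Ob[OF A(1)] \<Phi>_Ob[OF B(1)] \<phi>_transporter[OF H.Ob_carrier[OF A(1)] a(1)], of "\<phi> b"] ab by simp
    then have "on_mor \<Psi> P R (h <#>\<^bsub>G\<^esub> g) = H.\<delta> A (b \<otimes>\<^bsub>H\<^esub> a)" using \<Psi>_delta[OF A(1), of "b \<otimes>\<^bsub>H\<^esub> a"] ab by simp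
    also have "\<dots> = on_mor \<Psi> Q R h <#>\<^bsub>H\<^esub> on_mor \<Psi> P Q g"
      unfolding a(2) b(2) \<Psi>_delta[OF A(1) ab(1)] \<Psi>_delta[OF B(1) ab(2)] H.delta_mult[OF A(1) B(1) a(1) ab(2)] ..
    finally show "on_mor \<Psi> P R (Comp G.L P Q R h g) =
      Comp H.L (on_ob \<Psi> P) (on_ob \<Psi> Q) (on_ob \<Psi> R) (on_mor \<Psi> Q R h) (on_mor \<Psi> P Q g)" by simp
  qed
next
  fix P assume "P \<in> Ob H.L" then show "on_ob \<Psi> (on_ob \<Phi> P) = P" using \<Psi>\<Phi>_ob by simp
next
  fix Q assume "Q \<in> Ob G.L" then show "on_ob \<Phi> (on_ob \<Psi> Q) = Q" using \<Psi>_preimage(1) by simp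
next
  fix P P' m assume P: "P \<in> Ob H.L" "P' \<in> Ob H.L" "m \<in> Mor H.L P P'"
  then obtain h where h: "h \<in> transporter H P P'" "m = H.\<delta> P h" by (auto simp: H.Mor_iff)
  show "on_mor \<Psi> (on_ob \<Phi> P) (on_ob \<Phi> P') (on_mor \<Phi> P P' m) = m"
    unfolding h(2) \<Phi>_delta[OF P(1) transporterD[OF h(1)]] by (rule \<Psi>_delta[OF P(1) transporterD[OF h(1)]])
next
  fix Q Q' n assume P: "Q \<in> Ob G.L" "Q' \<in> Ob G.L" "n \<in> Mor G.L Q Q'"
  obtain A where A: "A \<in> Ob H.L" "Q = \<phi> ` A" using \<Psi>_Ob[OF P(1)] by blast
  obtain B where B: "B \<in> Ob H.L" "Q' = \<phi> ` B" using \<Psi>_Ob[OF P(2)] by blast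
  obtain h where h: "h \<in> transporter H A B" "n = G.\<delta> (\<phi> ` A) (\<phi> h)" using Mor_G[OF A(1) B(1)] P(3) A B by blast
  show "on_mor \<Phi> (on_ob \<Psi> Q) (on_ob \<Psi> Q') (on_mor \<Psi> Q Q' n) = n"
    unfolding h(2) A(2) \<Psi>\<Phi>_ob[OF A(1)] \<Psi>_delta[OF A(1) transporterD[OF h(1)]]
    by (rule \<Phi>_delta[OF A(1) transporterD[OF h(1)]])
next
  fix P Q R g h assume P: "P \<in> Ob H.L" "Q \<in> Ob H.L" "R \<in> Ob H.L" "g \<in> Mor H.L P Q" "h \<in> Mor H.L Q R"
  then show "Comp H.L P Q R h g \<in> Mor H.L P R" by (rule H.Comp_Mor)
next
  fix P Q R g h assume P: "P \<in> Ob G.L" "Q \<in> Ob G.L" "R \<in> Ob G.L" "g \<in> Mor G.L P Q" "h \<in> Mor G.L Q R"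
  then show "Comp G.L P Q R h g \<in> Mor G.L P R" by (rule G.Comp_Mor)
next
  fix P assume "P \<in> Ob H.L" then show "Ident H.L P \<in> Mor H.L P P" using H.one_transporter[of P P] by (auto simp: H.Mor_iff)
next
  fix P assume "P \<in> Ob G.L" then show "Ident G.L P \<in> Mor G.L P P" using G.one_transporter[of P P] by (auto simp: G.Mor_iff)
qed

end

section \<open>Transport of fusion systems and of automorphisms of linking systems\<close>

lemma fusion_isomorphism_trans:
  assumes "fusion_isomorphism S F T E \<phi>" "fusion_isomorphism T E U D \<psi>" "group S" "group T"
  shows "fusion_isomorphism S F U D (\<psi> \<circ> \<phi>)"
  unfolding fusion_isomorphism_def
proof (intro conjI allI impI)
  have \<phi>: "\<phi> \<in> iso S T" and \<psi>: "\<psi> \<in> iso T U"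
    using assms by (auto simp: fusion_isomorphism_def)
  show "\<psi> \<circ> \<phi> \<in> iso S U" by (rule iso_set_trans[OF \<phi> \<psi>])
  fix P Q assume PQ: "subgroup P S" "subgroup Q S"
  interpret \<phi>: group_hom S T \<phi>
    using \<phi> assms(3,4) by (simp add: group_hom_def group_hom_axioms_def iso_def)
  have sub: "subgroup (\<phi> ` P) T" "subgroup (\<phi> ` Q) T" using PQ \<phi>.subgroup_img_is_subgroup by auto
  have inj\<phi>: "inj_on \<phi> (carrier S)" and inj\<psi>: "inj_on \<psi> (carrier T)"
    using \<phi> \<psi> by (auto simp: iso_def bij_betw_def)
  have Pc: "P \<subseteq> carrier S" by (rule subgroup.subset[OF PQ(1)])
  have cT: "\<phi> ` carrier S = carrier T" using \<phi> by (simp add: iso_def bij_betw_def)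
  have inv: "inv_into (carrier S) (\<psi> \<circ> \<phi>) (\<psi> (\<phi> x)) = x"
    "inv_into (carrier T) \<psi> (\<psi> (\<phi> x)) = \<phi> x" "inv_into (carrier S) \<phi> (\<phi> x) = x" if "x \<in> P" for x
  proof -
    have x: "x \<in> carrier S" using that Pc by blast
    then have fx: "\<phi> x \<in> carrier T" using cT by blast
    have "inj_on (\<psi> \<circ> \<phi>) (carrier S)" using inj\<phi> inj\<psi> cT by (simp add: comp_inj_on)
    from inv_into_f_f[OF this x] show "inv_into (carrier S) (\<psi> \<circ> \<phi>) (\<psi> (\<phi> x)) = x" by simp
    show "inv_into (carrier T) \<psi> (\<psi> (\<phi> x)) = \<phi> x" by (rule inv_into_f_f[OF inj\<psi> fx])
    show "inv_into (carrier S) \<phi> (\<phi> x) = x" by (rule inv_into_f_f[OF inj\<phi> x])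
  qed
  have "D ((\<psi> \<circ> \<phi>) ` P) ((\<psi> \<circ> \<phi>) ` Q) = D (\<psi> ` \<phi> ` P) (\<psi> ` \<phi> ` Q)" by (simp add: image_comp)
  also have "\<dots> = (\<lambda>f. \<lambda>y\<in>\<psi> ` \<phi> ` P. \<psi> (f (inv_into (carrier T) \<psi> y))) ` E (\<phi> ` P) (\<phi> ` Q)"
    using assms(2) sub by (simp add: fusion_isomorphism_def)
  also have "E (\<phi> ` P) (\<phi> ` Q) = (\<lambda>f. \<lambda>y\<in>\<phi> ` P. \<phi> (f (inv_into (carrier S) \<phi> y))) ` F P Q"
    using assms(1) PQ by (simp add: fusion_isomorphism_def)
  also have "(\<lambda>f. \<lambda>y\<in>\<psi> ` \<phi> ` P. \<psi> (f (inv_into (carrier T) \<psi> y))) `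
      (\<lambda>f. \<lambda>y\<in>\<phi> ` P. \<phi> (f (inv_into (carrier S) \<phi> y))) ` F P Q =
      (\<lambda>f. \<lambda>y\<in>(\<psi> \<circ> \<phi>) ` P. (\<psi> \<circ> \<phi>) (f (inv_into (carrier S) (\<psi> \<circ> \<phi>) y))) ` F P Q"
    unfolding image_image
    by (intro image_cong refl) (auto simp: fun_eq_iff restrict_def inv)
  finally show "D ((\<psi> \<circ> \<phi>) ` P) ((\<psi> \<circ> \<phi>) ` Q) =
    (\<lambda>f. \<lambda>y\<in>(\<psi> \<circ> \<phi>) ` P. (\<psi> \<circ> \<phi>) (f (inv_into (carrier S) (\<psi> \<circ> \<phi>) y))) ` F P Q" .
qed

lemma fusion_isomorphism_identity:
  assumes "\<And>P Q. \<lbrakk>subgroup P T; subgroup Q T\<rbrakk> \<Longrightarrow> E P Q = F P Q" "\<And>P Q f. \<lbrakk>subgroup P T; f \<in> F P Q\<rbrakk> \<Longrightarrow> f \<in> extensional P"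
  shows "fusion_isomorphism T F T E (\<lambda>x. x)"
  unfolding fusion_isomorphism_def
proof (intro conjI allI impI)
  show "(\<lambda>x. x) \<in> iso T T" by (rule iso_set_refl)
  fix P Q assume PQ: "subgroup P T" "subgroup Q T"
  have "(\<lambda>y\<in>P. f (inv_into (carrier T) (\<lambda>x. x) y)) = f" if "f \<in> F P Q" for f
  proof
    fix y show "(\<lambda>y\<in>P. f (inv_into (carrier T) (\<lambda>x. x) y)) y = f y"
    proof (cases "y \<in> P")
      case True
      then have "y \<in> carrier T" using subgroup.subset[OF PQ(1)] by blast
      then have "inv_into (carrier T) (\<lambda>x. x) y = y" using inv_into_f_f[of "\<lambda>x. x" "carrier T" y] by simp
      then show ?thesis using True by simp
    next
      case False
      then show ?thesis using assms(2)[OF PQ(1) that] by (simp add: extensional_def)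
    qed
  qed
  then have "(\<lambda>f. \<lambda>y\<in>P. f (inv_into (carrier T) (\<lambda>x. x) y)) ` F P Q = F P Q" by simp
  then show "E ((\<lambda>x. x) ` P) ((\<lambda>x. x) ` Q) =
    (\<lambda>f. \<lambda>y\<in>(\<lambda>x. x) ` P. f (inv_into (carrier T) (\<lambda>x. x) y)) ` F P Q"
    using assms(1)[OF PQ] by simp
qed

context linking_comparison
begin

lemma fusion_isomorphism_\<phi>:
  "fusion_isomorphism (H\<lparr>carrier := T\<rparr>) (conj_homs H) (G\<lparr>carrier := U\<rparr>) (conj_homs G) \<phi>"
  unfolding fusion_isomorphism_def
proof (intro conjI allI impI)
  show "\<phi> \<in> iso (H\<lparr>carrier := T\<rparr>) (G\<lparr>carrier := U\<rparr>)"
  proof (rule isoI)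
    show "\<phi> \<in> hom (H\<lparr>carrier := T\<rparr>) (G\<lparr>carrier := U\<rparr>)"
      by (rule homI) (use \<phi>_T T_carrier in auto)
    show "bij_betw \<phi> (carrier (H\<lparr>carrier := T\<rparr>)) (carrier (G\<lparr>carrier := U\<rparr>))"
      using inj_T \<phi>_T by (simp add: bij_betw_def)
  qed
  fix P Q assume "subgroup P (H\<lparr>carrier := T\<rparr>)" "subgroup Q (H\<lparr>carrier := T\<rparr>)"
  note PQ = this
  have P: "subgroup P H" "P \<subseteq> T" and Q: "subgroup Q H" "Q \<subseteq> T"
    using H.incl_subgroup[OF H.T_sub PQ(1)] H.incl_subgroup[OF H.T_sub PQ(2)]
      subgroup.subset[OF PQ(1)] subgroup.subset[OF PQ(2)] by simp_all
  have Pc: "P \<subseteq> carrier H" by (rule subgroup.subset[OF P(1)])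
  have inv: "inv_into T \<phi> (\<phi> x) = x" if "x \<in> P" for x
    using inv_into_f_f[OF inj_T] that P(2) by blast
  let ?t = "\<lambda>f. \<lambda>y\<in>\<phi> ` P. \<phi> (f (inv_into (carrier (H\<lparr>carrier := T\<rparr>)) \<phi> y))"
  have t: "?t (\<lambda>x\<in>P. conj_by H h x) = (\<lambda>y\<in>\<phi> ` P. conj_by G g y)"
    if "\<And>x. x \<in> P \<Longrightarrow> conj_by G g (\<phi> x) = \<phi> (conj_by H h x)" for g h
    by (auto simp: fun_eq_iff restrict_def inv that)
  show "conj_homs G (\<phi> ` P) (\<phi> ` Q) = ?t ` conj_homs H P Q"
  proof (intro equalityI subsetI)
    fix c assume "c \<in> conj_homs G (\<phi> ` P) (\<phi> ` Q)"
    then obtain y where y: "y \<in> carrier G" "conj_by G y ` \<phi> ` P \<subseteq> \<phi> ` Q" "c = (\<lambda>x\<in>\<phi> ` P. conj_by G y x)"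
      by (auto simp: conj_homs_def transporter_def)
    obtain h where h: "h \<in> transporter H P Q" "\<And>x. x \<in> P \<Longrightarrow> conj_by G y (\<phi> x) = \<phi> (conj_by H h x)"
      using fusion_lift[OF P y(1,2) Q(2)] by blast
    have "c = ?t (\<lambda>x\<in>P. conj_by H h x)" unfolding y(3) by (rule t[OF h(2), symmetric])
    moreover have "(\<lambda>x\<in>P. conj_by H h x) \<in> conj_homs H P Q" using h(1) by (auto simp: conj_homs_def)
    ultimately show "c \<in> ?t ` conj_homs H P Q" by (rule image_eqI)
  next
    fix c assume "c \<in> ?t ` conj_homs H P Q"
    then obtain h where h: "h \<in> transporter H P Q" "c = ?t (\<lambda>x\<in>P. conj_by H h x)" by (auto simp: conj_homs_def)
    have "c = (\<lambda>y\<in>\<phi> ` P. conj_by G (\<phi> h) y)" unfolding h(2)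
      by (rule t) (use \<phi>_conj[OF transporterD[OF h(1)]] Pc in auto)
    then show "c \<in> conj_homs G (\<phi> ` P) (\<phi> ` Q)"
      using \<phi>_transporter[OF Pc h(1)] by (auto simp: conj_homs_def)
  qed
qed

lemma tr_AutLink:
  assumes A: "A \<in> carrier (AutLink p H T)"
  shows "iso.tr A \<in> carrier (AutLink p G U)"
  unfolding G.AutLink_iff
proof (intro conjI ballI impI)
  note A' = A[unfolded H.AutLink_iff]
  note A1 = conjunct1[OF A'] and A3 = conjunct1[OF conjunct2[OF conjunct2[OF A']]]
    and A4 = conjunct2[OF conjunct2[OF conjunct2[OF A']]]
  have F: "is_functor H.L H.L A" using H.AutLinkD(3)[OF A] .
  show "is_equivalence G.L G.L (iso.tr A)" by (rule iso.tr_equivalence[OF A1])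
  show "restrict_functor G.L (iso.tr A) = iso.tr A" by simp
  fix P assume P: "P \<in> Ob G.L"
  obtain X where X: "X \<in> Ob H.L" "P = \<phi> ` X" using \<Psi>_Ob[OF P] by blast
  have AX: "on_ob A X \<in> Ob H.L" using is_functorD(1)[OF F X(1)] .
  have ob: "on_ob (iso.tr A) P = \<phi> ` on_ob A X" using iso.tr_ob[OF P] \<Psi>\<Phi>_ob[OF X(1)] X(2) by simp
  have mor: "on_mor (iso.tr A) P (\<phi> ` Y) (G.\<delta> P (\<phi> h)) =
      on_mor \<Phi> (on_ob A X) (on_ob A Y) (on_mor A X Y (H.\<delta> X h))"
    if Y: "Y \<in> Ob H.L" and h: "h \<in> transporter H X Y" for Y h
  proof -
    have "G.\<delta> P (\<phi> h) \<in> Mor G.L P (\<phi> ` Y)"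
      unfolding X(2) using \<phi>_transporter[OF H.Ob_carrier[OF X(1)] h] by (auto simp: G.Mor_iff)
    then show ?thesis
      using iso.tr_mor[OF P \<Phi>_Ob[OF Y]] \<Psi>\<Phi>_ob[OF X(1)] \<Psi>\<Phi>_ob[OF Y] \<Psi>_delta[OF X(1) transporterD[OF h]] X(2) by simp
  qed
  have XX: "x \<in> transporter H X X" if "x \<in> X" for x
    using that H.conj_by_self_subgroup[OF H.Ob_subgroup[OF X(1)] that] H.Ob_carrier[OF X(1)] by (auto simp: transporter_def)
  have "on_mor (iso.tr A) P P ` G.\<delta> P ` P = (\<lambda>x. on_mor (iso.tr A) P (\<phi> ` X) (G.\<delta> P (\<phi> x))) ` X"
    unfolding X(2) by (simp add: image_image)
  also have "\<dots> = (\<lambda>x. on_mor \<Phi> (on_ob A X) (on_ob A X) (on_mor A X X (H.\<delta> X x))) ` X"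
    using mor[OF X(1) XX] by (intro image_cong) auto
  also have "\<dots> = on_mor \<Phi> (on_ob A X) (on_ob A X) ` on_mor A X X ` H.\<delta> X ` X" by (simp add: image_image)
  also have "on_mor A X X ` H.\<delta> X ` X = H.\<delta> (on_ob A X) ` on_ob A X" by (rule bspec[OF A3 X(1)])
  also have "on_mor \<Phi> (on_ob A X) (on_ob A X) ` H.\<delta> (on_ob A X) ` on_ob A X = G.\<delta> (\<phi> ` on_ob A X) ` \<phi> ` on_ob A X"
    unfolding image_image using \<Phi>_delta[OF AX] H.Ob_carrier[OF AX] by (intro image_cong) auto
  finally show "on_mor (iso.tr A) P P ` G.\<delta> P ` P = G.\<delta> (on_ob (iso.tr A) P) ` on_ob (iso.tr A) P"
    unfolding ob .
  fix Q assume Q: "Q \<in> Ob G.L" and PQ: "P \<subseteq> Q"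
  obtain Y where Y: "Y \<in> Ob H.L" "Q = \<phi> ` Y" using \<Psi>_Ob[OF Q] by blast
  have XY: "X \<subseteq> Y"
  proof -
    have "on_ob \<Psi> P \<subseteq> on_ob \<Psi> Q" using PQ by (auto simp: \<Psi>_def)
    then show ?thesis using \<Psi>\<Phi>_ob X Y by simp
  qed
  have "on_mor (iso.tr A) P Q (G.\<delta> P \<one>\<^bsub>G\<^esub>) = on_mor \<Phi> (on_ob A X) (on_ob A Y) (on_mor A X Y (H.\<delta> X \<one>\<^bsub>H\<^esub>))"
    using mor[OF Y(1) H.one_transporter[OF X(1) XY]] Y(2) by simp
  also have "on_mor A X Y (H.\<delta> X \<one>\<^bsub>H\<^esub>) = H.\<delta> (on_ob A X) \<one>\<^bsub>H\<^esub>" by (rule mp[OF bspec[OF bspec[OF A4 X(1)] Y(1)] XY])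
  finally show "on_mor (iso.tr A) P Q (G.\<delta> P \<one>\<^bsub>G\<^esub>) = G.\<delta> (on_ob (iso.tr A) P) \<one>\<^bsub>G\<^esub>"
    unfolding ob using \<Phi>_delta[OF AX, of "\<one>\<^bsub>H\<^esub>"] by simp
qed

abbreviation "rt \<equiv> transport_functor H.L \<Psi> \<Phi>"

sublocale osi: category_iso G.L H.L \<Psi> \<Phi> by (rule iso.flip)

lemma rt_AutLink:
  assumes A: "A \<in> carrier (AutLink p G U)"
  shows "rt A \<in> carrier (AutLink p H T)"
  unfolding H.AutLink_iff
proof (intro conjI ballI impI)
  note A' = A[unfolded G.AutLink_iff]
  note A1 = conjunct1[OF A'] and A3 = conjunct1[OF conjunct2[OF conjunct2[OF A']]]
    and A4 = conjunct2[OF conjunct2[OF conjunct2[OF A']]]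
  have F: "is_functor G.L G.L A" using G.AutLinkD(3)[OF A] .
  show "is_equivalence H.L H.L (rt A)" by (rule osi.tr_equivalence[OF A1])
  show "restrict_functor H.L (rt A) = rt A" by simp
  fix X assume X: "X \<in> Ob H.L"
  have P: "\<phi> ` X \<in> Ob G.L" by (rule \<Phi>_Ob[OF X])
  have AP: "on_ob A (\<phi> ` X) \<in> Ob G.L" by (rule is_functorD(1)[OF F P])
  obtain Z where Z: "Z \<in> Ob H.L" "on_ob A (\<phi> ` X) = \<phi> ` Z" using \<Psi>_Ob[OF AP] by blast
  have ob: "on_ob (rt A) X = Z" using osi.tr_ob[OF X] \<Psi>\<Phi>_ob[OF Z(1)] Z(2) by simp
  have mor: "on_mor (rt A) X Y (H.\<delta> X h) =
      on_mor \<Psi> (\<phi> ` Z) (on_ob A (\<phi> ` Y)) (on_mor A (\<phi> ` X) (\<phi> ` Y) (G.\<delta> (\<phi> ` X) (\<phi> h)))"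
    if Y: "Y \<in> Ob H.L" and h: "h \<in> transporter H X Y" for Y h
  proof -
    have "H.\<delta> X h \<in> Mor H.L X Y" using h by (auto simp: H.Mor_iff)
    then show ?thesis
      using osi.tr_mor[OF X Y] \<Phi>_delta[OF X transporterD[OF h]] Z(2) by simp
  qed
  have XX: "x \<in> transporter H X X" if "x \<in> X" for x
    using that H.conj_by_self_subgroup[OF H.Ob_subgroup[OF X] that] H.Ob_carrier[OF X] by (auto simp: transporter_def)
  have "on_mor (rt A) X X ` H.\<delta> X ` X = (\<lambda>x. on_mor (rt A) X X (H.\<delta> X x)) ` X" by (simp add: image_image)
  also have "\<dots> = (\<lambda>x. on_mor \<Psi> (\<phi> ` Z) (\<phi> ` Z) (on_mor A (\<phi> ` X) (\<phi> ` X) (G.\<delta> (\<phi> ` X) (\<phi> x)))) ` X"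
    using mor[OF X XX] Z(2) by (intro image_cong) auto
  also have "\<dots> = on_mor \<Psi> (\<phi> ` Z) (\<phi> ` Z) ` on_mor A (\<phi> ` X) (\<phi> ` X) ` G.\<delta> (\<phi> ` X) ` \<phi> ` X"
    by (simp add: image_image)
  also have "on_mor A (\<phi> ` X) (\<phi> ` X) ` G.\<delta> (\<phi> ` X) ` \<phi> ` X = G.\<delta> (\<phi> ` Z) ` \<phi> ` Z"
    using bspec[OF A3 P] unfolding Z(2) .
  also have "on_mor \<Psi> (\<phi> ` Z) (\<phi> ` Z) ` G.\<delta> (\<phi> ` Z) ` \<phi> ` Z = H.\<delta> Z ` Z"
    unfolding image_image using \<Psi>_delta[OF Z(1)] H.Ob_carrier[OF Z(1)] by (intro image_cong) auto
  finally show "on_mor (rt A) X X ` H.\<delta> X ` X = H.\<delta> (on_ob (rt A) X) ` on_ob (rt A) X" unfolding ob .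
  fix Y assume Y: "Y \<in> Ob H.L" and XY: "X \<subseteq> Y"
  have XY': "\<phi> ` X \<subseteq> \<phi> ` Y" using XY by (rule image_mono)
  have "on_mor (rt A) X Y (H.\<delta> X \<one>\<^bsub>H\<^esub>) =
      on_mor \<Psi> (\<phi> ` Z) (on_ob A (\<phi> ` Y)) (on_mor A (\<phi> ` X) (\<phi> ` Y) (G.\<delta> (\<phi> ` X) \<one>\<^bsub>G\<^esub>))"
    using mor[OF Y H.one_transporter[OF X XY]] by simp
  also have "on_mor A (\<phi> ` X) (\<phi> ` Y) (G.\<delta> (\<phi> ` X) \<one>\<^bsub>G\<^esub>) = G.\<delta> (\<phi> ` Z) \<one>\<^bsub>G\<^esub>"
    using mp[OF bspec[OF bspec[OF A4 P] \<Phi>_Ob[OF Y]] XY'] unfolding Z(2) .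
  finally show "on_mor (rt A) X Y (H.\<delta> X \<one>\<^bsub>H\<^esub>) = H.\<delta> (on_ob (rt A) X) \<one>\<^bsub>H\<^esub>"
    unfolding ob using \<Psi>_delta[OF Z(1), of "\<one>\<^bsub>H\<^esub>"] by simp
qed

text \<open>When \<open>f'\<close> on \<open>H\<close> and \<open>f\<close> on \<open>G\<close> are compatible with \<open>\<phi>\<close>, the functors that they induce correspond to
  each other. The three lemmas that follow are the forms in which this is used.\<close>

lemma rt_ind:
  assumes f: "G.stable f" and f': "H.stable f'"
    and compat: "\<And>h. h \<in> carrier H \<Longrightarrow> \<phi> (f' h) = f (\<phi> h)"
  shows "rt (G.ind f) = H.ind f'"
proof (rule functor_eqI)
  have img: "f ` \<phi> ` X = \<phi> ` f' ` X" if "X \<in> Ob H.L" for X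
    unfolding image_image using compat H.Ob_carrier[OF that] by (intro image_cong) auto
  fix X assume X: "X \<in> Ob H.L"
  show "on_ob (rt (G.ind f)) X = on_ob (H.ind f') X"
    using osi.tr_ob[OF X] G.ind_ob[OF \<Phi>_Ob[OF X]] img[OF X] \<Psi>\<Phi>_ob[OF H.stable_Ob[OF f' X]] H.ind_ob[OF X] by simp
  fix Y m assume Y: "Y \<in> Ob H.L" and m: "m \<in> Mor H.L X Y"
  obtain h where h: "h \<in> transporter H X Y" "m = H.\<delta> X h" using m by (auto simp: H.Mor_iff)
  have hc: "h \<in> carrier H" by (rule transporterD[OF h(1)])
  have mG: "G.\<delta> (\<phi> ` X) (\<phi> h) \<in> Mor G.L (\<phi> ` X) (\<phi> ` Y)"
    using \<phi>_transporter[OF H.Ob_carrier[OF X] h(1)] by (auto simp: G.Mor_iff)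
  have "f ` G.\<delta> (\<phi> ` X) (\<phi> h) = G.\<delta> (\<phi> ` f' ` X) (\<phi> (f' h))"
    using G.stable_delta[OF f \<Phi>_Ob[OF X], of "\<phi> h"] hc img[OF X] compat[OF hc] by simp
  then have "on_mor (rt (G.ind f)) X Y m = H.\<delta> (f' ` X) (f' h)"
    using osi.tr_mor[OF X Y m] \<Phi>_delta[OF X hc] h(2) G.ind_mor[OF \<Phi>_Ob[OF X] \<Phi>_Ob[OF Y] mG]
      \<Psi>_delta[OF H.stable_Ob[OF f' X] H.stable_closed[OF f' hc]] by simp
  also have "\<dots> = on_mor (H.ind f') X Y m"
    using H.ind_mor[OF X Y m] H.stable_delta[OF f' X hc] h(2) by simp
  finally show "on_mor (rt (G.ind f)) X Y m = on_mor (H.ind f') X Y m" .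
qed simp_all

lemma AutLink_eq_ind_H:
  assumes "B \<in> carrier (AutLink p H T)" "iso.tr B = G.ind f" "G.stable f" "H.stable f'"
    "\<And>h. h \<in> carrier H \<Longrightarrow> \<phi> (f' h) = f (\<phi> h)"
  shows "B = H.ind f'"
  using iso.tr_tr[OF H.AutLinkD(3,2)[OF assms(1)]] rt_ind[OF assms(3-5)] assms(2) by simp

lemma AutLink_eq_ind_G:
  assumes "A \<in> carrier (AutLink p G U)" "rt A = H.ind f'" "G.stable f" "H.stable f'"
    "\<And>h. h \<in> carrier H \<Longrightarrow> \<phi> (f' h) = f (\<phi> h)"
  shows "A = G.ind f"
  using osi.tr_tr[OF G.AutLinkD(3,2)[OF assms(1)]] osi.tr_tr[OF G.ind_is_functor[OF assms(3)] G.ind_restricted]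
    rt_ind[OF assms(3-5)] assms(2) by simp

lemma ind_eq_iff:
  assumes "G.stable f" "H.stable f'" "\<And>h. h \<in> carrier H \<Longrightarrow> \<phi> (f' h) = f (\<phi> h)"
    and "G.stable g" "H.stable g'" "\<And>h. h \<in> carrier H \<Longrightarrow> \<phi> (g' h) = g (\<phi> h)"
  shows "G.ind f = G.ind g \<longleftrightarrow> H.ind f' = H.ind g'"
  using osi.tr_tr[OF G.ind_is_functor[OF assms(1)] G.ind_restricted] osi.tr_tr[OF G.ind_is_functor[OF assms(4)] G.ind_restricted]
    rt_ind[OF assms(1-3)] rt_ind[OF assms(4-6)] by metis

end

section \<open>Removing the p-part of the kernel\<close>

definition link_kernel ::
    "nat \<Rightarrow> ('a, 'm) monoid_scheme \<Rightarrow> 'a set \<Rightarrow> ('a \<Rightarrow> 'a) set \<Rightarrow> ('a \<Rightarrow> 'a) set" where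
  "link_kernel p G T \<Gamma> = {f \<in> \<Gamma>. induced_functor p G T f = id_functor (linking_system p G T)}"

text \<open>Such a group \<open>\<Gamma>\<close> is large enough to compute the outer automorphisms of the linking system.
  A general \<open>\<Gamma>\<close>, in place of the full stabilizer of \<open>T\<close>, is considered because passing to a subgroup
  \<open>H\<close> of \<open>G\<close> only provides those automorphisms of \<open>H\<close> that are restrictions.\<close>

definition induces_link_automorphisms ::
    "nat \<Rightarrow> ('a, 'm) monoid_scheme \<Rightarrow> 'a set \<Rightarrow> ('a \<Rightarrow> 'a) set \<Rightarrow> bool" where
  "induces_link_automorphisms p G T \<Gamma> \<longleftrightarrow>
     subgroup \<Gamma> (AutoGroup G) \<and> \<Gamma> \<subseteq> stable_automorphisms G T \<and>
     (\<forall>g\<in>normalizer_in G T. restrict (conj_by G g) (carrier G) \<in> \<Gamma>) \<and>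
     (\<forall>A\<in>carrier (AutLink p G T). \<exists>f\<in>\<Gamma>. A = induced_functor p G T f)"

context sylow_pair
begin

abbreviation "A \<equiv> AutoGroup G"

lemma A_group: "group A" by (rule AutoGroup)

lemma A_stable: "f \<in> stable_automorphisms G T \<Longrightarrow> stable f"
  by (simp add: stable_automorphisms_iff)

lemma A_carrier: "f \<in> stable_automorphisms G T \<Longrightarrow> f \<in> carrier A"
  by (simp add: stable_automorphisms_def)

lemma A_mult_apply:
  "\<lbrakk>f \<in> carrier A; g \<in> carrier A; x \<in> carrier G\<rbrakk> \<Longrightarrow> (f \<otimes>\<^bsub>A\<^esub> g) x = f (g x)"
  by (simp add: AutoGroup_mult compose_def)

lemma A_eqI:
  "\<lbrakk>f \<in> carrier A; g \<in> carrier A; \<And>x. x \<in> carrier G \<Longrightarrow> f x = g x\<rbrakk> \<Longrightarrow> f = g"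
  by (auto simp: AutoGroup_carrier intro: extensionalityI)

lemma A_closed: "\<lbrakk>f \<in> carrier A; x \<in> carrier G\<rbrakk> \<Longrightarrow> f x \<in> carrier G"
  by (auto simp: AutoGroup_carrier iso_def hom_def)

lemma ind_mult:
  assumes "f \<in> stable_automorphisms G T" "g \<in> stable_automorphisms G T"
  shows "ind (f \<otimes>\<^bsub>A\<^esub> g) = comp_functor L (ind f) (ind g)"
  unfolding AutoGroup_mult[OF A_carrier[OF assms(1)] A_carrier[OF assms(2)]]
  by (rule ind_compose[OF A_stable[OF assms(2)]])

lemma ind_one: "ind \<one>\<^bsub>A\<^esub> = id_functor L"
  unfolding ind_id[symmetric] AutoGroup_one by (rule ind_cong) simp

lemma comp_id_ind: "stable f \<Longrightarrow> comp_functor L (id_functor L) (ind f) = ind f"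
  by (intro comp_id_functor ind_is_functor) simp_all

lemma link_kernel_subgroup:
  assumes "subgroup \<Gamma> A" "\<Gamma> \<subseteq> stable_automorphisms G T"
  shows "subgroup (link_kernel p G T \<Gamma>) A"
proof -
  interpret \<Gamma>: subgroup \<Gamma> A by fact
  show ?thesis
  proof (rule group.subgroupI[OF A_group])
    show "link_kernel p G T \<Gamma> \<subseteq> carrier A" using \<Gamma>.subset by (auto simp: link_kernel_def)
    have "\<one>\<^bsub>A\<^esub> \<in> link_kernel p G T \<Gamma>" using \<Gamma>.one_closed ind_one by (simp add: link_kernel_def)
    then show "link_kernel p G T \<Gamma> \<noteq> {}" by blast
  next
    fix f assume "f \<in> link_kernel p G T \<Gamma>"
    then have f: "f \<in> \<Gamma>" "ind f = id_functor L" by (auto simp: link_kernel_def)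
    have i: "inv\<^bsub>A\<^esub> f \<in> \<Gamma>" using \<Gamma>.m_inv_closed[OF f(1)] .
    have "ind (f \<otimes>\<^bsub>A\<^esub> inv\<^bsub>A\<^esub> f) = ind (inv\<^bsub>A\<^esub> f)"
      using ind_mult[of f "inv\<^bsub>A\<^esub> f"] f i assms(2) comp_id_ind[OF A_stable] by auto
    moreover have "f \<otimes>\<^bsub>A\<^esub> inv\<^bsub>A\<^esub> f = \<one>\<^bsub>A\<^esub>" using group.r_inv[OF A_group \<Gamma>.mem_carrier[OF f(1)]] .
    ultimately show "inv\<^bsub>A\<^esub> f \<in> link_kernel p G T \<Gamma>" using i ind_one by (simp add: link_kernel_def)
  next
    fix f g assume "f \<in> link_kernel p G T \<Gamma>" "g \<in> link_kernel p G T \<Gamma>"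
    then have f: "f \<in> \<Gamma>" "ind f = id_functor L" and g: "g \<in> \<Gamma>" "ind g = id_functor L" by (auto simp: link_kernel_def)
    have "ind (f \<otimes>\<^bsub>A\<^esub> g) = ind g"
      using ind_mult[of f g] f g assms(2) comp_id_ind[OF A_stable, of g] by auto
    then show "f \<otimes>\<^bsub>A\<^esub> g \<in> link_kernel p G T \<Gamma>" using \<Gamma>.m_closed[OF f(1) g(1)] g(2) by (simp add: link_kernel_def)
  qed
qed

lemma link_kernel_conj:
  assumes \<Gamma>: "subgroup \<Gamma> A" "\<Gamma> \<subseteq> stable_automorphisms G T" and g: "g \<in> \<Gamma>" and f: "f \<in> link_kernel p G T \<Gamma>"
  shows "conj_by A g f \<in> link_kernel p G T \<Gamma>"
proof -
  interpret \<Gamma>: subgroup \<Gamma> A by fact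
  have f': "f \<in> \<Gamma>" "ind f = id_functor L" using f by (auto simp: link_kernel_def)
  have i: "inv\<^bsub>A\<^esub> g \<in> \<Gamma>" by (rule \<Gamma>.m_inv_closed[OF g])
  have fi: "f \<otimes>\<^bsub>A\<^esub> inv\<^bsub>A\<^esub> g \<in> \<Gamma>" by (rule \<Gamma>.m_closed[OF f'(1) i])
  have s: "g \<in> stable_automorphisms G T" "f \<in> stable_automorphisms G T" "inv\<^bsub>A\<^esub> g \<in> stable_automorphisms G T"
    "f \<otimes>\<^bsub>A\<^esub> inv\<^bsub>A\<^esub> g \<in> stable_automorphisms G T"
    using g f'(1) i fi \<Gamma>(2) by auto
  have c: "conj_by A g f = g \<otimes>\<^bsub>A\<^esub> (f \<otimes>\<^bsub>A\<^esub> inv\<^bsub>A\<^esub> g)"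
    unfolding conj_by_def using s(1-3) A_carrier by (intro monoid.m_assoc[OF group.is_monoid[OF A_group]]) auto
  have "ind (conj_by A g f) = comp_functor L (ind g) (ind (inv\<^bsub>A\<^esub> g))"
    unfolding c ind_mult[OF s(1,4)] ind_mult[OF s(2,3)] f'(2) comp_id_ind[OF A_stable[OF s(3)]] ..
  also have "\<dots> = ind (g \<otimes>\<^bsub>A\<^esub> inv\<^bsub>A\<^esub> g)" using ind_mult[OF s(1,3)] by simp
  also have "\<dots> = id_functor L" using group.r_inv[OF A_group A_carrier[OF s(1)]] ind_one by simp
  finally show ?thesis using \<Gamma>.m_closed[OF g fi] c by (simp add: link_kernel_def)
qed

text \<open>On \<open>T\<close>, the element \<open>t\<inverse> f(t)\<close> lies both in \<open>T\<close> and in \<open>Core T\<close>, so it is trivial.\<close>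

lemma kernel_fixes:
  assumes "stable f" "ind f = id_functor L"
  shows "P \<in> Ob L \<Longrightarrow> f ` P = P"
    and "\<lbrakk>P \<in> Ob L; Q \<in> Ob L; x \<in> transporter G P Q\<rbrakk> \<Longrightarrow> f ` \<delta> P x = \<delta> P x"
    and "\<lbrakk>P \<in> Ob L; Q \<in> Ob L; x \<in> transporter G P Q\<rbrakk> \<Longrightarrow> f x \<in> \<delta> P x"
    and "t \<in> T \<Longrightarrow> f t = t"
proof -
  have eq: "ind f = ind (\<lambda>x. x)" using assms(2) ind_id by simp
  have 1: "f ` P = P" if "P \<in> Ob L" for P using eq ind_ob[OF that, of f] ind_ob[OF that, of "\<lambda>x. x"] by simp
  have 2: "f ` \<delta> P x = \<delta> P x" if "P \<in> Ob L" "Q \<in> Ob L" "x \<in> transporter G P Q" for P Q x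
  proof -
    have "\<delta> P x \<in> Mor L P Q" using that(3) by (auto simp: Mor_iff)
    from ind_mor[OF that(1,2) this, of f] ind_mor[OF that(1,2) this, of "\<lambda>x. x"] show ?thesis using eq by simp
  qed
  have 3: "f x \<in> \<delta> P x" if "P \<in> Ob L" "Q \<in> Ob L" "x \<in> transporter G P Q" for P Q x
  proof -
    have "x \<in> \<delta> P x" using delta_self[OF that(1)] that(3) by (simp add: transporter_iff)
    then show ?thesis using 2[OF that] by blast
  qed
  show "P \<in> Ob L \<Longrightarrow> f ` P = P" by (rule 1)
  show "\<lbrakk>P \<in> Ob L; Q \<in> Ob L; x \<in> transporter G P Q\<rbrakk> \<Longrightarrow> f ` \<delta> P x = \<delta> P x" by (rule 2)
  show "\<lbrakk>P \<in> Ob L; Q \<in> Ob L; x \<in> transporter G P Q\<rbrakk> \<Longrightarrow> f x \<in> \<delta> P x" by (rule 3)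
  show "f t = t" if t: "t \<in> T"
  proof -
    interpret T: subgroup T G by (rule T_sub)
    have tT: "t \<in> transporter G T T" using conj_by_self_subgroup[OF T_sub t] t by (simp add: transporter_iff)
    have ft: "f t \<in> T" using 1[OF T_Ob] t by blast
    have "inv t \<otimes> f t \<in> Core T" using 3[OF T_Ob T_Ob tT] delta_mem_iff[OF T_Ob, of t "f t"] t ft by simp
    then have "p_regular p G (inv t \<otimes> f t)" using Core_eq[OF T_Ob] by simp
    moreover have "inv t \<otimes> f t \<in> T" using t ft by simp
    ultimately have "inv t \<otimes> f t = \<one>" using p_element_p_regular_one T_p_element T.mem_carrier by blast
    then have "t \<otimes> (inv t \<otimes> f t) = t" using t by simp
    then show ?thesis using t ft by simp
  qed
qed

text \<open>Let \<open>R\<close> be a Sylow \<open>p\<close>-subgroup of the kernel \<open>C\<close> of the action of \<open>\<Gamma>\<close> on the linking system, and let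
  \<open>H\<close> be the subgroup of \<open>G\<close> fixed by \<open>R\<close>. Every class of morphisms is a coset of a group of order prime
  to \<open>p\<close> on which the \<open>p\<close>-group \<open>R\<close> acts, so it has a representative in \<open>H\<close>. Thus \<open>H\<close> has the same
  conjugations between centric subgroups, hence the same fusion system and the same linking
  system as \<open>G\<close>. By the Frattini argument the normalizer \<open>M\<close> of \<open>R\<close> in \<open>\<Gamma>\<close> still induces all
  automorphisms of the linking system. It acts on \<open>H\<close>, and on \<open>H\<close> the group \<open>R\<close> has become trivial, so
  that the kernel of the new action has order prime to \<open>p\<close>.\<close>

theorem link_kernel_coprime_reduction:
  assumes \<Gamma>: "induces_link_automorphisms p G T \<Gamma>"
  shows "\<exists>H \<Gamma>1. subgroup H G \<and> T \<subseteq> H \<and>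
    fusion_isomorphism (G\<lparr>carrier := T\<rparr>) (conj_homs G) (G\<lparr>carrier := T\<rparr>) (conj_homs (G\<lparr>carrier := H\<rparr>)) (\<lambda>x. x) \<and>
    induces_link_automorphisms p (G\<lparr>carrier := H\<rparr>) T \<Gamma>1 \<and>
    coprime (card (link_kernel p (G\<lparr>carrier := H\<rparr>) T \<Gamma>1)) p"
proof -
  interpret A: group A by (rule A_group)
  have \<Gamma>s: "subgroup \<Gamma> A" "\<Gamma> \<subseteq> stable_automorphisms G T"
    and \<Gamma>n: "\<And>g. g \<in> normalizer_in G T \<Longrightarrow> restrict (conj_by G g) (carrier G) \<in> \<Gamma>"
    and \<Gamma>l: "\<And>B. B \<in> carrier (AutLink p G T) \<Longrightarrow> \<exists>f\<in>\<Gamma>. B = ind f"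
    using \<Gamma> by (auto simp: induces_link_automorphisms_def)
  interpret \<Gamma>: subgroup \<Gamma> A by (rule \<Gamma>s(1))
  define C where "C = link_kernel p G T \<Gamma>"
  have Cs: "subgroup C A" unfolding C_def by (rule link_kernel_subgroup[OF \<Gamma>s])
  interpret C: subgroup C A by (rule Cs)
  have CG: "C \<subseteq> \<Gamma>" by (auto simp: C_def link_kernel_def)
  have Cid: "ind c = id_functor L" if "c \<in> C" for c using that by (simp add: C_def link_kernel_def)
  have stab: "stable f" if "f \<in> \<Gamma>" for f using that \<Gamma>s(2) A_stable by blast
  have finA: "finite (carrier A)" by (rule finite_AutoGroup)
  obtain R r where R: "sylow_subgroup p (A\<lparr>carrier := C\<rparr>) R" "subgroup R A" "R \<subseteq> C" "card R = p ^ r"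
    using A.sylow_subgroup_of_exists[OF prime_p finA Cs] by blast
  interpret R: subgroup R A by (rule R(2))
  have RG: "R \<subseteq> \<Gamma>" using R(3) CG by blast
  have RS: "stable \<rho>" if "\<rho> \<in> R" for \<rho> using stab RG that by blast
  define H where "H = {g \<in> carrier G. \<forall>\<rho>\<in>R. \<rho> g = g}"
  have HD: "\<rho> a = a" if "a \<in> H" "\<rho> \<in> R" for \<rho> a using that unfolding H_def by blast
  have HI: "a \<in> H" if "a \<in> carrier G" "\<And>\<rho>. \<rho> \<in> R \<Longrightarrow> \<rho> a = a" for a using that unfolding H_def by blast
  have Hsub: "H \<subseteq> carrier G" by (auto simp: H_def)
  have RT: "\<rho> t = t" if "\<rho> \<in> R" "t \<in> T" for \<rho> t
    using kernel_fixes(4)[OF stab Cid] that R(3) CG by blast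
  have Hs: "subgroup H G"
  proof (rule subgroupI)
    show "H \<subseteq> carrier G" by (auto simp: H_def)
    have "\<rho> \<one> = \<one>" if "\<rho> \<in> R" for \<rho> by (rule stable_one[OF RS[OF that]])
    then have "\<one> \<in> H" by (intro HI) simp
    then show "H \<noteq> {}" by blast
    show "inv a \<in> H" if a: "a \<in> H" for a
    proof (rule HI)
      have ac: "a \<in> carrier G" using a Hsub by blast
      then show "inv a \<in> carrier G" by simp
      show "\<rho> (inv a) = inv a" if "\<rho> \<in> R" for \<rho>
        using stable_inv[OF RS[OF that] ac] HD[OF a that] by simp
    qed
    show "a \<otimes> b \<in> H" if a: "a \<in> H" and b: "b \<in> H" for a b
    proof (rule HI)
      have abc: "a \<in> carrier G" "b \<in> carrier G" using a b Hsub by auto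
      then show "a \<otimes> b \<in> carrier G" by simp
      show "\<rho> (a \<otimes> b) = a \<otimes> b" if "\<rho> \<in> R" for \<rho>
        using stable_mult[OF RS[OF that] abc] HD[OF a that] HD[OF b that] by simp
    qed
  qed
  interpret H: subgroup H G by (rule Hs)
  have TH: "T \<subseteq> H" using RT subgroup.subset[OF T_sub] by (auto intro!: HI)
  let ?H = "G\<lparr>carrier := H\<rparr>"
  have gH: "group ?H" by (rule H.subgroup_is_group[OF is_group])
  have conjH: "conj_by ?H h x = conj_by G h x" if "h \<in> H" for h x
    using that Hs by (simp add: conj_by_def)
  \<comment> \<open>The \<open>p\<close>-group \<open>R\<close> fixes an element of the coset \<open>\<delta> P g\<close>, since the size of the coset is
    prime to \<open>p\<close>; elements of the coset induce the same conjugation on \<open>P\<close> as \<open>g\<close>.\<close>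
  have centric: "fusion_controlled G T H P" if P: "subgroup P G" "P \<subseteq> T" "p_centric p G P" for P
    unfolding fusion_controlled_def
  proof (intro ballI impI)
    fix g assume g: "g \<in> carrier G" and gP: "conj_by G g ` P \<subseteq> T"
    have PO: "P \<in> Ob L" using P by (simp add: Ob_iff)
    have gt: "g \<in> transporter G P T" using g gP by (simp add: transporter_iff)
    have dc: "\<delta> P g \<subseteq> carrier G" by (rule delta_subset[OF PO g])
    have cd: "card (\<delta> P g) = card (Core P)"
    proof -
      have "\<delta> P g = (\<lambda>w. g \<otimes> w) ` Core P" by (auto simp: link_delta_def l_coset_def)
      moreover have "inj_on (\<lambda>w. g \<otimes> w) (Core P)"
        using Core_carrier[OF PO] g by (auto simp: inj_on_def)
      ultimately show ?thesis using card_image by simp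
    qed
    have gR: "group (A\<lparr>carrier := R\<rparr>)" by (rule R.subgroup_is_group[OF A_group])
    have "p dvd card (\<delta> P g) \<longleftrightarrow> p dvd card {x \<in> \<delta> P g. \<forall>\<rho>\<in>carrier (A\<lparr>carrier := R\<rparr>). \<rho> x = x}"
    proof (rule p_group_fixed_points[OF prime_p gR, where act = "\<lambda>\<rho>. \<rho>"])
      show "order (A\<lparr>carrier := R\<rparr>) = p ^ r" using R(4) by (simp add: order_def)
      show "finite (\<delta> P g)" using dc fin finite_subset by blast
    next
      fix \<rho> x assume "\<rho> \<in> carrier (A\<lparr>carrier := R\<rparr>)" "x \<in> \<delta> P g"
      then show "\<rho> x \<in> \<delta> P g" using kernel_fixes(2)[OF stab Cid PO T_Ob gt, of \<rho>] RG R(3) by auto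
    next
      fix x assume "x \<in> \<delta> P g"
      then show "\<one>\<^bsub>A\<lparr>carrier := R\<rparr>\<^esub> x = x" using dc AutoGroup_one by auto
    next
      fix \<rho> \<sigma> x assume "\<rho> \<in> carrier (A\<lparr>carrier := R\<rparr>)" "\<sigma> \<in> carrier (A\<lparr>carrier := R\<rparr>)" "x \<in> \<delta> P g"
      then show "(\<rho> \<otimes>\<^bsub>A\<lparr>carrier := R\<rparr>\<^esub> \<sigma>) x = \<rho> (\<sigma> x)"
        using A_mult_apply[of \<rho> \<sigma> x] dc by auto
    qed
    moreover have "\<not> p dvd card (\<delta> P g)"
      using Core_subgroup(2)[OF PO] cd prime_p by (metis coprime_absorb_right not_prime_unit)
    ultimately have "{x \<in> \<delta> P g. \<forall>\<rho>\<in>carrier (A\<lparr>carrier := R\<rparr>). \<rho> x = x} \<noteq> {}" by (metis card.empty dvd_0_right)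
    then obtain x where x: "x \<in> \<delta> P g" "\<forall>\<rho>\<in>R. \<rho> x = x" by auto
    have xc: "x \<in> carrier G" using x(1) dc by blast
    have w: "inv g \<otimes> x \<in> Core P" using delta_mem_iff[OF PO g xc] x(1) by simp
    have wC: "inv g \<otimes> x \<in> centralizer_in G P" using w Core_eq[OF PO] by simp
    have "conj_by G x y = conj_by G g y" if y: "y \<in> P" for y
    proof -
      have yc: "y \<in> carrier G" using y Ob_carrier[OF PO] by blast
      have "conj_by G x y = conj_by G g (conj_by G (inv g \<otimes> x) y)"
        using g xc yc by (simp add: conj_by_conj_by)
      then show ?thesis using wC centralizer_in_iff_conj_by[OF Ob_carrier[OF PO]] y by simp
    qed
    moreover have "x \<in> H" using xc x(2) by (intro HI) auto
    ultimately show "\<exists>h\<in>H. \<forall>y\<in>P. conj_by G h y = conj_by G g y" by blast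
  qed
  have ctrl: "fusion_controlled G T H P" if "subgroup P G" "P \<subseteq> T" for P
    by (rule fusion_controlled_of_centric[OF prime_p fin sylow Hs centric that])
  interpret cmp: linking_comparison ?H p T G T "\<lambda>x. x"
  proof (intro linking_comparison.intro linking_comparison_axioms.intro)
    show "sylow_pair ?H p T"
    proof (intro sylow_pair.intro sylow_pair_axioms.intro)
      show "finite (carrier ?H)" using finite_subset[OF H.subset fin] by simp
      show "sylow_subgroup p ?H T" by (rule sylow_subgroup_between[OF prime_p fin sylow Hs TH])
    qed (rule gH, rule prime_p)
    show "sylow_pair G p T" by (rule sylow_pair_axioms)
    show "(\<lambda>x. x) \<in> hom ?H G" by (simp add: hom_def)
    show "p_regular p ?H x" if "x = \<one>" for x using that by (auto simp: p_regular_def intro!: exI[of _ 1])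
    show "x \<otimes>\<^bsub>?H\<^esub> t = t \<otimes>\<^bsub>?H\<^esub> x" if "x = \<one>" "t \<in> T" for x t
      using that subgroup.mem_carrier[OF T_sub] by simp
    show "\<exists>h\<in>carrier ?H. \<forall>x\<in>P. conj_by G y x = conj_by ?H h x"
      if P: "subgroup P ?H" "P \<subseteq> T" and y: "y \<in> carrier G" "conj_by G y ` (\<lambda>x. x) ` P \<subseteq> T" for P y
    proof -
      have "subgroup P G" by (rule incl_subgroup[OF Hs P(1)])
      from fusion_controlledD[OF ctrl[OF this P(2)] y(1) _ subset_refl] y(2)
      obtain h where "h \<in> H" "\<forall>x\<in>P. conj_by G h x = conj_by G y x" by auto
      then show ?thesis using conjH[of h] by (intro bexI[of _ h]) simp_all
    qed
  qed simp_all
  define M where "M = \<Gamma> \<inter> normalizer_in A R"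
  have Ms: "subgroup M A" unfolding M_def
    by (rule A.subgroups_Inter_pair[OF \<Gamma>s(1) A.normalizer_in_subgroup[OF R.subset]])
  interpret M: subgroup M A by (rule Ms)
  have MG: "M \<subseteq> \<Gamma>" by (simp add: M_def)
  have MR: "conj_by A \<mu> ` R = R" if "\<mu> \<in> M" for \<mu> using that unfolding M_def normalizer_in_def by blast
  have MI: "\<mu> \<in> M" if "\<mu> \<in> \<Gamma>" "conj_by A \<mu> ` R = R" for \<mu>
    unfolding M_def normalizer_in_def using that \<Gamma>.subset by blast
  have frattini: "\<exists>\<mu>\<in>M. ind f = ind \<mu>" if f: "f \<in> \<Gamma>" for f
  proof -
    have fc: "f \<in> carrier A" using f by simp
    have 1: "subgroup (conj_by A f ` R) A" by (rule A.conj_by_image_subgroup[OF fc R(2)])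
    have 2: "conj_by A f ` R \<subseteq> C"
      using link_kernel_conj[OF \<Gamma>s f] R(3) unfolding C_def by blast
    have 3: "card (conj_by A f ` R) = p ^ r" using A.card_conj_by_image[OF fc R.subset] R(4) by simp
    obtain c where c: "c \<in> C" "conj_by A c ` conj_by A f ` R \<subseteq> R"
      using A.p_subgroup_conj_into_sylow_of[OF prime_p finA Cs R(1) 1 2 3] by blast
    have cc: "c \<in> carrier A" using c(1) by simp
    have cf: "c \<otimes>\<^bsub>A\<^esub> f \<in> carrier A" by (rule A.m_closed[OF cc fc])
    have sub: "conj_by A (c \<otimes>\<^bsub>A\<^esub> f) ` R \<subseteq> R"
      using c(2) unfolding A.conj_by_image_image[OF cc fc R.subset] .
    have cR: "conj_by A (c \<otimes>\<^bsub>A\<^esub> f) ` R = R"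
      by (rule card_subset_eq[OF finite_subset[OF R.subset finA] sub A.card_conj_by_image[OF cf R.subset]])
    have cG: "c \<in> \<Gamma>" by (rule subsetD[OF CG c(1)])
    have cfM: "c \<otimes>\<^bsub>A\<^esub> f \<in> M"
      by (rule MI[OF \<Gamma>.m_closed[OF cG f] cR])
    have s: "c \<in> stable_automorphisms G T" "f \<in> stable_automorphisms G T" using cG f \<Gamma>s(2) by auto
    have "ind (c \<otimes>\<^bsub>A\<^esub> f) = ind f"
      unfolding ind_mult[OF s] Cid[OF c(1)] by (rule comp_id_ind[OF stab[OF f]])
    then show ?thesis using bexI[OF _ cfM, of "\<lambda>m. ind f = ind m"] by simp
  qed
  have MH: "\<mu> h \<in> H" if \<mu>: "\<mu> \<in> M" and h: "h \<in> H" for \<mu> h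
  proof -
    have hc: "h \<in> carrier G" using h by simp
    have \<mu>c: "\<mu> \<in> carrier A" using \<mu> by simp
    have "\<rho> (\<mu> h) = \<mu> h" if \<rho>: "\<rho> \<in> R" for \<rho>
    proof -
      obtain \<sigma> where \<sigma>: "\<sigma> \<in> R" "\<rho> = conj_by A \<mu> \<sigma>"
        using equalityD2[OF MR[OF \<mu>]] \<rho> by blast
      have \<sigma>c: "\<sigma> \<in> carrier A" using \<sigma>(1) by simp
      have "\<rho> \<otimes>\<^bsub>A\<^esub> \<mu> = \<mu> \<otimes>\<^bsub>A\<^esub> \<sigma>" unfolding \<sigma>(2) conj_by_def using \<mu>c \<sigma>c by (simp add: A.m_assoc)
      moreover have "(\<rho> \<otimes>\<^bsub>A\<^esub> \<mu>) h = \<rho> (\<mu> h)" using A_mult_apply[of \<rho> \<mu> h] \<rho> \<mu>c hc by simp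
      moreover have "(\<mu> \<otimes>\<^bsub>A\<^esub> \<sigma>) h = \<mu> (\<sigma> h)" using A_mult_apply[OF \<mu>c \<sigma>c hc] .
      moreover have "\<sigma> h = h" by (rule HD[OF h \<sigma>(1)])
      ultimately show ?thesis by simp
    qed
    then show ?thesis using A_closed[OF \<mu>c hc] by (intro HI)
  qed
  define res where "res \<mu> = restrict \<mu> H" for \<mu> :: "'a \<Rightarrow> 'a"
  have res_bij: "\<mu> ` H = H" if \<mu>: "\<mu> \<in> M" for \<mu>
  proof (rule card_subset_eq)
    show "finite H" using finite_subset[OF H.subset fin] .
    show "\<mu> ` H \<subseteq> H" using MH[OF \<mu>] by blast
    have "inj_on \<mu> H" using stable_inj[OF stab] \<mu> MG inj_on_subset[OF _ H.subset] by blast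
    then show "card (\<mu> ` H) = card H" by (rule card_image)
  qed
  have res_stable: "cmp.H.stable (res \<mu>)" "res \<mu> \<in> stable_automorphisms ?H T" if \<mu>: "\<mu> \<in> M" for \<mu>
  proof -
    have s: "stable \<mu>" using stab MG \<mu> by blast
    have "res \<mu> \<in> hom ?H ?H"
      by (rule homI) (use MH[OF \<mu>] stable_mult[OF s] in \<open>auto simp: res_def\<close>)
    moreover have "bij_betw (res \<mu>) H H"
      using inj_on_subset[OF stable_inj[OF s] H.subset] res_bij[OF \<mu>]
      by (simp add: bij_betw_def res_def inj_on_restrict_eq)
    moreover have "res \<mu> ` T = T"
    proof -
      have "res \<mu> ` T = \<mu> ` T" using TH by (intro image_cong) (auto simp: res_def)
      then show ?thesis using s by (simp add: stable_def)
    qed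
    ultimately show *: "cmp.H.stable (res \<mu>)" by (simp add: cmp.H.stable_def iso_def)
    show "res \<mu> \<in> stable_automorphisms ?H T"
      unfolding cmp.H.stable_automorphisms_iff using * by (simp add: res_def)
  qed
  have res_app: "res \<mu> h = \<mu> h" if "h \<in> H" for \<mu> h using that by (simp add: res_def)
  have res_ind: "ind \<mu> = ind \<nu> \<longleftrightarrow> cmp.H.ind (res \<mu>) = cmp.H.ind (res \<nu>)" if "\<mu> \<in> M" "\<nu> \<in> M" for \<mu> \<nu>
    by (rule cmp.ind_eq_iff[OF stab[OF subsetD[OF MG that(1)]] res_stable(1)[OF that(1)] _
          stab[OF subsetD[OF MG that(2)]] res_stable(1)[OF that(2)]])
      (simp_all add: res_app)
  define \<Gamma>1 where "\<Gamma>1 = res ` M"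
  have res_hom: "res \<in> hom (A\<lparr>carrier := M\<rparr>) (AutoGroup ?H)"
  proof (rule homI)
    fix \<mu> \<nu> assume "\<mu> \<in> carrier (A\<lparr>carrier := M\<rparr>)" "\<nu> \<in> carrier (A\<lparr>carrier := M\<rparr>)"
    then have m: "\<mu> \<in> M" "\<nu> \<in> M" by auto
    have c: "res \<mu> \<in> carrier (AutoGroup ?H)" "res \<nu> \<in> carrier (AutoGroup ?H)" "res (\<mu> \<otimes>\<^bsub>A\<^esub> \<nu>) \<in> carrier (AutoGroup ?H)"
      using res_stable(2) cmp.H.A_carrier m M.m_closed by auto
    have "res (\<mu> \<otimes>\<^bsub>A\<^esub> \<nu>) = res \<mu> \<otimes>\<^bsub>AutoGroup ?H\<^esub> res \<nu>"
    proof (rule cmp.H.A_eqI[OF c(3)])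
      show "res \<mu> \<otimes>\<^bsub>AutoGroup ?H\<^esub> res \<nu> \<in> carrier (AutoGroup ?H)"
        by (rule monoid.m_closed[OF group.is_monoid[OF cmp.H.A_group] c(1,2)])
      fix x assume "x \<in> carrier ?H"
      then have x: "x \<in> H" by simp
      show "res (\<mu> \<otimes>\<^bsub>A\<^esub> \<nu>) x = (res \<mu> \<otimes>\<^bsub>AutoGroup ?H\<^esub> res \<nu>) x"
        using cmp.H.A_mult_apply[OF c(1,2), of x] A_mult_apply[of \<mu> \<nu> x] x m MH[OF m(2) x] by (simp add: res_app)
    qed
    then show "res (\<mu> \<otimes>\<^bsub>A\<lparr>carrier := M\<rparr>\<^esub> \<nu>) = res \<mu> \<otimes>\<^bsub>AutoGroup ?H\<^esub> res \<nu>" by simp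
  next
    fix \<mu> assume "\<mu> \<in> carrier (A\<lparr>carrier := M\<rparr>)"
    then show "res \<mu> \<in> carrier (AutoGroup ?H)" using res_stable(2) cmp.H.A_carrier by auto
  qed
  have gM: "group (A\<lparr>carrier := M\<rparr>)" by (rule M.subgroup_is_group[OF A_group])
  interpret res: group_hom "A\<lparr>carrier := M\<rparr>" "AutoGroup ?H" res
    by (simp add: group_hom_def group_hom_axioms_def gM cmp.H.A_group res_hom)
  have \<Gamma>1s: "subgroup \<Gamma>1 (AutoGroup ?H)" "\<Gamma>1 \<subseteq> stable_automorphisms ?H T"
    using res.img_is_subgroup res_stable(2) by (auto simp: \<Gamma>1_def)
  have \<Gamma>1n: "restrict (conj_by ?H g) (carrier ?H) \<in> \<Gamma>1" if g: "g \<in> normalizer_in ?H T" for g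
  proof -
    have gH': "g \<in> H" "conj_by G g ` T = T" using g conjH by (auto simp: normalizer_in_def)
    have gN: "g \<in> normalizer_in G T" using gH' by (simp add: normalizer_in_def)
    define c where "c = restrict (conj_by G g) (carrier G)"
    have cG: "c \<in> \<Gamma>" unfolding c_def by (rule \<Gamma>n[OF gN])
    have comm: "\<rho> \<otimes>\<^bsub>A\<^esub> c = c \<otimes>\<^bsub>A\<^esub> \<rho>" if \<rho>: "\<rho> \<in> R" for \<rho>
    proof (rule A_eqI)
      fix x assume x: "x \<in> carrier G"
      have rs: "stable \<rho>" by (rule RS[OF \<rho>])
      have "(\<rho> \<otimes>\<^bsub>A\<^esub> c) x = \<rho> (conj_by G g x)" using A_mult_apply[of \<rho> c x] \<rho> cG x by (simp add: c_def)
      also have "\<dots> = conj_by G (\<rho> g) (\<rho> x)" using stable_conj[OF rs _ x] gH'(1) by simp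
      also have "\<rho> g = g" by (rule HD[OF gH'(1) \<rho>])
      also have "conj_by G g (\<rho> x) = (c \<otimes>\<^bsub>A\<^esub> \<rho>) x"
        using A_mult_apply[of c \<rho> x] \<rho> cG x stable_closed[OF rs x] by (simp add: c_def)
      finally show "(\<rho> \<otimes>\<^bsub>A\<^esub> c) x = (c \<otimes>\<^bsub>A\<^esub> \<rho>) x" .
    qed (use \<rho> cG in auto)
    have "conj_by A c \<rho> = \<rho>" if "\<rho> \<in> R" for \<rho>
      using A.conj_by_eq_self_iff[OF \<Gamma>.mem_carrier[OF cG] R.mem_carrier[OF that]] comm[OF that] by metis
    then have "conj_by A c ` R = R" by simp
    then have "c \<in> M" by (rule MI[OF cG])
    moreover have "res c = restrict (conj_by ?H g) (carrier ?H)"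
      using conjH[OF gH'(1)] by (auto simp: res_def c_def fun_eq_iff restrict_def)
    ultimately show ?thesis unfolding \<Gamma>1_def by (metis imageI)
  qed
  have \<Gamma>1l: "\<exists>f\<in>\<Gamma>1. B = cmp.H.ind f" if B: "B \<in> carrier (AutLink p ?H T)" for B
  proof -
    obtain f where f: "f \<in> \<Gamma>" "cmp.iso.tr B = ind f" using \<Gamma>l[OF cmp.tr_AutLink[OF B]] by blast
    obtain \<mu> where \<mu>: "\<mu> \<in> M" "ind f = ind \<mu>" using frattini[OF f(1)] by blast
    have "B = cmp.H.ind (res \<mu>)"
      by (rule cmp.AutLink_eq_ind_H[OF B f(2)[unfolded \<mu>(2)] stab[OF subsetD[OF MG \<mu>(1)]] res_stable(1)[OF \<mu>(1)]])
        (simp add: res_app)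
    then show ?thesis using \<mu>(1) by (auto simp: \<Gamma>1_def)
  qed
  have cop: "coprime (card (link_kernel p ?H T \<Gamma>1)) p"
  proof (rule group.coprime_card_of_p_regular[OF cmp.H.A_group prime_p cmp.H.finite_AutoGroup cmp.H.link_kernel_subgroup[OF \<Gamma>1s]])
    fix f assume "f \<in> link_kernel p ?H T \<Gamma>1"
    then obtain \<mu> where \<mu>: "\<mu> \<in> M" "f = res \<mu>" "cmp.H.ind (res \<mu>) = id_functor cmp.H.L"
      by (auto simp: link_kernel_def \<Gamma>1_def)
    have "res \<one>\<^bsub>A\<^esub> = \<one>\<^bsub>AutoGroup ?H\<^esub>" using res.hom_one by simp
    then have "ind \<mu> = ind \<one>\<^bsub>A\<^esub>"
      using res_ind[OF \<mu>(1) M.one_closed] \<mu>(3) cmp.H.ind_one by simp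
    then have \<mu>C: "\<mu> \<in> C" using ind_one \<mu>(1) MG by (auto simp: C_def link_kernel_def)
    have \<mu>c: "\<mu> \<in> carrier A" using \<mu>(1) by simp
    \<comment> \<open>The power of \<open>\<mu>\<close> with exponent the index \<open>m\<close> of \<open>R\<close> in \<open>C\<close> is a \<open>p\<close>-element of \<open>C\<close> normalizing its
      Sylow subgroup \<open>R\<close>. So it lies in \<open>R\<close> and restricts to the identity on \<open>H\<close>.\<close>
    define m where "m = card (rcosets\<^bsub>A\<lparr>carrier := C\<rparr>\<^esub> R)"
    have gC: "group (A\<lparr>carrier := C\<rparr>)" by (rule C.subgroup_is_group[OF A_group])
    have finC: "finite (carrier (A\<lparr>carrier := C\<rparr>))" using finite_subset[OF C.subset finA] by simp
    have cm: "card C = m * p ^ r" and pm: "\<not> p dvd m"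
      using sylow_subgroup_index[OF prime_p gC finC R(1)] R(4) unfolding m_def by (simp_all add: order_def mult.commute)
    have copm: "coprime m p" using pm prime_p by (metis coprime_commute prime_imp_coprime)
    define \<nu> where "\<nu> = \<mu> [^]\<^bsub>A\<^esub> m"
    have \<nu>c: "\<nu> \<in> carrier A" unfolding \<nu>_def using \<mu>c by simp
    have powsub: "\<nu> \<in> K" if "subgroup K A" "\<mu> \<in> K" for K
    proof -
      have "\<mu> [^]\<^bsub>A\<lparr>carrier := K\<rparr>\<^esub> m \<in> carrier (A\<lparr>carrier := K\<rparr>)"
        using that by (intro monoid.nat_pow_closed group.is_monoid subgroup.subgroup_is_group[OF that(1) A_group]) simp
      then show ?thesis by (simp add: \<nu>_def nat_pow_def)
    qed
    have "\<nu> [^]\<^bsub>A\<^esub> (p ^ r) = \<one>\<^bsub>A\<^esub>"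
      unfolding \<nu>_def using A.subgroup_pow_card[OF Cs \<mu>C] cm \<mu>c by (simp add: A.nat_pow_pow)
    then have pe: "p_element p A \<nu>" unfolding p_element_def by blast
    have "\<nu> \<in> R"
    proof -
      have \<nu>C: "\<nu> \<in> C" by (rule powsub[OF Cs \<mu>C])
      have \<nu>N: "\<nu> \<in> normalizer_in A R"
        by (rule powsub[OF A.normalizer_in_subgroup[OF R.subset]]) (use \<mu>(1) M_def in blast)
      have "conj_by (A\<lparr>carrier := C\<rparr>) \<nu> x = conj_by A \<nu> x" for x using \<nu>C Cs by (simp add: conj_by_def)
      then have "\<nu> \<in> normalizer_in (A\<lparr>carrier := C\<rparr>) R"
        using \<nu>N \<nu>C unfolding normalizer_in_def by auto
      then show ?thesis
        using group.p_element_normalizing_sylow[OF gC prime_p finC R(1)] pe by simp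
    qed
    have "res \<nu> = \<one>\<^bsub>AutoGroup ?H\<^esub>"
      unfolding cmp.H.AutoGroup_one using HD[OF _ \<open>\<nu> \<in> R\<close>] by (auto simp: res_def fun_eq_iff restrict_def)
    moreover have "res (\<mu> [^]\<^bsub>A\<lparr>carrier := M\<rparr>\<^esub> m) = f [^]\<^bsub>AutoGroup ?H\<^esub> m"
      using res.hom_nat_pow[of \<mu> m] \<mu>(1,2) by simp
    ultimately have "f [^]\<^bsub>AutoGroup ?H\<^esub> m = \<one>\<^bsub>AutoGroup ?H\<^esub>"
      unfolding \<nu>_def by (simp add: nat_pow_def)
    then show "p_regular p (AutoGroup ?H) f" unfolding p_regular_def using copm by blast
  qed
  have fus: "fusion_isomorphism (G\<lparr>carrier := T\<rparr>) (conj_homs G) (G\<lparr>carrier := T\<rparr>) (conj_homs ?H) (\<lambda>x. x)"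
  proof (rule fusion_isomorphism_identity)
    fix P Q assume PQ: "subgroup P (G\<lparr>carrier := T\<rparr>)" "subgroup Q (G\<lparr>carrier := T\<rparr>)"
    have P: "subgroup P G" "P \<subseteq> T" and QT: "Q \<subseteq> T"
      using incl_subgroup[OF T_sub PQ(1)] subgroup.subset[OF PQ(1)] subgroup.subset[OF PQ(2)] by simp_all
    show "conj_homs ?H P Q = conj_homs G P Q"
    proof (intro equalityI subsetI)
      fix c assume "c \<in> conj_homs ?H P Q"
      then obtain h where h: "h \<in> H" "conj_by ?H h ` P \<subseteq> Q" "c = (\<lambda>x\<in>P. conj_by ?H h x)"
        by (auto simp: conj_homs_def transporter_def)
      then have "h \<in> transporter G P Q" "c = (\<lambda>x\<in>P. conj_by G h x)"
        using conjH[OF h(1)] by (simp_all add: transporter_def)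
      then show "c \<in> conj_homs G P Q" by (auto simp: conj_homs_def)
    next
      fix c assume "c \<in> conj_homs G P Q"
      then obtain g where g: "g \<in> carrier G" "conj_by G g ` P \<subseteq> Q" "c = (\<lambda>x\<in>P. conj_by G g x)"
        by (auto simp: conj_homs_def transporter_def)
      have "conj_by G g ` P \<subseteq> T" using g(2) QT by blast
      from fusion_controlledD[OF ctrl[OF P] g(1) this subset_refl]
      obtain h where h: "h \<in> H" "\<And>x. x \<in> P \<Longrightarrow> conj_by G h x = conj_by G g x" by auto
      have "h \<in> transporter ?H P Q" using h g(2) conjH[OF h(1)] by (auto simp: transporter_def)
      moreover have "c = (\<lambda>x\<in>P. conj_by ?H h x)"
        unfolding g(3) using h(2) conjH[OF h(1)] by (auto simp: fun_eq_iff restrict_def)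
      ultimately show "c \<in> conj_homs ?H P Q" by (auto simp: conj_homs_def)
    qed
  next
    fix P Q f assume "f \<in> conj_homs G P Q"
    then show "f \<in> extensional P" by (auto simp: conj_homs_def)
  qed
  have "induces_link_automorphisms p ?H T \<Gamma>1"
    using \<Gamma>1s \<Gamma>1n \<Gamma>1l by (simp add: induces_link_automorphisms_def)
  then show ?thesis using Hs TH fus cop by blast
qed

end

section \<open>Inner automorphisms and outer classes\<close>

context group
begin

definition inner_aut :: "'a \<Rightarrow> 'a \<Rightarrow> 'a" where
  "inner_aut g = restrict (conj_by G g) (carrier G)"

lemma inner_mem: "g \<in> carrier G \<Longrightarrow> inner_aut g \<in> inner_automorphisms G"
  by (auto simp: inner_aut_def inner_automorphisms_def)

lemma inner_automorphisms_eq: "inner_automorphisms G = inner_aut ` carrier G"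
  by (auto simp: inner_aut_def inner_automorphisms_def)

lemma inner_apply: "x \<in> carrier G \<Longrightarrow> inner_aut g x = conj_by G g x"
  by (simp add: inner_aut_def)

end

context sylow_pair
begin

lemma inner_A:
  assumes "g \<in> carrier G" shows "inner_aut g \<in> carrier A"
proof -
  have "conj_by G g \<in> iso G G" using assms by (simp add: iso_def bij_betw_def conj_by_hom inj_on_conj_by)
  then have "inner_aut g \<in> iso G G" using iso_eq[of "conj_by G g" G "inner_aut g"] by (simp add: inner_apply)
  then show ?thesis by (simp add: AutoGroup_carrier inner_aut_def)
qed

lemma A_mult_closed: "\<lbrakk>f \<in> carrier A; g \<in> carrier A\<rbrakk> \<Longrightarrow> f \<otimes>\<^bsub>A\<^esub> g \<in> carrier A"
  by (rule monoid.m_closed[OF group.is_monoid[OF A_group]])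

lemma inner_group_hom: "group_hom G A inner_aut"
proof -
  have "inner_aut \<in> hom G A"
  proof (rule homI)
    fix g h assume gh: "g \<in> carrier G" "h \<in> carrier G"
    show "inner_aut (g \<otimes> h) = inner_aut g \<otimes>\<^bsub>A\<^esub> inner_aut h"
    proof (rule A_eqI)
      fix x assume x: "x \<in> carrier G"
      show "inner_aut (g \<otimes> h) x = (inner_aut g \<otimes>\<^bsub>A\<^esub> inner_aut h) x"
        using A_mult_apply[OF inner_A[OF gh(1)] inner_A[OF gh(2)] x] gh x
        by (simp add: inner_apply conj_by_conj_by)
    qed (use gh inner_A A_mult_closed in auto)
  qed (rule inner_A)
  then show ?thesis by (simp add: group_hom_def group_hom_axioms_def A_group)
qed

lemma A_inner:
  assumes f: "f \<in> carrier A" and g: "g \<in> carrier G"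
  shows "f \<otimes>\<^bsub>A\<^esub> inner_aut g = inner_aut (f g) \<otimes>\<^bsub>A\<^esub> f"
proof (rule A_eqI)
  have fg: "f g \<in> carrier G" by (rule A_closed[OF f g])
  fix x assume x: "x \<in> carrier G"
  have h: "group_hom G G f" using f by (simp add: AutoGroup_carrier iso_def group_hom_def group_hom_axioms_def)
  have "f (conj_by G g x) = conj_by G (f g) (f x)"
    using g x group_hom.hom_mult[OF h] group_hom.hom_inv[OF h] by (simp add: conj_by_def)
  then show "(f \<otimes>\<^bsub>A\<^esub> inner_aut g) x = (inner_aut (f g) \<otimes>\<^bsub>A\<^esub> f) x"
    using A_mult_apply[OF f inner_A[OF g] x] A_mult_apply[OF inner_A[OF fg] f x] x A_closed[OF f x]
    by (simp add: inner_apply)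
qed (use f g inner_A A_mult_closed A_closed in auto)

lemma inner_automorphisms_normal: "inner_automorphisms G \<lhd> A"
proof (rule group.normal_invI[OF A_group])
  show "subgroup (inner_automorphisms G) A"
    unfolding inner_automorphisms_eq by (rule group_hom.img_is_subgroup[OF inner_group_hom])
  fix f i assume f: "f \<in> carrier A" and "i \<in> inner_automorphisms G"
  then obtain g where g: "g \<in> carrier G" "i = inner_aut g" unfolding inner_automorphisms_eq by blast
  have fg: "f g \<in> carrier G" by (rule A_closed[OF f g(1)])
  have "f \<otimes>\<^bsub>A\<^esub> i \<otimes>\<^bsub>A\<^esub> inv\<^bsub>A\<^esub> f = inner_aut (f g)"
    unfolding g(2) A_inner[OF f g(1)]
    using group.inv_solve_right'[OF A_group inner_A[OF fg] A_mult_closed[OF inner_A[OF fg] f] f] by simp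
  then show "f \<otimes>\<^bsub>A\<^esub> i \<otimes>\<^bsub>A\<^esub> inv\<^bsub>A\<^esub> f \<in> inner_automorphisms G" using inner_mem[OF fg] by simp
qed

lemma inner_coset_eqI:
  assumes f: "f \<in> carrier A" and g: "g \<in> carrier G"
  shows "inner_automorphisms G #>\<^bsub>A\<^esub> (inner_aut g \<otimes>\<^bsub>A\<^esub> f) = inner_automorphisms G #>\<^bsub>A\<^esub> f"
proof -
  interpret N: normal "inner_automorphisms G" A by (rule inner_automorphisms_normal)
  have "inner_automorphisms G #>\<^bsub>A\<^esub> (inner_aut g \<otimes>\<^bsub>A\<^esub> f) = inner_automorphisms G #>\<^bsub>A\<^esub> inner_aut g #>\<^bsub>A\<^esub> f"
    using N.coset_mult_assoc[OF N.subset inner_A[OF g] f] by simp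
  also have "inner_automorphisms G #>\<^bsub>A\<^esub> inner_aut g = inner_automorphisms G"
    by (rule N.coset_join2[OF inner_A[OF g] N.subgroup_axioms inner_mem[OF g]])
  finally show ?thesis .
qed

lemma normalizer_subgroup: "subgroup (normalizer_in G T) G"
  by (rule normalizer_in_subgroup[OF subgroup.subset[OF T_sub]])

lemma InnLink_coset_conj:
  assumes f: "stable f" and y: "y \<in> normalizer_in G T"
  shows "InnLink p G T #>\<^bsub>AutLink p G T\<^esub> ind (conj_by G y \<circ> f) = InnLink p G T #>\<^bsub>AutLink p G T\<^esub> ind f"
proof -
  interpret N: subgroup "normalizer_in G T" G by (rule normalizer_subgroup)
  have s: "stable (conj_by G y \<circ> f)" by (rule stable_comp[OF stable_conj_by[OF y] f])
  have e: "ind (conj_by G z \<circ> (conj_by G y \<circ> f)) = ind (conj_by G (z \<otimes> y) \<circ> f)" if "z \<in> normalizer_in G T" for z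
    by (rule ind_cong) (use that y stable_closed[OF f] in \<open>simp add: conj_by_conj_by\<close>)
  have "(\<lambda>z. ind (conj_by G z \<circ> (conj_by G y \<circ> f))) ` normalizer_in G T =
    (\<lambda>z. ind (conj_by G (z \<otimes> y) \<circ> f)) ` normalizer_in G T"
    by (rule image_cong[OF refl e])
  also have "\<dots> = (\<lambda>z. ind (conj_by G z \<circ> f)) ` ((\<lambda>z. z \<otimes> y) ` normalizer_in G T)" by (simp add: image_image)
  also have "(\<lambda>z. z \<otimes> y) ` normalizer_in G T = normalizer_in G T"
  proof (intro equalityI subsetI)
    fix z assume z: "z \<in> normalizer_in G T"
    then have "z = (z \<otimes> inv y) \<otimes> y" using y by (simp add: m_assoc)
    moreover have "z \<otimes> inv y \<in> normalizer_in G T" using z y by simp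
    ultimately show "z \<in> (\<lambda>z. z \<otimes> y) ` normalizer_in G T" by blast
  qed (use y in auto)
  finally show ?thesis unfolding InnLink_coset[OF s] InnLink_coset[OF f] .
qed

text \<open>Two representatives of an outer class that both stabilize \<open>T\<close> differ by conjugation with an
  element of the normalizer of \<open>T\<close>, so the choice made in \<open>kappa\<close> is harmless.\<close>

lemma kappa_coset:
  assumes f: "f \<in> stable_automorphisms G T"
  shows "kappa p G T (inner_automorphisms G #>\<^bsub>A\<^esub> f) = InnLink p G T #>\<^bsub>AutLink p G T\<^esub> ind f"
proof -
  let ?X = "inner_automorphisms G #>\<^bsub>A\<^esub> f"
  define h where "h = (SOME h. h \<in> ?X \<inter> stable_automorphisms G T)"
  have fA: "f \<in> carrier A" and fs: "stable f" using f A_carrier A_stable by auto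
  have "f \<in> ?X" using group.rcos_self[OF A_group fA] normal_imp_subgroup[OF inner_automorphisms_normal] by blast
  then have "\<exists>h. h \<in> ?X \<inter> stable_automorphisms G T" using f by blast
  then have h: "h \<in> ?X" "h \<in> stable_automorphisms G T" unfolding h_def by (metis (mono_tags, lifting) Int_iff someI_ex)+
  obtain y where y: "y \<in> carrier G" "h = inner_aut y \<otimes>\<^bsub>A\<^esub> f"
    using h(1) unfolding inner_automorphisms_eq r_coset_def by auto
  have happ: "h x = conj_by G y (f x)" if "x \<in> carrier G" for x
    unfolding y(2) using A_mult_apply[OF inner_A[OF y(1)] fA that] inner_apply stable_closed[OF fs that] by simp
  have yN: "y \<in> normalizer_in G T"
  proof -
    have "h ` T = conj_by G y ` f ` T"
      unfolding image_image using happ subgroup.subset[OF T_sub] by (intro image_cong) auto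
    then show ?thesis using A_stable[OF h(2)] fs y(1) by (simp add: stable_def normalizer_in_def)
  qed
  have "ind h = ind (conj_by G y \<circ> f)" by (rule ind_cong) (simp add: happ)
  then show ?thesis unfolding kappa_def h_def[symmetric] using InnLink_coset_conj[OF fs yN] by simp
qed

lemma InnLink_coset_mult:
  assumes f: "stable f" and g: "stable g"
  shows "(InnLink p G T #>\<^bsub>AutLink p G T\<^esub> ind f) <#>\<^bsub>AutLink p G T\<^esub> (InnLink p G T #>\<^bsub>AutLink p G T\<^esub> ind g) =
    InnLink p G T #>\<^bsub>AutLink p G T\<^esub> ind (f \<circ> g)"
proof -
  interpret N: subgroup "normalizer_in G T" G by (rule normalizer_subgroup)
  have fN: "f y \<in> normalizer_in G T" if "y \<in> normalizer_in G T" for y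
  proof -
    have y: "y \<in> carrier G" "conj_by G y ` T = T" using that unfolding normalizer_in_def by blast+
    have fT: "f ` T = T" using f unfolding stable_def by blast
    have "conj_by G (f y) ` T = T"
      using stable_conj_image[OF f y(1) subgroup.subset[OF T_sub]] unfolding y(2) fT by (rule sym)
    then show ?thesis using stable_closed[OF f y(1)] unfolding normalizer_in_def by blast
  qed
  have mult: "monoid.mult (AutLink p G T) = comp_functor L" by (simp add: AutLink_def Let_def)
  have e: "comp_functor L (ind (conj_by G z \<circ> f)) (ind (conj_by G y \<circ> g)) = ind (conj_by G (z \<otimes> f y) \<circ> (f \<circ> g))"
    if "z \<in> normalizer_in G T" "y \<in> normalizer_in G T" for z y
  proof -
    have "comp_functor L (ind (conj_by G z \<circ> f)) (ind (conj_by G y \<circ> g)) = ind ((conj_by G z \<circ> f) \<circ> (conj_by G y \<circ> g))"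
      by (rule ind_comp[OF stable_comp[OF stable_conj_by[OF that(2)] g]])
    also have "\<dots> = ind (conj_by G (z \<otimes> f y) \<circ> (f \<circ> g))"
      by (rule ind_cong)
        (use that stable_closed[OF g] stable_closed[OF f] stable_conj[OF f] in \<open>simp add: conj_by_conj_by\<close>)
    finally show ?thesis .
  qed
  show ?thesis
    unfolding InnLink_coset[OF f] InnLink_coset[OF g] InnLink_coset[OF stable_comp[OF f g]] set_mult_def mult
  proof (intro equalityI subsetI)
    fix B assume "B \<in> (\<Union>h\<in>(\<lambda>y. ind (conj_by G y \<circ> f)) ` normalizer_in G T.
        \<Union>k\<in>(\<lambda>y. ind (conj_by G y \<circ> g)) ` normalizer_in G T. {comp_functor L h k})"
    then obtain z y where zy: "z \<in> normalizer_in G T" "y \<in> normalizer_in G T"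
      "B = comp_functor L (ind (conj_by G z \<circ> f)) (ind (conj_by G y \<circ> g))" by blast
    have "B = ind (conj_by G (z \<otimes> f y) \<circ> (f \<circ> g))" unfolding zy(3) by (rule e[OF zy(1,2)])
    then show "B \<in> (\<lambda>y. ind (conj_by G y \<circ> (f \<circ> g))) ` normalizer_in G T"
      using N.m_closed[OF zy(1) fN[OF zy(2)]] by (rule image_eqI)
  next
    fix B assume "B \<in> (\<lambda>y. ind (conj_by G y \<circ> (f \<circ> g))) ` normalizer_in G T"
    then obtain z where z: "z \<in> normalizer_in G T" "B = ind (conj_by G z \<circ> (f \<circ> g))" by blast
    have "z \<otimes> f \<one> = z" using z(1) stable_one[OF f] by simp
    then have B: "B = comp_functor L (ind (conj_by G z \<circ> f)) (ind (conj_by G \<one> \<circ> g))"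
      using e[OF z(1) N.one_closed] z(2) by simp
    show "B \<in> (\<Union>h\<in>(\<lambda>y. ind (conj_by G y \<circ> f)) ` normalizer_in G T.
        \<Union>k\<in>(\<lambda>y. ind (conj_by G y \<circ> g)) ` normalizer_in G T. {comp_functor L h k})"
      unfolding B
      by (rule UN_I[OF imageI[OF z(1)]], rule UN_I[OF imageI[OF N.one_closed]], rule singletonI)
  qed
qed

end

section \<open>An extension in which the kernel becomes inner\<close>

text \<open>\<open>Y\<close> stands for the semidirect product of \<open>G\<close> with the kernel \<open>K\<close> of the action of \<open>\<Gamma>\<close> on the linking
  system, divided by the normal subgroup of all pairs \<open>(h, k)\<close> with \<open>h\<close> in $O_{p'}(C_G(T))$ that
  centralize \<open>G\<close>; \<open>a\<close> and \<open>b\<close> are the images of the two factors. Since \<open>K\<close> has order prime to \<open>p\<close> and acts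
  trivially on the linking system, \<open>Y\<close> has the same fusion and linking systems as \<open>G\<close>. Every
  element \<open>\<gamma>\<close> of \<open>\<Gamma>\<close> extends to \<open>Y\<close>. The elements of \<open>K\<close> extend to inner automorphisms because \<open>K\<close> has been
  adjoined to \<open>G\<close>, and conjugations by elements of the normalizer of \<open>T\<close> extend to inner
  automorphisms because of the division.\<close>

locale kernel_extension = G: sylow_pair G p T + Y: group Y
  for G :: "('a, 'm) monoid_scheme" and p T and Y :: "('y, 'n) monoid_scheme" +
  fixes \<Gamma> :: "('a \<Rightarrow> 'a) set" and a :: "'a \<Rightarrow> 'y" and b :: "('a \<Rightarrow> 'a) \<Rightarrow> 'y"
  assumes \<Gamma>: "induces_link_automorphisms p G T \<Gamma>"
    and K_coprime: "coprime (card (link_kernel p G T \<Gamma>)) p"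
    and finY: "finite (carrier Y)"
    and orderY: "order Y dvd order G * card (link_kernel p G T \<Gamma>)"
    and a_hom: "a \<in> hom G Y"
    and b_hom: "b \<in> hom (AutoGroup G\<lparr>carrier := link_kernel p G T \<Gamma>\<rparr>) Y"
    and Y_surj: "y \<in> carrier Y \<Longrightarrow> \<exists>h\<in>carrier G. \<exists>k\<in>link_kernel p G T \<Gamma>. y = a h \<otimes>\<^bsub>Y\<^esub> b k"
    and b_a: "\<lbrakk>k \<in> link_kernel p G T \<Gamma>; h \<in> carrier G\<rbrakk> \<Longrightarrow> b k \<otimes>\<^bsub>Y\<^esub> a h = a (k h) \<otimes>\<^bsub>Y\<^esub> b k"
    and ab_one_iff: "\<lbrakk>h \<in> carrier G; k \<in> link_kernel p G T \<Gamma>\<rbrakk> \<Longrightarrow> a h \<otimes>\<^bsub>Y\<^esub> b k = \<one>\<^bsub>Y\<^esub> \<longleftrightarrow>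
       h \<in> p_prime_core p G (centralizer_in G T) \<and> (\<forall>x\<in>carrier G. h \<otimes>\<^bsub>G\<^esub> k x = x \<otimes>\<^bsub>G\<^esub> h)"
begin

abbreviation "A \<equiv> AutoGroup G"
abbreviation "K \<equiv> link_kernel p G T \<Gamma>"
abbreviation "U \<equiv> a ` T"

sublocale a: group_hom G Y a
  by (simp add: group_hom_def group_hom_axioms_def a_hom G.is_group Y.is_group)

sublocale A: group A by (rule G.A_group)

lemma \<Gamma>_sub: "subgroup \<Gamma> A" and \<Gamma>_stable_aut: "\<Gamma> \<subseteq> stable_automorphisms G T"
  and \<Gamma>_inner: "\<And>g. g \<in> normalizer_in G T \<Longrightarrow> restrict (conj_by G g) (carrier G) \<in> \<Gamma>"
  and \<Gamma>_lift: "\<And>B. B \<in> carrier (AutLink p G T) \<Longrightarrow> \<exists>f\<in>\<Gamma>. B = G.ind f"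
  using \<Gamma> by (auto simp: induces_link_automorphisms_def)

lemma \<Gamma>_stable: "\<gamma> \<in> \<Gamma> \<Longrightarrow> G.stable \<gamma>"
  using \<Gamma>_stable_aut G.A_stable by blast

lemma \<Gamma>_A: "\<gamma> \<in> \<Gamma> \<Longrightarrow> \<gamma> \<in> carrier A"
  using subgroup.mem_carrier[OF \<Gamma>_sub] .

lemma K_sub: "subgroup K A"
  by (rule G.link_kernel_subgroup[OF \<Gamma>_sub \<Gamma>_stable_aut])

lemma K_\<Gamma>: "k \<in> K \<Longrightarrow> k \<in> \<Gamma>" and K_ind: "k \<in> K \<Longrightarrow> G.ind k = id_functor G.L"
  by (auto simp: link_kernel_def)

lemma K_stable: "k \<in> K \<Longrightarrow> G.stable k" and K_A: "k \<in> K \<Longrightarrow> k \<in> carrier A"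
  using K_\<Gamma> \<Gamma>_stable \<Gamma>_A by auto

lemma K_closed: "\<lbrakk>k \<in> K; x \<in> carrier G\<rbrakk> \<Longrightarrow> k x \<in> carrier G"
  by (rule G.stable_closed[OF K_stable])

lemma K_fix: "\<lbrakk>k \<in> K; t \<in> T\<rbrakk> \<Longrightarrow> k t = t"
  by (rule G.kernel_fixes(4)[OF K_stable K_ind])

lemma K_mult: "\<lbrakk>k \<in> K; l \<in> K\<rbrakk> \<Longrightarrow> k \<otimes>\<^bsub>A\<^esub> l \<in> K"
  using subgroup.m_closed[OF K_sub] .

lemma K_one: "\<one>\<^bsub>A\<^esub> \<in> K" using subgroup.one_closed[OF K_sub] .

lemma K_inv: "k \<in> K \<Longrightarrow> inv\<^bsub>A\<^esub> k \<in> K" using subgroup.m_inv_closed[OF K_sub] .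

lemma K_conj: "\<lbrakk>\<gamma> \<in> \<Gamma>; k \<in> K\<rbrakk> \<Longrightarrow> conj_by A \<gamma> k \<in> K"
  by (rule G.link_kernel_conj[OF \<Gamma>_sub \<Gamma>_stable_aut])

lemma b_closed: "k \<in> K \<Longrightarrow> b k \<in> carrier Y"
  using b_hom by (auto simp: hom_def)

lemma b_mult: "\<lbrakk>k \<in> K; l \<in> K\<rbrakk> \<Longrightarrow> b (k \<otimes>\<^bsub>A\<^esub> l) = b k \<otimes>\<^bsub>Y\<^esub> b l"
  using b_hom by (simp add: hom_def)

sublocale b: group_hom "A\<lparr>carrier := K\<rparr>" Y b
  by (simp add: group_hom_def group_hom_axioms_def b_hom Y.is_group subgroup.subgroup_is_group[OF K_sub G.A_group])

lemma b_one: "b \<one>\<^bsub>A\<^esub> = \<one>\<^bsub>Y\<^esub>" using b.hom_one by simp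

lemma b_inv: "k \<in> K \<Longrightarrow> b (inv\<^bsub>A\<^esub> k) = inv\<^bsub>Y\<^esub> b k"
  using b.hom_inv[of k] A.m_inv_consistent[OF K_sub] by simp

lemma ab_mult:
  assumes "h \<in> carrier G" "k \<in> K" "h' \<in> carrier G" "k' \<in> K"
  shows "(a h \<otimes>\<^bsub>Y\<^esub> b k) \<otimes>\<^bsub>Y\<^esub> (a h' \<otimes>\<^bsub>Y\<^esub> b k') = a (h \<otimes>\<^bsub>G\<^esub> k h') \<otimes>\<^bsub>Y\<^esub> b (k \<otimes>\<^bsub>A\<^esub> k')"
proof -
  have c: "a h \<in> carrier Y" "a h' \<in> carrier Y" "b k \<in> carrier Y" "b k' \<in> carrier Y" "a (k h') \<in> carrier Y"
    using assms b_closed K_closed by auto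
  have "(a h \<otimes>\<^bsub>Y\<^esub> b k) \<otimes>\<^bsub>Y\<^esub> (a h' \<otimes>\<^bsub>Y\<^esub> b k') = a h \<otimes>\<^bsub>Y\<^esub> (b k \<otimes>\<^bsub>Y\<^esub> a h') \<otimes>\<^bsub>Y\<^esub> b k'"
    using c by (simp add: Y.m_assoc)
  also have "\<dots> = (a h \<otimes>\<^bsub>Y\<^esub> a (k h')) \<otimes>\<^bsub>Y\<^esub> (b k \<otimes>\<^bsub>Y\<^esub> b k')"
    unfolding b_a[OF assms(2,3)] using c by (simp add: Y.m_assoc)
  finally show ?thesis using assms K_closed by (simp add: b_mult)
qed

lemma a_one_iff:
  assumes "x \<in> carrier G"
  shows "a x = \<one>\<^bsub>Y\<^esub> \<longleftrightarrow> x \<in> G.Core T \<and> (\<forall>z\<in>carrier G. x \<otimes>\<^bsub>G\<^esub> z = z \<otimes>\<^bsub>G\<^esub> x)"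
  using ab_one_iff[OF assms K_one] b_one assms G.AutoGroup_one by simp

lemma conj_Y_T:
  assumes "h \<in> carrier G" "k \<in> K" "t \<in> T"
  shows "conj_by Y (a h \<otimes>\<^bsub>Y\<^esub> b k) (a t) = a (conj_by G h t)"
proof -
  have tc: "t \<in> carrier G" using assms(3) subgroup.mem_carrier[OF G.T_sub] by blast
  have c: "a h \<in> carrier Y" "b k \<in> carrier Y" "a t \<in> carrier Y" using assms tc b_closed by auto
  have "conj_by Y (b k) (a t) = a t"
    using Y.conj_by_eq_self_iff[OF c(2,3)] b_a[OF assms(2) tc] K_fix[OF assms(2,3)] by simp
  then have "conj_by Y (a h \<otimes>\<^bsub>Y\<^esub> b k) (a t) = conj_by Y (a h) (a t)"
    using Y.conj_by_conj_by[OF c(1,2,3)] by simp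
  also have "\<dots> = a (conj_by G h t)" using assms(1) tc by (simp add: conj_by_def)
  finally show ?thesis .
qed

lemma kernel_a_regular: "\<lbrakk>x \<in> carrier G; a x = \<one>\<^bsub>Y\<^esub>\<rbrakk> \<Longrightarrow> p_regular p G x"
  using a_one_iff G.Core_eq[OF G.T_Ob] by simp

lemma a_inj_T: "inj_on a T"
proof (rule inj_onI)
  interpret T: subgroup T G by (rule G.T_sub)
  fix s t assume st: "s \<in> T" "t \<in> T" "a s = a t"
  then have "a (s \<otimes>\<^bsub>G\<^esub> inv\<^bsub>G\<^esub> t) = \<one>\<^bsub>Y\<^esub>" by simp
  then have "p_regular p G (s \<otimes>\<^bsub>G\<^esub> inv\<^bsub>G\<^esub> t)" using st by (intro kernel_a_regular) auto
  moreover have stT: "s \<otimes>\<^bsub>G\<^esub> inv\<^bsub>G\<^esub> t \<in> T" using st by simp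
  ultimately have "s \<otimes>\<^bsub>G\<^esub> inv\<^bsub>G\<^esub> t = \<one>\<^bsub>G\<^esub>"
    using G.p_element_p_regular_one[OF T.mem_carrier[OF stT] G.T_p_element[OF stT]] by simp
  then show "s = t" using st G.inv_solve_right'[of "\<one>\<^bsub>G\<^esub>" s t] by simp
qed

text \<open>The order of \<open>Y\<close> divides the product of the orders of \<open>G\<close> and \<open>K\<close>, and the order of \<open>K\<close> is prime to
  \<open>p\<close>.\<close>

lemma U_sylow: "sylow_subgroup p Y U"
  unfolding sylow_subgroup_def
proof
  show U: "subgroup U Y" by (rule a.subgroup_img_is_subgroup[OF G.T_sub])
  let ?n = "multiplicity p (order G)"
  have cU: "card U = p ^ ?n" using card_image[OF a_inj_T] G.card_T by simp
  have nz: "order Y \<noteq> 0" "order G \<noteq> 0" "card K \<noteq> 0"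
  proof -
    show "order Y \<noteq> 0" using finY Y.order_gt_0_iff_finite by simp
    show "order G \<noteq> 0" using G.fin G.order_gt_0_iff_finite by simp
    have "finite K" using finite_subset[OF subgroup.subset[OF K_sub] G.finite_AutoGroup] .
    then show "card K \<noteq> 0" using K_one by (metis card_0_eq empty_iff)
  qed
  have "multiplicity p (order Y) = ?n"
  proof (rule antisym)
    have "multiplicity p (order Y) \<le> multiplicity p (order G * card K)"
      using orderY nz by (intro dvd_imp_multiplicity_le) auto
    also have "\<dots> = ?n + multiplicity p (card K)"
      using nz G.prime_p by (intro prime_elem_multiplicity_mult_distrib) auto
    also have "multiplicity p (card K) = 0"
    proof -
      have "\<not> p dvd card K" using K_coprime G.prime_p by (metis coprime_absorb_right not_prime_unit)
      then show ?thesis by (rule not_dvd_imp_multiplicity_0)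
    qed
    finally show "multiplicity p (order Y) \<le> ?n" by simp
    have "p ^ ?n dvd order Y" using Y.lagrange[OF U] cU by (metis dvd_triv_right)
    then show "?n \<le> multiplicity p (order Y)"
      using nz G.prime_p by (metis multiplicity_geI not_prime_unit)
  qed
  then show "card U = p ^ multiplicity p (order Y)" using cU by simp
qed

sublocale Y: sylow_pair Y p U
  by unfold_locales (rule G.prime_p, rule finY, rule U_sylow)

sublocale cmp: linking_comparison G p T Y U a
proof
  show "a \<in> hom G Y" by (rule a_hom)
  show "p_regular p G x" if "x \<in> carrier G" "a x = \<one>\<^bsub>Y\<^esub>" for x by (rule kernel_a_regular[OF that])
  show "x \<otimes>\<^bsub>G\<^esub> t = t \<otimes>\<^bsub>G\<^esub> x" if "x \<in> carrier G" "a x = \<one>\<^bsub>Y\<^esub>" "t \<in> T" for x t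
    using that a_one_iff subgroup.mem_carrier[OF G.T_sub] by blast
  show "\<exists>h\<in>carrier G. \<forall>x\<in>P. conj_by Y y (a x) = a (conj_by G h x)"
    if P: "subgroup P G" "P \<subseteq> T" and y: "y \<in> carrier Y" for P y
  proof -
    obtain h k where hk: "h \<in> carrier G" "k \<in> K" "y = a h \<otimes>\<^bsub>Y\<^esub> b k" using Y_surj[OF y] by blast
    then have "\<forall>x\<in>P. conj_by Y y (a x) = a (conj_by G h x)" using conj_Y_T[OF hk(1,2)] P(2) by blast
    then show ?thesis using hk(1) by blast
  qed
qed simp

text \<open>The extension of \<open>\<gamma>\<close> maps \<open>a h \<cdot> b k\<close> to \<open>a (\<gamma> h) \<cdot> b (\<gamma> k \<gamma>\<inverse>)\<close>. It is shown below
  that the result does not depend on the decomposition that is chosen.\<close>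

definition ext :: "('a \<Rightarrow> 'a) \<Rightarrow> 'y \<Rightarrow> 'y" where
  "ext \<gamma> = (\<lambda>y\<in>carrier Y. SOME z. \<exists>h\<in>carrier G. \<exists>k\<in>K. y = a h \<otimes>\<^bsub>Y\<^esub> b k \<and> z = a (\<gamma> h) \<otimes>\<^bsub>Y\<^esub> b (conj_by A \<gamma> k))"

lemma conj_by_A_apply:
  assumes "\<gamma> \<in> carrier A" "k \<in> carrier A" "x \<in> carrier G"
  shows "conj_by A \<gamma> k (\<gamma> x) = \<gamma> (k x)"
proof -
  have "conj_by A \<gamma> k \<otimes>\<^bsub>A\<^esub> \<gamma> = \<gamma> \<otimes>\<^bsub>A\<^esub> k" using assms(1,2) by (simp add: conj_by_def A.m_assoc)
  moreover have "(conj_by A \<gamma> k \<otimes>\<^bsub>A\<^esub> \<gamma>) x = conj_by A \<gamma> k (\<gamma> x)"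
    using G.A_mult_apply assms A.conj_by_closed by blast
  moreover have "(\<gamma> \<otimes>\<^bsub>A\<^esub> k) x = \<gamma> (k x)" by (rule G.A_mult_apply[OF assms])
  ultimately show ?thesis by simp
qed

text \<open>The normal subgroup by which the semidirect product is divided is described in terms of \<open>T\<close>
  and \<open>G\<close>, so it is invariant under \<open>\<Gamma>\<close>.\<close>

lemma kernel_\<Gamma>:
  assumes "\<gamma> \<in> \<Gamma>" "h \<in> carrier G" "k \<in> K" "a h \<otimes>\<^bsub>Y\<^esub> b k = \<one>\<^bsub>Y\<^esub>"
  shows "a (\<gamma> h) \<otimes>\<^bsub>Y\<^esub> b (conj_by A \<gamma> k) = \<one>\<^bsub>Y\<^esub>"
proof -
  have s: "G.stable \<gamma>" by (rule \<Gamma>_stable[OF assms(1)])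
  have gh: "\<gamma> h \<in> carrier G" by (rule G.stable_closed[OF s assms(2)])
  have hk: "h \<in> G.Core T" "\<And>x. x \<in> carrier G \<Longrightarrow> h \<otimes>\<^bsub>G\<^esub> k x = x \<otimes>\<^bsub>G\<^esub> h"
    using ab_one_iff[OF assms(2,3)] assms(4) by auto
  have "\<gamma> ` G.Core T = G.Core (\<gamma> ` T)" by (rule G.stable_Core[OF s G.T_Ob, symmetric])
  also have "\<gamma> ` T = T" using s by (simp add: G.stable_def)
  finally have 1: "\<gamma> h \<in> G.Core T" using hk(1) by blast
  have "\<gamma> h \<otimes>\<^bsub>G\<^esub> conj_by A \<gamma> k x = x \<otimes>\<^bsub>G\<^esub> \<gamma> h" if x: "x \<in> carrier G" for x
  proof -
    obtain z where z: "z \<in> carrier G" "x = \<gamma> z" using G.stable_surj[OF s] x by blast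
    have kz: "k z \<in> carrier G" by (rule K_closed[OF assms(3) z(1)])
    have "\<gamma> h \<otimes>\<^bsub>G\<^esub> conj_by A \<gamma> k x = \<gamma> h \<otimes>\<^bsub>G\<^esub> \<gamma> (k z)"
      unfolding z(2) conj_by_A_apply[OF \<Gamma>_A[OF assms(1)] K_A[OF assms(3)] z(1)] ..
    also have "\<dots> = \<gamma> (h \<otimes>\<^bsub>G\<^esub> k z)" using G.stable_mult[OF s assms(2) kz] by simp
    also have "\<dots> = x \<otimes>\<^bsub>G\<^esub> \<gamma> h" unfolding hk(2)[OF z(1)] z(2) by (rule G.stable_mult[OF s z(1) assms(2)])
    finally show ?thesis .
  qed
  then show ?thesis using ab_one_iff[OF gh K_conj[OF assms(1,3)]] 1 by blast
qed

lemma conj_by_A_mult: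
  assumes "\<gamma> \<in> \<Gamma>" "k \<in> K" "l \<in> K"
  shows "conj_by A \<gamma> (k \<otimes>\<^bsub>A\<^esub> l) = conj_by A \<gamma> k \<otimes>\<^bsub>A\<^esub> conj_by A \<gamma> l"
  using assms \<Gamma>_A K_A by (intro A.conj_by_mult) auto

lemma ext_prod:
  assumes "\<gamma> \<in> \<Gamma>" "h \<in> carrier G" "k \<in> K" "h' \<in> carrier G" "k' \<in> K"
  shows "(a (\<gamma> h) \<otimes>\<^bsub>Y\<^esub> b (conj_by A \<gamma> k)) \<otimes>\<^bsub>Y\<^esub> (a (\<gamma> h') \<otimes>\<^bsub>Y\<^esub> b (conj_by A \<gamma> k')) =
     a (\<gamma> (h \<otimes>\<^bsub>G\<^esub> k h')) \<otimes>\<^bsub>Y\<^esub> b (conj_by A \<gamma> (k \<otimes>\<^bsub>A\<^esub> k'))"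
proof -
  have s: "G.stable \<gamma>" by (rule \<Gamma>_stable[OF assms(1)])
  have "conj_by A \<gamma> k (\<gamma> h') = \<gamma> (k h')" by (rule conj_by_A_apply[OF \<Gamma>_A[OF assms(1)] K_A[OF assms(3)] assms(4)])
  then show ?thesis
    using ab_mult[OF G.stable_closed[OF s assms(2)] K_conj[OF assms(1,3)] G.stable_closed[OF s assms(4)] K_conj[OF assms(1,5)]]
      G.stable_mult[OF s assms(2) K_closed[OF assms(3,4)]] conj_by_A_mult[OF assms(1,3,5)] by simp
qed

lemma ext_ab:
  assumes "\<gamma> \<in> \<Gamma>" "h \<in> carrier G" "k \<in> K"
  shows "ext \<gamma> (a h \<otimes>\<^bsub>Y\<^esub> b k) = a (\<gamma> h) \<otimes>\<^bsub>Y\<^esub> b (conj_by A \<gamma> k)"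
proof -
  have s: "G.stable \<gamma>" by (rule \<Gamma>_stable[OF assms(1)])
  have uniq: "a (\<gamma> h') \<otimes>\<^bsub>Y\<^esub> b (conj_by A \<gamma> k') = a (\<gamma> h) \<otimes>\<^bsub>Y\<^esub> b (conj_by A \<gamma> k)"
    if h': "h' \<in> carrier G" "k' \<in> K" and eq: "a h \<otimes>\<^bsub>Y\<^esub> b k = a h' \<otimes>\<^bsub>Y\<^esub> b k'" for h' k'
  proof -
    \<comment> \<open>The first product is \<open>a x \<cdot> b l\<close> times the second, so \<open>a x \<cdot> b l\<close> is trivial, and so is its
      image under the extension of \<open>\<gamma>\<close>.\<close>
    define l where "l = k \<otimes>\<^bsub>A\<^esub> inv\<^bsub>A\<^esub> k'"
    define x where "x = h \<otimes>\<^bsub>G\<^esub> inv\<^bsub>G\<^esub> (l h')"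
    have l: "l \<in> K" unfolding l_def by (rule K_mult[OF assms(3) K_inv[OF h'(2)]])
    have lh: "l h' \<in> carrier G" by (rule K_closed[OF l h'(1)])
    have x: "x \<in> carrier G" unfolding x_def using assms(2) lh by simp
    have xh: "x \<otimes>\<^bsub>G\<^esub> l h' = h" unfolding x_def using assms(2) lh by (simp add: G.m_assoc)
    have lk: "l \<otimes>\<^bsub>A\<^esub> k' = k" unfolding l_def using K_A[OF assms(3)] K_A[OF h'(2)] by (simp add: A.m_assoc)
    have prod: "(a x \<otimes>\<^bsub>Y\<^esub> b l) \<otimes>\<^bsub>Y\<^esub> (a h' \<otimes>\<^bsub>Y\<^esub> b k') = a h \<otimes>\<^bsub>Y\<^esub> b k"
      using ab_mult[OF x l h'] xh lk by simp
    have c: "a x \<otimes>\<^bsub>Y\<^esub> b l \<in> carrier Y" "a h' \<otimes>\<^bsub>Y\<^esub> b k' \<in> carrier Y" using x l h' b_closed by auto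
    have "a x \<otimes>\<^bsub>Y\<^esub> b l = \<one>\<^bsub>Y\<^esub>" using prod eq c by simp
    then have "a (\<gamma> x) \<otimes>\<^bsub>Y\<^esub> b (conj_by A \<gamma> l) = \<one>\<^bsub>Y\<^esub>" by (rule kernel_\<Gamma>[OF assms(1) x l])
    moreover have "(a (\<gamma> x) \<otimes>\<^bsub>Y\<^esub> b (conj_by A \<gamma> l)) \<otimes>\<^bsub>Y\<^esub> (a (\<gamma> h') \<otimes>\<^bsub>Y\<^esub> b (conj_by A \<gamma> k')) =
        a (\<gamma> h) \<otimes>\<^bsub>Y\<^esub> b (conj_by A \<gamma> k)"
      using ext_prod[OF assms(1) x l h'] xh lk by simp
    moreover have "a (\<gamma> h') \<otimes>\<^bsub>Y\<^esub> b (conj_by A \<gamma> k') \<in> carrier Y"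
      using b_closed[OF K_conj[OF assms(1) h'(2)]] G.stable_closed[OF s h'(1)] by simp
    ultimately show ?thesis by simp
  qed
  let ?y = "a h \<otimes>\<^bsub>Y\<^esub> b k"
  have y: "?y \<in> carrier Y" using assms(2) b_closed[OF assms(3)] by simp
  have ex: "\<exists>z. \<exists>h\<in>carrier G. \<exists>k\<in>K. ?y = a h \<otimes>\<^bsub>Y\<^esub> b k \<and> z = a (\<gamma> h) \<otimes>\<^bsub>Y\<^esub> b (conj_by A \<gamma> k)"
    using assms(2,3) by blast
  obtain h' k' where "h' \<in> carrier G" "k' \<in> K" "?y = a h' \<otimes>\<^bsub>Y\<^esub> b k'"
    "ext \<gamma> ?y = a (\<gamma> h') \<otimes>\<^bsub>Y\<^esub> b (conj_by A \<gamma> k')"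
    using someI_ex[OF ex] y unfolding ext_def by auto
  then show ?thesis using uniq by simp
qed

lemma ext_a:
  assumes "\<gamma> \<in> \<Gamma>" "h \<in> carrier G" shows "ext \<gamma> (a h) = a (\<gamma> h)"
proof -
  have "conj_by A \<gamma> \<one>\<^bsub>A\<^esub> = \<one>\<^bsub>A\<^esub>" using \<Gamma>_A[OF assms(1)] by (simp add: conj_by_def)
  then show ?thesis
    using ext_ab[OF assms K_one] b_one a.hom_closed[OF assms(2)]
      a.hom_closed[OF G.stable_closed[OF \<Gamma>_stable[OF assms(1)] assms(2)]] by simp
qed

lemma ext_closed:
  assumes "\<gamma> \<in> \<Gamma>" "y \<in> carrier Y" shows "ext \<gamma> y \<in> carrier Y"
proof -
  obtain h k where hk: "h \<in> carrier G" "k \<in> K" "y = a h \<otimes>\<^bsub>Y\<^esub> b k" using Y_surj[OF assms(2)] by blast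
  show ?thesis unfolding hk(3) ext_ab[OF assms(1) hk(1,2)]
    using b_closed[OF K_conj[OF assms(1) hk(2)]] G.stable_closed[OF \<Gamma>_stable[OF assms(1)] hk(1)] by simp
qed

lemma ext_comp:
  assumes "\<gamma> \<in> \<Gamma>" "\<gamma>' \<in> \<Gamma>" "y \<in> carrier Y"
  shows "ext (\<gamma> \<otimes>\<^bsub>A\<^esub> \<gamma>') y = ext \<gamma> (ext \<gamma>' y)"
proof -
  obtain h k where hk: "h \<in> carrier G" "k \<in> K" "y = a h \<otimes>\<^bsub>Y\<^esub> b k" using Y_surj[OF assms(3)] by blast
  have gg: "\<gamma> \<otimes>\<^bsub>A\<^esub> \<gamma>' \<in> \<Gamma>" by (rule subgroup.m_closed[OF \<Gamma>_sub assms(1,2)])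
  have "conj_by A (\<gamma> \<otimes>\<^bsub>A\<^esub> \<gamma>') k = conj_by A \<gamma> (conj_by A \<gamma>' k)"
    using A.conj_by_conj_by[OF \<Gamma>_A[OF assms(1)] \<Gamma>_A[OF assms(2)] K_A[OF hk(2)]] by simp
  moreover have "(\<gamma> \<otimes>\<^bsub>A\<^esub> \<gamma>') h = \<gamma> (\<gamma>' h)" by (rule G.A_mult_apply[OF \<Gamma>_A[OF assms(1)] \<Gamma>_A[OF assms(2)] hk(1)])
  ultimately show ?thesis
    unfolding hk(3) ext_ab[OF gg hk(1,2)] ext_ab[OF assms(2) hk(1,2)]
    using ext_ab[OF assms(1) G.stable_closed[OF \<Gamma>_stable[OF assms(2)] hk(1)] K_conj[OF assms(2) hk(2)]] by simp
qed

lemma ext_one: "y \<in> carrier Y \<Longrightarrow> ext \<one>\<^bsub>A\<^esub> y = y"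
proof -
  assume "y \<in> carrier Y"
  then obtain h k where hk: "h \<in> carrier G" "k \<in> K" "y = a h \<otimes>\<^bsub>Y\<^esub> b k" using Y_surj by blast
  have "\<one>\<^bsub>A\<^esub> h = h" using hk(1) by (simp add: G.AutoGroup_one)
  then show ?thesis unfolding hk(3) ext_ab[OF subgroup.one_closed[OF \<Gamma>_sub] hk(1,2)]
    using A.conj_by_one[OF K_A[OF hk(2)]] by simp
qed

lemma ext_stable: "\<gamma> \<in> \<Gamma> \<Longrightarrow> ext \<gamma> \<in> stable_automorphisms Y U"
proof -
  assume g: "\<gamma> \<in> \<Gamma>"
  have gi: "inv\<^bsub>A\<^esub> \<gamma> \<in> \<Gamma>" by (rule subgroup.m_inv_closed[OF \<Gamma>_sub g])
  have e1: "ext \<gamma> (ext (inv\<^bsub>A\<^esub> \<gamma>) y) = y" "ext (inv\<^bsub>A\<^esub> \<gamma>) (ext \<gamma> y) = y" if "y \<in> carrier Y" for y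
    using ext_comp[OF g gi that] ext_comp[OF gi g that] ext_one[OF that] \<Gamma>_A[OF g] by simp_all
  have "bij_betw (ext \<gamma>) (carrier Y) (carrier Y)"
    by (rule bij_betw_byWitness[where f' = "ext (inv\<^bsub>A\<^esub> \<gamma>)"]) (use e1 ext_closed[OF g] ext_closed[OF gi] in auto)
  moreover have "ext \<gamma> \<in> hom Y Y"
  proof (rule homI[OF ext_closed[OF g]])
    fix x y assume "x \<in> carrier Y" "y \<in> carrier Y"
    then obtain h k h' k' where x: "h \<in> carrier G" "k \<in> K" "x = a h \<otimes>\<^bsub>Y\<^esub> b k"
      and y: "h' \<in> carrier G" "k' \<in> K" "y = a h' \<otimes>\<^bsub>Y\<^esub> b k'" using Y_surj by meson
    have hk: "h \<otimes>\<^bsub>G\<^esub> k h' \<in> carrier G" using x(1) K_closed[OF x(2) y(1)] by simp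
    show "ext \<gamma> (x \<otimes>\<^bsub>Y\<^esub> y) = ext \<gamma> x \<otimes>\<^bsub>Y\<^esub> ext \<gamma> y"
      unfolding x(3) y(3) ab_mult[OF x(1,2) y(1,2)] ext_ab[OF g x(1,2)] ext_ab[OF g y(1,2)]
        ext_ab[OF g hk K_mult[OF x(2) y(2)]] ext_prod[OF g x(1,2) y(1,2)] ..
  qed
  moreover have "ext \<gamma> ` U = U"
  proof -
    have "ext \<gamma> ` U = a ` \<gamma> ` T"
      unfolding image_image using ext_a[OF g] subgroup.mem_carrier[OF G.T_sub] by (intro image_cong) auto
    also have "\<gamma> ` T = T" using \<Gamma>_stable[OF g] by (simp add: G.stable_def)
    finally show ?thesis .
  qed
  moreover have "ext \<gamma> \<in> extensional (carrier Y)" by (simp add: ext_def)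
  ultimately show ?thesis by (simp add: Y.stable_automorphisms_iff Y.stable_def iso_def)
qed

lemma ext_kernel:
  assumes "\<kappa> \<in> K" "y \<in> carrier Y"
  shows "ext \<kappa> y = conj_by Y (b \<kappa>) y"
proof -
  obtain h k where hk: "h \<in> carrier G" "k \<in> K" "y = a h \<otimes>\<^bsub>Y\<^esub> b k" using Y_surj[OF assms(2)] by blast
  have c: "a h \<in> carrier Y" "b k \<in> carrier Y" "b \<kappa> \<in> carrier Y" "a (\<kappa> h) \<in> carrier Y"
    using hk assms b_closed K_closed by auto
  have "conj_by Y (b \<kappa>) y = (b \<kappa> \<otimes>\<^bsub>Y\<^esub> a h) \<otimes>\<^bsub>Y\<^esub> (b k \<otimes>\<^bsub>Y\<^esub> inv\<^bsub>Y\<^esub> b \<kappa>)"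
    unfolding hk(3) conj_by_def using c by (simp add: Y.m_assoc)
  also have "\<dots> = a (\<kappa> h) \<otimes>\<^bsub>Y\<^esub> (b \<kappa> \<otimes>\<^bsub>Y\<^esub> b k \<otimes>\<^bsub>Y\<^esub> b (inv\<^bsub>A\<^esub> \<kappa>))"
    unfolding b_a[OF assms(1) hk(1)] b_inv[OF assms(1)] using c by (simp add: Y.m_assoc)
  also have "b \<kappa> \<otimes>\<^bsub>Y\<^esub> b k \<otimes>\<^bsub>Y\<^esub> b (inv\<^bsub>A\<^esub> \<kappa>) = b (conj_by A \<kappa> k)"
    unfolding conj_by_def using b_mult assms(1) hk(2) K_mult K_inv by simp
  finally show ?thesis unfolding hk(3) using ext_ab[OF K_\<Gamma>[OF assms(1)] hk(1,2)] by simp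
qed

text \<open>Here the division by the normal subgroup is used. Both sides agree on the image of \<open>G\<close>. On
  \<open>b k\<close> they differ by \<open>a u\<close> against \<open>b k' (b k)\<inverse>\<close>, where \<open>u = g k(g\<inverse>)\<close> and \<open>k'\<close> is the conjugate of \<open>k\<close>. These
  two elements conjugate \<open>G\<close> in the same way, and \<open>u\<close> lies in \<open>Core T\<close> because \<open>k\<close> preserves the class of
  \<open>g\<inverse>\<close>, an automorphism of \<open>T\<close> in the linking system. So they coincide in \<open>Y\<close>.\<close>

lemma ext_inner:
  assumes g: "g \<in> normalizer_in G T" and y: "y \<in> carrier Y"
  shows "ext (restrict (conj_by G g) (carrier G)) y = conj_by Y (a g) y"
proof -
  obtain h k where hk: "h \<in> carrier G" "k \<in> K" "y = a h \<otimes>\<^bsub>Y\<^esub> b k" using Y_surj[OF y] by blast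
  define c where "c = restrict (conj_by G g) (carrier G)"
  have c: "c \<in> \<Gamma>" unfolding c_def by (rule \<Gamma>_inner[OF g])
  have gc: "g \<in> carrier G" using g by (simp add: normalizer_in_def)
  define k' where "k' = conj_by A c k"
  have k': "k' \<in> K" unfolding k'_def by (rule K_conj[OF c hk(2)])
  have kgi: "k (inv\<^bsub>G\<^esub> g) \<in> carrier G" by (rule K_closed[OF hk(2) G.inv_closed[OF gc]])
  define u where "u = g \<otimes>\<^bsub>G\<^esub> k (inv\<^bsub>G\<^esub> g)"
  have uc: "u \<in> carrier G" unfolding u_def using gc kgi by simp
  have ks: "G.stable k" by (rule K_stable[OF hk(2)])
  have "inv\<^bsub>G\<^esub> g \<in> normalizer_in G T" by (rule subgroup.m_inv_closed[OF G.normalizer_subgroup g])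
  then have "inv\<^bsub>G\<^esub> g \<in> transporter G T T" by (simp add: normalizer_in_def transporter_def)
  then have "k (inv\<^bsub>G\<^esub> g) \<in> G.\<delta> T (inv\<^bsub>G\<^esub> g)"
    by (rule G.kernel_fixes(3)[OF ks K_ind[OF hk(2)] G.T_Ob G.T_Ob])
  then have uO: "u \<in> G.Core T"
    unfolding u_def using G.delta_mem_iff[OF G.T_Ob G.inv_closed[OF gc] kgi] gc by simp
  have uinv: "inv\<^bsub>G\<^esub> u = k g \<otimes>\<^bsub>G\<^esub> inv\<^bsub>G\<^esub> g"
    unfolding u_def using gc kgi G.stable_inv[OF ks gc] K_closed[OF hk(2) gc] by (simp add: G.inv_mult_group)
  have "a u \<otimes>\<^bsub>Y\<^esub> b (k \<otimes>\<^bsub>A\<^esub> inv\<^bsub>A\<^esub> k') = \<one>\<^bsub>Y\<^esub>"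
    unfolding ab_one_iff[OF uc K_mult[OF hk(2) K_inv[OF k']]]
  proof (intro conjI ballI uO)
    fix x assume x: "x \<in> carrier G"
    define z where "z = (inv\<^bsub>A\<^esub> k') x"
    have z: "z \<in> carrier G" unfolding z_def by (rule K_closed[OF K_inv[OF k'] x])
    have kz: "k z \<in> carrier G" by (rule K_closed[OF hk(2) z])
    have "x = k' z" unfolding z_def using G.AutoGroup_inv(1)[OF K_A[OF k'] x] by simp
    also have "z = c (conj_by G (inv\<^bsub>G\<^esub> g) z)" using gc z by (simp add: c_def)
    also have "k' \<dots> = c (k (conj_by G (inv\<^bsub>G\<^esub> g) z))"
      unfolding k'_def by (rule conj_by_A_apply[OF \<Gamma>_A[OF c] K_A[OF hk(2)]]) (use gc z in simp)
    also have "\<dots> = conj_by G g (conj_by G (k (inv\<^bsub>G\<^esub> g)) (k z))"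
      using G.stable_conj[OF ks G.inv_closed[OF gc] z] kgi kz by (simp add: c_def)
    also have "\<dots> = conj_by G u (k z)" unfolding u_def by (rule G.conj_by_conj_by[OF gc kgi kz])
    finally have "x = conj_by G u (k z)" .
    then have "x \<otimes>\<^bsub>G\<^esub> u = u \<otimes>\<^bsub>G\<^esub> k z" using uc kz by (simp add: conj_by_def G.m_assoc)
    then show "u \<otimes>\<^bsub>G\<^esub> (k \<otimes>\<^bsub>A\<^esub> inv\<^bsub>A\<^esub> k') x = x \<otimes>\<^bsub>G\<^esub> u"
      unfolding G.A_mult_apply[OF K_A[OF hk(2)] K_A[OF K_inv[OF k']] x] z_def by simp
  qed
  then have "(a u \<otimes>\<^bsub>Y\<^esub> b k) \<otimes>\<^bsub>Y\<^esub> inv\<^bsub>Y\<^esub> b k' = \<one>\<^bsub>Y\<^esub>"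
    using b_mult[OF hk(2) K_inv[OF k']] b_inv[OF k'] uc b_closed[OF hk(2)] b_closed[OF k'] by (simp add: Y.m_assoc)
  then have aub: "a u \<otimes>\<^bsub>Y\<^esub> b k = b k'"
    using Y.inv_solve_right'[of "\<one>\<^bsub>Y\<^esub>" "a u \<otimes>\<^bsub>Y\<^esub> b k" "b k'"] uc b_closed[OF hk(2)] b_closed[OF k'] by simp
  have cl: "a h \<in> carrier Y" "a g \<in> carrier Y" "b k \<in> carrier Y" "a (k (inv\<^bsub>G\<^esub> g)) \<in> carrier Y"
    using hk gc kgi b_closed by auto
  have "conj_by Y (a g) y = a g \<otimes>\<^bsub>Y\<^esub> a h \<otimes>\<^bsub>Y\<^esub> (b k \<otimes>\<^bsub>Y\<^esub> a (inv\<^bsub>G\<^esub> g))"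
    unfolding hk(3) conj_by_def using cl gc by (simp add: Y.m_assoc)
  also have "b k \<otimes>\<^bsub>Y\<^esub> a (inv\<^bsub>G\<^esub> g) = inv\<^bsub>Y\<^esub> a g \<otimes>\<^bsub>Y\<^esub> (a u \<otimes>\<^bsub>Y\<^esub> b k)"
    unfolding b_a[OF hk(2) G.inv_closed[OF gc]] u_def using cl gc kgi by (simp add: Y.m_assoc)
  also have "a g \<otimes>\<^bsub>Y\<^esub> a h \<otimes>\<^bsub>Y\<^esub> (inv\<^bsub>Y\<^esub> a g \<otimes>\<^bsub>Y\<^esub> (a u \<otimes>\<^bsub>Y\<^esub> b k)) = a (c h) \<otimes>\<^bsub>Y\<^esub> b k'"
    unfolding aub using cl hk(1) gc b_closed[OF k'] by (simp add: c_def conj_by_def Y.m_assoc)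
  finally show ?thesis
    unfolding c_def[symmetric] hk(3) ext_ab[OF c hk(1,2)] k'_def by simp
qed

text \<open>An element of the normalizer of \<open>U\<close> is \<open>a h \<cdot> b k\<close> with \<open>h\<close> in the normalizer of \<open>T\<close>, and both factors
  conjugate \<open>Y\<close> by extensions of elements of \<open>\<Gamma>\<close>.\<close>

lemma normalizer_U:
  assumes "y \<in> normalizer_in Y U"
  shows "\<exists>\<nu>\<in>\<Gamma>. \<forall>x\<in>carrier Y. ext \<nu> x = conj_by Y y x"
proof -
  have y: "y \<in> carrier Y" "conj_by Y y ` U = U" using assms by (auto simp: normalizer_in_def)
  obtain h k where hk: "h \<in> carrier G" "k \<in> K" "y = a h \<otimes>\<^bsub>Y\<^esub> b k" using Y_surj[OF y(1)] by blast
  have "conj_by G h ` T \<subseteq> T"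
  proof clarify
    fix t assume t: "t \<in> T"
    have tc: "t \<in> carrier G" using t subgroup.mem_carrier[OF G.T_sub] by blast
    have "conj_by Y y (a t) \<in> U" using y(2) t by blast
    then obtain s where s: "s \<in> T" "conj_by Y y (a t) = a s" by blast
    then have "conj_by Y (a h) (a t) = a s"
      using conj_Y_T[OF hk(1,2) t] hk(3) cmp.\<phi>_conj[OF hk(1) tc] by simp
    then have "conj_by G h t = s" by (rule cmp.conj_eqI[OF hk(1) t s(1)])
    then show "conj_by G h t \<in> T" using s(1) by simp
  qed
  then have "conj_by G h ` T = T"
    using G.card_conj_by_image[OF hk(1) subgroup.subset[OF G.T_sub]]
      finite_subset[OF subgroup.subset[OF G.T_sub] G.fin] by (simp add: card_subset_eq)
  then have hN: "h \<in> normalizer_in G T" using hk(1) by (simp add: normalizer_in_def)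
  let ?c = "restrict (conj_by G h) (carrier G)"
  have "ext (?c \<otimes>\<^bsub>A\<^esub> k) x = conj_by Y y x" if x: "x \<in> carrier Y" for x
  proof -
    have bx: "conj_by Y (b k) x \<in> carrier Y" using b_closed[OF hk(2)] x by simp
    have "ext (?c \<otimes>\<^bsub>A\<^esub> k) x = conj_by Y (a h) (conj_by Y (b k) x)"
      unfolding ext_comp[OF \<Gamma>_inner[OF hN] K_\<Gamma>[OF hk(2)] x] ext_kernel[OF hk(2) x] by (rule ext_inner[OF hN bx])
    also have "\<dots> = conj_by Y y x" unfolding hk(3) using hk(1) b_closed[OF hk(2)] x by (simp add: Y.conj_by_conj_by)
    finally show ?thesis .
  qed
  moreover have "?c \<otimes>\<^bsub>A\<^esub> k \<in> \<Gamma>" by (rule subgroup.m_closed[OF \<Gamma>_sub \<Gamma>_inner[OF hN] K_\<Gamma>[OF hk(2)]])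
  ultimately show ?thesis by blast
qed

abbreviation "InnL \<equiv> InnLink p Y U"
abbreviation "AL \<equiv> AutLink p Y U"
abbreviation "AY \<equiv> AutoGroup Y"
abbreviation "out_class \<gamma> \<equiv> InnL #>\<^bsub>AL\<^esub> Y.ind (ext \<gamma>)"

lemma ext_Y_stable: "\<gamma> \<in> \<Gamma> \<Longrightarrow> Y.stable (ext \<gamma>)" and ext_AY: "\<gamma> \<in> \<Gamma> \<Longrightarrow> ext \<gamma> \<in> carrier AY"
  using ext_stable Y.A_stable Y.A_carrier by auto

lemma ext_ind_eq_iff:
  assumes "\<gamma> \<in> \<Gamma>" "\<gamma>' \<in> \<Gamma>"
  shows "Y.ind (ext \<gamma>) = Y.ind (ext \<gamma>') \<longleftrightarrow> G.ind \<gamma> = G.ind \<gamma>'"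
  by (rule cmp.ind_eq_iff[OF ext_Y_stable[OF assms(1)] \<Gamma>_stable[OF assms(1)] _ ext_Y_stable[OF assms(2)] \<Gamma>_stable[OF assms(2)]])
    (simp_all add: ext_a assms)

lemma AutLink_Y:
  assumes "B \<in> carrier AL"
  shows "\<exists>\<gamma>\<in>\<Gamma>. B = Y.ind (ext \<gamma>)"
proof -
  obtain \<gamma> where g: "\<gamma> \<in> \<Gamma>" "cmp.rt B = G.ind \<gamma>" using \<Gamma>_lift[OF cmp.rt_AutLink[OF assms]] by blast
  have "B = Y.ind (ext \<gamma>)"
    by (rule cmp.AutLink_eq_ind_G[OF assms g(2) ext_Y_stable[OF g(1)] \<Gamma>_stable[OF g(1)]]) (simp add: ext_a g(1))
  then show ?thesis using g(1) by blast
qed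

lemma OutLink_Y:
  assumes "X \<in> carrier (OutLink p Y U)"
  shows "\<exists>\<gamma>\<in>\<Gamma>. X = out_class \<gamma>"
proof -
  obtain B where "B \<in> carrier AL" "X = InnL #>\<^bsub>AL\<^esub> B"
    using assms by (auto simp: OutLink_def carrier_FactGroup)
  then show ?thesis using AutLink_Y by blast
qed

lemma out_class_mult:
  assumes "\<gamma> \<in> \<Gamma>" "\<gamma>' \<in> \<Gamma>"
  shows "out_class \<gamma> <#>\<^bsub>AL\<^esub> out_class \<gamma>' = out_class (\<gamma> \<otimes>\<^bsub>A\<^esub> \<gamma>')"
proof -
  have "Y.ind (ext \<gamma> \<circ> ext \<gamma>') = Y.ind (ext (\<gamma> \<otimes>\<^bsub>A\<^esub> \<gamma>'))"
    by (rule Y.ind_cong) (simp add: ext_comp[OF assms])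
  then show ?thesis using Y.InnLink_coset_mult[OF ext_Y_stable[OF assms(1)] ext_Y_stable[OF assms(2)]] by simp
qed

text \<open>If the functors induced by the extensions of \<open>\<gamma>\<close> and \<open>\<delta>\<close> agree modulo \<open>InnLink\<close>, then \<open>\<gamma>\<close> is a product of an
  element of \<open>K\<close>, an element \<open>\<nu>\<close> extending to an inner automorphism, and \<open>\<delta>\<close>. As the elements of \<open>K\<close> extend
  to inner automorphisms too, the outer classes agree.\<close>

lemma outer_class_determined:
  assumes "\<gamma> \<in> \<Gamma>" "\<delta> \<in> \<Gamma>" "out_class \<gamma> = out_class \<delta>"
  shows "inner_automorphisms Y #>\<^bsub>AY\<^esub> ext \<gamma> = inner_automorphisms Y #>\<^bsub>AY\<^esub> ext \<delta>"
proof -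
  interpret \<Gamma>: subgroup \<Gamma> A by (rule \<Gamma>_sub)
  have "Y.ind (ext \<gamma>) \<in> out_class \<gamma>"
  proof -
    have "Y.ind (conj_by Y \<one>\<^bsub>Y\<^esub> \<circ> ext \<gamma>) = Y.ind (ext \<gamma>)"
      by (rule Y.ind_cong) (simp add: ext_closed[OF assms(1)])
    then show ?thesis unfolding Y.InnLink_coset[OF ext_Y_stable[OF assms(1)]]
      by (rule image_eqI[OF sym subgroup.one_closed[OF Y.normalizer_subgroup]])
  qed
  then have "Y.ind (ext \<gamma>) \<in> out_class \<delta>" unfolding assms(3) .
  then obtain y where y: "y \<in> normalizer_in Y U" "Y.ind (ext \<gamma>) = Y.ind (conj_by Y y \<circ> ext \<delta>)"
    unfolding Y.InnLink_coset[OF ext_Y_stable[OF assms(2)]] by (elim imageE)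
  have yc: "y \<in> carrier Y" using y(1) unfolding normalizer_in_def by blast
  obtain \<nu> where \<nu>: "\<nu> \<in> \<Gamma>" "\<And>x. x \<in> carrier Y \<Longrightarrow> ext \<nu> x = conj_by Y y x" using normalizer_U[OF y(1)] by blast
  define \<mu> where "\<mu> = \<nu> \<otimes>\<^bsub>A\<^esub> \<delta>"
  have \<mu>: "\<mu> \<in> \<Gamma>" unfolding \<mu>_def by (rule \<Gamma>.m_closed[OF \<nu>(1) assms(2)])
  have \<mu>i: "inv\<^bsub>A\<^esub> \<mu> \<in> \<Gamma>" by (rule \<Gamma>.m_inv_closed[OF \<mu>])
  have ext\<mu>: "ext \<mu> x = conj_by Y y (ext \<delta> x)" if "x \<in> carrier Y" for x
    unfolding \<mu>_def ext_comp[OF \<nu>(1) assms(2) that] by (rule \<nu>(2)[OF ext_closed[OF assms(2) that]])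
  have "Y.ind (ext \<mu>) = Y.ind (conj_by Y y \<circ> ext \<delta>)" by (rule Y.ind_cong) (simp add: ext\<mu>)
  then have eq: "G.ind \<gamma> = G.ind \<mu>" using ext_ind_eq_iff[OF assms(1) \<mu>] y(2) by simp
  define \<kappa> where "\<kappa> = \<gamma> \<otimes>\<^bsub>A\<^esub> inv\<^bsub>A\<^esub> \<mu>"
  have s: "\<gamma> \<in> stable_automorphisms G T" "\<mu> \<in> stable_automorphisms G T" "inv\<^bsub>A\<^esub> \<mu> \<in> stable_automorphisms G T"
    using assms(1) \<mu> \<mu>i \<Gamma>_stable_aut by auto
  have "G.ind \<kappa> = comp_functor G.L (G.ind \<mu>) (G.ind (inv\<^bsub>A\<^esub> \<mu>))" unfolding \<kappa>_def G.ind_mult[OF s(1,3)] eq ..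
  also have "\<dots> = G.ind (\<mu> \<otimes>\<^bsub>A\<^esub> inv\<^bsub>A\<^esub> \<mu>)" using G.ind_mult[OF s(2,3)] by simp
  also have "\<dots> = id_functor G.L" using A.r_inv[OF \<Gamma>_A[OF \<mu>]] G.ind_one by simp
  finally have \<kappa>: "\<kappa> \<in> K" using \<Gamma>.m_closed[OF assms(1) \<mu>i] unfolding \<kappa>_def by (simp add: link_kernel_def)
  have \<gamma>: "\<gamma> = \<kappa> \<otimes>\<^bsub>A\<^esub> \<mu>" unfolding \<kappa>_def using \<Gamma>_A[OF assms(1)] \<Gamma>_A[OF \<mu>] by (simp add: A.m_assoc)
  define v where "v = b \<kappa> \<otimes>\<^bsub>Y\<^esub> y"
  have v: "v \<in> carrier Y" unfolding v_def using b_closed[OF \<kappa>] yc by simp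
  have "ext \<gamma> = Y.inner_aut v \<otimes>\<^bsub>AY\<^esub> ext \<delta>"
  proof (rule Y.A_eqI[OF ext_AY[OF assms(1)] Y.A_mult_closed[OF Y.inner_A[OF v] ext_AY[OF assms(2)]]])
    fix x assume x: "x \<in> carrier Y"
    have ex: "ext \<delta> x \<in> carrier Y" by (rule ext_closed[OF assms(2) x])
    have "ext \<gamma> x = conj_by Y (b \<kappa>) (conj_by Y y (ext \<delta> x))"
      unfolding \<gamma> ext_comp[OF K_\<Gamma>[OF \<kappa>] \<mu> x] ext\<mu>[OF x] by (rule ext_kernel[OF \<kappa>]) (use yc ex in simp)
    also have "\<dots> = conj_by Y v (ext \<delta> x)"
      unfolding v_def by (rule Y.conj_by_conj_by[OF b_closed[OF \<kappa>] yc ex])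
    also have "\<dots> = (Y.inner_aut v \<otimes>\<^bsub>AY\<^esub> ext \<delta>) x"
      unfolding Y.A_mult_apply[OF Y.inner_A[OF v] ext_AY[OF assms(2)] x] Y.inner_apply[OF ex] ..
    finally show "ext \<gamma> x = (Y.inner_aut v \<otimes>\<^bsub>AY\<^esub> ext \<delta>) x" .
  qed
  then show ?thesis using Y.inner_coset_eqI[OF ext_AY[OF assms(2)] v] by simp
qed

text \<open>The section maps the class of the functor induced by the extension of \<open>\<gamma>\<close> to the outer class
  of that extension.\<close>

theorem kappa_split: "kappa_split_surjective p Y U"
proof -
  define ch where "ch X = (SOME \<gamma>. \<gamma> \<in> \<Gamma> \<and> X = out_class \<gamma>)" for X
  have ch: "ch X \<in> \<Gamma>" "X = out_class (ch X)" if "X \<in> carrier (OutLink p Y U)" for X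
    using someI_ex[of "\<lambda>\<gamma>. \<gamma> \<in> \<Gamma> \<and> X = out_class \<gamma>"] OutLink_Y[OF that] unfolding ch_def by auto
  define s where "s X = inner_automorphisms Y #>\<^bsub>AY\<^esub> ext (ch X)" for X
  have sC: "s X \<in> carrier (OutGroup Y)" if "X \<in> carrier (OutLink p Y U)" for X
    unfolding s_def OutGroup_def carrier_FactGroup using ext_AY[OF ch(1)[OF that]] by (rule imageI)
  have mult: "monoid.mult (OutLink p Y U) = set_mult AL" by (simp add: OutLink_def)
  have "s \<in> hom (OutLink p Y U) (OutGroup Y)"
  proof (rule homI[OF sC])
    fix X Z assume X: "X \<in> carrier (OutLink p Y U)" and Z: "Z \<in> carrier (OutLink p Y U)"
    interpret N: normal "inner_automorphisms Y" AY by (rule Y.inner_automorphisms_normal)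
    have g: "ch X \<otimes>\<^bsub>A\<^esub> ch Z \<in> \<Gamma>" by (rule subgroup.m_closed[OF \<Gamma>_sub ch(1)[OF X] ch(1)[OF Z]])
    have XZ: "X \<otimes>\<^bsub>OutLink p Y U\<^esub> Z = out_class (ch X \<otimes>\<^bsub>A\<^esub> ch Z)"
      unfolding mult using out_class_mult[OF ch(1)[OF X] ch(1)[OF Z]] ch(2)[OF X] ch(2)[OF Z] by simp
    have ex: "\<exists>\<gamma>. \<gamma> \<in> \<Gamma> \<and> X \<otimes>\<^bsub>OutLink p Y U\<^esub> Z = out_class \<gamma>" using XZ g by blast
    have c: "ch (X \<otimes>\<^bsub>OutLink p Y U\<^esub> Z) \<in> \<Gamma>" "X \<otimes>\<^bsub>OutLink p Y U\<^esub> Z = out_class (ch (X \<otimes>\<^bsub>OutLink p Y U\<^esub> Z))"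
      using someI_ex[OF ex] unfolding ch_def[symmetric] by auto
    have eq: "ext (ch X \<otimes>\<^bsub>A\<^esub> ch Z) = ext (ch X) \<otimes>\<^bsub>AY\<^esub> ext (ch Z)"
    proof (rule Y.A_eqI[OF ext_AY[OF g] Y.A_mult_closed[OF ext_AY[OF ch(1)[OF X]] ext_AY[OF ch(1)[OF Z]]]])
      fix x assume x: "x \<in> carrier Y"
      show "ext (ch X \<otimes>\<^bsub>A\<^esub> ch Z) x = (ext (ch X) \<otimes>\<^bsub>AY\<^esub> ext (ch Z)) x"
        unfolding ext_comp[OF ch(1)[OF X] ch(1)[OF Z] x]
          Y.A_mult_apply[OF ext_AY[OF ch(1)[OF X]] ext_AY[OF ch(1)[OF Z]] x] ..
    qed
    have "s (X \<otimes>\<^bsub>OutLink p Y U\<^esub> Z) = inner_automorphisms Y #>\<^bsub>AY\<^esub> ext (ch X \<otimes>\<^bsub>A\<^esub> ch Z)"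
      unfolding s_def by (rule outer_class_determined[OF c(1) g]) (use c(2) XZ in simp)
    also have "\<dots> = s X <#>\<^bsub>AY\<^esub> s Z"
      unfolding eq s_def by (rule N.rcos_sum[OF ext_AY[OF ch(1)[OF X]] ext_AY[OF ch(1)[OF Z]], symmetric])
    finally show "s (X \<otimes>\<^bsub>OutLink p Y U\<^esub> Z) = s X \<otimes>\<^bsub>OutGroup Y\<^esub> s Z" by (simp add: OutGroup_def)
  qed
  moreover have "kappa p Y U (s X) = X" if "X \<in> carrier (OutLink p Y U)" for X
    unfolding s_def using Y.kappa_coset[OF ext_stable[OF ch(1)[OF that]]] ch(2)[OF that] by simp
  ultimately show ?thesis unfolding kappa_split_surjective_def by blast
qed

end

section \<open>Construction of the extension\<close>

definition semidirect ::
    "('a, 'm) monoid_scheme \<Rightarrow> ('a \<Rightarrow> 'a) set \<Rightarrow> ('a \<times> ('a \<Rightarrow> 'a)) monoid" where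
  "semidirect G K = \<lparr>carrier = carrier G \<times> K,
     monoid.mult = (\<lambda>(g, k) (h, l). (g \<otimes>\<^bsub>G\<^esub> k h, k \<otimes>\<^bsub>AutoGroup G\<^esub> l)),
     one = (\<one>\<^bsub>G\<^esub>, \<one>\<^bsub>AutoGroup G\<^esub>)\<rparr>"

lemma semidirect_simps [simp]:
  "carrier (semidirect G K) = carrier G \<times> K"
  "(g, k) \<otimes>\<^bsub>semidirect G K\<^esub> (h, l) = (g \<otimes>\<^bsub>G\<^esub> k h, k \<otimes>\<^bsub>AutoGroup G\<^esub> l)"
  "\<one>\<^bsub>semidirect G K\<^esub> = (\<one>\<^bsub>G\<^esub>, \<one>\<^bsub>AutoGroup G\<^esub>)"
  by (simp_all add: semidirect_def)

lemma (in group) nat_copy: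
  assumes "finite (carrier G)"
  shows "\<exists>(Y :: nat monoid) \<theta>. group Y \<and> \<theta> \<in> iso G Y"
proof -
  obtain e :: "'a \<Rightarrow> nat" where e: "inj_on e (carrier G)"
    using finite_imp_inj_to_nat_seg[OF assms] by blast
  define Y :: "nat monoid" where
    "Y = \<lparr>carrier = e ` carrier G,
      monoid.mult = (\<lambda>x y. e (inv_into (carrier G) e x \<otimes> inv_into (carrier G) e y)), one = e \<one>\<rparr>"
  have iso: "e \<in> iso G Y"
  proof (rule isoI)
    show "e \<in> hom G Y" by (rule homI) (auto simp: Y_def inv_into_f_f[OF e])
    show "bij_betw e (carrier G) (carrier Y)" using e by (simp add: Y_def bij_betw_def)
  qed
  have "group (Y\<lparr>one := e \<one>\<rparr>)" by (rule iso_imp_img_group[OF iso])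
  then have "group Y" by (simp add: Y_def)
  then show ?thesis using iso by blast
qed

context sylow_pair
begin

lemma semidirect_group:
  assumes "subgroup K A"
  shows "group (semidirect G K)"
proof (rule groupI)
  interpret A: group A by (rule A_group)
  have KA: "k \<in> carrier A" if "k \<in> K" for k using subgroup.mem_carrier[OF assms that] .
  have cl: "k x \<in> carrier G" if "k \<in> K" "x \<in> carrier G" for k x using A_closed[OF KA[OF that(1)] that(2)] .
  have hom: "k (x \<otimes> y) = k x \<otimes> k y" if "k \<in> K" "x \<in> carrier G" "y \<in> carrier G" for k x y
    using KA[OF that(1)] that(2,3) by (simp add: AutoGroup_carrier iso_def hom_def)
  note m = subgroup.m_closed[OF assms]
  show "\<one>\<^bsub>semidirect G K\<^esub> \<in> carrier (semidirect G K)" using subgroup.one_closed[OF assms] by simp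
  fix x assume "x \<in> carrier (semidirect G K)"
  then obtain g k where x: "x = (g, k)" "g \<in> carrier G" "k \<in> K" by auto
  have one_app: "\<one>\<^bsub>A\<^esub> y = y" if "y \<in> carrier G" for y using that by (simp add: AutoGroup_one)
  show "\<one>\<^bsub>semidirect G K\<^esub> \<otimes>\<^bsub>semidirect G K\<^esub> x = x"
    unfolding x(1) using x(2) KA[OF x(3)] one_app by simp
  have ki: "inv\<^bsub>A\<^esub> k \<in> K" by (rule subgroup.m_inv_closed[OF assms x(3)])
  have "((inv\<^bsub>A\<^esub> k) (inv g), inv\<^bsub>A\<^esub> k) \<otimes>\<^bsub>semidirect G K\<^esub> x = \<one>\<^bsub>semidirect G K\<^esub>"
  proof -
    have "(inv\<^bsub>A\<^esub> k) (inv g) \<otimes> (inv\<^bsub>A\<^esub> k) g = (inv\<^bsub>A\<^esub> k) \<one>"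
      using hom[OF ki, of "inv g" g] x(2) by simp
    also have "\<dots> = \<one>"
    proof -
      have "(inv\<^bsub>A\<^esub> k) \<one> \<otimes> (inv\<^bsub>A\<^esub> k) \<one> = (inv\<^bsub>A\<^esub> k) \<one>" using hom[OF ki, of \<one> \<one>] by simp
      then show ?thesis using cl[OF ki one_closed] by (simp add: l_cancel_one)
    qed
    finally show ?thesis unfolding x(1) using KA[OF x(3)] by simp
  qed
  moreover have "((inv\<^bsub>A\<^esub> k) (inv g), inv\<^bsub>A\<^esub> k) \<in> carrier (semidirect G K)" using cl[OF ki] ki x(2) by simp
  ultimately show "\<exists>y\<in>carrier (semidirect G K). y \<otimes>\<^bsub>semidirect G K\<^esub> x = \<one>\<^bsub>semidirect G K\<^esub>" by blast
  fix y assume "y \<in> carrier (semidirect G K)"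
  then obtain h l where y: "y = (h, l)" "h \<in> carrier G" "l \<in> K" by auto
  show "x \<otimes>\<^bsub>semidirect G K\<^esub> y \<in> carrier (semidirect G K)"
    unfolding x(1) y(1) using x(2) cl[OF x(3) y(2)] m[OF x(3) y(3)] by simp
  fix z assume "z \<in> carrier (semidirect G K)"
  then obtain u v where z: "z = (u, v)" "u \<in> carrier G" "v \<in> K" by auto
  show "x \<otimes>\<^bsub>semidirect G K\<^esub> y \<otimes>\<^bsub>semidirect G K\<^esub> z = x \<otimes>\<^bsub>semidirect G K\<^esub> (y \<otimes>\<^bsub>semidirect G K\<^esub> z)"
    unfolding x(1) y(1) z(1)
    using x(2) y(2) z(2) cl[OF x(3) y(2)] cl[OF y(3) z(2)] cl[OF x(3) cl[OF y(3) z(2)]]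
      A_mult_apply[OF KA[OF x(3)] KA[OF y(3)] z(2)] hom[OF x(3) y(2) cl[OF y(3) z(2)]]
      A.m_assoc[OF KA[OF x(3)] KA[OF y(3)] KA[OF z(3)]]
    by (simp add: m_assoc)
qed

text \<open>The normal subgroup \<open>M\<close> is the intersection of the subgroup \<open>Core T \<times> K\<close> with the centralizer of \<open>G\<close>
  in the semidirect product. Conjugation with \<open>G\<close> fixes \<open>M\<close> pointwise, and elements of \<open>K\<close> normalize
  both groups.\<close>

lemma kernel_extension_exists:
  assumes \<Gamma>: "induces_link_automorphisms p G T \<Gamma>" and cop: "coprime (card (link_kernel p G T \<Gamma>)) p"
  shows "\<exists>(Y :: nat monoid) a b. kernel_extension G p T Y \<Gamma> a b"
proof -
  interpret A: group A by (rule A_group)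
  define K where "K = link_kernel p G T \<Gamma>"
  have \<Gamma>s: "subgroup \<Gamma> A" "\<Gamma> \<subseteq> stable_automorphisms G T" using \<Gamma> by (auto simp: induces_link_automorphisms_def)
  have Ks: "subgroup K A" unfolding K_def by (rule link_kernel_subgroup[OF \<Gamma>s])
  have KA: "k \<in> carrier A" if "k \<in> K" for k using subgroup.mem_carrier[OF Ks that] .
  have Kst: "stable k" if "k \<in> K" for k using that \<Gamma>s(2) A_stable by (auto simp: K_def link_kernel_def)
  have K1: "\<one>\<^bsub>A\<^esub> \<in> K" by (rule subgroup.one_closed[OF Ks])
  have cl: "k x \<in> carrier G" if "k \<in> K" "x \<in> carrier G" for k x using A_closed[OF KA[OF that(1)] that(2)] .
  have one_app: "\<one>\<^bsub>A\<^esub> y = y" if "y \<in> carrier G" for y using that by (simp add: AutoGroup_one)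
  define X where "X = semidirect G K"
  have gX: "group X" unfolding X_def by (rule semidirect_group[OF Ks])
  interpret X: group X by (rule gX)
  have cX: "carrier X = carrier G \<times> K" by (simp add: X_def)
  have mX: "(g, k) \<otimes>\<^bsub>X\<^esub> (h, l) = (g \<otimes> k h, k \<otimes>\<^bsub>A\<^esub> l)" for g k h l by (simp add: X_def)
  have oX: "\<one>\<^bsub>X\<^esub> = (\<one>, \<one>\<^bsub>A\<^esub>)" by (simp add: X_def)
  define G' where "G' = (\<lambda>g. (g, \<one>\<^bsub>A\<^esub>)) ` carrier G"
  have G'c: "G' \<subseteq> carrier X" using K1 by (auto simp: G'_def cX)
  have CX: "subgroup (centralizer_in X G') X" by (rule X.centralizer_in_subgroup[OF G'c])
  have OC: "Core T \<subseteq> carrier G" using Core_carrier[OF T_Ob] by blast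
  have kO: "k u \<in> Core T" if "k \<in> K" "u \<in> Core T" for k u
  proof -
    have "k ` T = T" using Kst[OF that(1)] by (simp add: stable_def)
    then show ?thesis using stable_Core[OF Kst[OF that(1)] T_Ob] that(2) by auto
  qed
  have OK: "subgroup (Core T \<times> K) X"
  proof (rule X.subgroupI)
    show "Core T \<times> K \<subseteq> carrier X" using OC by (auto simp: cX)
    show "Core T \<times> K \<noteq> {}" using K1 subgroup.one_closed[OF Core_subgroup(1)[OF T_Ob]] by blast
  next
    fix x y assume "x \<in> Core T \<times> K" "y \<in> Core T \<times> K"
    then obtain u k v l where x: "x = (u, k)" "u \<in> Core T" "k \<in> K" and y: "y = (v, l)" "v \<in> Core T" "l \<in> K" by blast
    show "x \<otimes>\<^bsub>X\<^esub> y \<in> Core T \<times> K"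
      unfolding x(1) y(1) mX
      using subgroup.m_closed[OF Core_subgroup(1)[OF T_Ob] x(2) kO[OF x(3) y(2)]] subgroup.m_closed[OF Ks x(3) y(3)] by simp
  next
    fix x assume "x \<in> Core T \<times> K"
    then obtain u k where x: "x = (u, k)" "u \<in> Core T" "k \<in> K" by blast
    have ki: "inv\<^bsub>A\<^esub> k \<in> K" by (rule subgroup.m_inv_closed[OF Ks x(3)])
    have ui: "inv u \<in> Core T" by (rule subgroup.m_inv_closed[OF Core_subgroup(1)[OF T_Ob] x(2)])
    have uc: "u \<in> carrier G" using x(2) OC by blast
    let ?y = "((inv\<^bsub>A\<^esub> k) (inv u), inv\<^bsub>A\<^esub> k)"
    have "x \<otimes>\<^bsub>X\<^esub> ?y = \<one>\<^bsub>X\<^esub>"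
      unfolding x(1) mX oX using AutoGroup_inv(1)[OF KA[OF x(3)] inv_closed[OF uc]] uc KA[OF x(3)] by simp
    moreover have "x \<in> carrier X" "?y \<in> carrier X" using x uc cl[OF ki] ki by (auto simp: cX)
    ultimately have "inv\<^bsub>X\<^esub> x = ?y" by (metis X.inv_equality X.inv_inv X.inv_closed)
    then show "inv\<^bsub>X\<^esub> x \<in> Core T \<times> K" using kO[OF ki ui] ki by simp
  qed
  define M where "M = (Core T \<times> K) \<inter> centralizer_in X G'"
  have Ms: "subgroup M X" unfolding M_def by (rule X.subgroups_Inter_pair[OF OK CX])
  have M_iff: "(u, k) \<in> M \<longleftrightarrow> u \<in> Core T \<and> (\<forall>x\<in>carrier G. u \<otimes> k x = x \<otimes> u)"
    if u: "u \<in> carrier G" and k: "k \<in> K" for u k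
  proof -
    have "(u, k) \<otimes>\<^bsub>X\<^esub> (x, \<one>\<^bsub>A\<^esub>) = (x, \<one>\<^bsub>A\<^esub>) \<otimes>\<^bsub>X\<^esub> (u, k) \<longleftrightarrow> u \<otimes> k x = x \<otimes> u" if "x \<in> carrier G" for x
      unfolding mX using that u KA[OF k] one_app[OF u] by simp
    then show ?thesis using u k by (auto simp: M_def centralizer_in_def G'_def cX)
  qed
  have M_normal: "M \<lhd> X"
  proof (rule X.normal_invI[OF Ms])
    fix x m assume x: "x \<in> carrier X" and m: "m \<in> M"
    obtain g k where gk: "x = (g, k)" "g \<in> carrier G" "k \<in> K" using x by (auto simp: cX)
    have mc: "m \<in> carrier X" by (rule subgroup.mem_carrier[OF Ms m])
    let ?g = "(g, \<one>\<^bsub>A\<^esub>)" and ?k = "(\<one>, k)"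
    have c: "?g \<in> carrier X" "?k \<in> carrier X" using gk K1 by (auto simp: cX)
    have x': "x = ?g \<otimes>\<^bsub>X\<^esub> ?k" unfolding gk(1) mX using gk(2) one_app[OF one_closed] KA[OF gk(3)] by simp
    have kG: "conj_by X ?k ` G' \<subseteq> G'"
    proof
      fix z assume "z \<in> conj_by X ?k ` G'"
      then obtain y where y: "y \<in> carrier G" "z = conj_by X ?k (y, \<one>\<^bsub>A\<^esub>)" by (auto simp: G'_def)
      have yc: "(y, \<one>\<^bsub>A\<^esub>) \<in> carrier X" "(k y, \<one>\<^bsub>A\<^esub>) \<in> carrier X" using y(1) cl[OF gk(3) y(1)] K1 by (auto simp: cX)
      have "?k \<otimes>\<^bsub>X\<^esub> (y, \<one>\<^bsub>A\<^esub>) = (k y, \<one>\<^bsub>A\<^esub>) \<otimes>\<^bsub>X\<^esub> ?k"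
        unfolding mX using y(1) cl[OF gk(3) y(1)] KA[OF gk(3)] one_app[OF one_closed] by simp
      then have "z = (k y, \<one>\<^bsub>A\<^esub>)" unfolding y(2) conj_by_def using c(2) yc by (simp add: X.m_assoc)
      then show "z \<in> G'" using cl[OF gk(3) y(1)] by (auto simp: G'_def)
    qed
    have kG': "conj_by X ?k ` G' = G'"
    proof (rule card_subset_eq[OF _ kG X.card_conj_by_image[OF c(2) G'c]])
      show "finite G'" unfolding G'_def using fin by simp
    qed
    define n where "n = conj_by X ?k m"
    have "?k \<in> Core T \<times> K" using gk(3) subgroup.one_closed[OF Core_subgroup(1)[OF T_Ob]] by simp
    then have n1: "n \<in> Core T \<times> K"
      unfolding n_def using X.conj_by_self_subgroup[OF OK, of ?k] m M_def by blast
    have n2: "n \<in> centralizer_in X G'"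
      unfolding n_def using X.centralizer_in_conj_by[OF G'c c(2), of m] m kG' by (simp add: M_def)
    have nc: "n \<in> carrier X" unfolding n_def using c(2) mc by simp
    have "?g \<in> G'" using gk(2) by (auto simp: G'_def)
    then have comm: "n \<otimes>\<^bsub>X\<^esub> ?g = ?g \<otimes>\<^bsub>X\<^esub> n" by (rule X.centralizer_inD[OF n2])
    have "x \<otimes>\<^bsub>X\<^esub> m \<otimes>\<^bsub>X\<^esub> inv\<^bsub>X\<^esub> x = conj_by X ?g n"
      using X.conj_by_conj_by[OF c mc] unfolding n_def x' conj_by_def by simp
    also have "\<dots> = n" using X.conj_by_eq_self_iff[OF c(1) nc] comm by simp
    finally show "x \<otimes>\<^bsub>X\<^esub> m \<otimes>\<^bsub>X\<^esub> inv\<^bsub>X\<^esub> x \<in> M" using n1 n2 by (simp add: M_def)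
  qed
  interpret M: normal M X by (rule M_normal)
  let ?Q = "X Mod M"
  have gQ: "group ?Q" by (rule M.factorgroup_is_group)
  have finX: "finite (carrier X)"
    unfolding cX using fin finite_subset[OF subgroup.subset[OF Ks] finite_AutoGroup] by simp
  have finQ: "finite (carrier ?Q)" unfolding carrier_FactGroup using finX by simp
  obtain Y :: "nat monoid" and \<theta> where Y: "group Y" "\<theta> \<in> iso ?Q Y" using group.nat_copy[OF gQ finQ] by blast
  interpret Y: group Y by (rule Y(1))
  define \<pi> where "\<pi> = \<theta> \<circ> (\<lambda>x. M #>\<^bsub>X\<^esub> x)"
  have \<theta>hom: "\<theta> \<in> hom ?Q Y" and \<theta>bij: "bij_betw \<theta> (carrier ?Q) (carrier Y)" using Y(2) by (auto simp: iso_def)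
  have \<pi>hom: "\<pi> \<in> hom X Y" unfolding \<pi>_def by (rule Group.hom_compose[OF M.r_coset_hom_Mod \<theta>hom])
  interpret \<pi>: group_hom X Y \<pi> by (simp add: group_hom_def group_hom_axioms_def gX Y(1) \<pi>hom)
  have \<pi>surj: "\<pi> ` carrier X = carrier Y"
  proof -
    have "\<pi> ` carrier X = \<theta> ` carrier ?Q" unfolding \<pi>_def carrier_FactGroup by (simp add: image_comp)
    then show ?thesis using \<theta>bij by (simp add: bij_betw_def)
  qed
  have \<pi>ker: "\<pi> x = \<one>\<^bsub>Y\<^esub> \<longleftrightarrow> x \<in> M" if x: "x \<in> carrier X" for x
  proof -
    have xQ: "M #>\<^bsub>X\<^esub> x \<in> carrier ?Q" using x by (auto simp: carrier_FactGroup)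
    have MQ: "M \<in> carrier ?Q" using monoid.one_closed[OF group.is_monoid[OF gQ]] by simp
    have "\<theta> M = \<one>\<^bsub>Y\<^esub>" using hom_one[OF \<theta>hom gQ Y(1)] by simp
    then have "\<pi> x = \<one>\<^bsub>Y\<^esub> \<longleftrightarrow> \<theta> (M #>\<^bsub>X\<^esub> x) = \<theta> M" unfolding \<pi>_def by simp
    also have "\<dots> \<longleftrightarrow> M #>\<^bsub>X\<^esub> x = M" by (rule inj_on_eq_iff[OF bij_betw_imp_inj_on[OF \<theta>bij] xQ MQ])
    also have "\<dots> \<longleftrightarrow> x \<in> M"
    proof
      assume "M #>\<^bsub>X\<^esub> x = M" then show "x \<in> M" using X.rcos_self[OF x Ms] by simp
    next
      assume "x \<in> M" then show "M #>\<^bsub>X\<^esub> x = M" by (rule X.coset_join2[OF x Ms])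
    qed
    finally show ?thesis .
  qed
  have cardY: "order Y * card M = order G * card K"
  proof -
    have "order Y = card (rcosets\<^bsub>X\<^esub> M)"
      using bij_betw_same_card[OF \<theta>bij] by (simp add: order_def FactGroup_def)
    then have "order Y * card M = order X" using X.lagrange[OF Ms] by simp
    also have "order X = order G * card K" by (simp add: order_def cX card_cartesian_product)
    finally show ?thesis .
  qed
  define a where "a h = \<pi> (h, \<one>\<^bsub>A\<^esub>)" for h
  define b where "b k = \<pi> (\<one>, k)" for k
  have hX: "(h, \<one>\<^bsub>A\<^esub>) \<in> carrier X" if "h \<in> carrier G" for h using that K1 by (simp add: cX)
  have kX: "(\<one>, k) \<in> carrier X" if "k \<in> K" for k using that by (simp add: cX)
  have ab: "a h \<otimes>\<^bsub>Y\<^esub> b k = \<pi> (h, k)" if "h \<in> carrier G" "k \<in> K" for h k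
    unfolding a_def b_def using \<pi>.hom_mult[OF hX[OF that(1)] kX[OF that(2)]] that KA[OF that(2)] one_app[OF one_closed]
    by (simp add: mX)
  have "kernel_extension G p T Y \<Gamma> a b"
  proof (intro kernel_extension.intro kernel_extension_axioms.intro)
    show "sylow_pair G p T" by (rule sylow_pair_axioms)
    show "group Y" by (rule Y(1))
    show "induces_link_automorphisms p G T \<Gamma>" by (rule \<Gamma>)
    show "coprime (card (link_kernel p G T \<Gamma>)) p" by (rule cop)
    show "finite (carrier Y)" using \<pi>surj finX by (metis finite_imageI)
    show "order Y dvd order G * card (link_kernel p G T \<Gamma>)" using cardY unfolding K_def by (metis dvd_triv_left)
    show "a \<in> hom G Y"
    proof (rule homI)
      fix h h' assume h: "h \<in> carrier G" "h' \<in> carrier G"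
      show "a (h \<otimes> h') = a h \<otimes>\<^bsub>Y\<^esub> a h'"
        unfolding a_def using \<pi>.hom_mult[OF hX[OF h(1)] hX[OF h(2)]] one_app[OF h(2)] by (simp add: mX)
    qed (simp add: a_def hX)
    show "b \<in> hom (AutoGroup G\<lparr>carrier := link_kernel p G T \<Gamma>\<rparr>) Y"
      unfolding K_def[symmetric]
    proof (rule homI)
      fix k l assume "k \<in> carrier (A\<lparr>carrier := K\<rparr>)" "l \<in> carrier (A\<lparr>carrier := K\<rparr>)"
      then have k: "k \<in> K" "l \<in> K" by auto
      show "b (k \<otimes>\<^bsub>A\<lparr>carrier := K\<rparr>\<^esub> l) = b k \<otimes>\<^bsub>Y\<^esub> b l"
        unfolding b_def using \<pi>.hom_mult[OF kX[OF k(1)] kX[OF k(2)]] stable_one[OF Kst[OF k(1)]] by (simp add: mX)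
    qed (simp add: b_def kX)
    show "\<exists>h\<in>carrier G. \<exists>k\<in>link_kernel p G T \<Gamma>. y = a h \<otimes>\<^bsub>Y\<^esub> b k" if y: "y \<in> carrier Y" for y
    proof -
      obtain x where "x \<in> carrier X" "y = \<pi> x" using y unfolding \<pi>surj[symmetric] by (elim imageE)
      then obtain h k where "h \<in> carrier G" "k \<in> K" "y = \<pi> (h, k)" by (auto simp: cX)
      then show ?thesis using ab unfolding K_def by metis
    qed
    show "b k \<otimes>\<^bsub>Y\<^esub> a h = a (k h) \<otimes>\<^bsub>Y\<^esub> b k" if "k \<in> link_kernel p G T \<Gamma>" "h \<in> carrier G" for k h
    proof -
      have k: "k \<in> K" using that(1) K_def by simp
      have "b k \<otimes>\<^bsub>Y\<^esub> a h = \<pi> (k h, k)"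
        unfolding a_def b_def using \<pi>.hom_mult[OF kX[OF k] hX[OF that(2)]] cl[OF k that(2)] KA[OF k] by (simp add: mX)
      then show ?thesis using ab[OF cl[OF k that(2)] k] by simp
    qed
    show "a h \<otimes>\<^bsub>Y\<^esub> b k = \<one>\<^bsub>Y\<^esub> \<longleftrightarrow> h \<in> Core T \<and> (\<forall>x\<in>carrier G. h \<otimes> k x = x \<otimes> h)"
      if "h \<in> carrier G" "k \<in> link_kernel p G T \<Gamma>" for h k
    proof -
      have k: "k \<in> K" using that(2) K_def by simp
      show ?thesis unfolding ab[OF that(1) k] using \<pi>ker[of "(h, k)"] M_iff[OF that(1) k] that(1) k by (simp add: cX)
    qed
  qed
  then show ?thesis by blast
qed

lemma stable_automorphisms_induce:
  assumes "kappa_surjective p G T"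
  shows "induces_link_automorphisms p G T (stable_automorphisms G T)"
  unfolding induces_link_automorphisms_def
  using stable_automorphisms_subgroup restrict_conj_by_stable AutLink_induced[OF assms] by blast

end

section \<open>Tameness\<close>

theorem proposition5p3:
  fixes p :: nat
    and S :: "'a monoid" and F :: "'a hom_system"
    and G :: "'b monoid" and T :: "'b set"
  assumes "prime p"
    and "fusion_system p S F" and "saturated p S F"
    and "group G" and "finite (carrier G)" and "sylow_subgroup p G T"
    and "fusion_isomorphic S F (G\<lparr>carrier := T\<rparr>) (conj_homs G)"
    and "kappa_surjective p G T"
  shows "tame p S F"
proof -
  interpret G: sylow_pair G p T
    using assms by (simp add: sylow_pair_def sylow_pair_axioms_def)
  obtain H \<Gamma> where H: "subgroup H G" "T \<subseteq> H"
    and fus: "fusion_isomorphism (G\<lparr>carrier := T\<rparr>) (conj_homs G) (G\<lparr>carrier := T\<rparr>)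
        (conj_homs (G\<lparr>carrier := H\<rparr>)) (\<lambda>x. x)"
    and \<Gamma>: "induces_link_automorphisms p (G\<lparr>carrier := H\<rparr>) T \<Gamma>"
    and cop: "coprime (card (link_kernel p (G\<lparr>carrier := H\<rparr>) T \<Gamma>)) p"
    using G.link_kernel_coprime_reduction[OF G.stable_automorphisms_induce[OF assms(8)]] by blast
  interpret H: sylow_pair "G\<lparr>carrier := H\<rparr>" p T
  proof (intro sylow_pair.intro sylow_pair_axioms.intro)
    show "group (G\<lparr>carrier := H\<rparr>)" by (rule subgroup.subgroup_is_group[OF H(1) assms(4)])
    show "finite (carrier (G\<lparr>carrier := H\<rparr>))" using finite_subset[OF subgroup.subset[OF H(1)] assms(5)] by simp
    show "sylow_subgroup p (G\<lparr>carrier := H\<rparr>) T"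
      by (rule G.sylow_subgroup_between[OF assms(1,5,6) H])
  qed (rule assms(1))
  obtain Y :: "nat monoid" and a b where "kernel_extension (G\<lparr>carrier := H\<rparr>) p T Y \<Gamma> a b"
    using H.kernel_extension_exists[OF \<Gamma> cop] by blast
  then interpret E: kernel_extension "G\<lparr>carrier := H\<rparr>" p T Y \<Gamma> a b .
  obtain \<phi> where \<phi>: "fusion_isomorphism S F (G\<lparr>carrier := T\<rparr>) (conj_homs G) \<phi>"
    using assms(7) unfolding fusion_isomorphic_def by blast
  have gS: "group S" using assms(2) by (simp add: fusion_system_def finite_p_group_def)
  have gT: "group (G\<lparr>carrier := T\<rparr>)" by (rule subgroup.subgroup_is_group[OF G.T_sub assms(4)])
  have "fusion_isomorphism (G\<lparr>carrier := T\<rparr>) (conj_homs (G\<lparr>carrier := H\<rparr>)) (Y\<lparr>carrier := a ` T\<rparr>) (conj_homs Y) a"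
    using E.cmp.fusion_isomorphism_\<phi> by simp
  then have "fusion_isomorphism S F (Y\<lparr>carrier := a ` T\<rparr>) (conj_homs Y) (a \<circ> ((\<lambda>x. x) \<circ> \<phi>))"
    by (rule fusion_isomorphism_trans[OF fusion_isomorphism_trans[OF \<phi> fus gS gT] _ gS gT])
  then have "fusion_isomorphic S F (Y\<lparr>carrier := a ` T\<rparr>) (conj_homs Y)"
    unfolding fusion_isomorphic_def by blast
  then show ?thesis
    unfolding tame_def using E.Y.is_group E.finY E.U_sylow E.kappa_split by blast
qed

end
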